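(* Let $q$ be a prime power with $q\equiv -1 \pmod 3$, and let $G=\mathrm{PGU}_3(q)$. For every $c\in\mathbb{Z}^+\cup\{\infty\}$, the group $G$ has a $2$-minimal $c$-nilpotent cover, and $$\omega_c(G)=\begin{cases} 49 & \text{if } c\ge 2 \text{ and } q=2,\\ 71 & \text{if } c=1 \text{ and } q=2,\\ q^6+q^5+q^3+q^2+1 & \text{if } c\ge 2 \text{ and } q>2,\\ q^6+q^5+q^4+q^3+q^2+q+1 & \text{if } c=1 \text{ and } q>2.\end{cases}$$
   Context: $\mathrm{PGU}_3(q)$ is the quotient by its centre of the general unitary group $\mathrm{GU}_3(q)$ of a non-degenerate Hermitian form on a $3$-dimensional space over $\mathbb{F}_{q^2}$. For $c\in\mathbb{Z}^+$, a group is $c$-nilpotent if it is nilpotent of class at most $c$; it is $\infty$-nilpotent if it is nilpotent. A subset $X$ of a group $G$ is non-$c$-nilpotent if for any two distinct $x,y\in X$ the subgroup $\langle x,y\rangle$ is not $c$-nilpotent; $\omega_c(G)$ is the maximum order of a non-$c$-nilpotent subset of $G$. A family $\mathcal{N}$ of $c$-nilpotent subgroups of $G$ is a $c$-nilpotent cover of $G$ if every element of $G$ lies in some member of $\mathcal{N}$; it is $2$-minimal if one can choose for each member $X_i\in\mathcal{N}$ an element $g_i\in X_i$ (a distinguished element) such that $\langle g_i,g_j\rangle$ is not $c$-nilpotent whenever $i\ne j$. The condition $c\ge 2$ includes $c=\infty$. *)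

theory Defs
  imports
    "HOL-Analysis.Cartesian_Space"
    "HOL-Algebra.Coset"
    "HOL-Algebra.Generated_Groups"
    "HOL-Number_Theory.Prime_Powers"
    "HOL-Number_Theory.Cong"
    "HOL-Library.Extended_Nat"
begin

(* Hermitian forms over a field with q^2 elements, whose involutory automorphism is x |-> x ^ q.
   Semilinearity in the second argument follows from the first two conjuncts and the symmetry. *)

definition hermitian_form :: "nat \<Rightarrow> ('a::field ^ 'n \<Rightarrow> 'a ^ 'n \<Rightarrow> 'a) \<Rightarrow> bool" where
  "hermitian_form q h \<longleftrightarrow>
     (\<forall>u v w. h (u + v) w = h u w + h v w) \<and>
     (\<forall>a u v. h (a *s u) v = a * h u v) \<and>
     (\<forall>u v. h v u = h u v ^ q)"

definition nondegenerate_form :: "('a::field ^ 'n \<Rightarrow> 'a ^ 'n \<Rightarrow> 'a) \<Rightarrow> bool" where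
  "nondegenerate_form h \<longleftrightarrow> (\<forall>u. (\<forall>v. h u v = 0) \<longrightarrow> u = 0)"

definition GU :: "('a::field ^ 'n \<Rightarrow> 'a ^ 'n \<Rightarrow> 'a) \<Rightarrow> ('a ^ 'n ^ 'n) monoid" where
  "GU h = \<lparr>carrier = {A. invertible A \<and> (\<forall>u v. h (A *v u) (A *v v) = h u v)},
           monoid.mult = (**), one = mat 1\<rparr>"

definition group_center :: "('g, 'b) monoid_scheme \<Rightarrow> 'g set" where
  "group_center G = {z \<in> carrier G. \<forall>x \<in> carrier G. z \<otimes>\<^bsub>G\<^esub> x = x \<otimes>\<^bsub>G\<^esub> z}"

definition PGU :: "('a::field ^ 'n \<Rightarrow> 'a ^ 'n \<Rightarrow> 'a) \<Rightarrow> ('a ^ 'n ^ 'n) set monoid" where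
  "PGU h = GU h Mod group_center (GU h)"

(* Indexed from 0: lower_central G 0 = G and lower_central G (n + 1) = [lower_central G n, G],
   so G is nilpotent of class at most n iff lower_central G n is trivial. *)
fun lower_central :: "('g, 'b) monoid_scheme \<Rightarrow> nat \<Rightarrow> 'g set" where
  "lower_central G 0 = carrier G"
| "lower_central G (Suc n) =
     generate G {x \<otimes>\<^bsub>G\<^esub> y \<otimes>\<^bsub>G\<^esub> inv\<^bsub>G\<^esub> x \<otimes>\<^bsub>G\<^esub> inv\<^bsub>G\<^esub> y | x y.
                   x \<in> lower_central G n \<and> y \<in> carrier G}"

definition c_nilpotent :: "enat \<Rightarrow> ('g, 'b) monoid_scheme \<Rightarrow> bool" where
  "c_nilpotent c G \<longleftrightarrow>
     group G \<and> (\<exists>n::nat. enat n \<le> c \<and> lower_central G n = {\<one>\<^bsub>G\<^esub>})"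

definition c_nilpotent_pair :: "enat \<Rightarrow> ('g, 'b) monoid_scheme \<Rightarrow> 'g \<Rightarrow> 'g \<Rightarrow> bool" where
  "c_nilpotent_pair c G x y \<longleftrightarrow> c_nilpotent c (G\<lparr>carrier := generate G {x, y}\<rparr>)"

definition non_c_nilpotent_subset :: "enat \<Rightarrow> ('g, 'b) monoid_scheme \<Rightarrow> 'g set \<Rightarrow> bool" where
  "non_c_nilpotent_subset c G X \<longleftrightarrow>
     X \<subseteq> carrier G \<and> (\<forall>x \<in> X. \<forall>y \<in> X. x \<noteq> y \<longrightarrow> \<not> c_nilpotent_pair c G x y)"

(* Meaningful for finite G, where Max ranges over a finite non-empty set. *)
definition omega :: "enat \<Rightarrow> ('g, 'b) monoid_scheme \<Rightarrow> nat" where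
  "omega c G = Max (card ` {X. non_c_nilpotent_subset c G X})"

definition c_nilpotent_cover :: "enat \<Rightarrow> ('g, 'b) monoid_scheme \<Rightarrow> 'g set set \<Rightarrow> bool" where
  "c_nilpotent_cover c G \<N> \<longleftrightarrow>
     (\<forall>H \<in> \<N>. subgroup H G \<and> c_nilpotent c (G\<lparr>carrier := H\<rparr>)) \<and>
     carrier G \<subseteq> \<Union>\<N>"

definition two_minimal :: "enat \<Rightarrow> ('g, 'b) monoid_scheme \<Rightarrow> 'g set set \<Rightarrow> bool" where
  "two_minimal c G \<N> \<longleftrightarrow>
     (\<exists>g. (\<forall>H \<in> \<N>. g H \<in> H) \<and>
          (\<forall>H \<in> \<N>. \<forall>K \<in> \<N>. H \<noteq> K \<longrightarrow> \<not> c_nilpotent_pair c G (g H) (g K)))"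

end

theory Submission
  imports Defs "HOL-Number_Theory.Residues" "HOL-Computational_Algebra.Polynomial" "HOL-Analysis.Determinants"
begin

text \<open>
  A family of \<open>c\<close>-nilpotent subgroups \<open>H i\<close> covering a finite group, with elements \<open>g i\<close> of \<open>H i\<close>
  such that different \<open>g i\<close> never generate a \<open>c\<close>-nilpotent group, is a 2-minimal cover and has
  exactly \<open>omega\<close> members (lemma \<open>two_minimal_cover\<close>). The task is to exhibit such a family and to
  count it.

  \<^bold>\<open>The index set.\<close> One expects the abelian centralisers of regular elements to cover the group. To
  avoid a classification of elements by conjugacy types, these are indexed by algebras: let \<open>Alg\<close> be the
  set of three-dimensional commutative algebras, over the fixed field \<open>K\<close> with \<open>q\<close> elements, of
  operators that are Hermitian for the form. A Hermitian operator with a cyclic vector belongs to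
  exactly one of them, its centraliser; any other Hermitian operator is a scalar plus some \<open>out v\<close>, of
  rank at most one, and a given \<open>out v\<close> with \<open>v \<noteq> 0\<close> belongs to \<open>q\<^sup>2 + q + 1\<close> algebras. Counting pairs of
  an algebra and an element of it yields
  \<open>q\<^sup>6 + q\<^sup>5 + q\<^sup>4 + q\<^sup>3 + q\<^sup>2 + q + 1\<close> algebras (\<open>card_Alg\<close>), with no distinction of cases.
  The isometries commuting with an algebra \<open>S\<close> form the group \<open>Ucent S\<close>, which is abelian as soon as \<open>S\<close>
  has a cyclic element. Every isometry lies in one of these groups (\<open>unitary_in_Ucent\<close>).

  \<^bold>\<open>Class one, \<open>q > 2\<close>.\<close> A Cayley transform turns a cyclic element of \<open>S\<close> into an isometry with the same
  commutant, and the parameter of the transform can be chosen such that whatever commutes with it in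
  the projective group does so already in the unitary group (\<open>exists_distinguished\<close>). Distinguished
  elements of different algebras therefore do not commute.

  \<^bold>\<open>Class at least two, \<open>q > 2\<close>.\<close> If two distinguished elements generate a nilpotent group, they
  centralise a common nontrivial element. Either this already identifies the algebras, or it produces
  a common eigenvector \<open>v\<close>, and the same argument can be repeated on the quotient by \<open>v\<close>. The algebras
  turn out to be equal unless both consist of scalars and nilpotent operators for the flag of one
  isotropic point (\<open>distinguished_nilpotent_pair\<close>). There are \<open>q\<^sup>3 + 1\<close> isotropic points with \<open>q + 1\<close>
  algebras of this kind each, and they all contribute to one group of class two, the Sylow subgroup of
  the stabiliser of the point. Merging them lowers the number of members by \<open>q (q\<^sup>3 + 1)\<close>.

  \<^bold>\<open>The case \<open>q = 2\<close>.\<close> Here an algebra is used only if it contains \<open>out v\<close> for an isotropic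
  \<open>v\<close>; there are \<open>63\<close> such algebras, \<open>27\<close> of them unipotent at one of \<open>9\<close> points. They miss the cyclic
  isometries with scalar cube, which fix no isotropic point. Each of these is diagonal with
  eigenvalues \<open>1, w, w\<^sup>2\<close> in an orthonormal basis, or up to a scalar rotates one (\<open>small_q_cases\<close>). There are
  four orthonormal bases up to order and scalars. In the projective group, the
  centraliser of the diagonal element is nilpotent of class two, and the centralisers of the
  rotations are abelian; a basis has two kinds of rotations that are not diagonalisable. So each
  basis adds one member for class at least two and two members for class one, and the numbers are
  \<open>63 - 27 + 9 + 4 = 49\<close> and \<open>63 + 8 = 71\<close>.
\<close>

section \<open>Nilpotent pairs and covers in an abstract group\<close>

lemma (in group) commutator_eq_one_iff:
  assumes "x \<in> carrier G" "y \<in> carrier G"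
  shows "x \<otimes> y \<otimes> inv x \<otimes> inv y = \<one> \<longleftrightarrow> x \<otimes> y = y \<otimes> x"
proof -
  have "x \<otimes> y \<otimes> inv x \<otimes> inv y = (x \<otimes> y) \<otimes> inv (y \<otimes> x)"
    using assms by (simp add: inv_mult_group m_assoc)
  then show ?thesis using assms by (metis inv_closed inv_inv inv_equality m_closed r_inv)
qed

lemma (in group) lower_central_restrict:
  assumes H: "subgroup H G"
  shows "lower_central (G\<lparr>carrier := H\<rparr>) n \<subseteq> H"
    and "lower_central (G\<lparr>carrier := H\<rparr>) (Suc n) =
      generate G {x \<otimes> y \<otimes> inv x \<otimes> inv y | x y. x \<in> lower_central (G\<lparr>carrier := H\<rparr>) n \<and> y \<in> H}"
proof -
  have eq: "{x \<otimes>\<^bsub>G\<lparr>carrier := H\<rparr>\<^esub> y \<otimes>\<^bsub>G\<lparr>carrier := H\<rparr>\<^esub> inv\<^bsub>G\<lparr>carrier := H\<rparr>\<^esub> x \<otimes>\<^bsub>G\<lparr>carrier := H\<rparr>\<^esub> inv\<^bsub>G\<lparr>carrier := H\<rparr>\<^esub> y |x y.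
       x \<in> L \<and> y \<in> carrier (G\<lparr>carrier := H\<rparr>)} = {x \<otimes> y \<otimes> inv x \<otimes> inv y | x y. x \<in> L \<and> y \<in> H}" 
       (is "?A = ?B L") if "L \<subseteq> H" for L
    using that m_inv_consistent[OF H] by (intro Collect_cong ex_cong1) (auto simp: subset_iff)
  have sub: "{x \<otimes> y \<otimes> inv x \<otimes> inv y | x y. x \<in> L \<and> y \<in> H} \<subseteq> H" if "L \<subseteq> H" for L
    using that by (blast intro: subgroup.m_closed[OF H] subgroup.m_inv_closed[OF H])
  have step: "lower_central (G\<lparr>carrier := H\<rparr>) (Suc m) =
      generate G {x \<otimes> y \<otimes> inv x \<otimes> inv y | x y. x \<in> lower_central (G\<lparr>carrier := H\<rparr>) m \<and> y \<in> H}"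
    if "lower_central (G\<lparr>carrier := H\<rparr>) m \<subseteq> H" for m
    unfolding lower_central.simps eq[OF that] using generate_consistent[OF sub[OF that] H] by simp
  show *: "lower_central (G\<lparr>carrier := H\<rparr>) n \<subseteq> H" for n
  proof (induction n)
    case 0 then show ?case by simp
  next
    case (Suc n)
    show ?case unfolding step[OF Suc] using generate_subgroup_incl[OF sub[OF Suc] H] .
  qed
  show "lower_central (G\<lparr>carrier := H\<rparr>) (Suc n) =
      generate G {x \<otimes> y \<otimes> inv x \<otimes> inv y | x y. x \<in> lower_central (G\<lparr>carrier := H\<rparr>) n \<and> y \<in> H}"
    by (rule step[OF *])
qed

lemma (in group) one_in_lower_central:
  assumes "subgroup H G"
  shows "\<one> \<in> lower_central (G\<lparr>carrier := H\<rparr>) n"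
proof (cases n)
  case 0 then show ?thesis using subgroup.one_closed[OF assms] by simp
next
  case (Suc m) 
  show ?thesis unfolding Suc lower_central_restrict(2)[OF assms] by (rule generate.one)
qed

lemma (in group) lower_central_mono:
  assumes H: "subgroup H G" and L: "subgroup L G" and "L \<subseteq> H"
  shows "lower_central (G\<lparr>carrier := L\<rparr>) n \<subseteq> lower_central (G\<lparr>carrier := H\<rparr>) n"
proof (induction n)
  case 0 then show ?case using assms by simp
next
  case (Suc n)
  show ?case unfolding lower_central_restrict(2)[OF H] lower_central_restrict(2)[OF L]
    by (rule mono_generate) (use Suc \<open>L \<subseteq> H\<close> in blast)
qed

lemma (in group) c_nilpotent_restrict_iff:
  assumes H: "subgroup H G"
  shows "c_nilpotent c (G\<lparr>carrier := H\<rparr>) \<longleftrightarrow> 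
    (\<exists>n. enat n \<le> c \<and> lower_central (G\<lparr>carrier := H\<rparr>) n = {\<one>})"
  using subgroup.subgroup_is_group[OF H is_group] by (simp add: c_nilpotent_def)

lemma (in group) c_nilpotent_subgroup:
  assumes "subgroup H G" "subgroup L G" "L \<subseteq> H" "c_nilpotent c (G\<lparr>carrier := H\<rparr>)"
  shows "c_nilpotent c (G\<lparr>carrier := L\<rparr>)"
  using assms(4) lower_central_mono[OF assms(1-3)] one_in_lower_central[OF assms(2)]
  unfolding c_nilpotent_restrict_iff[OF assms(1)] c_nilpotent_restrict_iff[OF assms(2)] by blast

lemma (in group) c_nilpotent_abelian:
  assumes H: "subgroup H G"
    and ab: "\<And>x y. x \<in> H \<Longrightarrow> y \<in> H \<Longrightarrow> x \<otimes> y = y \<otimes> x"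
    and "1 \<le> c"
  shows "c_nilpotent c (G\<lparr>carrier := H\<rparr>)"
proof -
  have "x \<otimes> y \<otimes> inv x \<otimes> inv y = \<one>" if "x \<in> H" "y \<in> H" for x y
  proof -
    have "x \<in> carrier G" "y \<in> carrier G" using that subgroup.subset[OF H] by auto
    then show ?thesis using ab[OF that] commutator_eq_one_iff by blast
  qed
  then have "{x \<otimes> y \<otimes> inv x \<otimes> inv y | x y. x \<in> lower_central (G\<lparr>carrier := H\<rparr>) 0 \<and> y \<in> H} \<subseteq> {\<one>}"
    by auto
  then have "lower_central (G\<lparr>carrier := H\<rparr>) (Suc 0) = {\<one>}"
    unfolding lower_central_restrict(2)[OF H] 
    using generate_subgroup_incl[OF _ triv_subgroup] generate.one by blast
  moreover have "enat (Suc 0) \<le> c" using \<open>1 \<le> c\<close> by (simp add: one_enat_def)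
  ultimately show ?thesis unfolding c_nilpotent_restrict_iff[OF H] by blast
qed

text \<open>The centraliser of \<open>H\<close> is a subgroup containing all commutators, hence the derived
  subgroup; so the next term of the lower central series is trivial.\<close>

lemma (in group) c_nilpotent_class_two:
  assumes H: "subgroup H G"
    and c2: "\<And>x y w. x \<in> H \<Longrightarrow> y \<in> H \<Longrightarrow> w \<in> H \<Longrightarrow>
      (x \<otimes> y \<otimes> inv x \<otimes> inv y) \<otimes> w = w \<otimes> (x \<otimes> y \<otimes> inv x \<otimes> inv y)"
    and "2 \<le> c"
  shows "c_nilpotent c (G\<lparr>carrier := H\<rparr>)"
proof -
  have HG: "x \<in> carrier G" if "x \<in> H" for x using that subgroup.subset[OF H] by auto
  define C where "C = {z \<in> carrier G. \<forall>w\<in>H. z \<otimes> w = w \<otimes> z}"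
  have C: "subgroup C G"
  proof (rule subgroupI)
    show "C \<subseteq> carrier G" "C \<noteq> {}" using HG by (auto simp: C_def intro!: exI[of _ \<one>])
    fix a assume a: "a \<in> C"
    have "inv a \<otimes> w = w \<otimes> inv a" if "w \<in> H" for w
    proof -
      have aw: "a \<in> carrier G" "w \<in> carrier G" "w \<otimes> a = a \<otimes> w"
        using a that HG by (auto simp: C_def)
      have "inv a \<otimes> w = inv a \<otimes> (w \<otimes> a) \<otimes> inv a"
        using aw(1,2) by (simp add: m_assoc)
      also have "\<dots> = inv a \<otimes> a \<otimes> (w \<otimes> inv a)"
        unfolding aw(3) using aw(1,2) by (simp only: m_assoc m_closed inv_closed)
      finally show ?thesis using aw(1,2) by simp
    qed
    then show "inv a \<in> C" using a by (simp add: C_def)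
    fix b assume b: "b \<in> C"
    then show "a \<otimes> b \<in> C" using a HG by (auto simp: C_def) (metis m_assoc)
  qed
  have "{x \<otimes> y \<otimes> inv x \<otimes> inv y | x y. x \<in> lower_central (G\<lparr>carrier := H\<rparr>) 0 \<and> y \<in> H} \<subseteq> C"
    using c2 HG by (auto simp: C_def)
  then have l1: "lower_central (G\<lparr>carrier := H\<rparr>) (Suc 0) \<subseteq> C"
    unfolding lower_central_restrict(2)[OF H] using generate_subgroup_incl[OF _ C] by blast
  have "x \<otimes> y \<otimes> inv x \<otimes> inv y = \<one>" if "x \<in> C" "y \<in> H" for x y
  proof -
    have "x \<in> carrier G" "y \<in> carrier G" "x \<otimes> y = y \<otimes> x" using that HG by (auto simp: C_def)
    then show ?thesis using commutator_eq_one_iff by blast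
  qed
  then have "{x \<otimes> y \<otimes> inv x \<otimes> inv y | x y. x \<in> lower_central (G\<lparr>carrier := H\<rparr>) (Suc 0) \<and> y \<in> H} \<subseteq> {\<one>}"
    using l1 by auto
  then have "lower_central (G\<lparr>carrier := H\<rparr>) (Suc (Suc 0)) = {\<one>}"
    unfolding lower_central_restrict(2)[OF H, of "Suc 0"] 
    using generate_subgroup_incl[OF _ triv_subgroup] generate.one by blast
  moreover have "enat (Suc (Suc 0)) \<le> c" using \<open>2 \<le> c\<close> by (simp add: numeral_eq_enat numeral_2_eq_2)
  ultimately show ?thesis unfolding c_nilpotent_restrict_iff[OF H] by blast
qed

lemma (in group) subgroup_generate_pair:
  "x \<in> carrier G \<Longrightarrow> y \<in> carrier G \<Longrightarrow> subgroup (generate G {x, y}) G"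
  by (rule generate_is_subgroup) auto

text \<open>Take the first term of the lower central series contained in \<open>K\<close>; any element of the
  preceding term outside \<open>K\<close> does what is wanted. Here \<open>K\<close> is merely a set. With
  \<open>K = {\<one>}\<close> this is a nontrivial central element; with \<open>K\<close> the elements acting as scalars on a
  quotient space it is an element that is central as far as this quotient is concerned.\<close>

lemma (in group) c_nilpotent_pair_central_mod:
  assumes xy: "x \<in> carrier G" "y \<in> carrier G"
    and nil: "c_nilpotent_pair c G x y"
    and K: "\<one> \<in> K" "\<not> generate G {x, y} \<subseteq> K"
  obtains z where "z \<in> generate G {x, y}" "z \<notin> K"
    "\<And>w. w \<in> generate G {x, y} \<Longrightarrow> z \<otimes> w \<otimes> inv z \<otimes> inv w \<in> K"
proof -
  define N where "N = generate G {x, y}"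
  have N: "subgroup N G" unfolding N_def by (rule subgroup_generate_pair[OF xy])
  let ?L = "lower_central (G\<lparr>carrier := N\<rparr>)"
  obtain n where "?L n = {\<one>}"
    using nil unfolding c_nilpotent_pair_def N_def[symmetric] c_nilpotent_restrict_iff[OF N] by blast
  then have ex: "?L n \<subseteq> K" using K by simp
  define m where "m = (LEAST n. ?L n \<subseteq> K)"
  have m: "?L m \<subseteq> K" unfolding m_def by (rule LeastI[of "\<lambda>n. ?L n \<subseteq> K", OF ex])
  have "?L 0 = N" by simp
  then have "m \<noteq> 0" using m K(2) unfolding N_def by metis
  then obtain k where k: "m = Suc k" by (cases m) auto
  then have "\<not> ?L k \<subseteq> K" using not_less_Least[of k "\<lambda>n. ?L n \<subseteq> K"] unfolding m_def by auto
  then obtain z where z: "z \<in> ?L k" "z \<notin> K" by blast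
  have "z \<otimes> w \<otimes> inv z \<otimes> inv w \<in> K" if "w \<in> N" for w
  proof -
    have "z \<otimes> w \<otimes> inv z \<otimes> inv w \<in> ?L m"
      unfolding k lower_central_restrict(2)[OF N] using z that by (intro generate.incl) blast
    then show ?thesis using m by blast
  qed
  then show thesis using that z lower_central_restrict(1)[OF N] unfolding N_def by blast
qed

lemma (in group) c_nilpotent_1_pair_commute:
  assumes xy: "x \<in> carrier G" "y \<in> carrier G"
    and nil: "c_nilpotent_pair 1 G x y"
  shows "x \<otimes> y = y \<otimes> x"
proof -
  define N where "N = generate G {x, y}"
  have N: "subgroup N G" unfolding N_def by (rule subgroup_generate_pair[OF xy])
  have inN: "x \<in> N" "y \<in> N" unfolding N_def by (auto intro: generate.incl)
  let ?L = "lower_central (G\<lparr>carrier := N\<rparr>)"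
  obtain n where "enat n \<le> 1" "?L n = {\<one>}"
    using nil unfolding c_nilpotent_pair_def N_def[symmetric] c_nilpotent_restrict_iff[OF N] by blast
  then consider "?L 0 = {\<one>}" | "?L (Suc 0) = {\<one>}" 
    by (metis One_nat_def enat_ord_simps(1) le_Suc_eq le_zero_eq one_enat_def)
  then show ?thesis
  proof cases
    case 1 then show ?thesis using inN by simp
  next
    case 2
    have "x \<otimes> y \<otimes> inv x \<otimes> inv y \<in> ?L (Suc 0)"
      unfolding lower_central_restrict(2)[OF N] using inN by (intro generate.incl) auto
    then have "x \<otimes> y \<otimes> inv x \<otimes> inv y = \<one>" using 2 by simp
    then show ?thesis using commutator_eq_one_iff[OF xy] by blast
  qed
qed

text \<open>A covering family of \<open>c\<close>-nilpotent subgroups bounds \<open>omega\<close> from above, since a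
  non-\<open>c\<close>-nilpotent set meets each member in at most one element; distinguished elements bound it
  from below. The hypothesis on pairs makes both \<open>H\<close> and \<open>g\<close> injective on \<open>I\<close>: equal members, or
  equal elements, would generate a \<open>c\<close>-nilpotent subgroup. So the whole problem is to find \<open>H\<close> and
  \<open>g\<close>, and to count \<open>I\<close>.\<close>

lemma (in group) two_minimal_cover:
  fixes I :: "'i set" and H :: "'i \<Rightarrow> 'a set" and g :: "'i \<Rightarrow> 'a"
  assumes fin: "finite (carrier G)"
    and H: "\<And>i. i \<in> I \<Longrightarrow> subgroup (H i) G"
    and nil: "\<And>i. i \<in> I \<Longrightarrow> c_nilpotent c (G\<lparr>carrier := H i\<rparr>)"
    and cov: "\<And>x. x \<in> carrier G \<Longrightarrow> \<exists>i\<in>I. x \<in> H i"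
    and g: "\<And>i. i \<in> I \<Longrightarrow> g i \<in> H i"
    and pair: "\<And>i j. i \<in> I \<Longrightarrow> j \<in> I \<Longrightarrow> c_nilpotent_pair c G (g i) (g j) \<Longrightarrow> i = j"
    and "finite I"
  shows "(\<exists>\<N>. c_nilpotent_cover c G \<N> \<and> two_minimal c G \<N>) \<and> omega c G = card I"
proof -
  have gc: "g i \<in> carrier G" if "i \<in> I" for i using g[OF that] subgroup.subset[OF H[OF that]] by blast
  have within: "c_nilpotent_pair c G x y" if "i \<in> I" "x \<in> H i" "y \<in> H i" for i x y
  proof -
    have xy: "x \<in> carrier G" "y \<in> carrier G" using that subgroup.subset[OF H[OF that(1)]] by auto
    have "generate G {x, y} \<subseteq> H i" using that by (intro generate_subgroup_incl[OF _ H]) auto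
    then show ?thesis unfolding c_nilpotent_pair_def
      using c_nilpotent_subgroup[OF H subgroup_generate_pair[OF xy] _ nil] that by blast
  qed
  have Hinj: "i = j" if "i \<in> I" "j \<in> I" "H i = H j" for i j
    using pair[OF that(1,2)] within[OF that(1) g[OF that(1)], of "g j"] g[OF that(2)] that(3) by simp
  have ginj: "i = j" if "i \<in> I" "j \<in> I" "g i = g j" for i j
    using pair[OF that(1,2)] within[OF that(1) g[OF that(1)], of "g j"] g[OF that(1)] that(3) by simp
  have injH: "inj_on H I" using Hinj by (auto intro: inj_onI)
  have cover: "c_nilpotent_cover c G (H ` I)"
    using H nil cov by (auto simp: c_nilpotent_cover_def)
  have tm: "two_minimal c G (H ` I)" unfolding two_minimal_def
  proof (intro exI[of _ "\<lambda>X. g (inv_into I H X)"] conjI ballI impI)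
    fix X Y assume X: "X \<in> H ` I" and Y: "Y \<in> H ` I"
    show "g (inv_into I H X) \<in> X" using X g injH by (auto simp: inv_into_f_f)
    assume "X \<noteq> Y"
    then show "\<not> c_nilpotent_pair c G (g (inv_into I H X)) (g (inv_into I H Y))"
      using X Y injH pair[of "inv_into I H X" "inv_into I H Y"]
      by (metis f_inv_into_f inv_into_into)
  qed
  let ?F = "{X. non_c_nilpotent_subset c G X}"
  have "?F \<subseteq> Pow (carrier G)" by (auto simp: non_c_nilpotent_subset_def)
  then have finF: "finite ?F" using fin finite_subset by blast
  have le: "card X \<le> card I" if "X \<in> ?F" for X
  proof -
    have Xc: "X \<subseteq> carrier G" and np: "\<And>x y. x \<in> X \<Longrightarrow> y \<in> X \<Longrightarrow> c_nilpotent_pair c G x y \<Longrightarrow> x = y"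
      using that by (auto simp: non_c_nilpotent_subset_def)
    obtain f where f: "\<And>x. x \<in> X \<Longrightarrow> f x \<in> I \<and> x \<in> H (f x)" using cov Xc by (metis subsetD)
    have "inj_on f X" using f np within by (metis inj_onI)
    moreover have "f ` X \<subseteq> I" using f by blast
    ultimately show ?thesis using card_inj_on_le \<open>finite I\<close> by blast
  qed
  have "g ` I \<in> ?F" using gc pair by (auto simp: non_c_nilpotent_subset_def)
  moreover have "card (g ` I) = card I" using ginj by (intro card_image inj_onI)
  ultimately have "card I \<in> card ` ?F" by (metis imageI)
  then have "omega c G = card I" unfolding omega_def using finF le by (intro Max_eqI) auto
  then show ?thesis using cover tm by blast
qed

section \<open>The quadratic extension of finite fields\<close>

text \<open>All fibres of an additive map have the size of its kernel. Since the fixed field is a subset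
  and not a type, such counts take the place of dimension arguments over it.\<close>

lemma card_additive:
  fixes f :: "'b::{finite,ab_group_add} \<Rightarrow> 'c::ab_group_add"
  assumes diff: "\<And>x y. x \<in> G \<Longrightarrow> y \<in> G \<Longrightarrow> x - y \<in> G"
    and hom: "\<And>x y. x \<in> G \<Longrightarrow> y \<in> G \<Longrightarrow> f (x - y) = f x - f y"
  shows "card G = card (f ` G) * card {x \<in> G. f x = 0}"
proof -
  define k where "k = card {x \<in> G. f x = 0}"
  have add: "x + y \<in> G \<and> f (x + y) = f x + f y" if "x \<in> G" "y \<in> G" for x y
  proof -
    have z: "0 \<in> G" "f 0 = 0" using diff[OF that(1,1)] hom[OF that(1,1)] by auto
    have "- y \<in> G" "f (- y) = - f y" using diff[OF z(1) that(2)] hom[OF z(1) that(2)] z by auto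
    then show ?thesis using diff[OF that(1), of "- y"] hom[OF that(1), of "- y"] by simp
  qed
  have fib: "card {x \<in> G. f x = b} = k" if b: "b \<in> f ` G" for b
  proof -
    obtain a where a: "a \<in> G" "f a = b" using b by blast
    have "bij_betw (\<lambda>x. x + a) {x \<in> G. f x = 0} {x \<in> G. f x = b}"
      by (rule bij_betw_byWitness[where f' = "\<lambda>x. x - a"]) (use a add diff hom in auto)
    then show ?thesis unfolding k_def using bij_betw_same_card by fastforce
  qed
  have card_fibres: "card (\<Union>b\<in>f ` G. {x \<in> G. f x = b}) = (\<Sum>b\<in>f ` G. card {x \<in> G. f x = b})"
    by (rule card_UN_disjoint) auto
  have "G = (\<Union>b\<in>f ` G. {x \<in> G. f x = b})" by auto
  then have "card G = (\<Sum>b\<in>f ` G. card {x \<in> G. f x = b})"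
    by (metis (lifting) card_fibres)
  then show ?thesis using fib by (simp add: k_def)
qed

locale hermitian_plane =
  fixes q :: nat and h :: "'a::{field,finite} ^ 3 \<Rightarrow> 'a ^ 3 \<Rightarrow> 'a"
  assumes q_primepow: "primepow q"
    and q_mod_3: "[int q = -1] (mod 3)"
    and card_field: "CARD('a) = q ^ 2"
    and hermitian: "hermitian_form q h"
    and nondegenerate: "nondegenerate_form h"
begin

text \<open>The involution of the field with \<open>q\<^sup>2\<close> elements; \<open>K\<close> below is its fixed field.\<close>

definition bar :: "'a \<Rightarrow> 'a" where "bar x = x ^ q"

definition K :: "'a set" where "K = {x. bar x = x}"

lemma q_gt_1: "q > 1" using q_primepow primepow_gt_Suc_0 by simp

lemma q_mod: "3 dvd q + 1"
proof -
  have "3 dvd int q - (-1)" using q_mod_3 by (simp add: cong_iff_dvd_diff)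
  then have "int 3 dvd int (q + 1)" by (simp add: algebra_simps)
  then show ?thesis using int_dvd_int_iff by blast
qed

lemma q_ge_5: "q \<noteq> 2 \<Longrightarrow> q \<ge> 5"
  using q_mod q_gt_1 by (auto elim!: dvdE) presburger

lemma prime_char: "prime CHAR('a)"
  by (intro prime_CHAR_semidom finite_imp_CHAR_pos) auto

lemma q_char_power: "\<exists>k. q = CHAR('a) ^ k"
proof -
  obtain p k where pk: "prime p" "q = p ^ k" using q_primepow by (auto simp: primepow_def)
  have "CHAR('a) dvd q ^ 2" using CHAR_dvd_CARD[where 'a='a] card_field by simp
  then have "CHAR('a) dvd p" using prime_char pk by (metis prime_dvd_power)
  then have "CHAR('a) = p" using prime_char pk by (simp add: primes_dvd_imp_eq)
  then show ?thesis using pk by blast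
qed

lemma bar_add [simp]: "bar (x + y) = bar x + bar y"
  using q_char_power freshmans_dream'[OF prime_char] unfolding bar_def by metis

lemma bar_mult [simp]: "bar (x * y) = bar x * bar y" by (simp add: bar_def power_mult_distrib)

lemma bar_0 [simp]: "bar 0 = 0" and bar_1 [simp]: "bar 1 = 1" 
  using q_gt_1 by (auto simp: bar_def)

lemma bar_minus [simp]: "bar (- x) = - bar x"
  using bar_add[of x "- x"] by (simp del: bar_add add: eq_neg_iff_add_eq_0 add.commute)

lemma bar_diff [simp]: "bar (x - y) = bar x - bar y"
  using bar_add[of x "- y"] by simp

lemma bar_power [simp]: "bar (x ^ n) = bar x ^ n" by (simp add: bar_def power_mult[symmetric] mult.commute)

lemma bar_inverse [simp]: "bar (inverse x) = inverse (bar x)" by (simp add: bar_def power_inverse)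

lemma bar_divide [simp]: "bar (x / y) = bar x / bar y" by (simp add: bar_def power_divide)

lemma bar_numeral [simp]: "bar (numeral n) = numeral n"
proof (induction n rule: num_induct)
  case (inc n) then show ?case by (simp only: numeral_inc bar_add bar_1)
qed (simp only: bar_1 numeral_One)

lemma bar_eq_0_iff [simp]: "bar x = 0 \<longleftrightarrow> x = 0" using q_gt_1 by (simp add: bar_def)

lemma nonzero_power_card: "x \<noteq> 0 \<Longrightarrow> x ^ (q\<^sup>2 - 1) = (1::'a)"
proof -
  assume x: "x \<noteq> 0"
  have "(\<Prod>y\<in>UNIV-{0}. y) = (\<Prod>y\<in>UNIV-{0::'a}. x * y)"
    by (rule prod.reindex_bij_witness[of _ "\<lambda>y. x * y" "\<lambda>y. y / x"]) (use x in auto)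
  also have "\<dots> = x ^ (q\<^sup>2 - 1) * (\<Prod>y\<in>UNIV-{0}. y)"
    by (simp add: prod.distrib card_field)
  finally show ?thesis by simp
qed

lemma bar_bar [simp]: "bar (bar x) = x"
proof (cases "x = 0")
  case False
  have "q\<^sup>2 = Suc (q\<^sup>2 - 1)" using q_gt_1 by simp
  then have "x ^ q\<^sup>2 = x * x ^ (q\<^sup>2 - 1)" by (metis power_Suc)
  then show ?thesis using nonzero_power_card[OF False]
    by (simp add: bar_def power_mult[symmetric] power2_eq_square)
qed simp

lemma bar_inject [simp]: "bar x = bar y \<longleftrightarrow> x = y" by (metis bar_bar)

lemma K_iff: "x \<in> K \<longleftrightarrow> bar x = x" by (simp add: K_def)

lemma K_closed [simp, intro]:
  "0 \<in> K" "1 \<in> K" "x \<in> K \<Longrightarrow> y \<in> K \<Longrightarrow> x + y \<in> K" "x \<in> K \<Longrightarrow> y \<in> K \<Longrightarrow> x - y \<in> K"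
  "x \<in> K \<Longrightarrow> y \<in> K \<Longrightarrow> x * y \<in> K" "x \<in> K \<Longrightarrow> - x \<in> K" "x \<in> K \<Longrightarrow> inverse x \<in> K"
  "x \<in> K \<Longrightarrow> y \<in> K \<Longrightarrow> x / y \<in> K" "x * bar x \<in> K" "bar x * x \<in> K" "x + bar x \<in> K" "numeral n \<in> K"
  by (auto simp: K_iff mult.commute add.commute)

lemma card_roots_le:
  assumes "p \<noteq> 0" "\<And>x. P x \<Longrightarrow> poly p x = (0::'a)" "degree p \<le> n"
  shows "card {x. P x} \<le> n"
proof -
  have "card {x. P x} \<le> card {x. poly p x = 0}" using assms by (intro card_mono) auto
  also have "\<dots> \<le> degree p" using card_poly_roots_bound[OF assms(1)] .
  finally show ?thesis using assms(3) by simp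
qed

lemma card_norm_fibre_le: "card {x. x * bar x = c} \<le> q + 1"
proof (rule card_roots_le[of "monom 1 (q + 1) + [:- c:]"])
  have "degree (monom (1::'a) (q + 1) + [:- c:]) = q + 1"
    by (subst degree_add_eq_left) (auto simp: degree_monom_eq)
  then show "monom (1::'a) (q + 1) + [:- c:] \<noteq> 0" "degree (monom (1::'a) (q + 1) + [:- c:]) \<le> q + 1" 
    by auto
qed (auto simp: poly_monom bar_def)

lemma card_K_le: "card K \<le> q"
  unfolding K_def
proof (rule card_roots_le[of "monom 1 q + [:0, - 1:]"])
  have "degree (monom (1::'a) q + [:0, - 1:]) = q" using q_gt_1
    by (subst degree_add_eq_left) (auto simp: degree_monom_eq)
  then show "monom (1::'a) q + [:0, - 1:] \<noteq> 0" "degree (monom (1::'a) q + [:0, - 1:]) \<le> q" 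
    using q_gt_1 by auto
qed (auto simp: poly_monom bar_def)

text \<open>Counting settles the norm map at once: its fibres have at most \<open>q + 1\<close> elements and its
  nonzero values lie among the at most \<open>q - 1\<close> nonzero elements of the fixed field, so that
  \<open>q\<^sup>2 - 1 \<le> (q + 1) (q - 1)\<close> forces equality everywhere.\<close>

lemma norm_count:
  shows card_K: "card K = q" 
    and norm_surj: "c \<in> K \<Longrightarrow> \<exists>x. x * bar x = c"
    and card_norm_fibre: "c \<in> K \<Longrightarrow> c \<noteq> 0 \<Longrightarrow> card {x. x * bar x = c} = q + 1"
proof -
  let ?F = "\<lambda>c. {x. x * bar x = c}"
  have un: "(\<Union>c\<in>K - {0}. ?F c) = UNIV - {0}" by auto
  have "card (UNIV - {0::'a}) = (\<Sum>c\<in>K - {0}. card (?F c))"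
    unfolding un[symmetric] by (rule card_UN_disjoint) auto
  then have s: "(\<Sum>c\<in>K - {0}. card (?F c)) = (q + 1) * (q - 1)"
    using q_gt_1 by (simp add: card_field power2_eq_square algebra_simps diff_mult_distrib2)
  have kz: "card (K - {0}) = card K - 1" by (simp add: card_Diff_singleton_if)
  have le: "(\<Sum>c\<in>K - {0}. card (?F c)) \<le> (\<Sum>c\<in>K - {0}. q + 1)"
    by (rule sum_mono) (rule card_norm_fibre_le)
  then have "(q + 1) * (q - 1) \<le> (q + 1) * (card K - 1)"
    unfolding s using kz by (simp add: mult.commute)
  then have "q - 1 \<le> card K - 1" by (metis add_gr_0 less_one mult_le_cancel1)
  then show ck: "card K = q" using card_K_le q_gt_1 by simp
  have "(\<Sum>c\<in>K - {0}. card (?F c)) = (\<Sum>c\<in>K - {0}. q + 1)"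
    unfolding s using ck kz by simp
  then have eq: "card (?F c) = q + 1" if "c \<in> K - {0}" for c
    using sum_mono_inv[of "\<lambda>c. card (?F c)" "K - {0}" "\<lambda>_. q + 1" c] card_norm_fibre_le that by auto
  then show "c \<in> K \<Longrightarrow> c \<noteq> 0 \<Longrightarrow> card (?F c) = q + 1" by simp
  show "\<exists>x. x * bar x = c" if "c \<in> K"
  proof (cases "c = 0")
    case False
    then have "card (?F c) \<noteq> 0" using eq that by simp
    then show ?thesis using card.empty by (metis (mono_tags, lifting) Collect_empty_eq)
  qed auto
qed

lemma not_K: "\<exists>a. a \<notin> K"
proof -
  have "card K < CARD('a)" using card_K card_field q_gt_1 by (simp add: power2_eq_square)
  then show ?thesis by (metis UNIV_eq_I nat_neq_iff)
qed

lemma three_neq_0: "(3::'a) \<noteq> 0"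
proof
  assume "(3::'a) = 0"
  then have "of_nat 3 = (0::'a)" by simp
  then have "CHAR('a) dvd 3" using of_nat_eq_0_iff_char_dvd by blast
  then have "CHAR('a) \<le> 3" "CHAR('a) \<noteq> 2" by (auto dest: dvd_imp_le)
  then have c3: "CHAR('a) = 3" using prime_gt_1_nat[OF prime_char] by linarith
  obtain k where "q = 3 ^ k" using q_char_power c3 by auto
  then have "3 dvd q" using q_gt_1 by (cases k) auto
  then have "3 dvd (q + 1) - q" using q_mod dvd_diff_nat by blast
  then show False by simp
qed

text \<open>For \<open>t = h v v\<close> this is the condition for \<open>1 + c out v\<close> to be an isometry: a transvection if \<open>v\<close>
  is isotropic, when \<open>c\<close> must have trace zero, and otherwise a reflection, when \<open>1 + c t\<close> must have
  norm one.\<close>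

lemma exists_unitary_shift:
  assumes "t \<in> K"
  shows "\<exists>c. c \<noteq> 0 \<and> c + bar c + c * bar c * t = 0"
proof (cases "t = 0")
  case True
  obtain a where "a \<notin> K" using not_K by blast
  then have "a - bar a \<noteq> 0" by (auto simp: K_iff)
  then show ?thesis using True by (intro exI[of _ "a - bar a"]) simp
next
  case False
  have "card {x. x * bar x = 1} > 1" using card_norm_fibre[of 1] q_gt_1 by auto
  then obtain u where u: "u * bar u = 1" "u \<noteq> 1"
    by (metis (mono_tags, lifting) card_le_Suc0_iff_eq finite mem_Collect_eq not_less One_nat_def bar_1 mult_1)
  have t: "bar t = t" using assms by (simp add: K_iff)
  show ?thesis using u False
    by (intro exI[of _ "(u - 1) / t"]) (simp add: t field_simps)
qed

lemma trace_surj: "c \<in> K \<Longrightarrow> \<exists>x. x + bar x = c"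
proof -
  assume c: "c \<in> K"
  have im: "range (\<lambda>x. x + bar x) \<subseteq> K" by auto
  have ker: "card {x. x + bar x = 0} \<le> q"
  proof (rule card_roots_le[of "monom 1 q + [:0, 1:]"])
    have "degree (monom (1::'a) q + [:0, 1:]) = q" using q_gt_1
      by (subst degree_add_eq_left) (auto simp: degree_monom_eq)
    then show "monom (1::'a) q + [:0, 1:] \<noteq> 0" "degree (monom (1::'a) q + [:0, 1:]) \<le> q" 
      using q_gt_1 by auto
  qed (auto simp: poly_monom bar_def add.commute)
  have "card (UNIV::'a set) = card (range (\<lambda>x. x + bar x)) * card {x \<in> UNIV. x + bar x = 0}"
    by (rule card_additive) auto
  then have "q * q \<le> card (range (\<lambda>x. x + bar x)) * q"
    using ker card_field by (simp add: power2_eq_square)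
  then have "card K \<le> card (range (\<lambda>x. x + bar x))" using card_K q_gt_1 by simp
  then have "range (\<lambda>x. x + bar x) = K" using im by (simp add: card_seteq)
  then have "c \<in> range (\<lambda>x. x + bar x)" using c by simp
  then show ?thesis by (metis rangeE)
qed

lemma card_trace_fibre: "card {x. x + bar x = c} = q" if c: "c \<in> K"
proof -
  have im: "range (\<lambda>x. x + bar x) = K" 
  proof
    show "K \<subseteq> range (\<lambda>x. x + bar x)"
    proof
      fix c assume "c \<in> K"
      then obtain x where "x + bar x = c" using trace_surj by blast
      then show "c \<in> range (\<lambda>x. x + bar x)" by (intro image_eqI[of _ _ x]) simp_all
    qed
  qed auto
  have "card (UNIV::'a set) = card (range (\<lambda>x. x + bar x)) * card {x \<in> UNIV. x + bar x = 0}"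
    by (rule card_additive) auto
  then have k: "card {x. x + bar x = 0} = q" using im card_K card_field q_gt_1 by (simp add: power2_eq_square)
  obtain a where a: "a + bar a = c" using trace_surj c by blast
  have "bij_betw (\<lambda>x. x + a) {x. x + bar x = 0} {x. x + bar x = c}"
    by (rule bij_betw_byWitness[where f' = "\<lambda>x. x - a"]) (use a in \<open>auto simp: algebra_simps\<close>)
  then show ?thesis using k bij_betw_same_card by fastforce
qed

end

section \<open>Cyclic operators on a three-dimensional space\<close>

lemma mat_mult_vec [simp]: "mat c *v u = c *s (u :: 'a::comm_ring_1 ^ 'n)"
  by (simp add: vec_eq_iff matrix_vector_mult_def mat_def if_distrib[of "\<lambda>x. x * _"] cong: if_cong)

lemma mv_scale [simp]: "A *v (c *s u) = c *s (A *v u)" for A :: "'a::comm_ring_1 ^ 'n ^ 'm"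
  by (simp add: vec_eq_iff matrix_vector_mult_def sum_distrib_left ac_simps)

lemma mv_mult [simp]: "(A ** B) *v u = A *v (B *v u)" for A :: "'a::comm_ring_1 ^ 'n ^ 'm" and B :: "'a ^ 'k ^ 'n"
  by (simp add: matrix_vector_mul_assoc)

lemma mat_diag_mult [simp]: "mat a ** mat b = (mat (a * b) :: 'a::comm_ring_1 ^ 'n ^ 'n)"
  by (simp add: matrix_eq vec_eq_iff)

lemma mat_comm: "mat c ** A = A ** (mat c :: 'a::comm_ring_1 ^ 'n ^ 'n)"
  by (simp add: matrix_eq)

lemma mat_mat_assoc: "A ** (mat c ** B) = mat c ** (A ** (B :: 'a::comm_ring_1 ^ 'n ^ 'n))"
  by (simp add: matrix_eq)

lemmas mv_simps = matrix_vector_right_distrib matrix_vector_mult_diff_distrib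
  matrix_vector_mult_add_rdistrib matrix_vector_mult_diff_rdistrib

lemma mat_inj: "mat a = (mat b :: 'a::comm_ring_1 ^ 'n ^ 'n) \<longleftrightarrow> a = b"
  by (simp add: vec_eq_iff mat_def)

definition ind3 :: "'a::field ^ 3 \<Rightarrow> 'a ^ 3 \<Rightarrow> 'a ^ 3 \<Rightarrow> bool" where
  "ind3 u v w \<longleftrightarrow> (\<forall>x y z. x *s u + y *s v + z *s w = 0 \<longrightarrow> x = 0 \<and> y = 0 \<and> z = 0)"

lemma ind3D: "ind3 u v w \<Longrightarrow> x *s u + y *s v + z *s w = 0 \<Longrightarrow> x = 0 \<and> y = 0 \<and> z = 0"
  unfolding ind3_def by blast

lemma ind3_eqD:
  assumes "ind3 u v w" "x *s u + y *s v + z *s w = x' *s u + y' *s v + z' *s w"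
  shows "x = x' \<and> y = y' \<and> z = z'"
proof -
  have "(x - x') *s u + (y - y') *s v + (z - z') *s w = 0"
    using assms(2) by (simp add: vec_eq_iff algebra_simps)
  from ind3D[OF assms(1) this] show ?thesis by simp
qed

text \<open>Over a finite field, counting replaces dimension theory: the map sending coefficients to
  combinations is injective between sets of the same size.\<close>

lemma ind3_span:
  fixes u v w :: "'a::{field,finite} ^ 3"
  assumes "ind3 u v w"
  obtains x y z where "p = x *s u + y *s v + z *s w"
proof -
  let ?f = "\<lambda>(x, y, z). x *s u + y *s v + z *s w"
  have "inj ?f" using ind3_eqD[OF assms] by (auto intro!: injI)
  then have "card (range ?f) = CARD('a) * (CARD('a) * CARD('a))"
    by (simp add: card_image card_cartesian_product flip: UNIV_Times_UNIV)
  then have "range ?f = UNIV" by (intro card_subset_eq) (simp_all add: power3_eq_cube)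
  then show thesis using that by (metis (mono_tags, lifting) UNIV_I case_prod_conv image_iff surj_pair)
qed

lemma ind3_extend:
  fixes u v :: "'a::{field,finite} ^ 3"
  assumes "\<And>x y. x *s u + y *s v = 0 \<Longrightarrow> x = 0 \<and> y = 0"
  obtains w where "ind3 u v w"
proof -
  let ?f = "\<lambda>(x, y). x *s u + y *s v"
  have "card (range ?f) \<le> CARD('a \<times> 'a)" by (rule card_image_le) simp
  moreover have "1 < CARD('a)"
  proof -
    have "card {0, 1::'a} \<le> CARD('a)" by (intro card_mono) auto
    then show ?thesis by simp
  qed
  then have "CARD('a \<times> 'a) < CARD('a ^ 3)"
    by (simp add: power3_eq_cube card_cartesian_product flip: UNIV_Times_UNIV)
  ultimately have "range ?f \<noteq> UNIV" by auto
  then obtain w where w: "w \<notin> range ?f" by blast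
  have "ind3 u v w" unfolding ind3_def
  proof (intro allI impI)
    fix x y z assume e: "x *s u + y *s v + z *s w = 0"
    have "z = 0"
    proof (rule ccontr)
      assume z: "z \<noteq> 0"
      have "z *s w = - (x *s u) - y *s v" using e by (simp add: vec_eq_iff eq_neg_iff_add_eq_0 algebra_simps)
      then have "w = (- x / z) *s u + (- y / z) *s v" using z
        by (simp add: vec_eq_iff field_simps)
      then show False using w by (metis (mono_tags, lifting) case_prod_conv rangeI)
    qed
    then show "x = 0 \<and> y = 0 \<and> z = 0" using e assms[of x y] by simp
  qed
  then show thesis by (rule that)
qed

lemma mat_eq_on_ind3:
  fixes A B :: "'a::{field,finite} ^ 3 ^ 3"
  assumes "ind3 u v w" "A *v u = B *v u" "A *v v = B *v v" "A *v w = B *v w"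
  shows "A = B"
  unfolding matrix_eq
proof
  fix p obtain x y z where "p = x *s u + y *s v + z *s w" using ind3_span[OF assms(1)] by blast
  then show "A *v p = B *v p" using assms by (simp add: mv_simps)
qed

definition cyclic :: "'a::field ^ 3 ^ 3 \<Rightarrow> bool" where
  "cyclic A \<longleftrightarrow> (\<exists>u. ind3 u (A *v u) (A *v (A *v u)))"

definition pol :: "'a::field \<Rightarrow> 'a \<Rightarrow> 'a \<Rightarrow> 'a ^ 3 ^ 3 \<Rightarrow> 'a ^ 3 ^ 3" where
  "pol x y z A = mat x + mat y ** A + mat z ** (A ** A)"

lemma pol_vec [simp]: "pol x y z A *v u = x *s u + y *s (A *v u) + z *s (A *v (A *v u))"
  by (simp add: pol_def mv_simps)

lemma pol_comm: "A ** B = B ** A \<Longrightarrow> pol x y z A ** B = B ** pol x y z A"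
proof -
  assume c: "A ** B = B ** A"
  have "A *v (B *v u) = B *v (A *v u)" for u using arg_cong[OF c, of "\<lambda>M. M *v u"] by simp
  then show ?thesis by (simp add: matrix_eq mv_simps)
qed

lemma pol_self_comm: "pol x y z A ** A = A ** pol x y z A" by (rule pol_comm) simp

lemma cyclic_pol_inj:
  assumes "cyclic A" "pol x y z A = pol x' y' z' A"
  shows "x = x' \<and> y = y' \<and> z = z'"
proof -
  obtain u where u: "ind3 u (A *v u) (A *v (A *v u))" using assms(1) cyclic_def by blast
  show ?thesis using ind3_eqD[OF u] arg_cong[OF assms(2), of "\<lambda>M. M *v u"] by simp
qed

text \<open>An operator commuting with a cyclic one is a polynomial in it, since it is determined by
  the image of a cyclic vector.\<close>

lemma cyclic_commutant:
  fixes A B :: "'a::{field,finite} ^ 3 ^ 3"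
  assumes "cyclic A" "A ** B = B ** A"
  obtains x y z where "B = pol x y z A"
proof -
  obtain u where u: "ind3 u (A *v u) (A *v (A *v u))" using assms(1) cyclic_def by blast
  obtain x y z where xyz: "B *v u = x *s u + y *s (A *v u) + z *s (A *v (A *v u))"
    using ind3_span[OF u] by blast
  let ?P = "pol x y z A"
  have B: "B *v (A *v p) = A *v (B *v p)" for p using arg_cong[OF assms(2), of "\<lambda>M. M *v p"] by simp
  have P: "?P *v (A *v p) = A *v (?P *v p)" for p using arg_cong[OF pol_self_comm, of "\<lambda>M. M *v p"] by (simp del: pol_vec)
  have e: "B *v u = ?P *v u" using xyz by simp
  have "B = ?P" by (rule mat_eq_on_ind3[OF u]) (simp_all only: B P e)
  then show thesis by (rule that)
qed

lemma cyclic_commuting_commute: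
  fixes A B C :: "'a::{field,finite} ^ 3 ^ 3"
  assumes "cyclic A" "A ** B = B ** A" "A ** C = C ** A"
  shows "B ** C = C ** B"
  by (metis assms cyclic_commutant pol_comm)

lemma cyclic_minimal_polynomial:
  fixes A :: "'a::{field,finite} ^ 3 ^ 3"
  assumes "cyclic A"
  obtains x y z where "A ** (A ** A) = pol x y z A"
proof -
  have "A ** (A ** (A ** A)) = (A ** (A ** A)) ** A" by (simp add: matrix_mul_assoc)
  from cyclic_commutant[OF assms this] show thesis using that by blast
qed

lemma all_eigenvectors_scalar:
  fixes A :: "'a::{field,finite} ^ 3 ^ 3"
  assumes "\<And>u. \<exists>c. A *v u = c *s u"
  obtains c where "A = mat c"
proof -
  define e :: "3 \<Rightarrow> 'a ^ 3" where "e i = axis i 1" for i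
  obtain c where c: "\<And>u. A *v u = c u *s u" using assms by metis
  let ?w = "e 1 + e 2 + e 3"
  have "A *v ?w = c (e 1) *s e 1 + c (e 2) *s e 2 + c (e 3) *s e 3"
    using c by (simp add: mv_simps)
  then have eqs: "c ?w = c (e 1)" "c ?w = c (e 2)" "c ?w = c (e 3)"
    using c[of ?w] by (auto simp: vec_eq_iff forall_3 e_def axis_def)
  have i3: "ind3 (e 1) (e 2) (e 3)"
    by (simp add: ind3_def vec_eq_iff forall_3 e_def axis_def)
  have "A = mat (c ?w)"
    by (rule mat_eq_on_ind3[OF i3]) (use c eqs in \<open>simp_all\<close>)
  then show thesis by (rule that)
qed

text \<open>The dichotomy behind the whole count: an operator without a cyclic vector is a scalar plus an
  operator of rank at most one. Suppose \<open>u\<close> is not an eigenvector and let \<open>u, A u, w\<close> be a basis.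
  Subtracting from \<open>A\<close> the coefficient \<open>s\<close> of \<open>w\<close> in \<open>A w\<close> gives an operator \<open>B\<close> mapping \<open>w\<close>
  into the plane of \<open>u\<close> and \<open>u\<^sub>2 = B u\<close>, and this plane is invariant because \<open>u\<close> is not cyclic.
  Testing two vectors \<open>w + x u\<close> for cyclicity then shows that the range of \<open>B\<close> is the line
  of \<open>u\<^sub>2\<close>.\<close>

lemma not_cyclic:
  fixes A :: "'a::{field,finite} ^ 3 ^ 3"
  assumes nc: "\<not> cyclic A"
  obtains s x where "\<And>u. \<exists>t. A *v u = s *s u + t *s x"
proof (cases "\<forall>u. \<exists>c. A *v u = c *s u")
  case True
  then obtain c where "A = mat c" using all_eigenvectors_scalar by blast
  then have "A *v u = c *s u + 0 *s 0" for u by simp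
  then show thesis using that by blast
next
  case False
  then obtain u where u: "\<And>c. A *v u \<noteq> c *s u" by blast
  then have "u \<noteq> 0" by (metis matrix_vector_mult_0_right vec.scale_zero_left)
  have ind2: "x = 0 \<and> y = 0" if "x *s u + y *s (A *v u) = 0" for x y
  proof -
    have "y = 0"
    proof (rule ccontr)
      assume "y \<noteq> 0"
      then have "A *v u = (- x / y) *s u" using that by (simp add: vec_eq_iff field_simps eq_neg_iff_add_eq_0)
      then show False using u by blast
    qed
    then show ?thesis using that \<open>u \<noteq> 0\<close> by (simp)
  qed
  obtain w where w: "ind3 u (A *v u) w" using ind3_extend[OF ind2] by blast
  obtain a0 b0 s where s: "A *v w = a0 *s u + b0 *s (A *v u) + s *s w" using ind3_span[OF w] by blast
  define B where "B = A - mat s"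
  have Bv: "B *v x = A *v x - s *s x" for x by (simp add: B_def mv_simps)
  define u2 where "u2 = B *v u"
  have i3: "ind3 u u2 w" unfolding ind3_def
  proof (intro allI impI)
    fix x y z assume "x *s u + y *s u2 + z *s w = 0"
    then have "(x - y * s) *s u + y *s (A *v u) + z *s w = 0"
      by (simp add: u2_def Bv vec_eq_iff algebra_simps)
    from ind3D[OF w this] show "x = 0 \<and> y = 0 \<and> z = 0" by auto
  qed
  have ncB: "\<not> ind3 x (B *v x) (B *v (B *v x))" for x
  proof
    assume i: "ind3 x (B *v x) (B *v (B *v x))"
    have "ind3 x (A *v x) (A *v (A *v x))" unfolding ind3_def
    proof (intro allI impI)
      fix a b c assume "a *s x + b *s (A *v x) + c *s (A *v (A *v x)) = 0"
      then have "(a + b * s + c * s * s) *s x + (b + 2 * c * s) *s (B *v x) + c *s (B *v (B *v x)) = 0"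
        by (simp add: Bv mv_simps vec_eq_iff algebra_simps)
      from ind3D[OF i this] show "a = 0 \<and> b = 0 \<and> c = 0" by auto
    qed
    then show False using nc cyclic_def by blast
  qed
  obtain g d where gd: "B *v w = g *s u + d *s u2"
  proof
    show "B *v w = (a0 + b0 * s) *s u + b0 *s u2" 
      unfolding Bv s u2_def by (simp add: vec_eq_iff algebra_simps)
  qed
  obtain al be z where "B *v u2 = al *s u + be *s u2 + z *s w" using ind3_span[OF i3] by blast
  moreover have "z = 0"
  proof (rule ccontr)
    assume z: "z \<noteq> 0"
    have "ind3 u u2 (B *v u2)" unfolding ind3_def calculation
    proof (intro allI impI)
      fix x y t assume "x *s u + y *s u2 + t *s (al *s u + be *s u2 + z *s w) = 0"
      then have "(x + t * al) *s u + (y + t * be) *s u2 + (t * z) *s w = 0"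
        by (simp add: vec_eq_iff algebra_simps)
      from ind3D[OF i3 this] z show "x = 0 \<and> y = 0 \<and> t = 0" by auto
    qed
    then show False using ncB[of u] by (simp add: u2_def)
  qed
  ultimately have ab: "B *v u2 = al *s u + be *s u2" by simp
  have g0: "g = 0"
  proof (rule ccontr)
    assume "g \<noteq> 0"
    let ?x = "w - d *s u"
    have Bx: "B *v ?x = g *s u" "B *v (g *s u) = g *s u2" using gd by (simp_all add: mv_simps u2_def)
    have "ind3 ?x (B *v ?x) (B *v (B *v ?x))" unfolding Bx ind3_def
    proof (intro allI impI)
      fix x y z assume "x *s (w - d *s u) + y *s (g *s u) + z *s (g *s u2) = 0"
      then have "(y * g - x * d) *s u + (z * g) *s u2 + x *s w = 0"
        by (simp add: vec_eq_iff algebra_simps)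
      from ind3D[OF i3 this] \<open>g \<noteq> 0\<close> show "x = 0 \<and> y = 0 \<and> z = 0" by auto
    qed
    then show False using ncB by blast
  qed
  have al0: "al = 0"
  proof (rule ccontr)
    assume "al \<noteq> 0"
    let ?x = "w + (1 - d) *s u"
    have Bx: "B *v ?x = u2" using gd g0 by (simp add: mv_simps u2_def vec_eq_iff algebra_simps)
    have "ind3 ?x (B *v ?x) (B *v (B *v ?x))" unfolding Bx ab ind3_def
    proof (intro allI impI)
      fix x y z assume "x *s (w + (1 - d) *s u) + y *s u2 + z *s (al *s u + be *s u2) = 0"
      then have "(z * al + x * (1 - d)) *s u + (y + z * be) *s u2 + x *s w = 0"
        by (simp add: vec_eq_iff algebra_simps)
      from ind3D[OF i3 this] \<open>al \<noteq> 0\<close> show "x = 0 \<and> y = 0 \<and> z = 0" by auto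
    qed
    then show False using ncB by blast
  qed
  have "\<exists>t. A *v p = s *s p + t *s u2" for p
  proof -
    obtain x y z where "p = x *s u + y *s u2 + z *s w" using ind3_span[OF i3] by blast
    then have "B *v p = (x + y * be + z * d) *s u2"
      using gd g0 ab al0 by (simp add: mv_simps flip: u2_def) (simp add: vec_eq_iff algebra_simps)
    then have "A *v p = s *s p + (x + y * be + z * d) *s u2" unfolding Bv by (simp add: algebra_simps)
    then show ?thesis by blast
  qed
  then show thesis using that by blast
qed

section \<open>Hermitian operators\<close>

context hermitian_plane
begin

lemma h_add_left [simp]: "h (u + v) w = h u w + h v w"
  and h_scale_left [simp]: "h (c *s u) w = c * h u w"
  and h_swap: "h v u = bar (h u v)"
  using hermitian unfolding hermitian_form_def bar_def by blast+

lemma h_add_right [simp]: "h w (u + v) = h w u + h w v"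
  unfolding h_swap[of w "u + v"] h_swap[of w u] h_swap[of w v] by simp

lemma h_scale_right [simp]: "h w (c *s u) = bar c * h w u"
  unfolding h_swap[of w "c *s u"] h_swap[of w u] by simp

lemma h_zero [simp]: "h 0 w = 0" "h w 0 = 0"
  using h_scale_left[of 0 0 w] h_scale_right[of w 0 0] by simp_all

lemma h_minus [simp]: "h (- u) w = - h u w" "h w (- u) = - h w u"
  using h_scale_left[of "- 1" u w] h_scale_right[of w "- 1" u] by (simp_all add: vec.scale_minus_left)

lemma h_diff [simp]: "h (u - v) w = h u w - h v w" "h w (u - v) = h w u - h w v"
  using h_add_left[of u "- v" w] h_add_right[of w u "- v"] by simp_all

lemma bar_h [simp]: "bar (h u v) = h v u" by (rule h_swap[symmetric])

lemma h_self_K [simp, intro]: "h v v \<in> K" by (simp add: K_iff)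

lemma h_eq_0_comm: "h u v = 0 \<longleftrightarrow> h v u = 0" by (metis bar_eq_0_iff bar_h)

lemma h_nondeg: "(\<And>v. h u v = 0) \<Longrightarrow> u = 0"
  using nondegenerate unfolding nondegenerate_form_def by blast

lemma h_eqI: "(\<And>w. h u w = h v w) \<Longrightarrow> u = v"
  using h_nondeg[of "u - v"] by simp

lemma h_eqI': "(\<And>w. h w u = h w v) \<Longrightarrow> u = v"
  by (rule h_eqI) (metis bar_h)

lemma h_dual: assumes "v \<noteq> 0" obtains w where "h w v = 1" "h v w = 1"
proof -
  obtain w where w: "h v w \<noteq> 0" using assms h_nondeg by blast
  have "h v (bar (inverse (h v w)) *s w) = 1" using w by (simp del: bar_inverse)
  then show thesis using that by (metis bar_1 bar_h)
qed

lemma card_field_3: "CARD('a) ^ 3 = q ^ 6" by (simp add: card_field flip: power_mult)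

lemma card_V: "CARD('a ^ 3) = q ^ 6" by (simp add: card_field_3)

lemma card_perp: assumes "v \<noteq> 0" shows "card {u. h u v = 0} = q ^ 4"
proof -
  obtain w where "h w v = 1" using h_dual[OF assms] by blast
  then have "h (c *s w) v = c" for c by simp
  then have s: "range (\<lambda>u. h u v) = UNIV" by (metis surjI)
  have "card (UNIV::('a ^ 3) set) = card (range (\<lambda>u. h u v)) * card {u \<in> UNIV. h u v = 0}"
    by (rule card_additive) simp_all
  then have "q ^ 2 * card {u. h u v = 0} = q ^ 2 * q ^ 4"
    unfolding s card_V card_field by (simp flip: power_add)
  then show ?thesis using q_gt_1 by (simp only: mult_cancel1) simp
qed

lemma card_perp_pair: "card {u. h u v = 0 \<and> h u w = 0} \<ge> q ^ 2"
proof -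
  have "q ^ 4 \<le> card {u. h u v = 0}"
    using card_perp[of v] q_gt_1 by (cases "v = 0") (simp_all add: card_field_3 power_increasing)
  also have "card {u. h u v = 0} = card ((\<lambda>u. h u w) ` {u. h u v = 0}) * card {u \<in> {u. h u v = 0}. h u w = 0}"
    by (rule card_additive) simp_all
  also have "\<dots> \<le> q ^ 2 * card {u \<in> {u. h u v = 0}. h u w = 0}"
    by (intro mult_right_mono) (use card_mono[of "UNIV::'a set"] card_field in auto)
  finally have "q ^ 2 * q ^ 2 \<le> q ^ 2 * card {u. h u v = 0 \<and> h u w = 0}"
    by (simp flip: power_add)
  then show ?thesis using q_gt_1 by (simp only: mult_le_cancel1) simp
qed

lemma perp_pair: obtains u where "u \<noteq> 0" "h u v = 0" "h u w = 0"
proof -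
  have "\<not> {u. h u v = 0 \<and> h u w = 0} \<subseteq> {0}"
  proof
    assume "{u. h u v = 0 \<and> h u w = 0} \<subseteq> {0}"
    then have "card {u. h u v = 0 \<and> h u w = 0} \<le> 1" using card_mono[of "{0}"] by simp
    then have "q ^ 2 \<le> 1" using card_perp_pair[of v w] by linarith
    then show False using q_gt_1 by (simp add: power2_eq_square) (metis One_nat_def less_1_mult not_less)
  qed
  then show thesis using that by blast
qed

text \<open>The operator \<open>u \<mapsto> h u y x\<close>, given by its effect on the standard basis. The rank-one Hermitian
  operators are the \<open>K\<close>-multiples of the \<open>out v\<close>, and since the norm maps onto \<open>K\<close> they are the
  \<open>out v\<close> themselves. A Hermitian operator commutes with \<open>out v\<close> when \<open>v\<close> is
  one of its eigenvectors, so \<open>out\<close> lets points be treated as elements of algebras.\<close>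

definition outer :: "'a ^ 3 \<Rightarrow> 'a ^ 3 \<Rightarrow> 'a ^ 3 ^ 3" where
  "outer x y = (\<chi> i j. x $ i * h (axis j 1) y)"

abbreviation out :: "'a ^ 3 \<Rightarrow> 'a ^ 3 ^ 3" where "out v \<equiv> outer v v"

lemma outer_vec [simp]: "outer x y *v u = h u y *s x"
proof -
  have u: "u = u $ 1 *s axis 1 1 + u $ 2 *s axis 2 1 + u $ 3 *s axis 3 1"
    by (simp add: vec_eq_iff forall_3 axis_def)
  have "h u y = u $ 1 * h (axis 1 1) y + u $ 2 * h (axis 2 1) y + u $ 3 * h (axis 3 1) y"
    by (subst u) simp
  then show ?thesis by (simp add: vec_eq_iff outer_def matrix_vector_mult_def sum_3 algebra_simps)
qed

definition adj :: "'a ^ 3 ^ 3 \<Rightarrow> 'a ^ 3 ^ 3 \<Rightarrow> bool" where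
  "adj A B \<longleftrightarrow> (\<forall>u v. h (A *v u) v = h u (B *v v))"

definition Herm :: "('a ^ 3 ^ 3) set" where "Herm = {A. adj A A}"

lemma adjD: "adj A B \<Longrightarrow> h (A *v u) v = h u (B *v v)" by (simp add: adj_def)

lemma adj_unique: "adj A B \<Longrightarrow> adj A C \<Longrightarrow> B = C"
  unfolding adj_def matrix_eq by (metis h_eqI')

lemma adj_sym: "adj A B \<Longrightarrow> adj B A" unfolding adj_def by (metis bar_h)

lemma adj_add: "adj A B \<Longrightarrow> adj C D \<Longrightarrow> adj (A + C) (B + D)"
  and adj_diff: "adj A B \<Longrightarrow> adj C D \<Longrightarrow> adj (A - C) (B - D)"
  and adj_scale: "adj A B \<Longrightarrow> adj (mat c ** A) (mat (bar c) ** B)"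
  and adj_mat: "adj (mat c) (mat (bar c))"
  and adj_outer: "adj (outer x y) (outer y x)"
  and adj_mult: "adj A B \<Longrightarrow> adj C D \<Longrightarrow> adj (A ** C) (D ** B)"
  by (simp_all add: adj_def mv_simps mult.commute)

lemma adj_pol: "adj A B \<Longrightarrow> adj (pol x y z A) (pol (bar x) (bar y) (bar z) B)"
  unfolding pol_def by (intro adj_add adj_scale adj_mat adj_mult)

lemma HermD: "A \<in> Herm \<Longrightarrow> h (A *v u) v = h u (A *v v)" by (simp add: Herm_def adj_def)

lemma Herm_closed:
  "A \<in> Herm \<Longrightarrow> B \<in> Herm \<Longrightarrow> A + B \<in> Herm"
  "A \<in> Herm \<Longrightarrow> B \<in> Herm \<Longrightarrow> A - B \<in> Herm"
  "c \<in> K \<Longrightarrow> A \<in> Herm \<Longrightarrow> mat c ** A \<in> Herm"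
  "c \<in> K \<Longrightarrow> mat c \<in> Herm" "out v \<in> Herm" "outer u v + outer v u \<in> Herm"
proof -
  show "c \<in> K \<Longrightarrow> A \<in> Herm \<Longrightarrow> mat c ** A \<in> Herm" "c \<in> K \<Longrightarrow> mat c \<in> Herm"
    using adj_scale[of A A c] adj_mat[of c] by (auto simp: Herm_def K_iff)
  show "outer u v + outer v u \<in> Herm" 
    using adj_add[OF adj_outer[of u v] adj_outer[of v u]] by (simp add: Herm_def add.commute)
qed (auto simp: Herm_def intro: adj_add adj_diff adj_outer)

lemma Herm_pol: "A \<in> Herm \<Longrightarrow> x \<in> K \<Longrightarrow> y \<in> K \<Longrightarrow> z \<in> K \<Longrightarrow> pol x y z A \<in> Herm"
  using adj_pol[of A A x y z] by (simp add: Herm_def K_iff)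

lemma Herm_mult_comm: "A \<in> Herm \<Longrightarrow> B \<in> Herm \<Longrightarrow> A ** B \<in> Herm \<Longrightarrow> A ** B = B ** A"
  using adj_mult[of A A B B] adj_unique unfolding Herm_def by blast

lemma Herm_comm_mult: "A \<in> Herm \<Longrightarrow> B \<in> Herm \<Longrightarrow> A ** B = B ** A \<Longrightarrow> A ** B \<in> Herm"
  using adj_mult[of A A B B] unfolding Herm_def by simp

lemma Herm_pol_coeffs:
  assumes "A \<in> Herm" "cyclic A" "pol x y z A \<in> Herm"
  shows "x \<in> K" "y \<in> K" "z \<in> K"
proof -
  have "pol x y z A = pol (bar x) (bar y) (bar z) A"
    using adj_unique adj_pol[of A A x y z] assms unfolding Herm_def by blast
  from cyclic_pol_inj[OF assms(2) this] show "x \<in> K" "y \<in> K" "z \<in> K" by (auto simp: K_iff)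
qed

lemma cyclic_Herm_commutant:
  assumes "A \<in> Herm" "cyclic A" "B \<in> Herm" "A ** B = B ** A"
  obtains x y z where "x \<in> K" "y \<in> K" "z \<in> K" "B = pol x y z A"
  using cyclic_commutant[OF assms(2,4)] Herm_pol_coeffs[OF assms(1,2)] assms(3) by metis

lemma out_scale: "out (b *s v) = mat (b * bar b) ** out v"
  by (simp add: matrix_eq vec_eq_iff)

lemma outer_rank_one:
  assumes "\<And>u. \<exists>t. B *v u = t *s v" "adj B C"
  obtains w where "B = outer v w" "C = outer w v"
proof (cases "v = 0")
  case True
  then have "B = 0" using assms(1) by (simp add: matrix_eq)
  then have "B = outer v 0" using True by (simp add: matrix_eq)
  moreover then have "C = outer 0 v" using assms(2) adj_outer adj_unique by blast
  ultimately show thesis using that by blast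
next
  case False
  obtain f where f: "\<And>u. B *v u = f u *s v" using assms(1) by metis
  obtain d where d: "h v d = 1" using h_dual[OF False] by blast
  have "f u = h u (C *v d)" for u
    using adjD[OF assms(2), of u d] by (simp add: f d)
  then have "B = outer v (C *v d)" by (simp add: matrix_eq f)
  moreover then have "C = outer (C *v d) v" using assms(2) adj_outer adj_unique by metis
  ultimately show thesis using that by blast
qed

lemma outer_eq_swap:
  assumes "outer v w = outer w v" "v \<noteq> 0"
  obtains c where "c \<in> K" "w = c *s v"
proof -
  obtain d where d: "h d v = 1" "h v d = 1" using h_dual[OF assms(2)] by blast
  have w: "w = h d w *s v" using arg_cong[OF assms(1), of "\<lambda>M. M *v d"] d by simp
  have "h w d = h d w" using arg_cong[OF w, of "\<lambda>x. h x d"] d by simp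
  then have "h d w \<in> K" by (simp add: K_iff)
  then show thesis using w that by blast
qed

lemma Herm_rank_one:
  assumes "B \<in> Herm" "\<And>u. \<exists>t. B *v u = t *s v"
  obtains b where "B = out (b *s v)"
proof (cases "v = 0")
  case True
  then have "B = out (0 *s v)" using assms(2) by (simp add: matrix_eq)
  then show thesis by (rule that)
next
  case False
  have a: "adj B B" using assms(1) by (simp add: Herm_def)
  obtain w where w: "B = outer v w" "B = outer w v" using outer_rank_one[OF assms(2) a] by blast
  then obtain c where c: "c \<in> K" "w = c *s v" using outer_eq_swap[of v w] False by metis
  obtain b where "b * bar b = c" using norm_surj[OF c(1)] by blast
  then have "B = out (b *s v)" unfolding w(2) c(2) by (auto simp: matrix_eq vec_eq_iff)
  then show thesis by (rule that)
qed

lemma out_eq_iff: "out v = out w \<longleftrightarrow> (\<exists>b. b * bar b = 1 \<and> w = b *s v)"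
proof
  assume e: "out v = out w"
  show "\<exists>b. b * bar b = 1 \<and> w = b *s v"
  proof (cases "v = 0")
    case True
    have "w = 0"
    proof (rule ccontr)
      assume "w \<noteq> 0"
      then obtain d where "h d w = 1" using h_dual by blast
      then show False using arg_cong[OF e, of "\<lambda>M. M *v d"] True \<open>w \<noteq> 0\<close> by simp
    qed
    then show ?thesis using True by (intro exI[of _ 1]) simp
  next
    case False
    then obtain d where d: "h d v = 1" "h v d = 1" using h_dual by blast
    have v: "v = h d w *s w" using arg_cong[OF e, of "\<lambda>M. M *v d"] d by simp
    then have dw: "h d w * h w d = 1" using arg_cong[OF v, of "\<lambda>x. h x d"] d by simp
    have "h w d *s v = (h w d * h d w) *s w" by (subst v) simp
    then have "w = h w d *s v" using dw by (simp add: mult.commute)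
    then show ?thesis using dw by (intro exI[of _ "h w d"]) (simp add: mult.commute)
  qed
next
  assume "\<exists>b. b * bar b = 1 \<and> w = b *s v"
  then show "out v = out w" by (auto simp: out_scale)
qed

lemma out_nonzero: "v \<noteq> 0 \<Longrightarrow> out v \<noteq> 0"
  using out_eq_iff[of v 0] by (auto simp: matrix_eq)

text \<open>For Hermitian operators the rank-one part of such a decomposition is forced to be
  Hermitian as well, because the hyperplane perpendicular to the range is too large to be contained
  in it.\<close>

lemma Herm_scalar_plus_rank_one:
  assumes "A \<in> Herm" "\<And>u. \<exists>t. A *v u = s *s u + t *s x"
  obtains b where "s \<in> K" "A = mat s + out (b *s x)"
proof -
  obtain t where t: "\<And>u. A *v u = s *s u + t u *s x" using assms(2) by metis
  have e: "(s - bar s) * h u w = bar (t w) * h u x - t u * h x w" for u w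
    using HermD[OF assms(1), of u w] by (simp add: t algebra_simps)
  have "s \<in> K"
  proof (rule ccontr)
    assume "s \<notin> K"
    then have s0: "s - bar s \<noteq> 0" by (auto simp: K_iff)
    have "{u. h u x = 0} \<subseteq> (\<lambda>c. c *s x) ` UNIV"
    proof
      fix u assume "u \<in> {u. h u x = 0}"
      then have "(s - bar s) * h u w = - t u * h x w" for w using e[of u w] by simp
      then have "h u w = h ((- t u / (s - bar s)) *s x) w" for w using s0 by (simp add: field_simps)
      then show "u \<in> range (\<lambda>c. c *s x)" using h_eqI by blast
    qed
    then have "card {u. h u x = 0} \<le> card ((\<lambda>c. c *s x) ` UNIV)" by (intro card_mono) simp_all
    also have "\<dots> \<le> CARD('a)" by (rule card_image_le) simp
    finally have le: "card {u. h u x = 0} \<le> q ^ 2" by (simp add: card_field)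
    have "x \<noteq> 0"
    proof
      assume "x = 0"
      then have "{u. h u x = 0} = UNIV" by simp
      then have "q ^ 6 \<le> q ^ 2" using le by (simp add: card_field_3)
      then show False using q_gt_1 by (simp add: power_increasing_iff)
    qed
    then have "q ^ 4 \<le> q ^ 2" using le card_perp by simp
    then show False using q_gt_1 by simp
  qed
  have "A - mat s \<in> Herm" using assms \<open>s \<in> K\<close> by (intro Herm_closed)
  moreover have "\<exists>c. (A - mat s) *v u = c *s x" for u by (simp add: mv_simps t)
  ultimately obtain b where "A - mat s = out (b *s x)" using Herm_rank_one by blast
  then have "A = mat s + out (b *s x)" by (simp add: algebra_simps)
  then show thesis using that \<open>s \<in> K\<close> by blast
qed

lemma not_cyclic_Herm:
  assumes "A \<in> Herm" "\<not> cyclic A"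
  obtains s v where "s \<in> K" "A = mat s + out v"
  using not_cyclic[OF assms(2)] Herm_scalar_plus_rank_one[OF assms(1)] by metis

lemma not_cyclic_shift_outer: "\<not> cyclic (mat s + mat c ** outer x y)"
proof
  let ?A = "mat s + mat c ** outer x y" 
  assume cyclic: "cyclic ?A"
  have "pol (s * s + s * c * h x y) (- (2 * s + c * h x y)) 1 ?A = pol 0 0 0 ?A"
    by (simp add: matrix_eq mv_simps vec_eq_iff algebra_simps)
  from cyclic_pol_inj[OF cyclic this] show False by simp
qed

lemma not_cyclic_shift_out: "\<not> cyclic (mat s + out v)"
  using not_cyclic_shift_outer[of s 1 v v] by simp

lemma shift_out_inject:
  assumes "mat s + out v = mat s' + out v'"
  shows "s = s'" "out v = out v'"
proof -
  obtain u where u: "u \<noteq> 0" "h u v = 0" "h u v' = 0" using perp_pair by blast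
  then have "s *s u = s' *s u" using arg_cong[OF assms, of "\<lambda>M. M *v u"] by (simp add: mv_simps)
  then show "s = s'" using u by (simp)
  then show "out v = out v'" using assms by simp
qed

text \<open>The operator \<open>out v\<close> determines \<open>v\<close> up to the \<open>q + 1\<close> scalars of norm one.\<close>

lemma card_out: "card (out ` (- {0})) * (q + 1) = q ^ 6 - 1"
proof -
  let ?F = "\<lambda>B. {v. v \<noteq> 0 \<and> out v = B}"
  have fib: "card (?F B) = q + 1" if B: "B \<in> out ` (- {0})" for B
  proof -
    obtain v where v: "v \<noteq> 0" "B = out v" using B by auto
    have "?F B = (\<lambda>b. b *s v) ` {b. b * bar b = 1}"
      using v out_eq_iff[of v] by (auto simp: v(2) eq_commute[of "out _" "out v"])
    also have "card \<dots> = q + 1"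
      using v card_norm_fibre[of 1] by (subst card_image) (auto intro!: inj_onI)
    finally show ?thesis .
  qed
  have "card (\<Union>B\<in>out ` (- {0}). ?F B) = (\<Sum>B\<in>out ` (- {0}). card (?F B))"
    by (rule card_UN_disjoint) auto
  moreover have "(\<Union>B\<in>out ` (- {0}). ?F B) = UNIV - {0}" by auto
  ultimately show ?thesis using fib by (simp add: card_field_3)
qed

lemma dual_basis:
  assumes "ind3 u v w"
  obtains a b c where "h a u = 1" "h a v = 0" "h a w = 0" "h b u = 0" "h b v = 1" "h b w = 0"
    "h c u = 0" "h c v = 0" "h c w = 1"
proof -
  let ?f = "\<lambda>p. (h p u, h p v, h p w)"
  have "inj ?f"
  proof (rule injI)
    fix p r assume "?f p = ?f r"
    then have "h p x = h r x" for x
      by (rule_tac ind3_span[OF assms, of x]) simp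
    then show "p = r" by (rule h_eqI)
  qed
  then have "card (range ?f) = q ^ 6" by (simp add: card_image card_field_3)
  moreover have "CARD('a \<times> 'a \<times> 'a) = q ^ 6"
    by (simp add: card_cartesian_product card_field flip: UNIV_Times_UNIV power_add)
  ultimately have "range ?f = UNIV" by (intro card_subset_eq) simp_all
  then have "\<exists>p. ?f p = t" for t
  proof -
    have "t \<in> range ?f" using \<open>range ?f = UNIV\<close> by simp
    then obtain p where "t = ?f p" by (rule rangeE)
    then show ?thesis by (intro exI[of _ p]) simp
  qed
  from this[of "(1, 0, 0)"] this[of "(0, 1, 0)"] this[of "(0, 0, 1)"] show thesis using that by auto
qed

text \<open>Gram matrices with respect to a basis parametrise the Hermitian operators.\<close>

lemma card_Herm_kernel:
  assumes i: "ind3 u v w"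
  shows "card Herm = q ^ 9" and "card {A \<in> Herm. A *v u = 0} = q ^ 4"
proof -
  obtain a b c where d: "h a u = 1" "h a v = 0" "h a w = 0" "h b u = 0" "h b v = 1" "h b w = 0"
    "h c u = 0" "h c v = 0" "h c w = 1" using dual_basis[OF i] by blast
  have d': "h u a = 1" "h v a = 0" "h w a = 0" "h u b = 0" "h v b = 1" "h w b = 0"
    "h u c = 0" "h v c = 0" "h w c = 1" 
    using d by (simp_all add: h_eq_0_comm[of u] h_eq_0_comm[of v] h_eq_0_comm[of w]) (metis bar_1 bar_h)+
  define G where "G = (\<lambda>(r, s, t, x, y, z). mat r ** out a + mat s ** out b + mat t ** out c
     + (mat x ** outer a b + mat (bar x) ** outer b a) + (mat y ** outer a c + mat (bar y) ** outer c a)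
     + (mat z ** outer b c + mat (bar z) ** outer c b))"
  define g where "g A = (h (A *v u) u, h (A *v v) v, h (A *v w) w, h (A *v v) u, h (A *v w) u, h (A *v w) v)" for A
  define D where "D = K \<times> K \<times> K \<times> (UNIV::'a set) \<times> (UNIV::'a set) \<times> (UNIV::'a set)"
  have eqI: "A = B" if "A \<in> Herm" "B \<in> Herm" "g A = g B" for A B
  proof -
    have e: "h (A *v u) u = h (B *v u) u" "h (A *v v) v = h (B *v v) v" "h (A *v w) w = h (B *v w) w"
      "h (A *v v) u = h (B *v v) u" "h (A *v w) u = h (B *v w) u" "h (A *v w) v = h (B *v w) v"
      using that(3) by (simp_all add: g_def)
    have sw: "h (A *v x) y = bar (h (A *v y) x)" "h (B *v x) y = bar (h (B *v y) x)" for x y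
      using HermD[OF that(1)] HermD[OF that(2)] bar_h by metis+
    have *: "p = r" if "h p u = h r u" "h p v = h r v" "h p w = h r w" for p r
    proof (rule h_eqI)
      fix x obtain l m n where "x = l *s u + m *s v + n *s w" using ind3_span[OF i] by blast
      then show "h p x = h r x" using that by simp
    qed
    have "h (A *v u) v = h (B *v u) v" "h (A *v u) w = h (B *v u) w" "h (A *v v) w = h (B *v v) w"
      using sw[of u v] sw[of u w] sw[of v w] e by simp_all
    then show ?thesis using e by (intro mat_eq_on_ind3[OF i] *) auto
  qed
  have GH: "G p \<in> Herm" if "p \<in> D" for p
  proof -
    have x: "mat x ** outer y z + mat (bar x) ** outer z y \<in> Herm" for x y z
      using adj_add[OF adj_scale[OF adj_outer, of x y z] adj_scale[OF adj_outer, of "bar x" z y]]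
      by (simp add: Herm_def add.commute)
    show ?thesis using that unfolding G_def D_def
      by (auto intro!: Herm_closed(1,3,5) x)
  qed
  have gG: "g (G p) = p" if "p \<in> D" for p
    using that by (auto simp: g_def G_def D_def mv_simps d d')
  have gD: "g A \<in> D" if "A \<in> Herm" for A
    using HermD[OF that] by (auto simp: g_def D_def K_iff)
  have Gg: "G (g A) = A" if "A \<in> Herm" for A
    using eqI[OF GH[OF gD[OF that]] that] gG[OF gD[OF that]] by simp
  have "bij_betw g Herm D"
    by (rule bij_betw_byWitness[where f' = G]) (use gG Gg gD GH in auto)
  then have "card Herm = card D" by (rule bij_betw_same_card)
  then show "card Herm = q ^ 9"
    by (simp add: D_def card_cartesian_product card_K card_field flip: power_add power_Suc)
  define E where "E = {0::'a} \<times> K \<times> K \<times> {0::'a} \<times> {0::'a} \<times> (UNIV::'a set)"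
  have ED: "E \<subseteq> D" by (auto simp: E_def D_def)
  have gE: "g A \<in> E" if "A \<in> Herm" "A *v u = 0" for A
    using gD[OF that(1)] that HermD[OF that(1), of _ u] by (auto simp: g_def D_def E_def)
  have GE: "G p *v u = 0" if "p \<in> E" for p
    using that by (auto simp: G_def E_def mv_simps d')
  have "bij_betw g {A \<in> Herm. A *v u = 0} E"
    by (rule bij_betw_byWitness[where f' = G]) (use gG Gg gE GE GH ED in auto)
  then have "card {A \<in> Herm. A *v u = 0} = card E" by (rule bij_betw_same_card)
  then show "card {A \<in> Herm. A *v u = 0} = q ^ 4"
    by (simp add: E_def card_cartesian_product card_K card_field flip: power_add power_Suc)
qed

lemma extend_basis:
  fixes u :: "'a ^ 3"
  assumes "u \<noteq> 0"
  obtains v w where "ind3 u v w"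
proof -
  have "card (range (\<lambda>c. c *s u)) \<le> CARD('a)" by (rule card_image_le) simp
  also have "CARD('a) < CARD('a ^ 3)" unfolding card_V card_field using q_gt_1 by simp
  finally have "range (\<lambda>c. c *s u) \<noteq> UNIV" by auto
  then obtain v where v: "\<And>c. v \<noteq> c *s u" by blast
  have "x = 0 \<and> y = 0" if e: "x *s u + y *s v = 0" for x y
  proof -
    have "y = 0"
    proof (rule ccontr)
      assume "y \<noteq> 0"
      then have "v = (- x / y) *s u" using e by (simp add: vec_eq_iff field_simps eq_neg_iff_add_eq_0)
      then show False using v by blast
    qed
    then show ?thesis using e assms by simp
  qed
  then show thesis using ind3_extend that by blast
qed

lemma card_Herm: "card Herm = q ^ 9"
proof -
  have "axis 1 1 \<noteq> (0::'a ^ 3)" by (simp add: axis_eq_0_iff)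
  then obtain v w where "ind3 (axis 1 (1::'a)) v w" using extend_basis by blast
  then show ?thesis by (rule card_Herm_kernel(1))
qed

lemma card_Herm_annihilating: "v \<noteq> 0 \<Longrightarrow> card {A \<in> Herm. A *v v = 0} = q ^ 4"
  using card_Herm_kernel(2) by (blast elim: extend_basis)

end

section \<open>Maximal algebras of Hermitian operators and their number\<close>

context hermitian_plane
begin

lemma outer_zero [simp]: "outer 0 x = 0" "outer x 0 = 0" by (simp_all add: matrix_eq)

text \<open>The index set of the covers. The algebras are commutative, because a product of Hermitian
  operators is Hermitian only if the factors commute. An example is the Hermitian centraliser
  of a cyclic Hermitian operator, and the condition on the size makes it impossible for any other
  algebra to contain that operator.\<close>

definition Alg :: "('a ^ 3 ^ 3) set set" where
  "Alg = {S. S \<subseteq> Herm \<and> mat 1 \<in> S \<and> (\<forall>A\<in>S. \<forall>B\<in>S. A + B \<in> S \<and> A ** B \<in> S) \<and>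
    (\<forall>c\<in>K. \<forall>A\<in>S. mat c ** A \<in> S) \<and> card S = q ^ 3}"

lemma Alg_D:
  assumes "S \<in> Alg"
  shows "A \<in> S \<Longrightarrow> A \<in> Herm" "A \<in> S \<Longrightarrow> B \<in> S \<Longrightarrow> A + B \<in> S" "A \<in> S \<Longrightarrow> B \<in> S \<Longrightarrow> A ** B \<in> S"
    "c \<in> K \<Longrightarrow> A \<in> S \<Longrightarrow> mat c ** A \<in> S" "c \<in> K \<Longrightarrow> mat c \<in> S"
    "A \<in> S \<Longrightarrow> B \<in> S \<Longrightarrow> A - B \<in> S" "A \<in> S \<Longrightarrow> B \<in> S \<Longrightarrow> A ** B = B ** A" "card S = q ^ 3"
proof -
  show 1: "A \<in> S \<Longrightarrow> A \<in> Herm" "A \<in> S \<Longrightarrow> B \<in> S \<Longrightarrow> A + B \<in> S" "A \<in> S \<Longrightarrow> B \<in> S \<Longrightarrow> A ** B \<in> S"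
    "card S = q ^ 3" for A B
    using assms by (auto simp: Alg_def)
  show 2: "c \<in> K \<Longrightarrow> A \<in> S \<Longrightarrow> mat c ** A \<in> S" for c A using assms by (auto simp: Alg_def)
  have "mat 1 \<in> S" using assms by (auto simp: Alg_def)
  then show "c \<in> K \<Longrightarrow> mat c \<in> S" using 2[of c "mat 1"] by simp
  show "A - B \<in> S" if "A \<in> S" "B \<in> S"
  proof -
    have "mat (- 1) ** B \<in> S" using that 2 by blast
    then have "A + mat (- 1) ** B \<in> S" using 1 that by blast
    moreover have "A + mat (- 1) ** B = A - B" by (simp add: matrix_eq mv_simps)
    ultimately show ?thesis by simp
  qed
  show "A ** B = B ** A" if "A \<in> S" "B \<in> S"
    using Herm_mult_comm[OF 1(1)[OF that(1)] 1(1)[OF that(2)] 1(1)[OF 1(3)[OF that]]] .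
qed

lemma Alg_shift_iff: "S \<in> Alg \<Longrightarrow> s \<in> K \<Longrightarrow> mat s + A \<in> S \<longleftrightarrow> A \<in> S"
  using Alg_D(2)[of S "mat s" A] Alg_D(6)[of S "mat s + A" "mat s"] Alg_D(5)[of S s] by auto

definition herm_cent :: "'a ^ 3 ^ 3 \<Rightarrow> ('a ^ 3 ^ 3) set" where
  "herm_cent A = {B \<in> Herm. A ** B = B ** A}"

text \<open>The centraliser consists of the polynomials in \<open>A\<close> with coefficients in \<open>K\<close>: an operator
  \<open>x + y A + z A\<^sup>2\<close> has the adjoint with coefficients \<open>bar x, bar y, bar z\<close>.\<close>

lemma herm_cent_Alg:
  assumes A: "A \<in> Herm" "cyclic A"
  shows "herm_cent A \<in> Alg"
proof -
  have "herm_cent A = (\<lambda>(x, y, z). pol x y z A) ` (K \<times> K \<times> K)"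
  proof
    show "herm_cent A \<subseteq> (\<lambda>(x, y, z). pol x y z A) ` (K \<times> K \<times> K)"
    proof
      fix B assume "B \<in> herm_cent A"
      then obtain x y z where "x \<in> K" "y \<in> K" "z \<in> K" "B = pol x y z A"
        using cyclic_Herm_commutant[OF A] unfolding herm_cent_def by blast
      then show "B \<in> (\<lambda>(x, y, z). pol x y z A) ` (K \<times> K \<times> K)" by force
    qed
    show "(\<lambda>(x, y, z). pol x y z A) ` (K \<times> K \<times> K) \<subseteq> herm_cent A"
      using Herm_pol[OF A(1)] pol_self_comm[of _ _ _ A] by (auto simp: herm_cent_def)
  qed
  moreover have "inj_on (\<lambda>(x, y, z). pol x y z A) (K \<times> K \<times> K)"
    using cyclic_pol_inj[OF A(2)] by (auto intro!: inj_onI)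
  ultimately have card: "card (herm_cent A) = q ^ 3"
    by (simp add: card_image card_cartesian_product card_K power3_eq_cube)
  have comm: "B ** C = C ** B" if "B \<in> herm_cent A" "C \<in> herm_cent A" for B C
    using that unfolding herm_cent_def by (blast intro: cyclic_commuting_commute[OF A(2)])
  show ?thesis unfolding Alg_def
  proof (intro CollectI conjI ballI)
    fix B C assume BC: "B \<in> herm_cent A" "C \<in> herm_cent A"
    show "B + C \<in> herm_cent A" using BC 
      by (auto simp: herm_cent_def Herm_closed matrix_add_ldistrib) 
         (simp add: matrix_eq mv_simps)
    have "A ** B = B ** A" "A ** C = C ** A" using BC by (simp_all add: herm_cent_def)
    then have "A ** (B ** C) = B ** C ** A" by (simp add: matrix_mul_assoc) (simp flip: matrix_mul_assoc)
    then show "B ** C \<in> herm_cent A" using BC comm[OF BC] by (simp add: herm_cent_def Herm_comm_mult)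
  next
    fix c B assume "c \<in> K" "B \<in> herm_cent A"
    then show "mat c ** B \<in> herm_cent A" 
      by (auto simp: herm_cent_def Herm_closed mat_mat_assoc) (simp add: matrix_mul_assoc)
  qed (use card in \<open>auto simp: herm_cent_def Herm_closed\<close>)
qed

lemma Alg_eq_herm_cent: "S \<in> Alg \<Longrightarrow> A \<in> S \<Longrightarrow> cyclic A \<Longrightarrow> S = herm_cent A"
proof -
  assume S: "S \<in> Alg" "A \<in> S" "cyclic A"
  have "S \<subseteq> herm_cent A" using Alg_D[OF S(1)] S(2) by (auto simp: herm_cent_def)
  moreover have "card S = card (herm_cent A)" using Alg_D(8)[OF S(1)] Alg_D(8)[OF herm_cent_Alg] Alg_D(1)[OF S(1)] S by simp
  ultimately show ?thesis by (intro card_subset_eq) auto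
qed

text \<open>The \<open>K\<close>-span of \<open>1\<close> and \<open>out v\<close>, which is common to all algebras containing \<open>out v\<close>; adding one
  more operator in \<open>span_out2\<close> already determines the algebra.\<close>

definition span_out :: "'a ^ 3 \<Rightarrow> ('a ^ 3 ^ 3) set" where
  "span_out v = (\<lambda>(x, y). mat x + mat y ** out v) ` (K \<times> K)"

definition span_out2 :: "'a ^ 3 \<Rightarrow> 'a ^ 3 ^ 3 \<Rightarrow> ('a ^ 3 ^ 3) set" where
  "span_out2 v A = (\<lambda>(x, y, z). mat x + mat y ** out v + mat z ** A) ` (K \<times> K \<times> K)"

lemma span_out_I: "x \<in> K \<Longrightarrow> y \<in> K \<Longrightarrow> mat x + mat y ** out v \<in> span_out v" by (force simp: span_out_def)
lemma span_out2_I: "x \<in> K \<Longrightarrow> y \<in> K \<Longrightarrow> z \<in> K \<Longrightarrow> mat x + mat y ** out v + mat z ** A \<in> span_out2 v A" by (force simp: span_out2_def)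

lemma span_out_inj:
  assumes "v \<noteq> 0" "mat x + mat y ** out v = mat x' + mat y' ** out v"
  shows "x = x' \<and> y = y'"
proof -
  obtain u where u: "u \<noteq> 0" "h u v = 0" using perp_pair[of v v] by blast
  have x: "x = x'" using arg_cong[OF assms(2), of "\<lambda>M. M *v u"] u by (simp add: mv_simps)
  obtain d where d: "h d v = 1" using h_dual[OF assms(1)] by blast
  show ?thesis using arg_cong[OF assms(2), of "\<lambda>M. M *v d"] d x assms(1) by (simp add: mv_simps)
qed

lemma card_span_out: "v \<noteq> 0 \<Longrightarrow> card (span_out v) = q ^ 2"
  unfolding span_out_def using span_out_inj
  by (subst card_image) (auto intro!: inj_onI simp: card_cartesian_product card_K power2_eq_square)

lemma commute_out_iff:
  assumes "A \<in> Herm" "v \<noteq> 0"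
  shows "A ** out v = out v ** A \<longleftrightarrow> (\<exists>s\<in>K. A *v v = s *s v)"
proof
  assume e: "A ** out v = out v ** A"
  obtain d where d: "h d v = 1" "h v d = 1" using h_dual[OF assms(2)] by blast
  have av: "A *v v = h (A *v d) v *s v" using arg_cong[OF e, of "\<lambda>M. M *v d"] d by simp
  define s where "s = h (A *v d) v"
  have "bar s = h v (A *v d)" by (simp add: s_def)
  also have "\<dots> = h (A *v v) d" using HermD[OF assms(1)] by simp
  also have "\<dots> = s" using av d by (simp flip: s_def)
  finally show "\<exists>s\<in>K. A *v v = s *s v" using av by (auto simp: K_iff s_def)
next
  assume "\<exists>s\<in>K. A *v v = s *s v"
  then obtain s where s: "bar s = s" "A *v v = s *s v" by (auto simp: K_iff)
  have "h (A *v u) v = s * h u v" for u using s HermD[OF assms(1)] by simp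
  then show "A ** out v = out v ** A" by (simp add: matrix_eq s mult.commute) 
qed

lemma cyclic_kernel_line:
  fixes A :: "'a ^ 3 ^ 3"
  assumes "cyclic A" "A *v v = 0" "v \<noteq> 0" "A *v w = 0"
  obtains c where "w = c *s v"
proof -
  obtain u where u: "ind3 u (A *v u) (A *v (A *v u))" using assms(1) cyclic_def by blast
  obtain x y z where p: "A *v (A *v (A *v u)) = x *s u + y *s (A *v u) + z *s (A *v (A *v u))"
    using ind3_span[OF u] by blast
  have *: "\<exists>c. w = c *s (A *v (A *v u) - z *s (A *v u) - y *s u) \<and> c * x = 0" if w: "A *v w = 0" for w
  proof -
    obtain a b c where abc: "w = a *s u + b *s (A *v u) + c *s (A *v (A *v u))" using ind3_span[OF u] by blast
    have "A *v w = (c * x) *s u + (a + c * y) *s (A *v u) + (b + c * z) *s (A *v (A *v u))"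
      unfolding abc by (simp add: mv_simps p) (simp add: vec_eq_iff algebra_simps)
    then have "c * x = 0" "a = - (c * y)" "b = - (c * z)" using ind3D[OF u] w by (metis eq_neg_iff_add_eq_0)+
    then show ?thesis unfolding abc by (intro exI[of _ c]) (simp add: vec_eq_iff algebra_simps)
  qed
  from *[OF assms(2)] obtain c where c: "v = c *s (A *v (A *v u) - z *s (A *v u) - y *s u)" by blast
  from *[OF assms(4)] obtain d where d: "w = d *s (A *v (A *v u) - z *s (A *v u) - y *s u)" by blast
  have "c \<noteq> 0" using c assms(3) by auto
  then have "w = (d / c) *s v" unfolding c d by simp
  then show thesis by (rule that)
qed

lemma cyclic_shift: 
  fixes A :: "'a ^ 3 ^ 3"
  assumes "cyclic A" shows "cyclic (A - mat s)"
proof -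
  obtain u where u: "ind3 u (A *v u) (A *v (A *v u))" using assms cyclic_def by blast
  let ?B = "A - mat s"
  have "ind3 u (?B *v u) (?B *v (?B *v u))" unfolding ind3_def
  proof (intro allI impI)
    fix x y z assume "x *s u + y *s (?B *v u) + z *s (?B *v (?B *v u)) = 0"
    then have "(x - y * s + z * s * s) *s u + (y - 2 * z * s) *s (A *v u) + z *s (A *v (A *v u)) = 0"
      by (simp add: mv_simps vec_eq_iff algebra_simps)
    from ind3D[OF u this] show "x = 0 \<and> y = 0 \<and> z = 0" by auto
  qed
  then show ?thesis unfolding cyclic_def by blast
qed

lemma not_cyclic_annihilating:
  assumes "A \<in> Herm" "v \<noteq> 0" "A *v v = 0" "A \<notin> span_out v" "\<not> cyclic A"
  obtains w where "A = out w" "w \<noteq> 0" "h v w = 0" "\<And>c. w \<noteq> c *s v"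
proof -
  obtain s w where sw: "s \<in> K" "A = mat s + out w" using not_cyclic_Herm assms(1,5) by blast
  have nw: "w \<noteq> c *s v" for c
  proof
    assume "w = c *s v"
    then have "A = mat s + mat (c * bar c) ** out v" using sw(2) out_scale by metis
    then show False using span_out_I[OF sw(1)] assms(4) K_closed(9) by metis
  qed
  have e: "s *s v + h v w *s w = 0" using assms(3) sw(2) by (simp add: mv_simps)
  have "h v w = 0"
  proof (rule ccontr)
    assume "h v w \<noteq> 0"
    then have "w = (- s / h v w) *s v" using e by (simp add: vec_eq_iff field_simps eq_neg_iff_add_eq_0)
    then show False using nw by blast
  qed
  moreover have "w \<noteq> 0" using nw[of 0] by simp
  ultimately show thesis using that[of w] nw sw e assms(2) by simp
qed

text \<open>If \<open>A\<close> is cyclic, its cubic relation and \<open>A v = 0\<close> show that a quadratic expression in \<open>A\<close> has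
  its range in the line of \<open>v\<close>, and this expression is then a multiple of \<open>out v\<close>. Otherwise \<open>A\<close> has
  rank one and its square is a multiple of it.\<close>

lemma square_in_span_out2:
  assumes "A \<in> Herm" "v \<noteq> 0" "A *v v = 0" "A \<notin> span_out v"
  shows "A ** A \<in> span_out2 v A"
proof (cases "cyclic A")
  case True
  obtain x y z where p: "A ** (A ** A) = pol x y z A" using cyclic_minimal_polynomial[OF True] by blast
  have "A ** (A ** A) \<in> Herm" using assms(1) by (simp add: Herm_comm_mult matrix_mul_assoc)
  then have K: "x \<in> K" "y \<in> K" "z \<in> K" using Herm_pol_coeffs[OF assms(1) True, of x y z] p by simp_all
  have "x = 0" using arg_cong[OF p, of "\<lambda>M. M *v v"] assms(2,3) by simp
  define B where "B = pol (- y) (- z) 1 A"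
  have "A *v (B *v u) = 0" for u 
    using arg_cong[OF p, of "\<lambda>M. M *v u"] \<open>x = 0\<close> by (simp add: B_def mv_simps vec_eq_iff algebra_simps)
  then have "\<exists>t. B *v u = t *s v" for u using cyclic_kernel_line[OF True assms(3,2)] by metis
  moreover have "B \<in> Herm" unfolding B_def by (intro Herm_pol assms K_closed K)
  ultimately obtain b where b: "B = out (b *s v)" using Herm_rank_one by blast
  have "A ** A = mat y + mat (b * bar b) ** out v + mat z ** A"
    using b unfolding out_scale B_def by (simp add: matrix_eq mv_simps vec_eq_iff algebra_simps)
  then show ?thesis using span_out2_I K K_closed by metis
next
  case False
  then obtain w where A: "A = out w" using not_cyclic_annihilating[OF assms] by blast
  have "A ** A = mat 0 + mat 0 ** out v + mat (h w w) ** A"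
    unfolding A by (simp add: matrix_eq mult.commute)
  then show ?thesis using span_out2_I[of 0 0 "h w w"] by auto
qed

lemma span_out2_Alg:
  assumes "A \<in> Herm" "v \<noteq> 0" "A ** out v = out v ** A" "A \<notin> span_out v"
  shows "span_out2 v A \<in> Alg" "out v \<in> span_out2 v A" "A \<in> span_out2 v A"
proof -
  show "out v \<in> span_out2 v A" "A \<in> span_out2 v A" using span_out2_I[of 0 1 0 v A] span_out2_I[of 0 0 1 v A] by auto
  obtain s where s: "s \<in> K" "A *v v = s *s v" using commute_out_iff[OF assms(1,2)] assms(3) by blast
  let ?N = "out v"
  have hv: "h v v \<in> K" by simp
  have NN: "?N ** ?N = mat (h v v) ** ?N" by (simp add: matrix_eq)
  have AN: "A ** ?N = mat s ** ?N" by (simp add: matrix_eq s mult.commute)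
  have NA: "?N ** A = mat s ** ?N" using AN assms(3) by simp
  have T_add: "B + C \<in> span_out2 v A" if BC: "B \<in> span_out2 v A" "C \<in> span_out2 v A" for B C
  proof -
    obtain x y z x' y' z' where "x \<in> K" "y \<in> K" "z \<in> K" "x' \<in> K" "y' \<in> K" "z' \<in> K" 
       "B = mat x + mat y ** ?N + mat z ** A" "C = mat x' + mat y' ** ?N + mat z' ** A"
      using BC by (auto simp: span_out2_def)
    moreover from this have "B + C = mat (x + x') + mat (y + y') ** ?N + mat (z + z') ** A"
      by (simp add: matrix_eq mv_simps vec_eq_iff algebra_simps)
    ultimately show ?thesis using span_out2_I K_closed(3) by metis
  qed
  have T_scale: "mat c ** B \<in> span_out2 v A" if BC: "c \<in> K" "B \<in> span_out2 v A" for c B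
  proof -
    obtain x y z where "x \<in> K" "y \<in> K" "z \<in> K" "B = mat x + mat y ** ?N + mat z ** A" 
      using BC by (auto simp: span_out2_def)
    moreover from this have "mat c ** B = mat (c * x) + mat (c * y) ** ?N + mat (c * z) ** A"
      by (simp add: matrix_eq mv_simps vec_eq_iff algebra_simps)
    ultimately show ?thesis using span_out2_I K_closed(5) BC(1) by metis
  qed
  have T_mat: "mat c \<in> span_out2 v A" if "c \<in> K" for c using span_out2_I[of c 0 0 v A] that by simp
  have T_N: "mat c ** ?N \<in> span_out2 v A" if "c \<in> K" for c using span_out2_I[of 0 c 0 v A] that by simp
  have AA: "A ** A \<in> span_out2 v A"
  proof -
    define B where "B = A - mat s"
    have A: "A = mat s + B" by (simp add: B_def)
    have B: "B \<in> Herm" "B *v v = 0" using assms(1) s by (auto simp: B_def Herm_closed mv_simps)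
    have "B \<notin> span_out v"
    proof
      assume "B \<in> span_out v"
      then obtain x y where "x \<in> K" "y \<in> K" "B = mat x + mat y ** ?N" by (auto simp: span_out_def)
      then have "A = mat (s + x) + mat y ** ?N" unfolding A by (simp add: matrix_eq mv_simps vec_eq_iff algebra_simps)
      then show False using assms(4) span_out_I s(1) \<open>x \<in> K\<close> \<open>y \<in> K\<close> K_closed(3) by metis
    qed
    from square_in_span_out2[OF B(1) assms(2) B(2) this] obtain x y z where xyz: "x \<in> K" "y \<in> K" "z \<in> K"
      "B ** B = mat x + mat y ** ?N + mat z ** B" by (auto simp: span_out2_def)
    have "A ** A = mat s ** mat s + mat (2 * s) ** B + B ** B"
      unfolding A by (simp add: matrix_eq mv_simps vec_eq_iff algebra_simps)
    also have "\<dots> = mat (x - s * s - z * s) + mat y ** ?N + mat (2 * s + z) ** A"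
      unfolding xyz(4) A by (simp add: matrix_eq mv_simps vec_eq_iff algebra_simps)
    finally show ?thesis using span_out2_I xyz(1-3) s(1) K_closed by metis
  qed
  have T_mult: "B ** C \<in> span_out2 v A" if BC: "B \<in> span_out2 v A" "C \<in> span_out2 v A" for B C
  proof -
    obtain x y z x' y' z' where k: "x \<in> K" "y \<in> K" "z \<in> K" "x' \<in> K" "y' \<in> K" "z' \<in> K" and
       e: "B = mat x + mat y ** ?N + mat z ** A" "C = mat x' + mat y' ** ?N + mat z' ** A"
      using BC by (auto simp: span_out2_def)
    have "B ** C = mat (x * x') + mat (x * y') ** ?N + mat (x * z') ** A + mat (y * x') ** ?N
       + mat (y * y') ** (?N ** ?N) + mat (y * z') ** (?N ** A) + mat (z * x') ** A
       + mat (z * y') ** (A ** ?N) + mat (z * z') ** (A ** A)"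
      unfolding e by (simp add: matrix_eq mv_simps vec_eq_iff algebra_simps)
    moreover have "mat (y * y') ** (?N ** ?N) \<in> span_out2 v A" "mat (y * z') ** (?N ** A) \<in> span_out2 v A"
      "mat (z * y') ** (A ** ?N) \<in> span_out2 v A" "mat (z * z') ** (A ** A) \<in> span_out2 v A"
      unfolding NN NA AN using k s(1) hv by (intro T_scale T_N AA K_closed; simp)+
    ultimately show ?thesis
      using k by (auto intro!: T_add T_scale T_mat T_N K_closed \<open>A \<in> span_out2 v A\<close>)
  qed
  have sub: "span_out2 v A \<subseteq> Herm" using assms(1) by (auto simp: span_out2_def intro!: Herm_closed(1,3,4,5))
  have inj: "x = x' \<and> y = y' \<and> z = z'" if k: "x \<in> K" "y \<in> K" "z \<in> K" "x' \<in> K" "y' \<in> K" "z' \<in> K" 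
      and e: "mat x + mat y ** ?N + mat z ** A = mat x' + mat y' ** ?N + mat z' ** A" for x y z x' y' z'
  proof -
    have "z = z'"
    proof (rule ccontr)
      assume z: "z \<noteq> z'"
      have "(z - z') *s (A *v u) = (x' - x) *s u + ((y' - y) * h u v) *s v" for u
        using arg_cong[OF e, of "\<lambda>M. M *v u"] by (simp add: mv_simps vec_eq_iff algebra_simps)
      then have "A *v u = inverse (z - z') *s ((x' - x) *s u + ((y' - y) * h u v) *s v)" for u
        using z by (metis eq_iff_diff_eq_0 left_inverse vec.scale_one vec.scale_scale)
      then have "A = mat ((x' - x) / (z - z')) + mat ((y' - y) / (z - z')) ** ?N"
        using z by (simp add: matrix_eq mv_simps vec_eq_iff divide_inverse algebra_simps)
      then show False using assms(4) span_out_I k K_closed(4,8) by metis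
    qed
    then show "x = x' \<and> y = y' \<and> z = z'" using span_out_inj[OF assms(2)] e by simp
  qed
  have "inj_on (\<lambda>(x, y, z). mat x + mat y ** out v + mat z ** A) (K \<times> K \<times> K)"
    by (rule inj_onI) (clarsimp, rule inj)
  then have "card (span_out2 v A) = q ^ 3" unfolding span_out2_def 
    by (simp add: card_image card_cartesian_product card_K power3_eq_cube)
  then show "span_out2 v A \<in> Alg" using sub T_add T_mult T_scale T_mat by (auto simp: Alg_def)
qed

lemma Alg_through_pair:
  assumes "S \<in> Alg" "v \<noteq> 0" "out v \<in> S" "A \<in> S" "A \<notin> span_out v"
  shows "S = span_out2 v A"
proof -
  have "span_out2 v A \<subseteq> S" using assms by (auto simp: span_out2_def intro!: Alg_D(2,4,5)[OF assms(1)])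
  moreover have "span_out2 v A \<in> Alg" using assms Alg_D[OF assms(1)] by (intro span_out2_Alg) auto
  ultimately show ?thesis using Alg_D(8) assms(1) by (metis card_subset_eq finite)
qed

lemma span_out_subset: "S \<in> Alg \<Longrightarrow> out v \<in> S \<Longrightarrow> span_out v \<subseteq> S"
  by (auto simp: span_out_def intro!: Alg_D(2,4,5))

text \<open>The Hermitian operators commuting with \<open>out v\<close> form a \<open>K\<close>-space \<open>C\<close> of dimension five. Its
  elements outside the plane \<open>span_out v\<close> are partitioned by the algebras containing \<open>out v\<close>, each
  of which is a three-dimensional space containing the plane. Hence there are
  \<open>(q\<^sup>5 - q\<^sup>2) / (q\<^sup>3 - q\<^sup>2)\<close> of them.\<close>

lemma card_Alg_through:
  assumes v: "v \<noteq> 0"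
  shows "card {S \<in> Alg. out v \<in> S} = q ^ 2 + q + 1"
proof -
  define C where "C = {A \<in> Herm. A ** out v = out v ** A}"
  define Z where "Z = {A \<in> Herm. A *v v = 0}"
  define F where "F = (\<lambda>S. S - span_out v) ` {S \<in> Alg. out v \<in> S}"
  have "bij_betw (\<lambda>(s, A). mat s + A) (K \<times> Z) C"
  proof (rule bij_betw_imageI)
    show "inj_on (\<lambda>(s, A). mat s + A) (K \<times> Z)"
    proof (rule inj_onI, clarify)
      fix s A s' A' assume "A \<in> Z" "A' \<in> Z" and e: "mat s + A = mat s' + A'"
      have "s = s'" using \<open>A \<in> Z\<close> \<open>A' \<in> Z\<close> arg_cong[OF e, of "\<lambda>M. M *v v"] v by (simp add: mv_simps Z_def)
      then show "s = s' \<and> A = A'" using e by simp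
    qed
    show "(\<lambda>(s, A). mat s + A) ` (K \<times> Z) = C"
    proof safe
      fix s A assume "s \<in> K" "A \<in> Z"
      then show "mat s + A \<in> C" using commute_out_iff[of "mat s + A" v] v
        by (auto simp: C_def Z_def Herm_closed mv_simps)
    next
      fix A assume "A \<in> C"
      then obtain s where s: "s \<in> K" "A *v v = s *s v" using commute_out_iff v by (auto simp: C_def)
      then have "A - mat s \<in> Z" using \<open>A \<in> C\<close> by (auto simp: C_def Z_def Herm_closed mv_simps)
      moreover have "A = mat s + (A - mat s)" by simp
      ultimately show "A \<in> (\<lambda>(s, A). mat s + A) ` (K \<times> Z)" using s(1) by (metis (mono_tags, lifting) SigmaI case_prod_conv image_iff)
    qed
  qed
  then have "card (K \<times> Z) = card C" by (rule bij_betw_same_card)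
  then have cC: "card C = q ^ 5" using card_Herm_annihilating[OF v]
    by (simp add: card_cartesian_product card_K Z_def eval_nat_numeral)
  have LC: "span_out v \<subseteq> C" by (auto simp: span_out_def C_def matrix_eq mv_simps vec_eq_iff algebra_simps intro!: Herm_closed(1,3,4,5))
  have inS: "S \<subseteq> C" "span_out v \<subseteq> S" if "S \<in> Alg" "out v \<in> S" for S
    using that Alg_D[OF that(1)] span_out_subset by (auto simp: C_def)
  have "\<Union>F = C - span_out v"
  proof
    show "\<Union>F \<subseteq> C - span_out v" using inS by (auto simp: F_def)
    show "C - span_out v \<subseteq> \<Union>F"
    proof
      fix A assume "A \<in> C - span_out v"
      then have "span_out2 v A \<in> Alg" "out v \<in> span_out2 v A" "A \<in> span_out2 v A - span_out v" using span_out2_Alg v by (auto simp: C_def)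
      then show "A \<in> \<Union>F" by (auto simp: F_def)
    qed
  qed
  moreover have "card (C - span_out v) = q ^ 5 - q ^ 2" using LC cC card_span_out[OF v] by (simp add: card_Diff_subset)
  moreover have "(q ^ 3 - q ^ 2) * card F = card (\<Union>F)"
  proof (rule card_partition)
    show "card c = q ^ 3 - q ^ 2" if "c \<in> F" for c
      using that inS card_span_out[OF v] Alg_D(8) by (auto simp: F_def card_Diff_subset)
    show "c1 \<inter> c2 = {}" if c: "c1 \<in> F" "c2 \<in> F" "c1 \<noteq> c2" for c1 c2
    proof (rule ccontr)
      assume "c1 \<inter> c2 \<noteq> {}"
      then obtain A where A: "A \<in> c1" "A \<in> c2" by blast
      obtain S1 S2 where S: "S1 \<in> Alg" "out v \<in> S1" "c1 = S1 - span_out v" "S2 \<in> Alg" "out v \<in> S2" "c2 = S2 - span_out v"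
        using c by (auto simp: F_def)
      then have "S1 = span_out2 v A" "S2 = span_out2 v A" using Alg_through_pair[of _ v A] A v by auto
      then show False using S c by simp
    qed
  qed (auto simp: F_def)
  moreover have "card F = card {S \<in> Alg. out v \<in> S}" unfolding F_def
  proof (intro card_image inj_onI)
    fix S S' assume *: "S \<in> {S \<in> Alg. out v \<in> S}" "S' \<in> {S \<in> Alg. out v \<in> S}" "S - span_out v = S' - span_out v"
    have L: "span_out v \<subseteq> S" "span_out v \<subseteq> S'" using *(1,2) inS(2) by simp_all
    show "S = S'" using *(3) L by blast
  qed
  ultimately have e: "(q ^ 3 - q ^ 2) * card {S \<in> Alg. out v \<in> S} = q ^ 5 - q ^ 2" by simp
  have e2: "(q ^ 3 - q ^ 2) * (q ^ 2 + q + 1) = q ^ 5 - q ^ 2"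
    by (simp add: algebra_simps diff_mult_distrib power2_eq_square power3_eq_cube eval_nat_numeral)
  have "q ^ 3 - q ^ 2 \<noteq> 0" using q_gt_1 by (simp add: power_strict_increasing not_le)
  then show ?thesis using trans[OF e e2[symmetric]] unfolding mult_cancel1 by auto
qed

text \<open>Count in two ways the pairs of an algebra and a nonscalar element of it. A cyclic operator lies
  in exactly one algebra. The other nonscalar Hermitian operators are the \<open>s + out v\<close> with \<open>v \<noteq> 0\<close>;
  there are \<open>q (q\<^sup>6 - 1) / (q + 1)\<close> of them, and each lies in \<open>q\<^sup>2 + q + 1\<close> algebras.\<close>

lemma card_Alg: "card Alg = q ^ 6 + q ^ 5 + q ^ 4 + q ^ 3 + q ^ 2 + q + 1"
proof -
  define Sc :: "('a ^ 3 ^ 3) set" where "Sc = mat ` K"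
  define k where "k A = (if cyclic A then 1 else q ^ 2 + q + 1)" for A :: "'a ^ 3 ^ 3"
  define r where "r = card (out ` (- {0}))"
  define N where "N = {A \<in> Herm - Sc. \<not> cyclic A}"
  have cSc: "card Sc = q" unfolding Sc_def using card_K by (subst card_image) (auto intro!: inj_onI simp: mat_inj)
  have ScS: "Sc \<subseteq> S" if "S \<in> Alg" for S using Alg_D(5)[OF that] by (auto simp: Sc_def)
  have "(\<Sum>S\<in>Alg. card {A \<in> Herm - Sc. A \<in> S}) = sum k (Herm - Sc)"
  proof (rule sum_multicount_gen)
    show "\<forall>A\<in>Herm - Sc. card {S \<in> Alg. A \<in> S} = k A"
    proof
      fix A assume A: "A \<in> Herm - Sc"
      show "card {S \<in> Alg. A \<in> S} = k A"
      proof (cases "cyclic A")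
        case True
        then have "{S \<in> Alg. A \<in> S} = {herm_cent A}"
          using Alg_eq_herm_cent herm_cent_Alg A by (auto simp: herm_cent_def)
        then show ?thesis using True by (simp add: k_def)
      next
        case False
        then obtain s v where sv: "s \<in> K" "A = mat s + out v" using not_cyclic_Herm A by blast
        have "v \<noteq> 0"
        proof
          assume "v = 0"
          then have "A = mat s" using sv by (simp add: matrix_eq mv_simps)
          then show False using A sv by (auto simp: Sc_def)
        qed
        have "{S \<in> Alg. A \<in> S} = {S \<in> Alg. out v \<in> S}" unfolding sv(2) using Alg_shift_iff[OF _ sv(1)] by blast
        then show ?thesis using card_Alg_through[OF \<open>v \<noteq> 0\<close>] False by (simp add: k_def)
      qed
    qed
  qed auto
  moreover have "card {A \<in> Herm - Sc. A \<in> S} = q ^ 3 - q" if "S \<in> Alg" for S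
  proof -
    have "{A \<in> Herm - Sc. A \<in> S} = S - Sc" using Alg_D(1)[OF that] by auto
    then show ?thesis using ScS[OF that] cSc Alg_D(8)[OF that] by (simp add: card_Diff_subset)
  qed
  ultimately have 1: "card Alg * (q ^ 3 - q) = sum k (Herm - Sc)" by simp
  have ScH: "Sc \<subseteq> Herm" by (auto simp: Sc_def Herm_closed)
  have "sum k (Herm - Sc) = sum k ((Herm - Sc) - N) + sum k N"
    by (rule sum.subset_diff) (auto simp: N_def)
  also have "sum k ((Herm - Sc) - N) = card ((Herm - Sc) - N)"
    by (subst card_eq_sum, rule sum.cong) (auto simp: N_def k_def)
  also have "\<dots> = q ^ 9 - q - card N"
    using ScH cSc card_Herm by (subst card_Diff_subset) (auto simp: N_def card_Diff_subset)
  also have "sum k N = card N * (q ^ 2 + q + 1)" by (simp add: N_def k_def)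
  finally have 2: "sum k (Herm - Sc) = q ^ 9 - q - card N + card N * (q ^ 2 + q + 1)" .
  have "bij_betw (\<lambda>(s, B). mat s + B) (K \<times> out ` (- {0})) N"
  proof (rule bij_betw_imageI)
    show "inj_on (\<lambda>(s, B). mat s + B) (K \<times> out ` (- {0}))"
      using shift_out_inject by (auto intro!: inj_onI)
    show "(\<lambda>(s, B). mat s + B) ` (K \<times> out ` (- {0})) = N"
    proof (intro equalityI subsetI)
      fix X assume "X \<in> (\<lambda>(s, B). mat s + B) ` (K \<times> out ` (- {0}))"
      then obtain s v where sv: "s \<in> K" "v \<noteq> 0" "X = mat s + out v" by auto
      have "mat s + out v \<noteq> mat c" for c
        using shift_out_inject(2)[of s v c 0] out_nonzero[OF sv(2)] by auto
      then show "X \<in> N" using sv not_cyclic_shift_out by (auto simp: N_def Sc_def Herm_closed)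
    next
      fix A assume A: "A \<in> N"
      then obtain s v where sv: "s \<in> K" "A = mat s + out v" using not_cyclic_Herm by (auto simp: N_def)
      have "v \<noteq> 0"
      proof
        assume "v = 0"
        then have "A = mat s" using sv by (simp add: matrix_eq mv_simps)
        then show False using A sv by (auto simp: N_def Sc_def)
      qed
      then show "A \<in> (\<lambda>(s, B). mat s + B) ` (K \<times> out ` (- {0}))" using sv by force
    qed
  qed
  then have "card (K \<times> out ` (- {0})) = card N" by (rule bij_betw_same_card)
  then have cN: "card N = q * r" by (simp add: card_cartesian_product card_K r_def)
  have "N \<subseteq> Herm - Sc" by (auto simp: N_def)
  then have "card N \<le> card (Herm - Sc)" by (intro card_mono) auto
  then have le: "q * r \<le> q ^ 9 - q" using cN ScH cSc card_Herm by (simp add: card_Diff_subset)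
  have r: "r * (q + 1) = q ^ 6 - 1" using card_out by (simp add: r_def)
  \<comment> \<open>Integers avoid the truncated subtraction of natural numbers.\<close>
  define n where "n = int (card Alg)"
  define Q where "Q = int q"
  define R where "R = int r"
  have q1: "q \<le> q ^ 3" "q \<le> q ^ 9" "1 \<le> q ^ 6" using q_gt_1 by (auto simp: self_le_power)
  have R: "R * (Q + 1) = Q ^ 6 - 1"
    using arg_cong[OF r, of int] q1 by (simp add: R_def Q_def of_nat_diff algebra_simps)
  have "n * (Q ^ 3 - Q) = Q ^ 9 - Q - Q * R + Q * R * (Q ^ 2 + Q + 1)"
    using arg_cong[OF 1[unfolded 2 cN], of int] q1 le 
    by (simp add: n_def Q_def R_def of_nat_diff) (simp add: algebra_simps)
  then have "n * (Q ^ 3 - Q) * (Q + 1) = (Q ^ 9 - Q - Q * R + Q * R * (Q ^ 2 + Q + 1)) * (Q + 1)"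
    by (rule arg_cong)
  also have "\<dots> = (Q ^ 9 - Q) * (Q + 1) + Q * (R * (Q + 1)) * (Q ^ 2 + Q)"
    by (simp add: algebra_simps power2_eq_square)
  also have "\<dots> = (Q ^ 6 + Q ^ 5 + Q ^ 4 + Q ^ 3 + Q ^ 2 + Q + 1) * (Q ^ 3 - Q) * (Q + 1)"
    unfolding R by (simp add: algebra_simps eval_nat_numeral)
  finally have "n * ((Q ^ 3 - Q) * (Q + 1)) = (Q ^ 6 + Q ^ 5 + Q ^ 4 + Q ^ 3 + Q ^ 2 + Q + 1) * ((Q ^ 3 - Q) * (Q + 1))"
    by (simp only: mult.assoc)
  moreover have "(Q ^ 3 - Q) * (Q + 1) \<noteq> 0"
  proof -
    have "Q ^ 1 < Q ^ 3" using q_gt_1 by (intro power_strict_increasing) (auto simp: Q_def)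
    moreover have "Q + 1 > 0" by (simp add: Q_def)
    ultimately show ?thesis by simp
  qed
  ultimately have "n = Q ^ 6 + Q ^ 5 + Q ^ 4 + Q ^ 3 + Q ^ 2 + Q + 1" by (metis mult_right_cancel)
  then have "int (card Alg) = int (q ^ 6 + q ^ 5 + q ^ 4 + q ^ 3 + q ^ 2 + q + 1)" by (simp add: n_def Q_def)
  then show ?thesis by (simp only: of_nat_eq_iff)
qed

end

section \<open>Unitary operators\<close>

context hermitian_plane
begin

lemma rank_one_shift_not_cyclic:
  fixes A :: "'a ^ 3 ^ 3"
  assumes "\<And>u. \<exists>t. A *v u = s *s u + t *s x"
  shows "\<not> cyclic A"
proof
  assume "cyclic A"
  then obtain u where u: "ind3 u (A *v u) (A *v (A *v u))" using cyclic_def by blast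
  obtain t where t: "A *v u = s *s u + t *s x" using assms by blast
  obtain t' where t': "A *v x = s *s x + t' *s x" using assms by blast
  have "A *v (A *v u) = s *s (A *v u) + (t * (s + t')) *s x"
    using arg_cong[OF t, of "\<lambda>z. A *v z"] by (simp add: mv_simps t') (simp add: vec_eq_iff algebra_simps)
  also have "t *s x = A *v u - s *s u" unfolding t by simp
  then have "(t * (s + t')) *s x = (s + t') *s (A *v u - s *s u)" by (metis mult.commute vec.scale_scale)
  finally have "(s * (s + t')) *s u + (- s - (s + t')) *s (A *v u) + 1 *s (A *v (A *v u)) = 0"
    by (simp add: vec_eq_iff algebra_simps)
  from ind3D[OF u this] show False by simp
qed

text \<open>A nondegenerate form in three variables has Witt index at most one.\<close>

lemma no_isotropic_plane:
  assumes "h v v = 0" "h w w = 0" "h v w = 0" "v \<noteq> 0"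
  obtains c where "w = c *s v"
proof -
  have wv: "h w v = 0" using assms(3) h_eq_0_comm by blast
  have False if nw: "\<And>c. w \<noteq> c *s v"
  proof -
    have i2: "x = 0 \<and> y = 0" if e: "x *s v + y *s w = 0" for x y
    proof -
      have "y = 0"
      proof (rule ccontr)
        assume "y \<noteq> 0"
        then have "w = (- x / y) *s v" using e by (simp add: vec_eq_iff field_simps eq_neg_iff_add_eq_0)
        then show False using nw by blast
      qed
      then show ?thesis using e assms(4) by simp
    qed
    obtain u where u: "ind3 v w u" using ind3_extend[OF i2] by blast
    let ?p = "h w u *s v - h v u *s w"
    have "h ?p z = 0" for z
    proof -
      obtain a b c where "z = a *s v + b *s w + c *s u" using ind3_span[OF u] by blast
      then show ?thesis using assms wv by simp
    qed
    then have "?p = 0" by (rule h_nondeg)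
    then have "h w u *s v + (- h v u) *s w = 0" by (simp add: vec_eq_iff)
    from i2[OF this] have z: "h v u = 0" by simp
    have "h v z = 0" for z
    proof -
      obtain a b c where "z = a *s v + b *s w + c *s u" using ind3_span[OF u] by blast
      then show ?thesis using assms z by simp
    qed
    then show False using assms(4) h_nondeg by blast
  qed
  then show thesis using that by blast
qed

text \<open>If one of the vectors is isotropic, the operator has a Jordan block of size two for the eigenvalue
  \<open>0\<close>. Otherwise its eigenvalues are \<open>0\<close>, \<open>h v v\<close> and \<open>t h w w\<close>, and for \<open>q > 2\<close> the field \<open>K\<close> has
  room for three different ones. This is the point where \<open>q = 2\<close> begins to differ.\<close>

lemma two_outs_cyclic:
  assumes v: "v \<noteq> 0" "w \<noteq> 0" "h v w = 0" and nw: "\<And>c. w \<noteq> c *s v"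
    and q: "q > 2 \<or> h v v = 0 \<or> h w w = 0"
  obtains t where "t \<in> K" "cyclic (out v + mat t ** out w)"
proof -
  have wv: "h w v = 0" using v(3) h_eq_0_comm by blast
  have jordan: "cyclic (out x + out y)" 
    if xy: "x \<noteq> 0" "h x x = 0" "h y y \<noteq> 0" "h x y = 0" for x y
  proof -
    have yx: "h y x = 0" using xy(4) h_eq_0_comm by blast
    obtain d0 where d0: "h d0 x = 1" "h x d0 = 1" using h_dual[OF xy(1)] by blast
    define d where "d = d0 - (h d0 y / h y y) *s y"
    have d: "h d x = 1" "h x d = 1" "h d y = 0" using d0 xy yx by (simp_all add: d_def)
    have yd: "h y d = 0" using d(3) h_eq_0_comm by blast
    let ?B = "out x + out y" and ?g = "h y y"
    have B: "?B *v (y + d) = ?g *s y + x" "?B *v (?g *s y + x) = (?g * ?g) *s y"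
      using xy yx d by (simp_all add: mv_simps vec_eq_iff algebra_simps)
    have "ind3 (y + d) (?B *v (y + d)) (?B *v (?B *v (y + d)))"
      unfolding B ind3_def
    proof (intro allI impI)
      fix a b c assume e: "a *s (y + d) + b *s (?g *s y + x) + c *s ((?g * ?g) *s y) = 0"
      have a: "a = 0" using arg_cong[OF e, of "\<lambda>z. h z x"] xy yx d by simp
      have b: "b = 0" using arg_cong[OF e, of "\<lambda>z. h z d"] a xy yx d yd by simp
      have "c * (?g * ?g * ?g) = 0" using arg_cong[OF e, of "\<lambda>z. h z y"] a b xy yx d yd by simp
      then show "a = 0 \<and> b = 0 \<and> c = 0" using a b xy by simp
    qed
    then show ?thesis unfolding cyclic_def by blast
  qed
  consider "h v v = 0" | "h w w = 0" | "h v v \<noteq> 0" "h w w \<noteq> 0" "q > 2" using q by blast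
  then show thesis
  proof cases
    case 1
    then have "h w w \<noteq> 0" using no_isotropic_plane[of v w] v nw by metis
    then have "cyclic (out v + mat 1 ** out w)" using jordan[of v w] v 1 by simp
    then show thesis using that by blast
  next
    case 2
    have "h v v \<noteq> 0"
    proof
      assume "h v v = 0"
      then obtain c where "w = c *s v" using no_isotropic_plane[of v w] v 2 by metis
      then show False using nw by blast
    qed
    then have "cyclic (out v + mat 1 ** out w)" using jordan[of w v] v wv 2 by (simp add: add.commute)
    then show thesis using that by blast
  next
    case 3
    have "card {0, h v v / h w w} \<le> 2" by (simp add: card_insert_if)
    then have "\<not> K \<subseteq> {0, h v v / h w w}" using card_mono[of "{0, h v v / h w w}" K] card_K 3 by auto
    then obtain t where t: "t \<in> K" "t \<noteq> 0" "t \<noteq> h v v / h w w" by blast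
    obtain u where u: "u \<noteq> 0" "h u v = 0" "h u w = 0" using perp_pair by blast
    let ?a = "h v v" and ?b = "t * h w w"
    have ab: "?a \<noteq> 0" "?b \<noteq> 0" "?a \<noteq> ?b" using t 3 by (auto simp: field_simps)
    let ?B = "out v + mat t ** out w" and ?x = "v + w + u"
    have B: "?B *v ?x = ?a *s v + ?b *s w" "?B *v (?a *s v + ?b *s w) = (?a * ?a) *s v + (?b * ?b) *s w"
      using v wv u by (simp_all add: mv_simps vec_eq_iff algebra_simps)
    have "ind3 ?x (?B *v ?x) (?B *v (?B *v ?x))"
      unfolding B ind3_def
    proof (intro allI impI)
      fix x y z assume e: "x *s ?x + y *s (?a *s v + ?b *s w) + z *s ((?a * ?a) *s v + (?b * ?b) *s w) = 0"
      have 1: "x + y * ?a + z * (?a * ?a) = 0" 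
        using arg_cong[OF e, of "\<lambda>z. h z v"] v wv u ab(1) by (simp flip: distrib_right mult.assoc)
      have "(x + y * ?b + z * (?b * ?b)) * h w w = 0" 
        using arg_cong[OF e, of "\<lambda>z. h z w"] v wv u by (simp add: algebra_simps)
      then have 2: "x + y * ?b + z * (?b * ?b) = 0" using 3 by simp
      have "x *s u = - ((x + y * ?a + z * (?a * ?a)) *s v + (x + y * ?b + z * (?b * ?b)) *s w)"
        using e by (simp add: vec_eq_iff algebra_simps eq_neg_iff_add_eq_0)
      then have x: "x = 0" unfolding 1 2 using u(1) by simp
      have "(y + z * ?a) * ?a = 0" "(y + z * ?b) * ?b = 0" using 1 2 x by (simp_all add: algebra_simps)
      then have yz: "y + z * ?a = 0" "y + z * ?b = 0" using ab by simp_all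
      have "z * (?a - ?b) = (y + z * ?a) - (y + z * ?b)" by (simp add: right_diff_distrib)
      then have "z * (?a - ?b) = 0" unfolding yz by simp
      then show "x = 0 \<and> y = 0 \<and> z = 0" using x ab yz by simp
    qed
    then show thesis using that t(1) unfolding cyclic_def by blast
  qed
qed

text \<open>For \<open>q = 2\<close> the algebra of all operators that are diagonal, with entries in \<open>K\<close>, for a given
  orthonormal basis has no cyclic element. An algebra containing \<open>out v\<close> for an isotropic \<open>v\<close>
  has one for every \<open>q\<close>.\<close>

definition has_isotropic :: "('a ^ 3 ^ 3) set \<Rightarrow> bool" where
  "has_isotropic S \<longleftrightarrow> (\<exists>v. v \<noteq> 0 \<and> h v v = 0 \<and> out v \<in> S)"

text \<open>If there were no cyclic element, then every element would be a scalar plus an \<open>out v\<close>; since the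
  algebra has dimension three, it would contain \<open>out v\<close> and \<open>out w\<close> for perpendicular independent \<open>v\<close>
  and \<open>w\<close>, where \<open>v\<close> is isotropic if \<open>q = 2\<close>, and a combination of these is cyclic.\<close>

lemma Alg_exists_cyclic:
  assumes S: "S \<in> Alg" and q: "q > 2 \<or> has_isotropic S"
  obtains A where "A \<in> S" "cyclic A"
proof (rule ccontr)
  assume "\<not> thesis"
  then have nc: "\<not> cyclic A" if "A \<in> S" for A using that \<open>\<And>A. A \<in> S \<Longrightarrow> cyclic A \<Longrightarrow> thesis\<close> by blast
  obtain v where v: "v \<noteq> 0" "out v \<in> S" "q > 2 \<or> h v v = 0"
  proof (cases "has_isotropic S")
    case True then show thesis using that unfolding has_isotropic_def by blast
  next
    case False
    have "\<not> S \<subseteq> mat ` K"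
    proof
      assume "S \<subseteq> mat ` K"
      then have "card S \<le> card (mat ` K :: ('a ^ 3 ^ 3) set)" by (intro card_mono) auto
      also have "\<dots> \<le> q" using card_image_le[of K mat] card_K by simp
      also have "q < q ^ 3" using power_strict_increasing[of 1 3 q] q_gt_1 by simp
      finally show False using Alg_D(8)[OF S] by linarith
    qed
    then obtain A where A: "A \<in> S" "A \<notin> mat ` K" by blast
    then obtain s v where sv: "s \<in> K" "A = mat s + out v" using not_cyclic_Herm nc Alg_D(1)[OF S] by metis
    then have "v \<noteq> 0" using A by auto
    moreover have "out v \<in> S" using A Alg_shift_iff[OF S] sv by simp
    ultimately show thesis using that False q by blast
  qed
  have "\<not> S \<subseteq> span_out v"
  proof
    assume "S \<subseteq> span_out v"
    then have "card S \<le> card (span_out v)" by (intro card_mono) (auto simp: span_out_def)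
    then have "q ^ 3 \<le> q ^ 2" using card_span_out[OF v(1)] Alg_D(8)[OF S] by simp
    then show False using q_gt_1 by simp
  qed
  then obtain A0 where A0: "A0 \<in> S" "A0 \<notin> span_out v" by blast
  obtain s where s: "s \<in> K" "A0 *v v = s *s v" 
    using commute_out_iff[of A0 v] Alg_D(1,7)[OF S] A0 v by blast
  define A where "A = A0 - mat s"
  have A: "A \<in> S" "A *v v = 0" using Alg_D(6)[OF S A0(1) Alg_D(5)[OF S s(1)]] s by (simp_all add: A_def mv_simps)
  have "A \<notin> span_out v"
  proof
    assume "A \<in> span_out v"
    then obtain x y where xy: "x \<in> K" "y \<in> K" "A = mat x + mat y ** out v" by (auto simp: span_out_def)
    then have "A0 = mat (s + x) + mat y ** out v" unfolding A_def by (simp add: matrix_eq mv_simps vec_eq_iff algebra_simps)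
    then show False using A0(2) span_out_I s(1) xy K_closed(3) by metis
  qed
  then obtain w where w: "A = out w" "w \<noteq> 0" "h v w = 0" "\<And>c. w \<noteq> c *s v"
    using not_cyclic_annihilating[of A v] nc A v Alg_D(1)[OF S] by metis
  obtain t where t: "t \<in> K" "cyclic (out v + mat t ** out w)"
    using two_outs_cyclic[OF v(1) w(2-4)] v(3) by blast
  have "out v + mat t ** out w \<in> S" using A w v t by (intro Alg_D(2,4)[OF S]) auto
  then show False using nc t by blast
qed

subsection \<open>The group of isometries and its centre\<close>

definition U :: "('a ^ 3 ^ 3) set" where
  "U = {A. \<forall>u v. h (A *v u) (A *v v) = h u v}"

lemma U_D: "g \<in> U \<Longrightarrow> h (g *v u) (g *v v) = h u v" by (simp add: U_def)

lemma U_inj: "g \<in> U \<Longrightarrow> g *v u = 0 \<Longrightarrow> u = 0"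
  using U_D[of g u] by (metis h_nondeg h_zero(1))

lemma invertible_of_injective:
  fixes A :: "'a ^ 3 ^ 3"
  assumes "\<And>u. A *v u = 0 \<Longrightarrow> u = 0"
  shows "invertible A"
  unfolding invertible_left_inverse matrix_left_invertible_injective
proof (rule injI)
  fix x y assume "A *v x = A *v y"
  then have "A *v (x - y) = 0" by (simp add: mv_simps)
  then show "x = y" using assms by force
qed

lemma carrier_GU: "carrier (GU h) = U"
  using U_inj invertible_of_injective by (auto simp: GU_def U_def)

lemma GU_simps [simp]: "x \<otimes>\<^bsub>GU h\<^esub> y = x ** y" "\<one>\<^bsub>GU h\<^esub> = mat 1"
  by (simp_all add: GU_def)

lemma U_mult: "a \<in> U \<Longrightarrow> b \<in> U \<Longrightarrow> a ** b \<in> U" and U_one: "mat 1 \<in> U"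
  by (simp_all add: U_def)

lemma U_inverse: assumes "g \<in> U" obtains g' where "g' \<in> U" "g ** g' = mat 1" "g' ** g = mat 1"
proof -
  obtain g' where g': "g ** g' = mat 1" "g' ** g = mat 1"
    using invertible_of_injective[OF U_inj[OF assms]] unfolding invertible_def by blast
  have "g *v (g' *v u) = u" for u using arg_cong[OF g'(1), of "\<lambda>M. M *v u"] by simp
  then have "h (g' *v u) (g' *v v) = h u v" for u v using U_D[OF assms, of "g' *v u" "g' *v v"] by simp
  then have "g' \<in> U" by (simp add: U_def)
  then show thesis using that g' by blast
qed

lemma group_GU: "group (GU h)"
proof (rule groupI)
  fix x assume "x \<in> carrier (GU h)"
  then show "\<exists>y\<in>carrier (GU h). y \<otimes>\<^bsub>GU h\<^esub> x = \<one>\<^bsub>GU h\<^esub>"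
    using U_inverse by (metis GU_simps carrier_GU)
qed (auto simp: carrier_GU U_mult U_one matrix_mul_assoc)

definition ginv :: "'a ^ 3 ^ 3 \<Rightarrow> 'a ^ 3 ^ 3" where "ginv g = inv\<^bsub>GU h\<^esub> g"

lemma ginv [simp]: 
  assumes "g \<in> U"
  shows "ginv g \<in> U" "g ** ginv g = mat 1" "ginv g ** g = mat 1" "g *v (ginv g *v u) = u" "ginv g *v (g *v u) = u"
proof -
  interpret group "GU h" by (rule group_GU)
  show *: "ginv g \<in> U" "g ** ginv g = mat 1" "ginv g ** g = mat 1"
    using assms inv_closed[of g] r_inv[of g] l_inv[of g] by (simp_all add: ginv_def carrier_GU)
  show "g *v (ginv g *v u) = u" "ginv g *v (g *v u) = u"
    using arg_cong[OF *(2), of "\<lambda>M. M *v u"] arg_cong[OF *(3), of "\<lambda>M. M *v u"] by simp_all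
qed

lemma adj_ginv: "g \<in> U \<Longrightarrow> adj g (ginv g)"
  unfolding adj_def using U_D[of "ginv g"] by (metis ginv(1,5))

lemma ginv_comm:
  assumes "g \<in> U" "g ** A = A ** g"
  shows "ginv g ** A = A ** ginv g"
proof -
  have "ginv g ** A = ginv g ** (A ** g) ** ginv g" using assms(1) by (simp flip: matrix_mul_assoc)
  also have "\<dots> = ginv g ** g ** (A ** ginv g)" unfolding assms(2)[symmetric] by (simp only: matrix_mul_assoc)
  finally show ?thesis using assms(1) by simp
qed

lemma mat_U_iff: "mat c \<in> U \<longleftrightarrow> c * bar c = 1"
proof
  assume "mat c \<in> U"
  obtain d where d: "h (axis 1 1) d = 1" using h_dual[of "axis 1 1"] by (metis axis_eq_0_iff zero_neq_one)
  show "c * bar c = 1" using U_D[OF \<open>mat c \<in> U\<close>, of "axis 1 1" d] d by (simp add: mult.commute)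
qed (auto simp: U_def mult.commute simp flip: mult.assoc)

lemma exists_U_shift:
  obtains c where "c \<noteq> 0" "mat 1 + mat c ** out v \<in> U"
proof -
  obtain c where c: "c \<noteq> 0" "c + bar c + c * bar c * h v v = 0" using exists_unitary_shift[of "h v v"] by auto
  have "mat 1 + mat c ** out v \<in> U" unfolding U_def
  proof (intro CollectI allI)
    fix u w
    have "h ((mat 1 + mat c ** out v) *v u) ((mat 1 + mat c ** out v) *v w)
      = h u w + (c + bar c + c * bar c * h v v) * h u v * h v w"
      by (simp add: mv_simps algebra_simps)
    then show "h ((mat 1 + mat c ** out v) *v u) ((mat 1 + mat c ** out v) *v w) = h u w" using c by simp
  qed
  then show thesis using that c by blast
qed

text \<open>An operator commuting with a nontrivial isometry of the form \<open>1 + c out v\<close> has \<open>v\<close> as an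
  eigenvector; such isometries exist for all \<open>v\<close>.\<close>

lemma center_GU: "group_center (GU h) = {mat c | c. c * bar c = 1}"
proof
  show "{mat c | c. c * bar c = 1} \<subseteq> group_center (GU h)"
    using mat_U_iff by (auto simp: group_center_def carrier_GU mat_comm)
  show "group_center (GU h) \<subseteq> {mat c | c. c * bar c = 1}"
  proof
    fix z assume "z \<in> group_center (GU h)"
    then have z: "z \<in> U" "\<And>x. x \<in> U \<Longrightarrow> z ** x = x ** z" by (auto simp: group_center_def carrier_GU)
    have "\<exists>c. z *v v = c *s v" for v
    proof (cases "v = 0")
      case False
      obtain c where c: "c \<noteq> 0" "mat 1 + mat c ** out v \<in> U" using exists_U_shift by blast
      obtain d where d: "h d v = 1" using h_dual[OF False] by blast
      from z(2)[OF c(2)] have "c *s (z *v v) = (c * h (z *v d) v) *s v"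
        by (drule_tac arg_cong[of _ _ "\<lambda>M. M *v d"]) (simp add: mv_simps d)
      then have "z *v v = h (z *v d) v *s v" using c(1) by (simp add: vec_eq_iff)
      then show ?thesis by blast
    qed simp
    then obtain c where "z = mat c" using all_eigenvectors_scalar by blast
    then show "z \<in> {mat c | c. c * bar c = 1}" using z(1) mat_U_iff by blast
  qed
qed

end

section \<open>The projective unitary group through its lifts\<close>

context hermitian_plane
begin

text \<open>Elements of the projective group are handled through their lifts \<open>g\<close> in \<open>U\<close>; two lifts of the
  same element differ by a scalar of norm one.\<close>

definition proj :: "'a ^ 3 ^ 3 \<Rightarrow> ('a ^ 3 ^ 3) set" where
  "proj g = group_center (GU h) #>\<^bsub>GU h\<^esub> g"

lemma proj_eq: "proj g = {mat c ** g | c. c * bar c = 1}"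
  by (auto simp: proj_def r_coset_def center_GU)

lemma mat_cancel: "c \<noteq> 0 \<Longrightarrow> mat c ** A = mat c ** B \<longleftrightarrow> A = (B :: 'a ^ 3 ^ 3)"
  by (simp add: matrix_eq)

lemma scalar_mult_U: "c * bar c = 1 \<Longrightarrow> g \<in> U \<Longrightarrow> mat c ** g \<in> U"
  using mat_U_iff U_mult by blast

lemma proj_eq_iff: "proj a = proj b \<longleftrightarrow> (\<exists>c. c * bar c = 1 \<and> b = mat c ** a)"
proof
  assume "proj a = proj b"
  moreover have "b \<in> proj b" unfolding proj_eq by (rule CollectI, rule exI[of _ 1]) simp
  ultimately show "\<exists>c. c * bar c = 1 \<and> b = mat c ** a" by (auto simp: proj_eq)
next
  assume "\<exists>c. c * bar c = 1 \<and> b = mat c ** a"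
  then obtain c where c: "c * bar c = 1" "b = mat c ** a" by blast
  have a: "a = mat (bar c) ** b" using c by (simp add: matrix_mul_assoc mult.commute)
  show "proj a = proj b"
  proof
    show "proj b \<subseteq> proj a"
    proof
      fix x assume "x \<in> proj b"
      then obtain d where "d * bar d = 1" "x = mat d ** b" by (auto simp: proj_eq)
      then have "d * c * bar (d * c) = 1" "x = mat (d * c) ** a"
        using c by (simp_all add: matrix_mul_assoc) (metis mult.assoc mult.commute mult.left_neutral)
      then show "x \<in> proj a" unfolding proj_eq by blast
    qed
    show "proj a \<subseteq> proj b"
    proof
      fix x assume "x \<in> proj a"
      then obtain d where "d * bar d = 1" "x = mat d ** a" by (auto simp: proj_eq)
      then have "d * bar c * bar (d * bar c) = 1" "x = mat (d * bar c) ** b"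
        using c(1) by (simp_all add: matrix_mul_assoc a) (metis mult.assoc mult.commute mult.left_neutral)
      then show "x \<in> proj b" unfolding proj_eq by blast
    qed
  qed
qed

lemma center_normal: "group_center (GU h) \<lhd> GU h"
proof -
  interpret group "GU h" by (rule group_GU)
  have sub: "subgroup (group_center (GU h)) (GU h)"
  proof (rule subgroupI)
    show "group_center (GU h) \<subseteq> carrier (GU h)" by (auto simp: group_center_def)
    show "group_center (GU h) \<noteq> {}" unfolding center_GU by (auto intro!: exI[of _ 1])
  next
    fix a assume "a \<in> group_center (GU h)"
    then obtain c where c: "c * bar c = 1" "a = mat c" by (auto simp: center_GU)
    have "inv\<^bsub>GU h\<^esub> (mat c) = mat (bar c)"
      using c mat_U_iff by (intro inv_equality) (simp_all add: carrier_GU mult.commute)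
    then show "inv\<^bsub>GU h\<^esub> a \<in> group_center (GU h)" using c by (auto simp: center_GU mult.commute)
    fix b assume "b \<in> group_center (GU h)"
    then obtain d where d: "d * bar d = 1" "b = mat d" by (auto simp: center_GU)
    have "(c * d) * bar (c * d) = 1" using c d by (simp add: mult.assoc) (metis mult.assoc mult.commute mult.left_neutral)
    then show "a \<otimes>\<^bsub>GU h\<^esub> b \<in> group_center (GU h)" using c d unfolding center_GU by auto
  qed
  show ?thesis unfolding normal_inv_iff
  proof (intro conjI sub ballI)
    fix x z assume "x \<in> carrier (GU h)" "z \<in> group_center (GU h)"
    moreover from this have "x \<otimes>\<^bsub>GU h\<^esub> z \<otimes>\<^bsub>GU h\<^esub> inv\<^bsub>GU h\<^esub> x = z"
      by (auto simp: center_GU carrier_GU mat_mat_assoc simp flip: ginv_def matrix_mul_assoc)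
    ultimately show "x \<otimes>\<^bsub>GU h\<^esub> z \<otimes>\<^bsub>GU h\<^esub> inv\<^bsub>GU h\<^esub> x \<in> group_center (GU h)" by simp
  qed
qed

lemma group_PGU: "group (PGU h)"
  unfolding PGU_def by (rule normal.factorgroup_is_group[OF center_normal])

lemma carrier_PGU: "carrier (PGU h) = proj ` U"
  by (auto simp: PGU_def FactGroup_def RCOSETS_def proj_def carrier_GU)

lemma proj_mult: "a \<in> U \<Longrightarrow> b \<in> U \<Longrightarrow> proj a \<otimes>\<^bsub>PGU h\<^esub> proj b = proj (a ** b)"
  using normal.rcos_sum[OF center_normal, of a b] by (simp add: PGU_def FactGroup_def proj_def carrier_GU)

lemma proj_one: "\<one>\<^bsub>PGU h\<^esub> = proj (mat 1)"
  by (auto simp: PGU_def FactGroup_def proj_eq center_GU)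

lemma proj_inv: "a \<in> U \<Longrightarrow> inv\<^bsub>PGU h\<^esub> (proj a) = proj (ginv a)"
proof -
  assume a: "a \<in> U"
  interpret group "PGU h" by (rule group_PGU)
  show ?thesis using a by (intro inv_equality) (simp_all add: carrier_PGU proj_mult proj_one)
qed

lemma proj_one_iff: "proj a = \<one>\<^bsub>PGU h\<^esub> \<Longrightarrow> \<exists>c. a = mat c"
  unfolding proj_one using proj_eq_iff[of "mat 1" a] by auto

lemma finite_PGU: "finite (carrier (PGU h))" by (simp add: carrier_PGU)

lemma subgroup_proj:
  assumes "H \<subseteq> U" "mat 1 \<in> H" "\<And>a b. a \<in> H \<Longrightarrow> b \<in> H \<Longrightarrow> a ** b \<in> H" "\<And>a. a \<in> H \<Longrightarrow> ginv a \<in> H"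
  shows "subgroup (proj ` H) (PGU h)"
proof -
  interpret group "PGU h" by (rule group_PGU)
  show ?thesis
  proof (rule subgroupI)
    show "proj ` H \<subseteq> carrier (PGU h)" using assms(1) by (auto simp: carrier_PGU)
    show "proj ` H \<noteq> {}" using assms(2) by auto
  next
    fix x assume "x \<in> proj ` H"
    then obtain a where a: "a \<in> H" "x = proj a" by blast
    then show "inv\<^bsub>PGU h\<^esub> x \<in> proj ` H" using assms proj_inv[of a] by auto
    fix y assume "y \<in> proj ` H"
    then obtain b where b: "b \<in> H" "y = proj b" by blast
    moreover from this have "a \<in> U" "b \<in> U" using assms(1) a by auto
    ultimately show "x \<otimes>\<^bsub>PGU h\<^esub> y \<in> proj ` H" using assms(3) a by (simp add: proj_mult)
  qed
qed

lemma proj_commute_iff: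
  assumes "a \<in> U" "b \<in> U"
  shows "proj a \<otimes>\<^bsub>PGU h\<^esub> proj b = proj b \<otimes>\<^bsub>PGU h\<^esub> proj a \<longleftrightarrow> (\<exists>c. c * bar c = 1 \<and> a ** b = mat c ** (b ** a))"
  using proj_eq_iff[of "b ** a" "a ** b"] assms by (auto simp: proj_mult)

lemma proj_commutator:
  assumes "a \<in> U" "b \<in> U"
  shows "proj a \<otimes>\<^bsub>PGU h\<^esub> proj b \<otimes>\<^bsub>PGU h\<^esub> inv\<^bsub>PGU h\<^esub> proj a \<otimes>\<^bsub>PGU h\<^esub> inv\<^bsub>PGU h\<^esub> proj b = proj (a ** b ** ginv a ** ginv b)"
  using assms by (simp add: proj_inv proj_mult U_mult)

section \<open>The abelian subgroup attached to a Hermitian algebra\<close>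

definition Ucent :: "('a ^ 3 ^ 3) set \<Rightarrow> ('a ^ 3 ^ 3) set" where
  "Ucent S = {g \<in> U. \<forall>A\<in>S. g ** A = A ** g}"

lemma Ucent_subgroup: "subgroup (proj ` Ucent S) (PGU h)"
proof (rule subgroup_proj)
  fix a b assume ab: "a \<in> Ucent S" "b \<in> Ucent S"
  show "a ** b \<in> Ucent S" unfolding Ucent_def
  proof (intro CollectI conjI ballI)
    fix A assume "A \<in> S"
    then have "a ** A = A ** a" "b ** A = A ** b" using ab by (auto simp: Ucent_def)
    then show "a ** b ** A = A ** (a ** b)" by (metis matrix_mul_assoc)
  qed (use ab U_mult in \<open>auto simp: Ucent_def\<close>)
qed (auto simp: Ucent_def U_one ginv_comm)

lemma Ucent_abelian:
  assumes "A \<in> S" "cyclic A" "a \<in> Ucent S" "b \<in> Ucent S"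
  shows "a ** b = b ** a"
  using cyclic_commuting_commute[OF assms(2), of a b] assms by (simp add: Ucent_def)

lemma Ucent_c_nilpotent:
  assumes "A \<in> S" "cyclic A" "1 \<le> c"
  shows "c_nilpotent c (PGU h\<lparr>carrier := proj ` Ucent S\<rparr>)"
proof -
  interpret group "PGU h" by (rule group_PGU)
  show ?thesis
  proof (rule c_nilpotent_abelian[OF Ucent_subgroup _ assms(3)])
    fix x y assume "x \<in> proj ` Ucent S" "y \<in> proj ` Ucent S"
    then obtain a b where ab: "a \<in> Ucent S" "b \<in> Ucent S" "x = proj a" "y = proj b" by blast
    then show "x \<otimes>\<^bsub>PGU h\<^esub> y = y \<otimes>\<^bsub>PGU h\<^esub> x"
      using Ucent_abelian[OF assms(1,2) ab(1,2)] by (simp add: proj_mult Ucent_def)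
  qed
qed

text \<open>A unitary operator is recovered from the two Hermitian operators \<open>g + g\<inverse>\<close> and
  \<open>a g + bar a g\<inverse>\<close>, which commute with everything that commutes with \<open>g\<close>.\<close>

lemma unitary_Hermitian_parts:
  assumes "g \<in> U" "a \<notin> K"
  shows "g + ginv g \<in> Herm" "mat a ** g + mat (bar a) ** ginv g \<in> Herm"
    "mat (bar a - a) ** g = mat (bar a) ** (g + ginv g) - (mat a ** g + mat (bar a) ** ginv g)"
proof -
  have a: "adj g (ginv g)" "adj (ginv g) g" using adj_ginv[OF assms(1)] adj_sym by auto
  show "g + ginv g \<in> Herm" using adj_add[OF a] by (simp add: Herm_def add.commute)
  show "mat a ** g + mat (bar a) ** ginv g \<in> Herm"
    using adj_add[OF adj_scale[OF a(1), of a] adj_scale[OF a(2), of "bar a"]] by (simp add: Herm_def add.commute)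
  show "mat (bar a - a) ** g = mat (bar a) ** (g + ginv g) - (mat a ** g + mat (bar a) ** ginv g)"
    by (simp add: matrix_eq mv_simps vec_eq_iff algebra_simps)
qed

text \<open>By the dichotomy \<open>g\<close> is a scalar plus an operator with range in the line of some \<open>x\<close>. Both
  Hermitian parts of \<open>g\<close> have the same shape, so they are scalars plus multiples of \<open>out x\<close>; hence
  \<open>g = r + r' out x\<close>, and \<open>r' \<noteq> 0\<close> unless \<open>g\<close> is scalar. If \<open>g\<close> is scalar, any nonzero \<open>x\<close> will do.\<close>

lemma unitary_not_cyclic:
  assumes g: "g \<in> U" and nc: "\<not> cyclic g"
  obtains x where "x \<noteq> 0" "\<And>S. S \<in> Alg \<Longrightarrow> out x \<in> S \<Longrightarrow> g \<in> Ucent S"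
    "\<And>B. (\<And>c. g \<noteq> mat c) \<Longrightarrow> B ** g = g ** B \<Longrightarrow> B ** out x = out x ** B"
proof -
  obtain s x0 where sx0: "\<And>u. \<exists>t. g *v u = s *s u + t *s x0" using not_cyclic[OF nc] by blast
  obtain e :: "'a ^ 3" where e: "e \<noteq> 0" by (metis axis_eq_0_iff zero_neq_one)
  \<comment> \<open>A scalar \<open>g\<close> leaves no trace of a point, and an arbitrary one is taken.\<close>
  define x where "x = (if x0 = 0 then e else x0)"
  have x: "x \<noteq> 0" using e by (simp add: x_def)
  have sx: "\<exists>t. g *v u = s *s u + t *s x" for u
    using sx0[of u] by (cases "x0 = 0") (auto simp: x_def intro: exI[of _ 0])
  have s0: "s \<noteq> 0"
  proof
    assume "s = 0"
    then have im: "\<exists>t. g *v u = t *s x" for u using sx[of u] by simp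
    have "\<exists>t. p = t *s x" for p using im[of "ginv g *v p"] g by simp
    then have "\<exists>t. p = t *s x" for p by blast
    then have "range (\<lambda>t. t *s x) = UNIV" by auto
    then have "CARD('a ^ 3) \<le> CARD('a)" using card_image_le[of UNIV "\<lambda>t. t *s x"] by simp
    then show False unfolding card_V card_field using q_gt_1 by simp
  qed
  have gs: "\<exists>t. ginv g *v u = inverse s *s u + t *s x" for u
  proof -
    obtain t where t: "g *v (ginv g *v u) = s *s (ginv g *v u) + t *s x" using sx by blast
    then have "u = s *s (ginv g *v u) + t *s x" using g by simp
    then have "ginv g *v u = inverse s *s u + (- t / s) *s x" using s0 by (simp add: vec_eq_iff field_simps)
    then show ?thesis by blast
  qed
  obtain a where a: "a \<notin> K" using not_K by blast
  note parts = unitary_Hermitian_parts[OF g a]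
  define X where "X = g + ginv g"
  define Y where "Y = mat a ** g + mat (bar a) ** ginv g"
  have "\<exists>t. X *v u = (s + inverse s) *s u + t *s x" for u
  proof -
    obtain t t' where "g *v u = s *s u + t *s x" "ginv g *v u = inverse s *s u + t' *s x" using sx gs by blast
    then have "X *v u = (s + inverse s) *s u + (t + t') *s x" by (simp add: X_def mv_simps vec_eq_iff algebra_simps)
    then show ?thesis by blast
  qed
  with parts(1) obtain b where X: "s + inverse s \<in> K" "X = mat (s + inverse s) + out (b *s x)"
    using Herm_scalar_plus_rank_one unfolding X_def by metis
  have "\<exists>t. Y *v u = (a * s + bar a * inverse s) *s u + t *s x" for u
  proof -
    obtain t t' where "g *v u = s *s u + t *s x" "ginv g *v u = inverse s *s u + t' *s x" using sx gs by blast
    then have "Y *v u = (a * s + bar a * inverse s) *s u + (a * t + bar a * t') *s x" by (simp add: Y_def mv_simps vec_eq_iff algebra_simps)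
    then show ?thesis by blast
  qed
  with parts(2) obtain b' where Y: "a * s + bar a * inverse s \<in> K" "Y = mat (a * s + bar a * inverse s) + out (b' *s x)"
    using Herm_scalar_plus_rank_one unfolding Y_def by metis
  have gXY: "mat (bar a - a) ** g = mat (bar a) ** X - Y" using parts(3) by (simp add: X_def Y_def)
  have a0: "bar a - a \<noteq> 0" using a by (simp add: K_iff)
  have gL: "g = mat r + mat r' ** out x" 
    if r: "r = (bar a * (s + inverse s) - (a * s + bar a * inverse s)) / (bar a - a)" 
       "r' = (bar a * (b * bar b) - b' * bar b') / (bar a - a)" for r r'
  proof -
    have r2: "(bar a - a) * r = bar a * (s + inverse s) - (a * s + bar a * inverse s)"
       "(bar a - a) * r' = bar a * (b * bar b) - b' * bar b'" using r a0 by simp_all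
    have "mat (bar a - a) ** (mat r + mat r' ** out x) = mat ((bar a - a) * r) + mat ((bar a - a) * r') ** out x"
      by (simp add: matrix_eq mv_simps vec_eq_iff algebra_simps)
    also have "\<dots> = mat (bar a - a) ** g"
      unfolding gXY X(2) Y(2) out_scale r2 by (simp add: matrix_eq mv_simps vec_eq_iff algebra_simps)
    finally have "mat (bar a - a) ** g = mat (bar a - a) ** (mat r + mat r' ** out x)" by simp
    then have "mat (inverse (bar a - a)) ** (mat (bar a - a) ** g) = mat (inverse (bar a - a)) ** (mat (bar a - a) ** (mat r + mat r' ** out x))"
      by simp
    then show ?thesis using a0 by (simp add: matrix_mul_assoc)
  qed
  obtain r r' where gr: "g = mat r + mat r' ** out x" using gL[OF refl refl] by blast
  show thesis
  proof
    show "x \<noteq> 0" by (rule x)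
  next
    fix S assume S: "S \<in> Alg" "out x \<in> S"
    have "g ** A = A ** g" if "A \<in> S" for A
    proof -
      have o: "out x ** A = A ** out x" using Alg_D(7)[OF S(1)] S(2) that by blast
      have "h (A *v u) x *s x = h u x *s (A *v x)" for u
        using arg_cong[OF o, of "\<lambda>M. M *v u"] by simp
      then show ?thesis unfolding gr by (simp add: matrix_eq mv_simps)
    qed
    then show "g \<in> Ucent S" using g by (simp add: Ucent_def)
  next
    fix B assume ns: "\<And>c. g \<noteq> mat c" and B: "B ** g = g ** B"
    have r': "r' \<noteq> 0" using ns[of r] gr by auto
    have "B ** (mat r' ** out x) = (mat r' ** out x) ** B"
    proof -
      have o: "mat r' ** out x = g - mat r" unfolding gr by simp
      have "B *v (g *v u) = g *v (B *v u)" for u using arg_cong[OF B, of "\<lambda>M. M *v u"] by simp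
      then show ?thesis unfolding o by (simp add: matrix_eq mv_simps)
    qed
    then have "mat r' ** (B ** out x) = mat r' ** (out x ** B)"
      by (simp only: mat_mat_assoc matrix_mul_assoc[symmetric])
    then show "B ** out x = out x ** B" using r' mat_cancel by blast
  qed
qed

lemma adj_exists: "\<exists>C. adj A C"
proof -
  have "axis 1 1 \<noteq> (0::'a ^ 3)" by (simp add: axis_eq_0_iff)
  then obtain v w where i: "ind3 (axis 1 (1::'a)) v w" using extend_basis by blast
  let ?u = "axis 1 (1::'a)"
  obtain a b c where d: "h a ?u = 1" "h a v = 0" "h a w = 0" "h b ?u = 0" "h b v = 1" "h b w = 0"
    "h c ?u = 0" "h c v = 0" "h c w = 1" using dual_basis[OF i] by blast
  have d': "h ?u a = 1" "h v a = 0" "h w a = 0" "h ?u b = 0" "h v b = 1" "h w b = 0"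
    "h ?u c = 0" "h v c = 0" "h w c = 1" 
    using d by (simp_all add: h_eq_0_comm[of ?u] h_eq_0_comm[of v] h_eq_0_comm[of w]) (metis bar_1 bar_h)+
  have "A = outer (A *v ?u) a + outer (A *v v) b + outer (A *v w) c"
    by (rule mat_eq_on_ind3[OF i]) (simp_all add: mv_simps d')
  moreover have "adj (outer (A *v ?u) a + outer (A *v v) b + outer (A *v w) c) 
    (outer a (A *v ?u) + outer b (A *v v) + outer c (A *v w))"
    by (intro adj_add adj_outer)
  ultimately show ?thesis by metis
qed

text \<open>The commutant \<open>R\<close> of \<open>g\<close> consists of the \<open>q\<^sup>6\<close> polynomials in \<open>g\<close>, and it is closed under
  adjoints because \<open>g\<inverse>\<close> has the same commutant. Its Hermitian part \<open>T\<close> is the kernel of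
  \<open>B \<mapsto> B - B\<^sup>*\<close>, whose range is skew and therefore embedded into \<open>T\<close> by a scalar of trace zero; so
  \<open>T\<close> has at least \<open>q\<^sup>3\<close> elements. As \<open>T\<close> and \<open>a T\<close> are independent for \<open>a \<notin> K\<close>, it has at most as
  many.\<close>

lemma unitary_cyclic_Alg:
  assumes g: "g \<in> U" "cyclic g"
  shows "{B \<in> Herm. g ** B = B ** g} \<in> Alg"
proof -
  define R where "R = {B. g ** B = B ** g}"
  define T where "T = {B \<in> Herm. g ** B = B ** g}"
  define star where "star A = (SOME C. adj A C)" for A
  have star: "adj A (star A)" for A unfolding star_def using someI_ex[OF adj_exists] .
  have star_eq: "star A = C" if "adj A C" for A C using star that adj_unique by blast
  have RI: "A + B \<in> R" "A - B \<in> R" "mat c ** A \<in> R" if "A \<in> R" "B \<in> R" for A B c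
  proof -
    have "g *v (A *v u) = A *v (g *v u)" "g *v (B *v u) = B *v (g *v u)" for u
      using that[unfolded R_def mem_Collect_eq, THEN arg_cong, of "\<lambda>M. M *v u"] by simp_all
    then show "A + B \<in> R" "A - B \<in> R" "mat c ** A \<in> R" by (simp_all add: R_def matrix_eq mv_simps)
  qed
  have starR: "star B \<in> R" if "B \<in> R" for B
  proof -
    have "ginv g ** B = B ** ginv g" using ginv_comm[OF g(1)] that by (simp add: R_def)
    then have "adj (ginv g ** B) (star B ** g)" "adj (ginv g ** B) (g ** star B)"
      using adj_mult[OF adj_sym[OF adj_ginv[OF g(1)]] star, of B] adj_mult[OF star adj_sym[OF adj_ginv[OF g(1)]], of B] by simp_all
    then show ?thesis using adj_unique by (auto simp: R_def)
  qed
  have TR: "T \<subseteq> R" by (auto simp: T_def R_def)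
  have "R = range (\<lambda>(x, y, z). pol x y z g)"
  proof
    show "R \<subseteq> range (\<lambda>(x, y, z). pol x y z g)"
    proof
      fix B assume "B \<in> R"
      then obtain x y z where "B = pol x y z g" using cyclic_commutant[OF g(2)] unfolding R_def by blast
      then have "B = (\<lambda>(x, y, z). pol x y z g) (x, y, z)" by simp
      then show "B \<in> range (\<lambda>(x, y, z). pol x y z g)" by (rule range_eqI)
    qed
    show "range (\<lambda>(x, y, z). pol x y z g) \<subseteq> R" using pol_self_comm[of _ _ _ g] by (auto simp: R_def)
  qed
  moreover have "inj (\<lambda>(x, y, z). pol x y z g)"
    using cyclic_pol_inj[OF g(2)] by (auto intro!: injI)
  ultimately have cR: "card R = q ^ 6"
    by (simp add: card_image card_cartesian_product card_field flip: UNIV_Times_UNIV power_add)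
  obtain a where a: "a \<notin> K" using not_K by blast
  define t where "t = a - bar a"
  have t: "t \<noteq> 0" "bar t = - t" using a by (auto simp: t_def K_iff)
  have "card R = card ((\<lambda>B. B - star B) ` R) * card {B \<in> R. B - star B = 0}"
  proof (rule card_additive)
    fix x y show "x - y - star (x - y) = x - star x - (y - star y)"
      using star_eq[OF adj_diff[OF star star], of x y] by simp
  qed (use RI in auto)
  also have "{B \<in> R. B - star B = 0} = T"
  proof -
    have "B - star B = 0 \<longleftrightarrow> adj B B" for B using star[of B] star_eq[of B B] by auto
    then show ?thesis by (auto simp: T_def R_def Herm_def)
  qed
  also have "card ((\<lambda>B. B - star B) ` R) \<le> card ((\<lambda>B. mat t ** B) ` T)"
  proof (rule card_mono)
    show "(\<lambda>B. B - star B) ` R \<subseteq> (\<lambda>B. mat t ** B) ` T"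
    proof
      fix X assume "X \<in> (\<lambda>B. B - star B) ` R"
      then obtain B where B: "B \<in> R" "X = B - star B" by blast
      have XR: "X \<in> R" using RI B starR by blast
      have "adj X (star B - B)" unfolding B(2) by (intro adj_diff star adj_sym[OF star])
      then have "adj (mat (inverse t) ** X) (mat (bar (inverse t)) ** (star B - B))" by (rule adj_scale)
      also have "mat (bar (inverse t)) ** (star B - B) = mat (inverse t) ** X"
        unfolding B(2) using t by (simp add: matrix_eq mv_simps vec_eq_iff algebra_simps)
      finally have "mat (inverse t) ** X \<in> T" using RI(3)[OF XR XR] by (simp add: T_def Herm_def R_def)
      moreover have "X = mat t ** (mat (inverse t) ** X)" using t by (simp add: matrix_mul_assoc)
      ultimately show "X \<in> (\<lambda>B. mat t ** B) ` T" by blast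
    qed
  qed simp
  also have "card ((\<lambda>B. mat t ** B) ` T) \<le> card T" by (rule card_image_le) simp
  finally have "(q ^ 3)\<^sup>2 \<le> (card T)\<^sup>2" using cR by (simp add: power2_eq_square flip: power_add)
  then have ge: "q ^ 3 \<le> card T" by (simp only: power2_nat_le_eq_le)
  have "inj_on (\<lambda>(B, C). B + mat a ** C) (T \<times> T)"
  proof -
    have "B = B' \<and> C = C'" if "B \<in> T" "C \<in> T" "B' \<in> T" "C' \<in> T" "B + mat a ** C = B' + mat a ** C'" for B C B' C'
    proof -
      have H: "adj B B" "adj C C" "adj B' B'" "adj C' C'" using that by (auto simp: T_def Herm_def)
      have "adj (B + mat a ** C) (B + mat (bar a) ** C)" "adj (B + mat a ** C) (B' + mat (bar a) ** C')"
        using adj_add[OF H(1) adj_scale[OF H(2)], of a] adj_add[OF H(3) adj_scale[OF H(4)], of a] that(5) by simp_all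
      then have e: "B + mat (bar a) ** C = B' + mat (bar a) ** C'" using adj_unique by blast
      have "t *s (C *v u) = t *s (C' *v u)" for u
      proof -
        have 1: "B *v u + a *s (C *v u) = B' *v u + a *s (C' *v u)"
          using arg_cong[OF that(5), of "\<lambda>M. M *v u"] by (simp add: mv_simps)
        have 2: "B *v u + bar a *s (C *v u) = B' *v u + bar a *s (C' *v u)"
          using arg_cong[OF e, of "\<lambda>M. M *v u"] by (simp add: mv_simps)
        have "t *s (C *v u) = (B *v u + a *s (C *v u)) - (B *v u + bar a *s (C *v u))"
          by (simp add: t_def vec_eq_iff algebra_simps)
        also have "\<dots> = t *s (C' *v u)"
          unfolding 1 2 by (simp add: t_def vec_eq_iff algebra_simps)
        finally show ?thesis .
      qed
      then have "C = C'" using t by (simp add: matrix_eq)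
      then show ?thesis using that(5) by simp
    qed
    then show ?thesis by (auto intro!: inj_onI)
  qed
  moreover have "B + mat a ** C \<in> R" if "B \<in> T" "C \<in> T" for B C
    using that TR by (intro RI(1) RI(3)[of C C]) auto
  ultimately have "card (T \<times> T) \<le> card R" by (intro card_inj_on_le[of _ _ R]) auto
  then have "(card T)\<^sup>2 \<le> (q ^ 3)\<^sup>2" using cR by (simp add: power2_eq_square card_cartesian_product flip: power_add)
  then have "card T \<le> q ^ 3" by (simp only: power2_nat_le_eq_le)
  then have card: "card T = q ^ 3" using ge by (rule le_antisym)
  have comm: "B ** C = C ** B" if "B \<in> T" "C \<in> T" for B C
    using that unfolding T_def by (blast intro: cyclic_commuting_commute[OF g(2)])
  have "T \<in> Alg" unfolding Alg_def
  proof (intro CollectI conjI ballI)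
    fix B C assume BC: "B \<in> T" "C \<in> T"
    then show "B + C \<in> T" using RI(1)[of B C] by (simp add: T_def R_def Herm_closed)
    have "g ** B = B ** g" "g ** C = C ** g" using BC by (simp_all add: T_def)
    then have "g ** (B ** C) = B ** C ** g" by (simp add: matrix_mul_assoc) (simp flip: matrix_mul_assoc)
    then show "B ** C \<in> T" using BC comm[OF BC] by (simp add: T_def Herm_comm_mult)
  next
    fix c B assume "c \<in> K" "B \<in> T"
    then show "mat c ** B \<in> T" using RI(3)[of B B c] by (simp add: T_def R_def Herm_closed)
  qed (use card in \<open>auto simp: T_def Herm_closed\<close>)
  then show ?thesis by (simp add: T_def)
qed

lemma unitary_in_Ucent:
  assumes "g \<in> U" obtains S where "S \<in> Alg" "g \<in> Ucent S"
proof (cases "cyclic g")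
  case True
  show thesis by (rule that[OF unitary_cyclic_Alg[OF assms True]]) (use assms in \<open>auto simp: Ucent_def\<close>)
next
  case False
  obtain x where x: "x \<noteq> 0" "\<And>S. S \<in> Alg \<Longrightarrow> out x \<in> S \<Longrightarrow> g \<in> Ucent S"
    using unitary_not_cyclic[OF assms False] by metis
  have "card {S \<in> Alg. out x \<in> S} \<noteq> 0" using card_Alg_through[OF x(1)] by simp
  then have "{S \<in> Alg. out x \<in> S} \<noteq> {}" by force
  then show thesis using that x by blast
qed

section \<open>Cayley transforms\<close>

text \<open>The Cayley transform \<open>(A - a) (A - bar a)\<inverse>\<close> is unitary because \<open>A\<close> is Hermitian. The operator
  \<open>A\<close> is recovered from it rationally, so that both have the same commutant.\<close>

lemma cayley:
  assumes A: "A \<in> Herm" "cyclic A" and a: "a \<notin> K" 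
    and ker: "\<And>w. A *v w = bar a *s w \<Longrightarrow> w = 0"
  obtains g where "g \<in> U" "cyclic g" "g ** (A - mat (bar a)) = A - mat a" "g ** A = A ** g"
    "\<And>k. k ** g = g ** k \<Longrightarrow> k ** A = A ** k"
proof -
  define B where "B = A - mat (bar a)"
  have "invertible B"
    by (rule invertible_of_injective) (use ker in \<open>auto simp: B_def mv_simps\<close>)
  then obtain B' where B': "B ** B' = mat 1" "B' ** B = mat 1" unfolding invertible_def by blast
  have BB: "B *v (B' *v u) = u" "B' *v (B *v u) = u" for u
    using arg_cong[OF B'(1), of "\<lambda>M. M *v u"] arg_cong[OF B'(2), of "\<lambda>M. M *v u"] by simp_all
  define g where "g = (A - mat a) ** B'"
  have gB: "g ** B = A - mat a" unfolding g_def using B' by (simp flip: matrix_mul_assoc)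
  have gBv: "g *v (B *v u) = A *v u - a *s u" for u
    using arg_cong[OF gB, of "\<lambda>M. M *v u"] by (simp add: mv_simps)
  have Bv: "B *v u = A *v u - bar a *s u" for u by (simp add: B_def mv_simps)
  have surj: "\<exists>w. u = B *v w" for u using BB(1)[of u] by metis
  have "h (A *v u - a *s u) (A *v v - a *s v) = h (B *v u) (B *v v)" for u v
    using HermD[OF A(1), of u v] by (simp add: Bv algebra_simps)
  then have hB: "h (g *v (B *v u)) (g *v (B *v v)) = h (B *v u) (B *v v)" for u v by (simp only: gBv)
  have "h (g *v u) (g *v v) = h u v" for u v
  proof -
    obtain u' v' where "u = B *v u'" "v = B *v v'" using surj by blast
    then show ?thesis using hB by simp
  qed
  then have gU: "g \<in> U" unfolding U_def by blast
  have AB: "A ** B = B ** A" by (simp add: B_def matrix_eq mv_simps)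
  have "g ** A = (A - mat a) ** (B' ** (A ** B)) ** B'" 
    using B' unfolding g_def by (simp flip: matrix_mul_assoc)
  also have "\<dots> = (A - mat a) ** A ** B'" unfolding AB using B' by (simp add: matrix_mul_assoc)
  also have "\<dots> = A ** g" unfolding g_def by (simp add: matrix_eq mv_simps)
  finally have gA: "g ** A = A ** g" .
  have a0: "bar a - a \<noteq> 0" using a by (simp add: K_iff)
  have cg: "cyclic g"
  proof (rule ccontr)
    assume "\<not> cyclic g"
    then obtain s x where sx: "\<And>u. \<exists>t. g *v u = s *s u + t *s x" using not_cyclic by blast
    have e: "\<exists>t. (s - 1) *s (A *v u) = (s * bar a - a) *s u + t *s x" for u
    proof -
      obtain t where "g *v (B *v u) = s *s (B *v u) + t *s x" using sx by blast
      then have "A *v u - a *s u = s *s (B *v u) + t *s x" unfolding gBv .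
      then have "A *v u - a *s u = s *s (A *v u - bar a *s u) + t *s x" unfolding Bv .
      then have "(s - 1) *s (A *v u) = (s * bar a - a) *s u + (- t) *s x"
        by (simp add: vec_eq_iff algebra_simps)
      then show ?thesis by blast
    qed
    have s1: "s \<noteq> 1"
    proof
      assume s: "s = 1"
      have im: "\<exists>t. u = t *s x" for u
      proof -
        obtain t where "0 = (bar a - a) *s u + t *s x" using e[of u] s by auto
        then have "u = (- t / (bar a - a)) *s x" using a0 by (simp add: vec_eq_iff field_simps eq_neg_iff_add_eq_0)
        then show ?thesis by blast
      qed
      then have "range (\<lambda>t. t *s x) = UNIV" by auto
      then have "CARD('a ^ 3) \<le> CARD('a)" using card_image_le[of UNIV "\<lambda>t. t *s x"] by simp
      then show False unfolding card_V card_field using q_gt_1 by simp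
    qed
    have "\<exists>t. A *v u = ((s * bar a - a) / (s - 1)) *s u + t *s x" for u
    proof -
      obtain t where t: "(s - 1) *s (A *v u) = (s * bar a - a) *s u + t *s x" using e by blast
      have "A *v u = inverse (s - 1) *s ((s - 1) *s (A *v u))" using s1 by simp
      also have "\<dots> = ((s * bar a - a) / (s - 1)) *s u + (t / (s - 1)) *s x"
        unfolding t by (simp add: divide_inverse vec.scale_right_distrib mult.commute)
      finally have "A *v u = ((s * bar a - a) / (s - 1)) *s u + (t / (s - 1)) *s x" .
      then show ?thesis by blast
    qed
    then show False using rank_one_shift_not_cyclic A(2) by blast
  qed
  have comm: "k ** A = A ** k" if kg: "k ** g = g ** k" for k
  proof -
    have k: "k *v (g *v u) = g *v (k *v u)" for u using arg_cong[OF kg, of "\<lambda>M. M *v u"] by simp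
    have c: "g *v (B *v u) - B *v u = (bar a - a) *s u" for u
    proof -
      have "g *v (B *v u) - B *v u = (A *v u - a *s u) - B *v u" unfolding gBv ..
      also have "\<dots> = (bar a - a) *s u" unfolding Bv by (simp add: vec_eq_iff algebra_simps)
      finally show ?thesis .
    qed
    have "B *v (k *v u) = k *v (B *v u)" for u
    proof -
      let ?d = "k *v (B *v u) - B *v (k *v u)"
      have "g *v ?d - ?d = k *v (g *v (B *v u) - B *v u) - (g *v (B *v (k *v u)) - B *v (k *v u))"
        by (simp add: mv_simps k)
      also have "\<dots> = 0" unfolding c by simp
      finally have gd: "g *v ?d - ?d = 0" .
      obtain w where w: "?d = B *v w" using surj by blast
      have "(bar a - a) *s w = 0" using gd c[of w] w by simp
      then show ?thesis using w a0 by simp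
    qed
    then show ?thesis by (simp add: matrix_eq Bv mv_simps)
  qed
  show thesis using that[OF gU cg _ gA comm] gB by (simp add: B_def)
qed

section \<open>Elements whose projective centraliser is as small as possible\<close>

text \<open>Two elements of the projective group commute when their lifts satisfy \<open>k g = c g k\<close> for a scalar \<open>c\<close>.
  For rigid \<open>g\<close> this forces the lifts themselves to commute.\<close>

definition rigid :: "'a ^ 3 ^ 3 \<Rightarrow> bool" where
  "rigid g \<longleftrightarrow> (\<forall>k\<in>U. \<forall>c. k ** g = mat c ** (g ** k) \<longrightarrow> c = 1)"

lemma cube_pol:
  assumes "g \<in> U" "cyclic g" "g ** (g ** g) = pol x y z g"
  shows "x \<noteq> 0"
proof
  assume x: "x = 0"
  have "g *v (g *v (g *v u)) = g *v (y *s u + z *s (g *v u))" for u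
    using arg_cong[OF assms(3), of "\<lambda>M. M *v u"] x by (simp add: mv_simps)
  then have "ginv g *v (g *v (g *v (g *v u))) = ginv g *v (g *v (y *s u + z *s (g *v u)))" for u by simp
  then have "g *v (g *v u) = y *s u + z *s (g *v u)" for u using assms(1) by simp
  then have "pol 0 0 1 g = pol y z 0 g" by (simp add: matrix_eq)
  from cyclic_pol_inj[OF assms(2) this] show False by simp
qed

text \<open>Comparing the cubic relation \<open>g\<^sup>3 = x + y g + z g\<^sup>2\<close> with the one of the conjugate
  \<open>k g k\<inverse> = c g\<close> gives \<open>c\<^sup>3 x = x\<close>, \<open>c\<^sup>2 y = y\<close> and \<open>c z = z\<close>. As \<open>x \<noteq> 0\<close>, a scalar \<open>c \<noteq> 1\<close> is a
  primitive cube root of unity, which leaves \<open>y = z = 0\<close>.\<close>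

lemma rigidI:
  assumes g: "g \<in> U" "cyclic g" and nd: "\<And>d. g ** (g ** g) \<noteq> mat d"
  shows "rigid g"
  unfolding rigid_def
proof (intro ballI allI impI)
  fix k c assume k: "k \<in> U" and kg: "k ** g = mat c ** (g ** k)"
  obtain x y z where p: "g ** (g ** g) = pol x y z g" using cyclic_minimal_polynomial[OF g(2)] by blast
  have x: "x \<noteq> 0" using cube_pol[OF g p] .
  have kgv: "k *v (g *v u) = c *s (g *v (k *v u))" for u using arg_cong[OF kg, of "\<lambda>M. M *v u"] by simp
  have pv: "g *v (g *v (g *v u)) = x *s u + y *s (g *v u) + z *s (g *v (g *v u))" for u
    using arg_cong[OF p, of "\<lambda>M. M *v u"] by simp
  have "pol (c * c * c * x) (c * c * c * y) (c * c * c * z) g *v w = pol x (c * y) (c * c * z) g *v w" for w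
  proof -
    define u where "u = ginv k *v w"
    have w: "k *v u = w" using k by (simp add: u_def)
    have "k *v (g *v (g *v (g *v u))) = (c * c * c) *s (g *v (g *v (g *v w)))"
      by (simp add: kgv w mult.assoc)
    moreover have "k *v (g *v (g *v (g *v u))) = x *s w + (c * y) *s (g *v w) + (c * c * z) *s (g *v (g *v w))"
      unfolding pv[of u] by (simp add: mv_simps kgv w) (simp add: ac_simps)
    ultimately show ?thesis unfolding pv[of w] by (simp add: vec_eq_iff algebra_simps)
  qed
  then have "pol (c * c * c * x) (c * c * c * y) (c * c * c * z) g = pol x (c * y) (c * c * z) g"
    unfolding matrix_eq by blast
  from cyclic_pol_inj[OF g(2) this] have e: "c * c * c * x = x" "c * c * c * y = c * y" "c * c * c * z = c * c * z" by auto
  then have c3: "c * c * c = 1" using x by simp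
  show "c = 1"
  proof (rule ccontr)
    assume c: "c \<noteq> 1"
    have "y = c * y" using e(2) c3 by simp
    then have "(c - 1) * y = 0" by (simp add: left_diff_distrib)
    then have y: "y = 0" using c by simp
    have "c * c \<noteq> 1" using c c3 by auto
    have "z = c * c * z" using e(3) c3 by simp
    then have "(c * c - 1) * z = 0" by (simp add: left_diff_distrib)
    then have "z = 0" using \<open>c * c \<noteq> 1\<close> by simp
    then have "g ** (g ** g) = mat x" using p y by (simp add: matrix_eq)
    then show False using nd by blast
  qed
qed

text \<open>Since \<open>out v\<close> commutes with \<open>g\<close>, the scalar \<open>a\<close> by which \<open>g\<close> multiplies \<open>v\<close> is also the one by
  which it multiplies the linear form \<open>h _ v\<close>. If \<open>g\<^sup>3\<close> is scalar, it is \<open>a\<^sup>3\<close>, so \<open>g\<^sup>2 x + a g x + a\<^sup>2 x\<close>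
  is an eigenvector for \<open>a\<close>. As \<open>g\<close> is cyclic, it lies in the line of \<open>v\<close> and is perpendicular to
  \<open>v\<close>. For \<open>h x v = 1\<close> this reads \<open>3 a\<^sup>2 = 0\<close>, but the characteristic is not three.\<close>

lemma isotropic_cube_not_scalar:
  assumes g: "g \<in> U" "cyclic g" and v: "v \<noteq> 0" "h v v = 0" "g ** out v = out v ** g"
  shows "g ** (g ** g) \<noteq> mat d"
proof
  assume d: "g ** (g ** g) = mat d"
  obtain x where x: "h x v = 1" "h v x = 1" using h_dual[OF v(1)] by blast
  define a where "a = h (g *v x) v"
  have gv: "g *v v = a *s v"
    using arg_cong[OF v(3), of "\<lambda>M. M *v x"] x by (simp add: a_def)
  have gu: "h (g *v u) v = a * h u v" for u
  proof -
    have "h u v *s (g *v v) = h (g *v u) v *s v" using arg_cong[OF v(3), of "\<lambda>M. M *v u"] by simp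
    then have "h (h u v *s (g *v v)) x = h (h (g *v u) v *s v) x" by simp
    then show ?thesis using gv x by (simp add: mult.commute)
  qed
  have a0: "a \<noteq> 0" using U_inj[OF g(1), of v] gv v(1) by auto
  have ggg: "g *v (g *v (g *v u)) = d *s u" for u using arg_cong[OF d, of "\<lambda>M. M *v u"] by simp
  have "d *s v = (a * a * a) *s v" using ggg[of v] by (auto simp: gv mult.assoc)
  then have d3: "d = a * a * a" using v(1) by (metis vector_mul_rcancel)
  define Q where "Q = g *v (g *v x) + a *s (g *v x) + (a * a) *s x"
  have "(g - mat a) *v Q = 0" unfolding Q_def
    by (simp add: mv_simps ggg d3) (simp add: vec_eq_iff algebra_simps)
  moreover have "(g - mat a) *v v = 0" by (simp add: mv_simps gv)
  ultimately obtain c where "Q = c *s v" using cyclic_kernel_line[OF cyclic_shift[OF g(2)]] v(1) by metis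
  then have "h Q v = 0" using v(2) by simp
  then have "3 * (a * a) = 0" unfolding Q_def by (simp add: gu x algebra_simps)
  then show False using three_neq_0 a0 by simp
qed

text \<open>The operator \<open>m\<close> acts as a scalar on the quotient by the line of \<open>v\<close>.\<close>

definition scalar_mod :: "'a ^ 3 \<Rightarrow> 'a ^ 3 ^ 3 \<Rightarrow> bool" where
  "scalar_mod v m \<longleftrightarrow> (\<exists>c. \<forall>u. \<exists>t. m *v u = c *s u + t *s v)"

lemma cyclic_not_scalar_mod: "cyclic A \<Longrightarrow> \<not> scalar_mod v A"
  using rank_one_shift_not_cyclic unfolding scalar_mod_def by blast

text \<open>The analogue of \<open>rigid\<close> for the quotient by the line of \<open>v\<close> and for isometries fixing this line.\<close>

definition rigid_mod :: "'a ^ 3 \<Rightarrow> 'a ^ 3 ^ 3 \<Rightarrow> bool" where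
  "rigid_mod v g \<longleftrightarrow> (\<forall>k\<in>U. \<forall>c b. k *v v = b *s v \<longrightarrow>
    (\<forall>u. \<exists>t. k *v (g *v u) = c *s (g *v (k *v u)) + t *s v) \<longrightarrow> c = 1)"

lemma cyclic_eigenvector_basis:
  fixes A :: "'a ^ 3 ^ 3"
  assumes "cyclic A" "v \<noteq> 0" "A *v v = a *s v"
  obtains u where "ind3 u (A *v u) v"
proof -
  define B where "B = A - mat a"
  have Bv: "B *v u = A *v u - a *s u" for u by (simp add: B_def mv_simps)
  obtain u where u: "ind3 u (B *v u) (B *v (B *v u))" using cyclic_shift[OF assms(1)] unfolding B_def cyclic_def by blast
  have "ind3 u (A *v u) v" unfolding ind3_def
  proof (intro allI impI)
    fix x y z assume e: "x *s u + y *s (A *v u) + z *s v = 0"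
    have "B *v v = 0" using assms(3) by (simp add: Bv)
    then have "B *v (x *s u + y *s (A *v u)) = 0"
      using arg_cong[OF e, of "\<lambda>w. B *v w"] by (simp add: mv_simps)
    then have "0 *s u + (x + y * a) *s (B *v u) + y *s (B *v (B *v u)) = 0"
      by (simp add: mv_simps Bv) (simp add: vec_eq_iff algebra_simps)
    from ind3D[OF u this] have "y = 0" "x = 0" by auto
    then show "x = 0 \<and> y = 0 \<and> z = 0" using e assms(2) by simp
  qed
  then show thesis by (rule that)
qed

text \<open>On the quotient by an eigenvector, a cyclic operator remains cyclic, so that what commutes
  with it there is linear in it.\<close>

lemma commute_mod:
  fixes A B :: "'a ^ 3 ^ 3"
  assumes "cyclic A" "v \<noteq> 0" "A *v v = a *s v" "B *v v = b *s v"
    and comm: "\<And>u. \<exists>t. B *v (A *v u) = A *v (B *v u) + t *s v"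
  obtains x y where "\<And>u. \<exists>t. B *v u = x *s u + y *s (A *v u) + t *s v"
proof -
  obtain u where u: "ind3 u (A *v u) v" using cyclic_eigenvector_basis[OF assms(1-3)] by blast
  obtain x y t where xyt: "B *v u = x *s u + y *s (A *v u) + t *s v" using ind3_span[OF u] by blast
  obtain t' where t': "B *v (A *v u) = A *v (B *v u) + t' *s v" using comm by blast
  have "\<exists>t. B *v w = x *s w + y *s (A *v w) + t *s v" for w
  proof -
    obtain l m n where w: "w = l *s u + m *s (A *v u) + n *s v" using ind3_span[OF u] by blast
    have "B *v w = x *s w + y *s (A *v w) + (l * t + m * (t * a + t') + n * (b - x - y * a)) *s v"
      unfolding w by (simp add: mv_simps t' xyt assms(3,4)) (simp add: vec_eq_iff algebra_simps)
    then show ?thesis by blast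
  qed
  then show thesis using that by blast
qed

text \<open>On the two-dimensional quotient \<open>g\<^sup>2 = n + \<tau> g\<close> with \<open>n \<noteq> 0\<close>. Comparing with the relation of the
  conjugate \<open>c g\<close> gives \<open>c\<^sup>2 = 1\<close> and \<open>c \<tau> = \<tau>\<close>. So \<open>c \<noteq> 1\<close> requires an odd characteristic and \<open>\<tau> = 0\<close>,
  that is, a scalar square.\<close>

lemma rigid_modI:
  assumes g: "g \<in> U" "cyclic g" and v: "v \<noteq> 0" "g *v v = a *s v" 
    and sq: "(2::'a) = 0 \<or> \<not> scalar_mod v (g ** g)"
  shows "rigid_mod v g"
  unfolding rigid_mod_def
proof (intro ballI allI impI)
  fix k c b assume k: "k \<in> U" "k *v v = b *s v" and kg: "\<forall>u. \<exists>t. k *v (g *v u) = c *s (g *v (k *v u)) + t *s v"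
  obtain u where u: "ind3 u (g *v u) v" using cyclic_eigenvector_basis[OF g(2) v] by blast
  have a0: "a \<noteq> 0" using U_inj[OF g(1), of v] v by auto
  have b0: "b \<noteq> 0" using U_inj[OF k(1), of v] k v by auto
  have "\<exists>t. (g ** g) *v (g *v w) = g *v ((g ** g) *v w) + t *s v" for w by (intro exI[of _ 0]) simp
  then obtain n tau where nt: "\<And>w. \<exists>t. g *v (g *v w) = n *s w + tau *s (g *v w) + t *s v"
    using commute_mod[OF g(2) v, of "g ** g" "a * a"] v(2) by (auto simp: mult.commute)
  have n0: "n \<noteq> 0"
  proof
    assume "n = 0"
    then obtain t where "g *v (g *v u) = tau *s (g *v u) + t *s v" using nt[of u] by auto
    then have "g *v (g *v u) = g *v (tau *s u + (t / a) *s v)" using a0 by (simp add: mv_simps v(2))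
    then have "ginv g *v (g *v (g *v u)) = ginv g *v (g *v (tau *s u + (t / a) *s v))" by simp
    then have "g *v u = tau *s u + (t / a) *s v" using g(1) by simp
    then have "(- tau) *s u + 1 *s (g *v u) + (- (t / a)) *s v = 0" by (simp add: vec_eq_iff)
    from ind3D[OF u this] show False by simp
  qed
  define w where "w = ginv k *v u"
  have kw: "k *v w = u" using k by (simp add: w_def)
  obtain t1 where t1: "k *v (g *v w) = c *s (g *v u) + t1 *s v" using kg kw by metis
  obtain t2 where t2: "k *v (g *v (g *v w)) = c *s (g *v (c *s (g *v u) + t1 *s v)) + t2 *s v" using kg t1 by metis
  obtain t3 where t3: "g *v (g *v w) = n *s w + tau *s (g *v w) + t3 *s v" using nt by blast
  obtain t4 where t4: "g *v (g *v u) = n *s u + tau *s (g *v u) + t4 *s v" using nt by blast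
  have "k *v (g *v (g *v w)) = n *s u + tau *s (c *s (g *v u) + t1 *s v) + (t3 * b) *s v"
    unfolding t3 by (simp add: mv_simps kw t1 k(2))
  then have "n *s u + (tau * c) *s (g *v u) + (tau * t1 + t3 * b) *s v =
     (c * c * n) *s u + (c * c * tau) *s (g *v u) + (c * c * t4 + c * t1 * a + t2) *s v"
    unfolding t2 by (simp add: mv_simps v(2) t4) (simp add: vec_eq_iff algebra_simps)
  from ind3_eqD[OF u this] have e: "n = c * c * n" "tau * c = c * c * tau" by auto
  then have c2: "c * c = 1" using n0 by simp
  show "c = 1"
  proof (cases "tau = 0")
    case True
    have "scalar_mod v (g ** g)" unfolding scalar_mod_def
    proof (rule exI[of _ n], rule allI)
      fix w show "\<exists>t. (g ** g) *v w = n *s w + t *s v" using nt[of w] True by simp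
    qed
    then have "(2::'a) = 0" using sq by blast
    then have "(c - 1) * (c - 1) = 0" using c2 by (simp add: algebra_simps)
    then show ?thesis by simp
  next
    case False
    then have "c = c * c" using e(2) by (simp add: mult.commute)
    then show ?thesis using c2 by simp
  qed
qed

section \<open>Nilpotent pairs\<close>

lemma combination_divide:
  fixes p :: "'a ^ 3"
  assumes "d \<noteq> 0" and e: "d *s p = a *s u + b *s v"
  shows "p = (a / d) *s u + (b / d) *s v"
proof -
  have "p = inverse d *s (d *s p)" using assms(1) by simp
  then show ?thesis unfolding e by (simp add: divide_inverse vec.scale_right_distrib mult.commute)
qed

text \<open>For an isotropic \<open>v\<close> these are the Hermitian operators that are nilpotent with respect to the flag
  formed by \<open>v\<close> and its perpendicular plane. \<open>Unip v\<close> adds the scalars of \<open>K\<close>.\<close>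

definition Nil :: "'a ^ 3 \<Rightarrow> ('a ^ 3 ^ 3) set" where
  "Nil v = {X \<in> Herm. X *v v = 0 \<and> (\<forall>u. h u v = 0 \<longrightarrow> (\<exists>t. X *v u = t *s v))}"

definition Unip :: "'a ^ 3 \<Rightarrow> ('a ^ 3 ^ 3) set" where
  "Unip v = {mat s + X | s X. s \<in> K \<and> X \<in> Nil v}"

lemma Nil_range: "X \<in> Nil v \<Longrightarrow> h (X *v u) v = 0"
  using HermD[of X u v] by (simp add: Nil_def)

text \<open>The square of \<open>A\<close> again belongs to \<open>Nil v\<close>, so the constant term of a polynomial in \<open>A\<close> is its
  only part outside \<open>Nil v\<close>.\<close>

lemma herm_cent_subset_Unip:
  assumes A: "A \<in> Nil v" "cyclic A"
  shows "herm_cent A \<subseteq> Unip v"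
proof
  fix B assume "B \<in> herm_cent A"
  moreover have AH: "A \<in> Herm" using A by (simp add: Nil_def)
  ultimately obtain x y z where xyz: "x \<in> K" "y \<in> K" "z \<in> K" "B = pol x y z A"
    using cyclic_Herm_commutant[OF AH A(2)] unfolding herm_cent_def by blast
  let ?X = "mat y ** A + mat z ** (A ** A)"
  have "?X = pol 0 y z A" by (simp add: pol_def)
  then have "?X \<in> Herm" using Herm_pol[OF AH, of 0 y z] xyz by simp
  moreover have "?X *v v = 0" using A(1) by (simp add: Nil_def mv_simps)
  moreover have "\<exists>t. ?X *v u = t *s v" if u: "h u v = 0" for u
  proof -
    obtain t where "A *v u = t *s v" using A(1) u by (auto simp: Nil_def)
    moreover have "A *v v = 0" using A(1) by (simp add: Nil_def)
    ultimately have "?X *v u = (y * t) *s v" by (simp add: mv_simps)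
    then show ?thesis by blast
  qed
  ultimately have "?X \<in> Nil v" by (simp add: Nil_def)
  moreover have "B = mat x + ?X" using xyz by (simp add: pol_def add.assoc)
  ultimately show "B \<in> Unip v" using xyz(1) unfolding Unip_def by blast
qed

text \<open>The properties that allow \<open>g\<close> to represent the algebra \<open>S\<close> in the cover: what commutes with \<open>g\<close> up
  to a scalar, on the whole space or on the quotient by a point of \<open>S\<close>, commutes with \<open>g\<close> there.\<close>

definition distinguished :: "('a ^ 3 ^ 3) set \<Rightarrow> 'a ^ 3 ^ 3 \<Rightarrow> bool" where
  "distinguished S g \<longleftrightarrow> g \<in> Ucent S \<and> cyclic g \<and> rigid g \<and> (\<forall>v. v \<noteq> 0 \<longrightarrow> out v \<in> S \<longrightarrow> rigid_mod v g)"

lemma distinguishedD: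
  assumes "distinguished S g"
  shows "g \<in> U" "g \<in> Ucent S" "cyclic g" "rigid g" "v \<noteq> 0 \<Longrightarrow> out v \<in> S \<Longrightarrow> rigid_mod v g"
    "A \<in> S \<Longrightarrow> g ** A = A ** g"
  using assms by (auto simp: distinguished_def Ucent_def)

lemma rigidD: "rigid g \<Longrightarrow> k \<in> U \<Longrightarrow> k ** g = mat c ** (g ** k) \<Longrightarrow> k ** g = g ** k"
  unfolding rigid_def by force

lemma proj_commute_rigid:
  assumes "rigid g" "g \<in> U" "k \<in> U" "proj k \<otimes>\<^bsub>PGU h\<^esub> proj g = proj g \<otimes>\<^bsub>PGU h\<^esub> proj k"
  shows "k ** g = g ** k"
  using assms proj_commute_iff[OF assms(3,2)] rigidD by blast

text \<open>A cyclic operator lies in one algebra only.\<close>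

lemma same_algebra:
  assumes "S \<in> Alg" "S' \<in> Alg" "A \<in> S" "cyclic A" "A' \<in> S'" "cyclic A'" "A ** A' = A' ** A"
  shows "S = S'"
proof -
  have "A' \<in> herm_cent A" using assms Alg_D(1)[OF assms(2)] by (simp add: herm_cent_def)
  then have "A' \<in> S" using Alg_eq_herm_cent assms by blast
  then show ?thesis using Alg_eq_herm_cent assms by blast
qed

text \<open>By rigidity \<open>g\<close> and \<open>g'\<close> commute. The operators \<open>A\<close> and \<open>A'\<close> commute with the cyclic operators \<open>g\<close>
  and \<open>g'\<close>, respectively, and passing from one commutant to the next they commute with each
  other.\<close>

lemma distinguished_commuting:
  assumes "S \<in> Alg" "S' \<in> Alg" "A \<in> S" "cyclic A" "A' \<in> S'" "cyclic A'" "distinguished S g" "distinguished S' g'"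
    and "proj g \<otimes>\<^bsub>PGU h\<^esub> proj g' = proj g' \<otimes>\<^bsub>PGU h\<^esub> proj g"
  shows "S = S'"
proof -
  note d = distinguishedD[OF assms(7)] and d' = distinguishedD[OF assms(8)]
  have "g ** g' = g' ** g" using proj_commute_rigid[OF d'(4) d'(1) d(1)] assms(9) by simp
  moreover have "g' ** A' = A' ** g'" using d'(6) assms by blast
  ultimately have "g ** A' = A' ** g" using cyclic_commuting_commute[OF d'(3), of g A'] by metis
  moreover have "g ** A = A ** g" using d(6) assms by blast
  ultimately have "A ** A' = A' ** A" using cyclic_commuting_commute[OF d(3), of A A'] by metis
  then show ?thesis using same_algebra assms by blast
qed

lemma scalar_mod_mat_mult: "scalar_mod v m \<Longrightarrow> scalar_mod v (mat c ** m)"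
  unfolding scalar_mod_def
proof -
  assume "\<exists>b. \<forall>u. \<exists>t. m *v u = b *s u + t *s v"
  then obtain b where b: "\<And>u. \<exists>t. m *v u = b *s u + t *s v" by blast
  have "\<exists>t. (mat c ** m) *v u = (c * b) *s u + t *s v" for u
  proof -
    obtain t where "m *v u = b *s u + t *s v" using b by blast
    then have "(mat c ** m) *v u = (c * b) *s u + (c * t) *s v" by (simp add: vec_eq_iff algebra_simps)
    then show ?thesis by blast
  qed
  then show "\<exists>b. \<forall>u. \<exists>t. (mat c ** m) *v u = b *s u + t *s v" by blast
qed

lemma stabiliser_subgroup: "subgroup (proj ` {m \<in> U. \<exists>c. m *v v = c *s v}) (PGU h)"
proof (rule subgroup_proj)
  fix a assume a: "a \<in> {m \<in> U. \<exists>c. m *v v = c *s v}"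
  then obtain c where c: "a \<in> U" "a *v v = c *s v" by blast
  have "\<exists>c. ginv a *v v = c *s v"
  proof (cases "v = 0")
    case False
    then have c0: "c \<noteq> 0" using U_inj[OF c(1), of v] c(2) by auto
    have e: "c *s (ginv a *v v) = v" using ginv(5)[OF c(1), of v] c(2) by simp
    have "ginv a *v v = inverse c *s v" using arg_cong[OF e, of "\<lambda>w. inverse c *s w"] c0 by simp
    then show ?thesis by blast
  qed simp
  then show "ginv a \<in> {m \<in> U. \<exists>c. m *v v = c *s v}" using c by simp
qed (auto simp: U_one U_mult intro: exI[of _ 1])

lemma proj_nilpotent_pair_central:
  assumes gU: "g \<in> U" "g' \<in> U" and gs: "\<And>c. g \<noteq> mat c"
    and nil: "c_nilpotent_pair c (PGU h) (proj g) (proj g')"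
  obtains k where "k \<in> U" "\<forall>c. k \<noteq> mat c"
    "proj k \<otimes>\<^bsub>PGU h\<^esub> proj g = proj g \<otimes>\<^bsub>PGU h\<^esub> proj k" "proj k \<otimes>\<^bsub>PGU h\<^esub> proj g' = proj g' \<otimes>\<^bsub>PGU h\<^esub> proj k"
proof -
  interpret P: group "PGU h" by (rule group_PGU)
  let ?N = "generate (PGU h) {proj g, proj g'}"
  have gc: "proj g \<in> carrier (PGU h)" "proj g' \<in> carrier (PGU h)" using gU by (auto simp: carrier_PGU)
  have inN: "proj g \<in> ?N" "proj g' \<in> ?N" by (auto intro: generate.incl)
  have "\<not> ?N \<subseteq> {\<one>\<^bsub>PGU h\<^esub>}" using inN(1) gs proj_one_iff by blast
  then obtain z where z: "z \<in> ?N" "z \<noteq> \<one>\<^bsub>PGU h\<^esub>" 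
    "\<And>w. w \<in> ?N \<Longrightarrow> z \<otimes>\<^bsub>PGU h\<^esub> w \<otimes>\<^bsub>PGU h\<^esub> inv\<^bsub>PGU h\<^esub> z \<otimes>\<^bsub>PGU h\<^esub> inv\<^bsub>PGU h\<^esub> w = \<one>\<^bsub>PGU h\<^esub>"
    using P.c_nilpotent_pair_central_mod[OF gc nil, of "{\<one>\<^bsub>PGU h\<^esub>}"] by (metis insertI1 singletonD)
  have Nc: "?N \<subseteq> carrier (PGU h)" using P.generate_incl[of "{proj g, proj g'}"] gc by blast
  then obtain k where k: "k \<in> U" "z = proj k" using z(1) by (auto simp: carrier_PGU)
  have kns: "k \<noteq> mat c" for c
  proof
    assume c: "k = mat c"
    then have "c * bar c = 1" using k(1) mat_U_iff by simp
    then have "proj (mat 1) = proj k" unfolding proj_eq_iff c by (intro exI[of _ c]) simp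
    then show False using z(2) k(2) by (simp add: proj_one)
  qed
  have zc: "z \<otimes>\<^bsub>PGU h\<^esub> proj g = proj g \<otimes>\<^bsub>PGU h\<^esub> z" "z \<otimes>\<^bsub>PGU h\<^esub> proj g' = proj g' \<otimes>\<^bsub>PGU h\<^esub> z"
    using z(3)[OF inN(1)] z(3)[OF inN(2)] P.commutator_eq_one_iff[OF subsetD[OF Nc z(1)]] gc by blast+
  show thesis using that[OF k(1)] kns zc unfolding k(2) by blast
qed

text \<open>The heart of the matter for class at least two. Let \<open>k\<close> be a lift of a nontrivial central element
  of the nilpotent group generated by \<open>g\<close> and \<open>g'\<close>. If \<open>k\<close> is cyclic, it links the commutants of \<open>g\<close>
  and \<open>g'\<close>, and \<open>S = S'\<close>. Otherwise \<open>k\<close> singles out a point \<open>v\<close> with \<open>out v\<close> in both algebras. Then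
  consider the elements that act as scalars on the quotient by \<open>v\<close>: an element \<open>m\<close> outside this set
  and central modulo it commutes on the quotient with \<open>g\<close> and \<open>g'\<close>, since these are rigid there too.
  A cyclic operator has a commutative commutant also on the quotient, and so a cyclic \<open>B'\<close> in \<open>S'\<close>
  agrees modulo \<open>v\<close> with \<open>x + y B\<close> for a cyclic \<open>B\<close> in \<open>S\<close>.

  The difference \<open>B' - x - y B\<close> has its range in the line of \<open>v\<close>, and comparing it with its adjoint
  decides the matter: if \<open>x\<close> and \<open>y\<close> are in \<open>K\<close>, it is a multiple of \<open>out v\<close> and \<open>S = S'\<close>; the only
  other possibility is that \<open>v\<close> is isotropic and both \<open>B\<close> and \<open>B'\<close> are nilpotent with respect to the
  flag of \<open>v\<close>.\<close>

lemma distinguished_nilpotent_pair: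
  assumes S: "S \<in> Alg" "S' \<in> Alg" and A: "A \<in> S" "cyclic A" "A' \<in> S'" "cyclic A'" 
    and g: "distinguished S g" "distinguished S' g'"
    and nil: "c_nilpotent_pair c (PGU h) (proj g) (proj g')"
  shows "S = S' \<or> (\<exists>v. v \<noteq> 0 \<and> h v v = 0 \<and> S \<subseteq> Unip v \<and> S' \<subseteq> Unip v)"
proof -
  interpret P: group "PGU h" by (rule group_PGU)
  note d = distinguishedD[OF g(1)] and d' = distinguishedD[OF g(2)]
  let ?N = "generate (PGU h) {proj g, proj g'}"
  have gc: "proj g \<in> carrier (PGU h)" "proj g' \<in> carrier (PGU h)" using d(1) d'(1) by (auto simp: carrier_PGU)
  have inN: "proj g \<in> ?N" "proj g' \<in> ?N" by (auto intro: generate.incl)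
  have gs: "g \<noteq> mat c" for c using cyclic_not_scalar_mod[OF d(3), of 0] by (auto simp: scalar_mod_def)
  obtain k where k: "k \<in> U" and kns: "\<forall>c. k \<noteq> mat c"
    and zc: "proj k \<otimes>\<^bsub>PGU h\<^esub> proj g = proj g \<otimes>\<^bsub>PGU h\<^esub> proj k" "proj k \<otimes>\<^bsub>PGU h\<^esub> proj g' = proj g' \<otimes>\<^bsub>PGU h\<^esub> proj k"
    by (rule proj_nilpotent_pair_central[OF d(1) d'(1) gs nil])
  have kg: "k ** g = g ** k" "k ** g' = g' ** k"
    using proj_commute_rigid[OF d(4) d(1) k(1)] proj_commute_rigid[OF d'(4) d'(1) k(1)] zc by auto
  have kA: "k ** A = A ** k" "k ** A' = A' ** k"
    using cyclic_commuting_commute[OF d(3) kg(1)[symmetric] d(6)[OF A(1)]]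
      cyclic_commuting_commute[OF d'(3) kg(2)[symmetric] d'(6)[OF A(3)]] by auto
  show ?thesis
  proof (cases "cyclic k")
    case True
    then have "A ** A' = A' ** A" using cyclic_commuting_commute kA by blast
    then show ?thesis using same_algebra[OF S A] by blast
  next
    case False
    obtain v where v: "v \<noteq> 0" "\<And>B. B ** k = k ** B \<Longrightarrow> B ** out v = out v ** B"
      using unitary_not_cyclic[OF k(1) False] kns by metis
    have AH: "A \<in> Herm" "A' \<in> Herm" using Alg_D(1) S A by blast+
    have "out v \<in> herm_cent A" "out v \<in> herm_cent A'" using v(2)[of A] v(2)[of A'] kA by (auto simp: herm_cent_def Herm_closed)
    then have vS: "out v \<in> S" "out v \<in> S'" using Alg_eq_herm_cent S A by auto
    have eig: "\<exists>c. m *v v = c *s v" if m: "m ** out v = out v ** m" for m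
    proof -
      obtain x where x: "h x v = 1" using h_dual[OF v(1)] by blast
      show ?thesis using arg_cong[OF m, of "\<lambda>M. M *v x"] x by auto
    qed
    obtain a where gv1: "g *v v = a *s v" using eig[OF d(6)[OF vS(1)]] by blast
    obtain a' where gv2: "g' *v v = a' *s v" using eig[OF d'(6)[OF vS(2)]] by blast
    note gv = gv1 gv2
    \<comment> \<open>Now everything is read on the quotient by the line of \<open>v\<close>.\<close>
    let ?K = "proj ` {m \<in> U. scalar_mod v m}"
    have K: "proj m \<in> ?K \<longleftrightarrow> scalar_mod v m" if "m \<in> U" for m
    proof
      assume "proj m \<in> ?K"
      then obtain m' where "scalar_mod v m'" "proj m' = proj m" by auto
      then show "scalar_mod v m" using scalar_mod_mat_mult unfolding proj_eq_iff by blast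
    qed (use that in blast)
    have "proj g \<notin> ?K" using K[OF d(1)] cyclic_not_scalar_mod[OF d(3)] by blast
    then have nK: "\<not> ?N \<subseteq> ?K" using inN by blast
    have "scalar_mod v (mat 1)" unfolding scalar_mod_def by (intro exI[of _ 1] allI exI[of _ 0]) simp
    then have oK: "\<one>\<^bsub>PGU h\<^esub> \<in> ?K" unfolding proj_one using U_one by blast
    obtain y where y: "y \<in> ?N" "y \<notin> ?K" 
      "\<And>w. w \<in> ?N \<Longrightarrow> y \<otimes>\<^bsub>PGU h\<^esub> w \<otimes>\<^bsub>PGU h\<^esub> inv\<^bsub>PGU h\<^esub> y \<otimes>\<^bsub>PGU h\<^esub> inv\<^bsub>PGU h\<^esub> w \<in> ?K"
      by (rule P.c_nilpotent_pair_central_mod[OF gc nil oK nK]) (rule that)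
    have "?N \<subseteq> proj ` {m \<in> U. \<exists>c. m *v v = c *s v}"
      using d(1) d'(1) gv by (intro P.generate_subgroup_incl[OF _ stabiliser_subgroup]) auto
    from subsetD[OF this y(1)] obtain m b where m: "m \<in> U" "y = proj m" "m *v v = b *s v" by blast
    have mns: "\<not> scalar_mod v m" using y(2) m K by blast
    have com: "\<exists>c. \<forall>u. \<exists>t. m *v (r *v u) = c *s (r *v (m *v u)) + t *s v" 
      if r: "r \<in> U" "proj r \<in> ?N" for r
    proof -
      have "proj (m ** r ** ginv m ** ginv r) \<in> ?K" using y(3)[OF r(2)] m r by (simp add: proj_commutator)
      then have "scalar_mod v (m ** r ** ginv m ** ginv r)"
        using K[OF U_mult[OF U_mult[OF U_mult[OF m(1) r(1)] ginv(1)[OF m(1)]] ginv(1)[OF r(1)]]] by blast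
      then obtain c where c0: "\<And>u. \<exists>t. (m ** r ** ginv m ** ginv r) *v u = c *s u + t *s v" unfolding scalar_mod_def by blast
      then have c: "\<exists>t. m *v (r *v (ginv m *v (ginv r *v u))) = c *s u + t *s v" for u by simp
      have "\<exists>t. m *v (r *v u) = c *s (r *v (m *v u)) + t *s v" for u
        using c[of "r *v (m *v u)"] m r by simp
      then show ?thesis by blast
    qed
    obtain c1 where c1: "\<And>u. \<exists>t. m *v (g *v u) = c1 *s (g *v (m *v u)) + t *s v" using com[OF d(1) inN(1)] by blast
    have "c1 = 1" using d(5)[OF v(1) vS(1), unfolded rigid_mod_def, rule_format, OF m(1,3) c1] .
    then have mg: "\<And>u. \<exists>t. m *v (g *v u) = g *v (m *v u) + t *s v" using c1 by simp
    obtain c2 where c2: "\<And>u. \<exists>t. m *v (g' *v u) = c2 *s (g' *v (m *v u)) + t *s v" using com[OF d'(1) inN(2)] by blast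
    have "c2 = 1" using d'(5)[OF v(1) vS(2), unfolded rigid_mod_def, rule_format, OF m(1,3) c2] .
    then have mg': "\<And>u. \<exists>t. m *v (g' *v u) = g' *v (m *v u) + t *s v" using c2 by simp
    have mod_pol: "\<exists>t. m *v (B *v u) = B *v (m *v u) + t *s v"
      if r: "cyclic r" "r *v v = e *s v" "\<And>u. \<exists>t. m *v (r *v u) = r *v (m *v u) + t *s v" "r ** B = B ** r" for r B u e
    proof -
      obtain x y z where B: "B = pol x y z r" using cyclic_commutant[OF r(1,4)] by blast
      obtain t1 where t1: "m *v (r *v u) = r *v (m *v u) + t1 *s v" using r(3) by blast
      obtain t2 where t2: "m *v (r *v (r *v u)) = r *v (m *v (r *v u)) + t2 *s v" using r(3) by blast
      have "m *v (B *v u) = B *v (m *v u) + (y * t1 + z * (t1 * e + t2)) *s v"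
        unfolding B by (simp add: mv_simps t2 t1 r(2)) (simp add: vec_eq_iff algebra_simps)
      then show ?thesis by blast
    qed
    have mA: "\<exists>t. m *v (A *v u) = A *v (m *v u) + t *s v" for u
      using mod_pol[OF d(3) gv(1) mg d(6)[OF A(1)]] .
    have mA': "\<exists>t. m *v (A' *v u) = A' *v (m *v u) + t *s v" for u
      using mod_pol[OF d'(3) gv(2) mg' d'(6)[OF A(3)]] .
    obtain l where l: "l \<in> K" "A *v v = l *s v" using commute_out_iff[OF AH(1) v(1)] v(2) kA by metis
    obtain l' where l': "l' \<in> K" "A' *v v = l' *s v" using commute_out_iff[OF AH(2) v(1)] v(2) kA by metis
    define B where "B = A - mat l"
    define B' where "B' = A' - mat l'"
    have B: "B \<in> S" "cyclic B" "B *v v = 0 *s v" "B \<in> Herm"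
      using Alg_D(6)[OF S(1) A(1) Alg_D(5)[OF S(1) l(1)]] cyclic_shift[OF A(2)] l AH 
      by (simp_all add: B_def mv_simps Herm_closed)
    have B': "B' \<in> S'" "cyclic B'" "B' *v v = 0 *s v" "B' \<in> Herm"
      using Alg_D(6)[OF S(2) A(3) Alg_D(5)[OF S(2) l'(1)]] cyclic_shift[OF A(4)] l' AH 
      by (simp_all add: B'_def mv_simps Herm_closed)
    have mB: "\<exists>t. m *v (B *v u) = B *v (m *v u) + t *s v" for u
      using mA[of u] by (auto simp: B_def mv_simps vec_eq_iff algebra_simps)
    have mB': "\<exists>t. m *v (B' *v u) = B' *v (m *v u) + t *s v" for u
      using mA'[of u] by (auto simp: B'_def mv_simps vec_eq_iff algebra_simps)
    obtain x0 y0 where my: "\<And>u. \<exists>t. m *v u = x0 *s u + y0 *s (B *v u) + t *s v"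
      using commute_mod[OF B(2) v(1) B(3) m(3) mB] by blast
    have y0: "y0 \<noteq> 0"
    proof
      assume "y0 = 0"
      then have "scalar_mod v m" using my unfolding scalar_mod_def by simp blast
      then show False using mns by blast
    qed
    have "\<exists>t. B' *v (B *v u) = B *v (B' *v u) + t *s v" for u
    proof -
      obtain t1 where t1: "m *v (B' *v u) = B' *v (m *v u) + t1 *s v" using mB' by blast
      obtain t2 where t2: "m *v u = x0 *s u + y0 *s (B *v u) + t2 *s v" using my by blast
      obtain t3 where t3: "m *v (B' *v u) = x0 *s (B' *v u) + y0 *s (B *v (B' *v u)) + t3 *s v" using my by blast
      have "y0 *s (B' *v (B *v u)) = y0 *s (B *v (B' *v u)) + (t3 - t1) *s v"
        using t1 unfolding t3 t2 by (simp add: mv_simps B'(3)) (simp add: vec_eq_iff algebra_simps)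
      then have "B' *v (B *v u) = B *v (B' *v u) + ((t3 - t1) / y0) *s v"
        using y0 by (simp add: vec_eq_iff field_simps)
      then show ?thesis by blast
    qed
    then obtain x y where xy: "\<And>u. \<exists>t. B' *v u = x *s u + y *s (B *v u) + t *s v"
      using commute_mod[OF B(2) v(1) B(3) B'(3)] by blast
    \<comment> \<open>\<open>C\<close> vanishes on the quotient, and \<open>D\<close> is its adjoint; so both have rank at most one.\<close>
    define C where "C = B' - mat x - mat y ** B"
    define D where "D = B' - mat (bar x) - mat (bar y) ** B"
    have Cv: "\<exists>t. C *v u = t *s v" for u using xy[of u] by (auto simp: C_def mv_simps vec_eq_iff algebra_simps)
    have "adj C D" unfolding C_def D_def using B(4) B'(4) by (intro adj_diff adj_mat adj_scale) (auto simp: Herm_def)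
    then obtain w where w: "C = outer v w" "D = outer w v" using outer_rank_one[OF Cv] by blast
    have Cvv: "h v w *s v = - x *s v" using arg_cong[OF w(1), of "\<lambda>M. M *v v"] B(3) B'(3) by (simp add: C_def mv_simps vec_eq_iff)
    have Dvv: "h v v *s w = - bar x *s v" using arg_cong[OF w(2), of "\<lambda>M. M *v v"] B(3) B'(3) by (simp add: D_def mv_simps vec_eq_iff)
    have CD: "mat (bar x - x) + mat (bar y - y) ** B = outer v w - outer w v"
      unfolding w[symmetric] C_def D_def by (simp add: matrix_eq mv_simps vec_eq_iff algebra_simps)
    have CDv: "(bar x - x) *s u + (bar y - y) *s (B *v u) = h u w *s v - h u v *s w" for u
      using arg_cong[OF CD, of "\<lambda>M. M *v u"] by (simp add: mv_simps)
    have same_if_K: ?thesis if K: "x \<in> K" "y \<in> K"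
    proof -
      have "C = D" using K unfolding C_def D_def by (simp add: K_iff)
      then have "C \<in> Herm" using \<open>adj C D\<close> by (simp add: Herm_def)
      then obtain b where b: "C = out (b *s v)" using Herm_rank_one Cv by blast
      have "B' = mat x + mat y ** B + mat (b * bar b) ** out v"
        using b unfolding out_scale C_def by (simp add: algebra_simps)
      then have "B' \<in> S" using K B(1) vS(1) Alg_D(5)[OF S(1) K(1)]
        by (auto intro!: Alg_D(2,4)[OF S(1)])
      then have "S = S'" using Alg_eq_herm_cent[of S B'] Alg_eq_herm_cent[of S' B'] S B' by simp
      then show ?thesis by blast
    qed
    show ?thesis
    proof (cases "h v v = 0")
      case False
      define r where "r = - bar x / h v v"
      have wr: "w = r *s v" using Dvv False by (simp add: r_def vec_eq_iff field_simps)
      have yK: "y \<in> K"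
      proof (rule ccontr)
        assume "y \<notin> K"
        then have y: "bar y - y \<noteq> 0" by (simp add: K_iff)
        have "\<exists>t. B *v u = ((x - bar x) / (bar y - y)) *s u + t *s v" for u
        proof -
          have "(bar y - y) *s (B *v u) = (x - bar x) *s u + (h u w - h u v * r) *s v"
            using CDv[of u] unfolding wr by (simp add: vec_eq_iff algebra_simps)
          then have "B *v u = ((x - bar x) / (bar y - y)) *s u + ((h u w - h u v * r) / (bar y - y)) *s v"
            by (rule combination_divide[OF y])
          then show ?thesis by blast
        qed
        then show False using rank_one_shift_not_cyclic B(2) by blast
      qed
      obtain u where u: "u \<noteq> 0" "h u v = 0" using perp_pair[of v v] by blast
      have "(bar x - x) *s u = 0" using CDv[of u] u wr yK by (simp add: K_iff)
      then have "x \<in> K" using u by (simp add: K_iff)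
      then show ?thesis using yK same_if_K by blast
    next
      case True
      have x: "x = 0" using Dvv True v(1) by simp
      then have hw: "h v w = 0" using Cvv v(1) by simp
      show ?thesis
      proof (cases "y \<in> K")
        case True
        then show ?thesis using same_if_K x by simp
      next
        case False
        then have y: "bar y - y \<noteq> 0" by (simp add: K_iff)
        have Bu: "\<exists>t. B *v u = t *s v" if "h u v = 0" for u
        proof -
          have "(bar y - y) *s (B *v u) = h u w *s v" using CDv[of u] x that by simp
          then have "B *v u = (h u w / (bar y - y)) *s v" using y by (simp add: vec_eq_iff field_simps)
          then show ?thesis by blast
        qed
        then have BM: "B \<in> Nil v" using B by (simp add: Nil_def)
        have "\<exists>t. B' *v u = t *s v" if "h u v = 0" for u
        proof -
          obtain t where "B *v u = t *s v" using Bu \<open>h u v = 0\<close> by blast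
          moreover obtain t' where "B' *v u = x *s u + y *s (B *v u) + t' *s v" using xy by blast
          ultimately have "B' *v u = (y * t + t') *s v" using x by (simp add: vec_eq_iff algebra_simps)
          then show ?thesis by blast
        qed
        then have "B' \<in> Nil v" using B' by (simp add: Nil_def)
        then show ?thesis using herm_cent_subset_Unip B B' BM Alg_eq_herm_cent S True v(1) by metis
      qed
    qed
  qed
qed

section \<open>Existence of distinguished elements\<close>

lemma two_eq_0_iff: "(2::'a) = 0" if "q = 2"
proof -
  have "CHAR('a) dvd q ^ 2" using CHAR_dvd_CARD[where 'a='a] card_field by simp
  then have "CHAR('a) dvd 2" using prime_char that by (metis prime_dvd_power)
  then have "of_nat 2 = (0::'a)" using of_nat_eq_0_iff_char_dvd by blast
  then show ?thesis by simp
qed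

lemma card_trace_norm_le:
  assumes "(2::'a) \<noteq> 0"
  shows "card {a::'a. 2 * (a * bar a) + z * (a + bar a) + c = 0} \<le> q + 1"
proof (rule card_roots_le[of "monom 2 (q + 1) + (monom z q + [:c, z:])"])
  have d: "degree (monom z q + [:c, z:]) < q + 1"
  proof -
    have "degree (monom z q + [:c, z:]) \<le> max q 1"
      by (rule degree_add_le_max[THEN order_trans]) (auto simp: degree_monom_le intro: le_trans[OF degree_monom_le])
    then show ?thesis using q_gt_1 by simp
  qed
  have "degree (monom 2 (q + 1) + (monom z q + [:c, z:])) = q + 1"
    using d assms by (subst degree_add_eq_left) (auto simp: degree_monom_eq)
  then show "monom 2 (q + 1) + (monom z q + [:c, z:]) \<noteq> 0"
    "degree (monom 2 (q + 1) + (monom z q + [:c, z:])) \<le> q + 1" by auto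
qed (auto simp: poly_monom bar_def algebra_simps)

lemma card_cubic_roots_le: "card {a::'a. a * a * a + m1 * a + m0 = 0} \<le> 3"
  by (rule card_roots_le[of "[:m0, m1, 0, 1:]"]) (auto simp: algebra_simps)

lemma card_norm_le: "card {a::'a. 3 * (a * bar a) + m1 = 0} \<le> q + 1"
proof -
  have "{a::'a. 3 * (a * bar a) + m1 = 0} = {a. a * bar a = - m1 / 3}"
    using three_neq_0 by (auto simp: field_simps eq_neg_iff_add_eq_0)
  then show ?thesis using card_norm_fibre_le by simp
qed

text \<open>The parameter of the Cayley transform has to avoid the eigenvalues of the cubic, one norm
  condition and one condition for each root of the cubic in the fixed field. Three roots in the
  fixed field exclude each other: every such condition then has the two other roots among its
  solutions. This economy matters only for \<open>q = 5\<close>.\<close>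

lemma exists_cayley_parameter:
  assumes q: "q \<ge> 5" and m: "m1 \<in> K" "m0 \<in> K"
  obtains a where "a \<notin> K" "a * a * a + m1 * a + m0 \<noteq> 0" "3 * (a * bar a) + m1 \<noteq> 0"
    "\<And>z. z \<in> K \<Longrightarrow> z * z * z + m1 * z + m0 = 0 \<Longrightarrow> (2::'a) \<noteq> 0 \<Longrightarrow>
       2 * (a * bar a) + z * (a + bar a) + 2 * (m1 + z * z) \<noteq> 0"
proof -
  define R where "R = {a. a * a * a + m1 * a + m0 = 0}"
  define W where "W = {a. 3 * (a * bar a) + m1 = 0}"
  define N where "N z = {a. 2 * (a * bar a) + z * (a + bar a) + 2 * (m1 + z * z) = 0}" for z
  have cR: "card R \<le> 3" unfolding R_def by (rule card_cubic_roots_le)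
  have cW: "card W \<le> q + 1" unfolding W_def by (rule card_norm_le)
  have cN: "card (N z) \<le> q + 1" if "(2::'a) \<noteq> 0" for z unfolding N_def by (rule card_trace_norm_le[OF that])
  have qq: "5 * q \<le> q ^ 2" using q by (simp add: power2_eq_square)
  \<comment> \<open>\<open>B\<close> collects the forbidden parameters.\<close>
  have ex: "\<exists>B. card B < q ^ 2 \<and> K \<subseteq> B \<and> R \<subseteq> B \<and> W \<subseteq> B \<and> ((2::'a) \<noteq> 0 \<longrightarrow> (\<forall>z \<in> K \<inter> R. N z \<subseteq> B))"
  proof (cases "(2::'a) = 0")
    case True
    have "card (K \<union> (R \<union> W)) \<le> q + (3 + (q + 1))"
      using card_Un_le[of K "R \<union> W"] card_Un_le[of R W] cR cW card_K by linarith
    then show ?thesis using qq q True by (intro exI[of _ "K \<union> (R \<union> W)"]) auto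
  next
    case False
    show ?thesis
    proof (cases "\<exists>z1 z2. z1 \<in> K \<inter> R \<and> z2 \<in> K \<inter> R \<and> z1 \<noteq> z2")
      case True
      then obtain z1 z2 where z: "z1 \<in> K" "z1 \<in> R" "z2 \<in> K" "z2 \<in> R" "z1 \<noteq> z2" by blast
      have "(z1 - z2) * (z1 * z1 + z1 * z2 + z2 * z2 + m1)
        = (z1 * z1 * z1 + m1 * z1 + m0) - (z2 * z2 * z2 + m1 * z2 + m0)" by (simp add: algebra_simps)
      also have "\<dots> = 0" using z(2,4) unfolding R_def by simp
      finally have "(z1 - z2) * (z1 * z1 + z1 * z2 + z2 * z2 + m1) = 0" .
      then have s: "z1 * z1 + z1 * z2 + z2 * z2 + m1 = 0" using z(5) by simp
      then have m1: "m1 = - (z1 * z1 + z1 * z2 + z2 * z2)" by (simp only: add_eq_0_iff)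
      have m0: "m0 = - (z1 * z1 * z1 + m1 * z1)" using z(2) unfolding R_def mem_Collect_eq by (simp only: add_eq_0_iff)
      define z3 where "z3 = - z1 - z2"
      have fac: "x * x * x + m1 * x + m0 = (x - z1) * (x - z2) * (x - z3)" for x
        unfolding m0 m1 z3_def by (simp add: algebra_simps)
      have R: "R = {z1, z2, z3}" unfolding R_def fac by auto
      have z3K: "z3 \<in> K" using z by (auto simp: z3_def)
      have bK: "bar z1 = z1" "bar z2 = z2" "bar z3 = z3" using z z3K by (simp_all add: K_iff)
      show ?thesis
      proof (cases "z3 = z1 \<or> z3 = z2")
        case True
        have "card (K \<union> (W \<union> (N z1 \<union> N z2))) \<le> q + ((q + 1) + ((q + 1) + (q + 1)))"
          using card_Un_le[of K "W \<union> (N z1 \<union> N z2)"] card_Un_le[of W "N z1 \<union> N z2"] 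
            card_Un_le[of "N z1" "N z2"] cN[OF False, of z1] cN[OF False, of z2] cW card_K by linarith
        then show ?thesis using qq q True z z3K R
          by (intro exI[of _ "K \<union> (W \<union> (N z1 \<union> N z2))"]) auto
      next
        case d: False
        have two: "card (N x - K) \<le> q - 1" if "y \<in> N x" "w \<in> N x" "y \<in> K" "w \<in> K" "y \<noteq> w" for x y w
        proof -
          have "card (N x - K) \<le> card (N x - {y, w})" using that by (intro card_mono) auto
          also have "\<dots> = card (N x) - 2" using that by (subst card_Diff_subset) auto
          finally show ?thesis using cN[OF False, of x] by linarith
        qed
        \<comment> \<open>Each condition has the two other roots among its solutions, and these are counted in \<open>K\<close> already.\<close>
        have inN: "z2 \<in> N z1" "z3 \<in> N z1" "z1 \<in> N z2" "z3 \<in> N z2" "z1 \<in> N z3" "z2 \<in> N z3"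
          unfolding N_def m1 z3_def using bK(1,2) by (simp_all add: algebra_simps)
        have c: "card (N z1 - K) \<le> q - 1" "card (N z2 - K) \<le> q - 1" "card (N z3 - K) \<le> q - 1"
          using two inN z z3K d by metis+
        let ?B = "K \<union> (W \<union> ((N z1 - K) \<union> ((N z2 - K) \<union> (N z3 - K))))"
        have "card ?B \<le> q + ((q + 1) + ((q - 1) + ((q - 1) + (q - 1))))"
          using card_Un_le[of K "W \<union> ((N z1 - K) \<union> ((N z2 - K) \<union> (N z3 - K)))"]
            card_Un_le[of W "(N z1 - K) \<union> ((N z2 - K) \<union> (N z3 - K))"]
            card_Un_le[of "N z1 - K" "(N z2 - K) \<union> (N z3 - K)"]
            card_Un_le[of "N z2 - K" "N z3 - K"] c cW card_K by linarith
        then show ?thesis using qq q z z3K R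
          by (intro exI[of _ ?B]) auto
      qed
    next
      case u: False
      obtain M where M: "card M \<le> q + 1" "\<And>z. z \<in> K \<inter> R \<Longrightarrow> N z \<subseteq> M"
      proof (cases "K \<inter> R = {}")
        case True then show thesis using that[of "{}"] by simp
      next
        case F: False
        then obtain z0 where "z0 \<in> K \<inter> R" by blast
        then have "z = z0" if "z \<in> K \<inter> R" for z using u that by blast
        then show thesis using that[of "N z0"] cN[OF False] by blast
      qed
      have "card (K \<union> (R \<union> (W \<union> M))) \<le> q + (3 + ((q + 1) + (q + 1)))"
        using card_Un_le[of K "R \<union> (W \<union> M)"] card_Un_le[of R "W \<union> M"] card_Un_le[of W M] M(1) cR cW card_K by linarith
      then show ?thesis using qq q M(2) by (intro exI[of _ "K \<union> (R \<union> (W \<union> M))"]) auto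
    qed
  qed
  then obtain B where B: "card B < q ^ 2" "K \<subseteq> B" "R \<subseteq> B" "W \<subseteq> B" "(2::'a) \<noteq> 0 \<Longrightarrow> z \<in> K \<inter> R \<Longrightarrow> N z \<subseteq> B" for z
    by blast
  have "B \<noteq> UNIV" using B(1) card_field by auto
  then obtain a where a: "a \<notin> B" by blast
  show thesis
  proof (rule that[of a])
    show "a \<notin> K" "a * a * a + m1 * a + m0 \<noteq> 0" "3 * (a * bar a) + m1 \<noteq> 0"
      using a B by (auto simp: R_def W_def)
    fix z assume "z \<in> K" "z * z * z + m1 * z + m0 = 0" "(2::'a) \<noteq> 0"
    then have "N z \<subseteq> B" using B(5)[of z] by (simp add: R_def)
    then show "2 * (a * bar a) + z * (a + bar a) + 2 * (m1 + z * z) \<noteq> 0" using a by (auto simp: N_def)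
  qed
qed

text \<open>Since the characteristic is not three, subtracting a scalar from a cyclic generator removes the
  quadratic term of its cubic relation. This shortens the conditions on the parameter.\<close>

lemma exists_traceless_generator:
  assumes S: "S \<in> Alg" and q: "q > 2 \<or> has_isotropic S"
  obtains A m1 m0 where "A \<in> S" "cyclic A" "m1 \<in> K" "m0 \<in> K"
    "\<And>u. A *v (A *v (A *v u)) = - (m1 *s (A *v u)) - m0 *s u"
proof -
  obtain B where B: "B \<in> S" "cyclic B" using Alg_exists_cyclic[OF S q] by blast
  have BH: "B \<in> Herm" using Alg_D(1)[OF S B(1)] .
  obtain x y z where p: "B ** (B ** B) = pol x y z B" using cyclic_minimal_polynomial[OF B(2)] by blast
  have "B ** (B ** B) \<in> Herm" using BH by (simp add: Herm_comm_mult matrix_mul_assoc)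
  then have K: "x \<in> K" "y \<in> K" "z \<in> K" using Herm_pol_coeffs[OF BH B(2), of x y z] p by simp_all
  define s where "s = z / 3"
  have z: "z = 3 * s" using three_neq_0 by (simp add: s_def)
  have sK: "s \<in> K" using K by (auto simp: s_def)
  define A where "A = B - mat s"
  have Av: "A *v u = B *v u - s *s u" for u by (simp add: A_def mv_simps)
  have pv: "B *v (B *v (B *v u)) = x *s u + y *s (B *v u) + z *s (B *v (B *v u))" for u
    using arg_cong[OF p, of "\<lambda>M. M *v u"] by simp
  let ?m1 = "- (y + 2 * z * s - 3 * s * s)" and ?m0 = "- (x + y * s + z * s * s - s * s * s)"
  show thesis
  proof (rule that[of A ?m1 ?m0])
    show "A \<in> S" unfolding A_def using Alg_D(6)[OF S B(1) Alg_D(5)[OF S sK]] .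
    show "cyclic A" unfolding A_def by (rule cyclic_shift[OF B(2)])
    show "?m1 \<in> K" "?m0 \<in> K" using K sK by (intro K_closed; simp)+
    fix u
    show "A *v (A *v (A *v u)) = - (?m1 *s (A *v u)) - ?m0 *s u"
      by (simp add: Av mv_simps pv z) (simp add: vec_eq_iff algebra_simps)
  qed
qed

text \<open>An eigenvector whose eigenvalue is not in \<open>K\<close> is isotropic, and it is perpendicular to the
  isotropic vector \<open>v\<close>, which has an eigenvalue in \<open>K\<close>. So it lies in the line of \<open>v\<close>, a
  contradiction. Hence with an isotropic point every \<open>a \<notin> K\<close> may serve as the parameter of a Cayley
  transform, and this is what makes \<open>q = 2\<close> possible.\<close>

lemma iso_no_eigenvalue:
  assumes S: "S \<in> Alg" "has_isotropic S" and A: "A \<in> S" and a: "a \<notin> K" and w: "A *v w = bar a *s w"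
  shows "w = 0"
proof -
  obtain v where v: "v \<noteq> 0" "h v v = 0" "out v \<in> S" using S(2) unfolding has_isotropic_def by blast
  have AH: "A \<in> Herm" using Alg_D(1)[OF S(1) A] .
  obtain l where l: "l \<in> K" "A *v v = l *s v" using commute_out_iff[OF AH v(1)] Alg_D(7)[OF S(1) A v(3)] by blast
  have ba: "bar a \<noteq> a" using a by (simp add: K_iff)
  have "bar a * h w w = a * h w w" using HermD[OF AH, of w w] w by simp
  then have ww: "h w w = 0" using ba by simp
  have al: "bar a \<noteq> l" using a l(1) by (metis K_iff bar_bar)
  have "h w v = 0" using HermD[OF AH, of w v] w l a by auto
  then have "h v w = 0" using h_eq_0_comm by blast
  then obtain c where c: "w = c *s v" using no_isotropic_plane[OF v(2) ww _ v(1)] by blast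
  then have "(c * l) *s v = (bar a * c) *s v" using w l(2) by simp
  then have "c * (bar a - l) = 0" using v(1) by (auto simp: algebra_simps)
  then show ?thesis using c al by auto
qed

text \<open>The Cayley transform \<open>g\<close> of a traceless generator \<open>A\<close> works for a suitable parameter \<open>a\<close>. Its cube
  is scalar only if \<open>3 a bar a = - m1\<close>, and never if \<open>S\<close> has an isotropic point. In odd
  characteristic its square is scalar modulo a point of \<open>S\<close> with eigenvalue \<open>z\<close> under \<open>A\<close> only if
  \<open>2 a bar a + z (a + bar a) + 2 (m1 + z\<^sup>2) = 0\<close>.\<close>

lemma exists_distinguished:
  assumes S: "S \<in> Alg" and q: "q > 2 \<or> has_isotropic S"
  obtains g where "distinguished S g"
proof -
  obtain A m1 m0 where A: "A \<in> S" "cyclic A" "m1 \<in> K" "m0 \<in> K"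
    and A3: "\<And>u. A *v (A *v (A *v u)) = - (m1 *s (A *v u)) - m0 *s u"
    using exists_traceless_generator[OF S q] by blast
  have AH: "A \<in> Herm" using Alg_D(1)[OF S A(1)] .
  obtain a where a: "a \<notin> K" "has_isotropic S \<or> (a * a * a + m1 * a + m0 \<noteq> 0 \<and> 3 * (a * bar a) + m1 \<noteq> 0)"
    "\<And>z. z \<in> K \<Longrightarrow> z * z * z + m1 * z + m0 = 0 \<Longrightarrow> (2::'a) \<noteq> 0 \<Longrightarrow>
       2 * (a * bar a) + z * (a + bar a) + 2 * (m1 + z * z) \<noteq> 0"
  proof (cases "q = 2")
    case True
    obtain a where "a \<notin> K" using not_K by blast
    then show thesis using that[of a] two_eq_0_iff[OF True] q True by simp
  next
    case False
    then show thesis using exists_cayley_parameter[OF q_ge_5[OF False] A(3,4)] that by metis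
  qed
  have ker: "w = 0" if w: "A *v w = bar a *s w" for w
  proof (cases "has_isotropic S")
    case True then show ?thesis using iso_no_eigenvalue[OF S _ A(1) a(1) w] by blast
  next
    case False
    then have "bar (a * a * a + m1 * a + m0) \<noteq> 0" using a(2) by (simp del: bar_add bar_mult)
    then have n: "bar a * bar a * bar a + m1 * bar a + m0 \<noteq> 0" using A(3,4) by (simp add: K_iff)
    have "(bar a * bar a * bar a + m1 * bar a + m0) *s w = 0"
    proof -
      have "(bar a * bar a * bar a + m1 * bar a + m0) *s w = A *v (A *v (A *v w)) + m1 *s (A *v w) + m0 *s w"
        by (simp add: w) (simp add: vec_eq_iff algebra_simps)
      then show ?thesis unfolding A3 by simp
    qed
    then show ?thesis using n by simp
  qed
  obtain g where g: "g \<in> U" "cyclic g" "g ** (A - mat (bar a)) = A - mat a" "g ** A = A ** g"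
    using cayley[OF AH A(2) a(1) ker] by metis
  have gS: "g \<in> Ucent S" unfolding Ucent_def
  proof (intro CollectI conjI ballI g(1))
    fix X assume "X \<in> S"
    then have "A ** X = X ** A" using Alg_D(7)[OF S A(1)] by blast
    then show "g ** X = X ** g" using cyclic_commuting_commute[OF A(2) g(4)[symmetric]] by blast
  qed
  have gB: "g *v (A *v u - bar a *s u) = A *v u - a *s u" for u
    using arg_cong[OF g(3), of "\<lambda>M. M *v u"] by (simp add: mv_simps)
  have gA: "g *v (A *v u) = A *v (g *v u)" for u using arg_cong[OF g(4), of "\<lambda>M. M *v u"] by simp
  have gB': "A *v (g *v u) = bar a *s (g *v u) + A *v u - a *s u" for u
    using gB[of u] unfolding gA[symmetric] by (simp add: mv_simps diff_eq_eq algebra_simps)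
  define Bop where "Bop u = A *v u - bar a *s u" for u
  define Cop where "Cop u = A *v u - a *s u" for u
  have gBC: "g *v Bop u = Cop u" for u using gB by (simp add: Bop_def Cop_def)
  have gC: "g *v Cop u = Cop (g *v u)" for u by (simp add: Cop_def mv_simps gA)
  have nt: "rigid g"
  proof (cases "has_isotropic S")
    case True
    then obtain v where v: "v \<noteq> 0" "h v v = 0" "out v \<in> S" unfolding has_isotropic_def by blast
    then show ?thesis using rigidI[OF g(1,2)] isotropic_cube_not_scalar[OF g(1,2) v(1,2)] gS by (auto simp: Ucent_def)
  next
    case False
    show ?thesis
    proof (rule rigidI[OF g(1,2)])
      fix d show "g ** (g ** g) \<noteq> mat d"
      proof
        assume "g ** (g ** g) = mat d"
        from arg_cong[OF this, of "\<lambda>M. M *v u" for u] have ggg: "g *v (g *v (g *v u)) = d *s u" for u by simp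
        \<comment> \<open>\<open>d (A - bar a)\<^sup>3 = (A - a)\<^sup>3\<close>; the coefficients of \<open>A\<^sup>2\<close> and \<open>A\<close> are compared.\<close>
        have e: "d *s Bop (Bop (Bop u)) = Cop (Cop (Cop u))" for u
          unfolding ggg[symmetric] by (simp add: gBC gC)
        have "pol (- (d * (m0 + bar a * bar a * bar a))) (d * (3 * bar a * bar a - m1)) (- (3 * d * bar a)) A *v u
            = pol (- (m0 + a * a * a)) (3 * a * a - m1) (- (3 * a)) A *v u" for u
          using e[of u] unfolding Bop_def Cop_def
          by (simp add: mv_simps A3) (simp add: vec_eq_iff algebra_simps)
        then have "pol (- (d * (m0 + bar a * bar a * bar a))) (d * (3 * bar a * bar a - m1)) (- (3 * d * bar a)) A
            = pol (- (m0 + a * a * a)) (3 * a * a - m1) (- (3 * a)) A" unfolding matrix_eq by blast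
        from cyclic_pol_inj[OF A(2) this] have "3 * d * bar a = 3 * a" 
          and d2: "d * (3 * bar a * bar a - m1) = 3 * a * a - m1" by auto
        then have d1: "d * bar a = a" using three_neq_0 by (simp add: mult.assoc)
        have "a * (3 * bar a * bar a - m1) = (d * bar a) * (3 * bar a * bar a - m1)" unfolding d1 ..
        also have "\<dots> = bar a * (3 * a * a - m1)" unfolding d2[symmetric] by (simp add: ac_simps)
        finally have "(a - bar a) * (3 * (a * bar a) + m1) = 0" by (simp add: algebra_simps)
        moreover have "a - bar a \<noteq> 0" using a(1) by (simp add: K_iff)
        ultimately show False using a(2) False by simp
      qed
    qed
  qed
  have "rigid_mod v g" if v: "v \<noteq> 0" "out v \<in> S" for v
  proof -
    obtain l where l: "l \<in> K" "A *v v = l *s v" using commute_out_iff[OF AH v(1)] Alg_D(7)[OF S A(1) v(2)] by blast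
    have "(l * l * l + m1 * l + m0) *s v = 0"
    proof -
      have "(l * l * l + m1 * l + m0) *s v = A *v (A *v (A *v v)) + m1 *s (A *v v) + m0 *s v"
        by (simp add: l) (simp add: vec_eq_iff algebra_simps)
      then show ?thesis unfolding A3 by simp
    qed
    then have ml: "l * l * l + m1 * l + m0 = 0" using v(1) by simp
    have go: "g ** out v = out v ** g" using gS v(2) by (simp add: Ucent_def)
    obtain x where x: "h x v = 1" using h_dual[OF v(1)] by blast
    have gv: "g *v v = h (g *v x) v *s v" using arg_cong[OF go, of "\<lambda>M. M *v x"] x by simp
    have "(2::'a) = 0 \<or> \<not> scalar_mod v (g ** g)"
    proof (rule ccontr)
      assume "\<not> ((2::'a) = 0 \<or> \<not> scalar_mod v (g ** g))"
      then have two: "(2::'a) \<noteq> 0" and "scalar_mod v (g ** g)" by auto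
      then obtain n where n: "\<And>u. \<exists>t. g *v (g *v u) = n *s u + t *s v" unfolding scalar_mod_def by auto
      obtain u where u: "ind3 u (A *v u) v" using cyclic_eigenvector_basis[OF A(2) v(1) l(2)] by blast
      \<comment> \<open>The cubic of \<open>A\<close> divided by its linear factor at \<open>l\<close> maps into the kernel of \<open>A - l\<close>, the line of \<open>v\<close>.\<close>
      let ?p = "A *v (A *v u) + l *s (A *v u) + (m1 + l * l) *s u"
      have "(A - mat l) *v ?p = - ((l * l * l + m1 * l + m0) *s u)"
        by (simp add: mv_simps A3) (simp add: vec_eq_iff algebra_simps)
      then have "(A - mat l) *v ?p = 0" using ml by simp
      moreover have "(A - mat l) *v v = 0" using l by (simp add: mv_simps)
      ultimately obtain t where t: "?p = t *s v" using cyclic_kernel_line[OF cyclic_shift[OF A(2)]] v(1) by metis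
      have AA: "A *v (A *v u) = t *s v - l *s (A *v u) - (m1 + l * l) *s u" unfolding t[symmetric] by simp
      obtain t' where "g *v (g *v Bop (Bop u)) = n *s Bop (Bop u) + t' *s v" using n by blast
      then have "Cop (Cop u) = n *s Bop (Bop u) + t' *s v" by (simp add: gBC gC)
      then have "(a * a - (m1 + l * l)) *s u + (- l - 2 * a) *s (A *v u) + t *s v
          = (n * (bar a * bar a - (m1 + l * l))) *s u + (n * (- l - 2 * bar a)) *s (A *v u) + (n * t + t') *s v"
        unfolding Bop_def Cop_def by (simp add: mv_simps AA) (simp add: vec_eq_iff algebra_simps)
      from ind3_eqD[OF u this] have e: "a * a - (m1 + l * l) = n * (bar a * bar a - (m1 + l * l))"
        "- l - 2 * a = n * (- l - 2 * bar a)" by auto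
      have "(- l - 2 * a) * (bar a * bar a - (m1 + l * l)) = (- l - 2 * bar a) * (a * a - (m1 + l * l))"
        unfolding e by (simp add: ac_simps)
      then have "(a - bar a) * (2 * (a * bar a) + l * (a + bar a) + 2 * (m1 + l * l)) = 0" by (simp add: algebra_simps)
      moreover have "a - bar a \<noteq> 0" using a(1) by (simp add: K_iff)
      ultimately show False using a(3)[OF l(1) ml two] by simp
    qed
    then show ?thesis using rigid_modI[OF g(1,2) v(1) gv] by blast
  qed
  then have "distinguished S g" unfolding distinguished_def using gS g(2) nt by blast
  then show thesis by (rule that)
qed

section \<open>Isotropic points and the Sylow subgroups attached to them\<close>

definition Isotropic :: "('a ^ 3) set" where "Isotropic = {v. v \<noteq> 0 \<and> h v v = 0}"

lemma Isotropic_exists: "Isotropic \<noteq> {}"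
proof -
  obtain v :: "'a ^ 3" where v: "v \<noteq> 0" by (metis axis_eq_0_iff zero_neq_one)
  obtain w where w: "w \<noteq> 0" "h w v = 0" using perp_pair[of v v] by blast
  show ?thesis
  proof (cases "h v v = 0 \<or> h w w = 0")
    case True then show ?thesis using v w by (auto simp: Isotropic_def)
  next
    case False
    have vw: "h v w = 0" using w(2) h_eq_0_comm by blast
    obtain x where x: "x * bar x = - (h v v / h w w)" using norm_surj[of "- (h v v / h w w)"] by auto
    have "h (v + x *s w) (v + x *s w) = h v v + (x * bar x) * h w w"
      using w vw by (simp add: algebra_simps)
    also have "\<dots> = 0" unfolding x using False by simp
    finally have "h (v + x *s w) (v + x *s w) = 0" .
    moreover have "v + x *s w \<noteq> 0"
    proof
      assume "v + x *s w = 0"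
      then have "h (v + x *s w) v = 0" by simp
      then show False using w False by simp
    qed
    ultimately show ?thesis by (auto simp: Isotropic_def)
  qed
qed

text \<open>Fix an isotropic \<open>e\<close>. On each line in the direction of \<open>e\<close> through a vector \<open>u\<close> not perpendicular to
  \<open>e\<close>, the isotropic vectors are the solutions of a trace equation, so there are \<open>q\<close> of them. The
  isotropic vectors perpendicular to \<open>e\<close> are multiples of \<open>e\<close>.\<close>

lemma card_Isotropic: "card Isotropic = (q ^ 3 + 1) * (q ^ 2 - 1)"
proof -
  obtain e where e: "e \<noteq> 0" "h e e = 0" using Isotropic_exists by (auto simp: Isotropic_def)
  define P where "P = {u. h u e \<noteq> 0}"
  have "P = UNIV - {u. h u e = 0}" by (auto simp: P_def)
  then have cP: "card P = q ^ 6 - q ^ 4" using card_perp[OF e(1)] card_V by (simp add: card_Diff_subset card_field_3)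
  let ?X = "Sigma P (\<lambda>u. {t. h (u + t *s e) (u + t *s e) = 0})"
  have fib: "card {t. h (u + t *s e) (u + t *s e) = 0} = q" if u: "u \<in> P" for u
  proof -
    have "{t. h (u + t *s e) (u + t *s e) = 0} = {t. t * h e u + bar (t * h e u) = - h u u}"
      using e by (auto simp: algebra_simps eq_neg_iff_add_eq_0)
    moreover have "bij_betw (\<lambda>t. t * h e u) {t. t * h e u + bar (t * h e u) = - h u u} {t. t + bar t = - h u u}"
      by (rule bij_betw_byWitness[where f' = "\<lambda>t. t / h e u"]) (use u h_eq_0_comm in \<open>auto simp: P_def\<close>)
    ultimately show ?thesis using card_trace_fibre[of "- h u u"] bij_betw_same_card by fastforce
  qed
  have "bij_betw (\<lambda>(u, t). (u + t *s e, t)) ?X ((Isotropic \<inter> P) \<times> UNIV)"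
  proof (rule bij_betw_byWitness[where f' = "\<lambda>(w, t). (w - t *s e, t)"])
    have he: "h (u + t *s e) e = h u e" "h (u - t *s e) e = h u e" for u t using e by simp_all
    show "(\<lambda>(u, t). (u + t *s e, t)) ` ?X \<subseteq> (Isotropic \<inter> P) \<times> UNIV"
    proof
      fix p assume "p \<in> (\<lambda>(u, t). (u + t *s e, t)) ` ?X"
      then obtain x where x: "x \<in> ?X" "p = (case x of (u, t) \<Rightarrow> (u + t *s e, t))" by blast
      obtain u t where "x = (u, t)" by (cases x)
      then have u: "u \<in> P" and z: "h (u + t *s e) (u + t *s e) = 0" and p: "p = (u + t *s e, t)"
        using x by (simp_all del: h_add_left h_add_right)
      from u have "u + t *s e \<in> P" using he(1)[of u t] e(2) by (simp add: P_def)
      moreover have "0 \<notin> P" by (simp add: P_def)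
      ultimately have "u + t *s e \<in> P" "u + t *s e \<noteq> 0" by metis+
      then show "p \<in> (Isotropic \<inter> P) \<times> UNIV" using z unfolding p by (simp add: Isotropic_def)
    qed
    show "(\<lambda>(w, t). (w - t *s e, t)) ` ((Isotropic \<inter> P) \<times> UNIV) \<subseteq> ?X"
      using e(2) by (auto simp: Isotropic_def P_def algebra_simps)
  qed auto
  then have "card ?X = card ((Isotropic \<inter> P) \<times> (UNIV::'a set))" by (rule bij_betw_same_card)
  moreover have "card ?X = card P * q" using fib by (subst card_SigmaI) auto
  ultimately have "card (Isotropic \<inter> P) * q * q = (q ^ 6 - q ^ 4) * q"
    using cP by (simp add: card_cartesian_product card_field power2_eq_square mult.assoc)
  then have "card (Isotropic \<inter> P) * q = q ^ 6 - q ^ 4" using q_gt_1 by simp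
  also have "\<dots> = (q ^ 5 - q ^ 3) * q"
  proof -
    have "q ^ 6 = q ^ 5 * q" "q ^ 4 = q ^ 3 * q" by (simp_all add: eval_nat_numeral)
    then show ?thesis by (simp only: diff_mult_distrib)
  qed
  finally have c1: "card (Isotropic \<inter> P) = q ^ 5 - q ^ 3" using q_gt_1 by (metis less_numeral_extra(3) mult_right_cancel not_less_zero)
  have "Isotropic - P = (\<lambda>c. c *s e) ` (UNIV - {0})"
  proof (intro equalityI subsetI)
    fix w assume "w \<in> Isotropic - P"
    then have w: "w \<noteq> 0" "h w w = 0" "h w e = 0" by (auto simp: Isotropic_def P_def)
    then have "h e w = 0" using h_eq_0_comm by blast
    then obtain c where "w = c *s e" using no_isotropic_plane[OF e(2) w(2) _ e(1)] by blast
    then show "w \<in> (\<lambda>c. c *s e) ` (UNIV - {0})" using w by auto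
  qed (use e in \<open>auto simp: Isotropic_def P_def\<close>)
  moreover have "inj_on (\<lambda>c. c *s e) (UNIV - {0})" using e(1) by (auto intro!: inj_onI)
  ultimately have c2: "card (Isotropic - P) = q ^ 2 - 1" by (simp add: card_image card_Diff_singleton card_field)
  have "card Isotropic = card (Isotropic \<inter> P) + card (Isotropic - P)" by (rule card_Int_Diff[OF finite])
  also have "\<dots> = (q ^ 5 - q ^ 3) + (q ^ 2 - 1)" using c1 c2 by simp
  also have "\<dots> = (q ^ 3 + 1) * (q ^ 2 - 1)"
  proof -
    have "q ^ 3 \<le> q ^ 5" "1 \<le> q ^ 2" using q_gt_1 by (simp_all add: power_increasing)
    moreover have "q ^ 3 * q ^ 2 = q ^ 5" by (simp flip: power_add)
    ultimately show ?thesis by (simp only: diff_mult_distrib2 add_mult_distrib mult_1 mult_1_right)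
  qed
  finally show ?thesis .
qed

lemma out_Nil: "h v v = 0 \<Longrightarrow> out v \<in> Nil v" by (auto simp: Nil_def Herm_closed)

lemma Nil_subset_Unip: "Nil v \<subseteq> Unip v"
proof
  fix X assume "X \<in> Nil v"
  then have "mat 0 + X \<in> Unip v" unfolding Unip_def using K_closed(1) by blast
  then show "X \<in> Unip v" by simp
qed

text \<open>If \<open>out v\<close> and \<open>out w\<close> commute, then \<open>v\<close> and \<open>w\<close> are perpendicular or proportional, and
  isotropic vectors that are perpendicular are proportional.\<close>

lemma iso_commute:
  assumes "v \<in> Isotropic" "w \<in> Isotropic" "out v ** out w = out w ** out v"
  obtains c where "w = c *s v"
proof (cases "h v w = 0")
  case True then show thesis using no_isotropic_plane assms(1,2) that by (auto simp: Isotropic_def)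
next
  case False
  then have wv: "h w v \<noteq> 0" using h_eq_0_comm by blast
  obtain u where u: "h u v = 1" using h_dual assms(1) by (auto simp: Isotropic_def)
  have e: "(h u w * h w v) *s v = h v w *s w" using arg_cong[OF assms(3), of "\<lambda>M. M *v u"] u by (simp add: mult.commute)
  have "w = inverse (h v w) *s (h v w *s w)" using False by simp
  also have "\<dots> = (inverse (h v w) * (h u w * h w v)) *s v" unfolding e[symmetric] by simp
  finally show thesis by (rule that)
qed

lemma Unip_commute_out: "v \<noteq> 0 \<Longrightarrow> X \<in> Unip v \<Longrightarrow> X \<in> Herm \<and> X ** out v = out v ** X"
proof -
  assume v: "v \<noteq> 0" and "X \<in> Unip v"
  then obtain s Y where sY: "s \<in> K" "Y \<in> Nil v" "X = mat s + Y" by (auto simp: Unip_def)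
  then have X: "X \<in> Herm" by (auto simp: Nil_def Herm_closed)
  moreover have "X *v v = s *s v" using sY by (simp add: Nil_def mv_simps)
  ultimately show ?thesis using commute_out_iff[OF X v] sY(1) by blast
qed

lemma Unip_scale: assumes "c \<noteq> 0" shows "Unip (c *s v) = Unip v"
proof -
  have t: "(\<exists>t. X = t *s (c *s v)) \<longleftrightarrow> (\<exists>t. X = t *s v)" for X
  proof
    assume "\<exists>t. X = t *s v"
    then obtain t where "X = t *s v" by blast
    then have "X = (t / c) *s (c *s v)" using assms by simp
    then show "\<exists>t. X = t *s (c *s v)" by blast
  qed auto
  have "Nil (c *s v) = Nil v" using assms unfolding Nil_def t by (auto simp: mv_simps)
  then show ?thesis by (simp add: Unip_def)
qed

lemma Unip_eq_iff:
  assumes "v \<in> Isotropic" "w \<in> Isotropic"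
  shows "Unip v = Unip w \<longleftrightarrow> (\<exists>c. c \<noteq> 0 \<and> w = c *s v)"
proof
  assume "Unip v = Unip w"
  moreover have "out v \<in> Unip v" using assms out_Nil Nil_subset_Unip by (auto simp: Isotropic_def)
  ultimately have "out v ** out w = out w ** out v" using Unip_commute_out assms by (auto simp: Isotropic_def)
  then obtain c where "w = c *s v" using iso_commute assms by blast
  then show "\<exists>c. c \<noteq> 0 \<and> w = c *s v" using assms by (auto simp: Isotropic_def intro!: exI[of _ c])
next
  assume "\<exists>c. c \<noteq> 0 \<and> w = c *s v"
  then show "Unip v = Unip w" using Unip_scale by auto
qed

lemma card_Unip: "card (Unip ` Isotropic) = q ^ 3 + 1"
proof -
  have fib: "card {v \<in> Isotropic. Unip v = Q} = q ^ 2 - 1" if Q: "Q \<in> Unip ` Isotropic" for Q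
  proof -
    obtain v where v: "v \<in> Isotropic" "Q = Unip v" using Q by blast
    have "{w \<in> Isotropic. Unip w = Q} = (\<lambda>c. c *s v) ` (UNIV - {0})"
    proof (intro equalityI subsetI)
      fix w assume "w \<in> {w \<in> Isotropic. Unip w = Q}"
      then show "w \<in> (\<lambda>c. c *s v) ` (UNIV - {0})" using Unip_eq_iff[OF v(1), of w] v(2) by auto
    next
      fix w assume "w \<in> (\<lambda>c. c *s v) ` (UNIV - {0})"
      then obtain c where "c \<noteq> 0" "w = c *s v" by auto
      then show "w \<in> {w \<in> Isotropic. Unip w = Q}" using v Unip_scale by (auto simp: Isotropic_def)
    qed
    moreover have "inj_on (\<lambda>c. c *s v) (UNIV - {0})" using v(1) by (auto intro!: inj_onI simp: Isotropic_def)
    ultimately show ?thesis by (simp add: card_image card_Diff_singleton card_field)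
  qed
  have "card (\<Union>Q\<in>Unip ` Isotropic. {v \<in> Isotropic. Unip v = Q}) = (\<Sum>Q\<in>Unip ` Isotropic. card {v \<in> Isotropic. Unip v = Q})"
    by (rule card_UN_disjoint) auto
  moreover have "(\<Union>Q\<in>Unip ` Isotropic. {v \<in> Isotropic. Unip v = Q}) = Isotropic" by auto
  ultimately have e: "card (Unip ` Isotropic) * (q ^ 2 - 1) = (q ^ 3 + 1) * (q ^ 2 - 1)" using fib card_Isotropic by simp
  have "q ^ 2 - 1 \<noteq> 0" using one_less_power[OF q_gt_1, of 2] by simp
  then show ?thesis using e by (simp only: mult_cancel2) auto
qed

lemma iso_perp_basis:
  assumes v: "v \<in> Isotropic"
  obtains w d where "h w v = 0" "h v w = 0" "h w w \<noteq> 0" "h d v = 1" "h v d = 1" "h d w = 0" "h w d = 0" "ind3 v w d"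
proof -
  have v0: "v \<noteq> 0" "h v v = 0" using v by (auto simp: Isotropic_def)
  have "card ((\<lambda>c. c *s v) ` UNIV) \<le> CARD('a)" by (rule card_image_le) simp
  also have "\<dots> < card {u. h u v = 0}" unfolding card_perp[OF v0(1)] card_field using q_gt_1 by simp
  finally have "\<not> card {u. h u v = 0} \<le> card ((\<lambda>c. c *s v) ` UNIV)" by simp
  then have "\<not> {u. h u v = 0} \<subseteq> (\<lambda>c. c *s v) ` UNIV" using card_mono[of "(\<lambda>c. c *s v) ` UNIV"] by auto
  then obtain w where w: "h w v = 0" "\<And>c. w \<noteq> c *s v" by blast
  have vw: "h v w = 0" using w(1) h_eq_0_comm by blast
  have ww: "h w w \<noteq> 0"
  proof
    assume "h w w = 0"
    then obtain c where "w = c *s v" using no_isotropic_plane[OF v0(2) _ vw v0(1)] by blast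
    then show False using w(2) by blast
  qed
  obtain d0 where d0: "h d0 v = 1" using h_dual[OF v0(1)] by blast
  define d where "d = d0 - (h d0 w / h w w) *s w"
  have d: "h d v = 1" "h d w = 0" using d0 w ww by (simp_all add: d_def)
  have d': "h v d = 1" "h w d = 0" using d by (metis bar_1 bar_h, metis h_eq_0_comm)
  have "ind3 v w d" unfolding ind3_def
  proof (intro allI impI)
    fix x y z assume e: "x *s v + y *s w + z *s d = 0"
    have "z = 0" using arg_cong[OF e, of "\<lambda>u. h u v"] v0 w d by simp
    moreover have "x = 0" using arg_cong[OF e, of "\<lambda>u. h u d"] d' \<open>z = 0\<close> by simp
    moreover have "y = 0" using arg_cong[OF e, of "\<lambda>u. h u w"] vw d ww by simp
    ultimately show "x = 0 \<and> y = 0 \<and> z = 0" by simp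
  qed
  then show thesis using that w(1) vw ww d d' by blast
qed

lemma card_Nil:
  assumes v: "v \<in> Isotropic"
  shows "card (Nil v) = q ^ 3"
proof -
  have v0: "v \<noteq> 0" "h v v = 0" using v by (auto simp: Isotropic_def)
  obtain w d where b: "h w v = 0" "h v w = 0" "h w w \<noteq> 0" "h d v = 1" "h v d = 1" "h d w = 0" "h w d = 0" "ind3 v w d"
    using iso_perp_basis[OF v] by blast
  define Z where "Z = {A \<in> Herm. A *v v = 0}"
  have "card Z = card ((\<lambda>A. h (A *v w) w) ` Z) * card {A \<in> Z. h (A *v w) w = 0}"
    by (rule card_additive) (auto simp: Z_def Herm_closed mv_simps)
  moreover have "(\<lambda>A. h (A *v w) w) ` Z = K"
  proof (intro equalityI subsetI)
    fix x assume "x \<in> (\<lambda>A. h (A *v w) w) ` Z"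
    then obtain A where "A \<in> Herm" "x = h (A *v w) w" by (auto simp: Z_def)
    then show "x \<in> K" using HermD[of A w w] by (simp add: K_iff)
  next
    fix x assume x: "x \<in> K"
    let ?A = "mat (x / (h w w * h w w)) ** out w"
    have "?A \<in> Z" using x b h_self_K[of w] by (auto simp: Z_def intro!: Herm_closed K_closed)
    moreover have "x = h (?A *v w) w" using b by simp
    ultimately show "x \<in> (\<lambda>A. h (A *v w) w) ` Z" by (rule rev_image_eqI)
  qed
  moreover have "{A \<in> Z. h (A *v w) w = 0} = Nil v"
  proof (intro equalityI subsetI)
    fix A assume "A \<in> {A \<in> Z. h (A *v w) w = 0}"
    then have A: "A \<in> Herm" "A *v v = 0" "h (A *v w) w = 0" by (auto simp: Z_def)
    obtain x y z where xyz: "A *v w = x *s v + y *s w + z *s d" using ind3_span[OF b(8)] by blast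
    have "h (A *v w) v = 0" using HermD[OF A(1), of w v] A(2) by simp
    then have "z = 0" unfolding xyz using v0 b by simp
    moreover have "y = 0" using A(3) unfolding xyz using v0 b by simp
    ultimately have Aw: "A *v w = x *s v" using xyz by simp
    have "\<exists>t. A *v u = t *s v" if u: "h u v = 0" for u
    proof -
      obtain x' y' z' where u': "u = x' *s v + y' *s w + z' *s d" using ind3_span[OF b(8)] by blast
      then have "z' = 0" using u v0 b by simp
      then have "A *v u = (y' * x) *s v" unfolding u' by (simp add: mv_simps A Aw)
      then show ?thesis by blast
    qed
    then show "A \<in> Nil v" using A by (simp add: Nil_def)
  next
    fix A assume A: "A \<in> Nil v"
    then obtain t where "A *v w = t *s v" using b(1) by (auto simp: Nil_def)
    then show "A \<in> {A \<in> Z. h (A *v w) w = 0}" using A b by (simp add: Nil_def Z_def)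
  qed
  ultimately have "q ^ 4 = q * card (Nil v)" using card_Herm_annihilating[OF v0(1)] card_K by (simp add: Z_def)
  then have "q * card (Nil v) = q * q ^ 3" by (auto simp: eval_nat_numeral)
  then show ?thesis using q_gt_1 by simp
qed

text \<open>Otherwise \<open>A\<close> would be of the form \<open>out w\<close> with \<open>w\<close> perpendicular to \<open>v\<close> and not proportional to it;
  such a \<open>w\<close> is not isotropic, so \<open>out w\<close> does not map it into the line of \<open>v\<close>.\<close>

lemma Nil_cyclic:
  assumes v: "v \<in> Isotropic" and A: "A \<in> Nil v" "A \<notin> span_out v"
  shows "cyclic A"
proof (rule ccontr)
  assume "\<not> cyclic A"
  moreover have v0: "v \<noteq> 0" "h v v = 0" using v by (auto simp: Isotropic_def)
  moreover have "A \<in> Herm" "A *v v = 0" using A(1) by (auto simp: Nil_def)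
  ultimately obtain w where w: "A = out w" "w \<noteq> 0" "h v w = 0" "\<And>c. w \<noteq> c *s v"
    using not_cyclic_annihilating[of A v] A(2) by blast
  have "h w w \<noteq> 0"
  proof
    assume "h w w = 0"
    then obtain c where "w = c *s v" using no_isotropic_plane[OF v0(2) _ w(3) v0(1)] by blast
    then show False using w(4) by blast
  qed
  moreover have "h w v = 0" using w(3) h_eq_0_comm by blast
  then obtain t where "h w w *s w = t *s v" using A w(1) by (auto simp: Nil_def)
  then have "inverse (h w w) *s (h w w *s w) = (inverse (h w w) * t) *s v" by simp
  ultimately show False using w(4) by simp
qed

text \<open>The unipotent algebras at \<open>v\<close>. For class at least two they cannot be told apart, since all
  isometries commuting with one of them lie in a common group of class two modulo scalars.\<close>

definition UnipAlg :: "'a ^ 3 \<Rightarrow> ('a ^ 3 ^ 3) set set" where "UnipAlg v = {S \<in> Alg. S \<subseteq> Unip v}"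

lemma span_out_Nil: "v \<in> Isotropic \<Longrightarrow> span_out v \<inter> Nil v = (\<lambda>y. mat y ** out v) ` K"
proof (intro equalityI subsetI)
  fix X assume v: "v \<in> Isotropic" and X: "X \<in> span_out v \<inter> Nil v"
  then obtain x y where xy: "x \<in> K" "y \<in> K" "X = mat x + mat y ** out v" by (auto simp: span_out_def)
  have "X *v v = x *s v" using v xy by (simp add: mv_simps Isotropic_def)
  then have "x = 0" using v X by (simp add: Nil_def Isotropic_def)
  then show "X \<in> (\<lambda>y. mat y ** out v) ` K" using xy by simp
next
  fix X assume v: "v \<in> Isotropic" and "X \<in> (\<lambda>y. mat y ** out v) ` K"
  then obtain y where y: "y \<in> K" "X = mat y ** out v" by blast
  then show "X \<in> span_out v \<inter> Nil v" using v span_out_I[of 0 y v] by (auto simp: Nil_def Isotropic_def intro!: Herm_closed)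
qed

lemma UnipAlg_Nil:
  assumes v: "v \<in> Isotropic" and S: "S \<in> UnipAlg v"
  shows "card (S \<inter> Nil v) = q ^ 2" "out v \<in> S"
proof -
  have v0: "v \<noteq> 0" "h v v = 0" using v by (auto simp: Isotropic_def)
  have Alg: "S \<in> Alg" and SQ: "S \<subseteq> Unip v" using S by (auto simp: UnipAlg_def)
  have "bij_betw (\<lambda>(s, X). mat s + X) (K \<times> (S \<inter> Nil v)) S"
  proof (rule bij_betw_imageI)
    show "inj_on (\<lambda>(s, X). mat s + X) (K \<times> (S \<inter> Nil v))"
    proof (rule inj_onI, clarify)
      fix s X s' X' assume "X \<in> S" "X \<in> Nil v" "X' \<in> S" "X' \<in> Nil v" and e: "mat s + X = mat s' + X'"
      moreover have "s *s v = s' *s v" using arg_cong[OF e, of "\<lambda>M. M *v v"] \<open>X \<in> Nil v\<close> \<open>X' \<in> Nil v\<close> by (simp add: Nil_def mv_simps)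
      ultimately show "s = s' \<and> X = X'" using v0 by simp
    qed
    show "(\<lambda>(s, X). mat s + X) ` (K \<times> (S \<inter> Nil v)) = S"
    proof (intro equalityI subsetI)
      fix X assume "X \<in> (\<lambda>(s, X). mat s + X) ` (K \<times> (S \<inter> Nil v))"
      then obtain s Y where "s \<in> K" "Y \<in> S" "X = mat s + Y" by auto
      then show "X \<in> S" using Alg_shift_iff[OF Alg] by simp
    next
      fix X assume X: "X \<in> S"
      then obtain s Y where "s \<in> K" "Y \<in> Nil v" "X = mat s + Y" using SQ by (auto simp: Unip_def)
      moreover from this have "Y \<in> S" using X Alg_shift_iff[OF Alg] by simp
      ultimately show "X \<in> (\<lambda>(s, X). mat s + X) ` (K \<times> (S \<inter> Nil v))" by force
    qed
  qed
  then have "card (K \<times> (S \<inter> Nil v)) = card S" by (rule bij_betw_same_card)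
  then have "q * card (S \<inter> Nil v) = q * q ^ 2" using card_K Alg_D(8)[OF Alg] by (simp add: card_cartesian_product eval_nat_numeral)
  then show c: "card (S \<inter> Nil v) = q ^ 2" using q_gt_1 by simp
  have "\<not> S \<inter> Nil v \<subseteq> span_out v"
  proof
    assume "S \<inter> Nil v \<subseteq> span_out v"
    then have "S \<inter> Nil v \<subseteq> (\<lambda>y. mat y ** out v) ` K" using span_out_Nil[OF v] by blast
    then have "card (S \<inter> Nil v) \<le> card K" by (meson card_image_le card_mono finite le_trans)
    then show False using c card_K q_gt_1 by (simp add: power2_eq_square)
  qed
  then obtain A where A: "A \<in> S" "A \<in> Nil v" "A \<notin> span_out v" by blast
  have "S = herm_cent A" using Alg_eq_herm_cent[OF Alg A(1) Nil_cyclic[OF v A(2,3)]] .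
  moreover have "out v \<in> herm_cent A" using Unip_commute_out[OF v0(1), of A] A(2) Nil_subset_Unip
    by (auto simp: herm_cent_def Herm_closed)
  ultimately show "out v \<in> S" by simp
qed

lemma UnipAlg_iso: "v \<in> Isotropic \<Longrightarrow> S \<in> UnipAlg v \<Longrightarrow> has_isotropic S"
  using UnipAlg_Nil(2) unfolding has_isotropic_def Isotropic_def by blast

text \<open>The elements of \<open>Nil v\<close> that are not multiples of \<open>out v\<close> are cyclic, so they are partitioned by
  the algebras: \<open>(q\<^sup>3 - q) / (q\<^sup>2 - q)\<close> of them.\<close>

lemma card_UnipAlg:
  assumes v: "v \<in> Isotropic"
  shows "card (UnipAlg v) = q + 1"
proof -
  have v0: "v \<noteq> 0" "h v v = 0" using v by (auto simp: Isotropic_def)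
  define L where "L = span_out v \<inter> Nil v"
  have cL: "card L = q" unfolding L_def span_out_Nil[OF v] using card_K span_out_inj[OF v0(1), of 0 _ 0]
    by (subst card_image) (auto intro!: inj_onI)
  define F where "F = (\<lambda>S. S \<inter> Nil v - L) ` UnipAlg v"
  have LS: "L \<subseteq> S \<inter> Nil v" if "S \<in> UnipAlg v" for S
    using span_out_subset[of S v] UnipAlg_Nil(2)[OF v that] that by (auto simp: L_def UnipAlg_def)
  have cen: "S = herm_cent A" if "S \<in> UnipAlg v" "A \<in> S \<inter> Nil v - L" for S A
    using that Alg_eq_herm_cent[of S A] Nil_cyclic[OF v, of A] by (auto simp: L_def UnipAlg_def)
  have UF: "\<Union>F = Nil v - L"
  proof
    show "Nil v - L \<subseteq> \<Union>F"
    proof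
      fix A assume A: "A \<in> Nil v - L"
      then have cA: "cyclic A" using Nil_cyclic[OF v] by (auto simp: L_def)
      moreover have AH: "A \<in> Herm" using A by (simp add: Nil_def)
      ultimately have "herm_cent A \<in> UnipAlg v" using herm_cent_Alg herm_cent_subset_Unip A by (auto simp: UnipAlg_def)
      moreover have "A \<in> herm_cent A" using AH by (simp add: herm_cent_def)
      ultimately show "A \<in> \<Union>F" using A by (auto simp: F_def)
    qed
  qed (auto simp: F_def)
  have "(q ^ 2 - q) * card F = card (\<Union>F)"
  proof (rule card_partition)
    show "card c = q ^ 2 - q" if "c \<in> F" for c
      using that LS cL UnipAlg_Nil(1)[OF v] by (auto simp: F_def card_Diff_subset)
    show "c1 \<inter> c2 = {}" if c: "c1 \<in> F" "c2 \<in> F" "c1 \<noteq> c2" for c1 c2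
    proof (rule ccontr)
      assume "c1 \<inter> c2 \<noteq> {}"
      then obtain A where A: "A \<in> c1" "A \<in> c2" by blast
      obtain S1 S2 where S: "S1 \<in> UnipAlg v" "c1 = S1 \<inter> Nil v - L" "S2 \<in> UnipAlg v" "c2 = S2 \<inter> Nil v - L"
        using c by (auto simp: F_def)
      then have "S1 = S2" using cen[OF S(1), of A] cen[OF S(3), of A] A by simp
      then show False using S c by simp
    qed
  qed (auto simp: F_def)
  also have "card (\<Union>F) = q ^ 3 - q" unfolding UF using card_Nil[OF v] cL by (subst card_Diff_subset) (auto simp: L_def)
  also have "card F = card (UnipAlg v)" unfolding F_def
  proof (intro card_image inj_onI)
    fix S S' assume S: "S \<in> UnipAlg v" "S' \<in> UnipAlg v" "S \<inter> Nil v - L = S' \<inter> Nil v - L"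
    have "card (S \<inter> Nil v - L) = q ^ 2 - q" using LS[OF S(1)] cL UnipAlg_Nil(1)[OF v S(1)] by (simp add: card_Diff_subset L_def)
    moreover have "q < q ^ 2" using q_gt_1 by (simp add: power2_eq_square)
    ultimately have "card (S \<inter> Nil v - L) \<noteq> 0" by simp
    then have "S \<inter> Nil v - L \<noteq> {}" by (metis card.empty)
    then obtain A where "A \<in> S \<inter> Nil v - L" by blast
    then show "S = S'" using cen S by metis
  qed
  finally have e: "(q ^ 2 - q) * card (UnipAlg v) = q ^ 3 - q" .
  have "(q ^ 2 - q) * (q + 1) = q ^ 3 - q" by (simp add: diff_mult_distrib eval_nat_numeral algebra_simps)
  then have "(q ^ 2 - q) * card (UnipAlg v) = (q ^ 2 - q) * (q + 1)" using e by simp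
  moreover have "q ^ 2 - q \<noteq> 0" using q_gt_1 by (simp add: power2_eq_square)
  ultimately show ?thesis unfolding mult_cancel1 by auto
qed

text \<open>An algebra is commutative and therefore contains \<open>out v\<close> for at most one isotropic point \<open>v\<close>.\<close>

lemma card_iso_Alg: "card {S \<in> Alg. has_isotropic S} = (q ^ 3 + 1) * (q ^ 2 + q + 1)"
  and card_UnipAlg_total: "card (\<Union>v\<in>Isotropic. UnipAlg v) = (q ^ 3 + 1) * (q + 1)"
proof -
  have uniq: "Unip v = Unip w" if *: "S \<in> Alg" "v \<in> Isotropic" "w \<in> Isotropic" "out v \<in> S" "out w \<in> S" for S v w
  proof -
    obtain c where c: "w = c *s v" using iso_commute[OF *(2,3)] Alg_D(7)[OF *(1,4,5)] by blast
    then have "c \<noteq> 0" using *(3) by (auto simp: Isotropic_def)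
    then show ?thesis using Unip_scale c by simp
  qed
  define T where "T Q = {S \<in> Alg. \<exists>v\<in>Isotropic. Unip v = Q \<and> out v \<in> S}" for Q
  have T: "T (Unip v) = {S \<in> Alg. out v \<in> S}" if v: "v \<in> Isotropic" for v
  proof (intro equalityI subsetI)
    fix S assume "S \<in> T (Unip v)"
    then obtain w where w: "S \<in> Alg" "w \<in> Isotropic" "Unip w = Unip v" "out w \<in> S" by (auto simp: T_def)
    then obtain c where "c \<noteq> 0" "v = c *s w" using Unip_eq_iff v by blast
    then have "out v = mat (c * bar c) ** out w" by (simp add: out_scale)
    then show "S \<in> {S \<in> Alg. out v \<in> S}" using w Alg_D(4)[OF w(1) K_closed(9)] by simp
  qed (use v in \<open>auto simp: T_def\<close>)
  have "{S \<in> Alg. has_isotropic S} = (\<Union>Q\<in>Unip ` Isotropic. T Q)" by (auto simp: T_def has_isotropic_def Isotropic_def)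
  moreover have "card (\<Union>Q\<in>Unip ` Isotropic. T Q) = (\<Sum>Q\<in>Unip ` Isotropic. card (T Q))"
  proof (rule card_UN_disjoint)
    show "\<forall>Q\<in>Unip ` Isotropic. \<forall>Q'\<in>Unip ` Isotropic. Q \<noteq> Q' \<longrightarrow> T Q \<inter> T Q' = {}"
    proof (intro ballI impI)
      fix Q Q' assume "Q \<in> Unip ` Isotropic" "Q' \<in> Unip ` Isotropic" "Q \<noteq> Q'"
      show "T Q \<inter> T Q' = {}"
      proof (rule ccontr)
        assume "T Q \<inter> T Q' \<noteq> {}"
        then obtain S v w where "S \<in> Alg" "v \<in> Isotropic" "Unip v = Q" "out v \<in> S" "w \<in> Isotropic" "Unip w = Q'" "out w \<in> S"
          unfolding T_def by blast
        then show False using uniq[of S v w] \<open>Q \<noteq> Q'\<close> by simp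
      qed
    qed
  qed auto
  moreover have "card (T Q) = q ^ 2 + q + 1" if "Q \<in> Unip ` Isotropic" for Q
    using that T card_Alg_through by (auto simp: Isotropic_def)
  ultimately show "card {S \<in> Alg. has_isotropic S} = (q ^ 3 + 1) * (q ^ 2 + q + 1)" by (simp add: card_Unip)
  define T' where "T' Q = {S \<in> Alg. S \<subseteq> Q}" for Q :: "('a ^ 3 ^ 3) set"
  have T': "T' (Unip v) = UnipAlg v" for v by (simp add: T'_def UnipAlg_def)
  have "(\<Union>v\<in>Isotropic. UnipAlg v) = (\<Union>Q\<in>Unip ` Isotropic. T' Q)" by (simp add: T')
  moreover have "card (\<Union>Q\<in>Unip ` Isotropic. T' Q) = (\<Sum>Q\<in>Unip ` Isotropic. card (T' Q))"
  proof (rule card_UN_disjoint)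
    show "\<forall>Q\<in>Unip ` Isotropic. \<forall>Q'\<in>Unip ` Isotropic. Q \<noteq> Q' \<longrightarrow> T' Q \<inter> T' Q' = {}"
    proof (intro ballI impI)
      fix Q Q' assume "Q \<in> Unip ` Isotropic" "Q' \<in> Unip ` Isotropic" "Q \<noteq> Q'"
      then obtain v w where vw: "v \<in> Isotropic" "w \<in> Isotropic" "Q = Unip v" "Q' = Unip w" "Unip v \<noteq> Unip w" by blast
      show "T' Q \<inter> T' Q' = {}"
      proof (rule ccontr)
        assume "T' Q \<inter> T' Q' \<noteq> {}"
        then obtain S where "S \<in> UnipAlg v" "S \<in> UnipAlg w" unfolding vw T' by blast
        then show False using uniq[of S v w] UnipAlg_Nil(2) vw by (auto simp: UnipAlg_def)
      qed
    qed
  qed auto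
  moreover have "card (T' Q) = q + 1" if "Q \<in> Unip ` Isotropic" for Q
    using that T' card_UnipAlg by auto
  ultimately show "card (\<Union>v\<in>Isotropic. UnipAlg v) = (q ^ 3 + 1) * (q + 1)" by (simp add: card_Unip)
qed

text \<open>Scalar multiples \<open>s n\<close> of the isometries \<open>n\<close> that act trivially on the factors of the flag formed by
  \<open>v\<close> and its perpendicular plane. For isotropic \<open>v\<close> the image in the projective group is the Sylow
  subgroup, for the characteristic, of the stabiliser of the point \<open>v\<close>.\<close>

definition Uunip :: "'a ^ 3 \<Rightarrow> ('a ^ 3 ^ 3) set" where
  "Uunip v = {g \<in> U. \<exists>s. g *v v = s *s v \<and> (\<forall>u. h (g *v u - s *s u) v = 0) \<and>
    (\<forall>u. h u v = 0 \<longrightarrow> (\<exists>t. g *v u - s *s u = t *s v))}"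

lemma Uunip_E:
  assumes "g \<in> Uunip v"
  obtains s where "g \<in> U" "g *v v = s *s v" "\<And>u. h (g *v u - s *s u) v = 0"
    "\<And>u. h u v = 0 \<Longrightarrow> \<exists>t. g *v u - s *s u = t *s v"
  using assms unfolding Uunip_def by blast

lemma Uunip_I:
  assumes "g \<in> U" "g *v v = s *s v" "\<And>u. h (g *v u - s *s u) v = 0"
    "\<And>u. h u v = 0 \<Longrightarrow> \<exists>t. g *v u - s *s u = t *s v"
  shows "g \<in> Uunip v"
  using assms unfolding Uunip_def by blast

lemma Uunip_subgroup:
  assumes v: "v \<in> Isotropic"
  shows "subgroup (proj ` Uunip v) (PGU h)"
proof (rule subgroup_proj)
  have v0: "v \<noteq> 0" "h v v = 0" using v by (auto simp: Isotropic_def)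
  show "Uunip v \<subseteq> U" by (auto simp: Uunip_def)
  have "\<exists>t. mat 1 *v u - 1 *s u = t *s v" for u by (intro exI[of _ 0]) simp
  then show "mat 1 \<in> Uunip v" by (intro Uunip_I[of _ _ 1]) (simp_all add: U_one)
  fix a assume a: "a \<in> Uunip v"
  then obtain s where s: "a \<in> U" "a *v v = s *s v" "\<And>u. h (a *v u - s *s u) v = 0"
    "\<And>u. h u v = 0 \<Longrightarrow> \<exists>t. a *v u - s *s u = t *s v" using Uunip_E by blast
  have hau: "h (a *v u) v = s * h u v" for u using s(3)[of u] by simp
  have s0: "s \<noteq> 0" using U_inj[OF s(1), of v] s(2) v0 by auto
  have giu: "ginv a *v u - inverse s *s u = - inverse s *s (a *v (ginv a *v u) - s *s (ginv a *v u))" for u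
    using s(1) s0 by (simp add: vec_eq_iff algebra_simps)
  show "ginv a \<in> Uunip v"
  proof (rule Uunip_I[of _ _ "inverse s"])
    show "ginv a \<in> U" using s by simp
    have e: "v = s *s (ginv a *v v)" using ginv(5)[OF s(1), of v] s(2) by simp
    show "ginv a *v v = inverse s *s v" using arg_cong[OF e, of "\<lambda>w. inverse s *s w"] s0 by simp
    show "h (ginv a *v u - inverse s *s u) v = 0" for u unfolding giu h_scale_left s(3) by simp
    fix u assume u: "h u v = 0"
    have "h u v = s * h (ginv a *v u) v" using hau[of "ginv a *v u"] s(1) by simp
    then have "h (ginv a *v u) v = 0" using u s0 by simp
    then obtain t where t: "a *v (ginv a *v u) - s *s (ginv a *v u) = t *s v" using s(4) by blast
    have "ginv a *v u - inverse s *s u = (- inverse s * t) *s v" unfolding giu t by simp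
    then show "\<exists>t. ginv a *v u - inverse s *s u = t *s v" by blast
  qed
  fix b assume b: "b \<in> Uunip v"
  then obtain r where r: "b \<in> U" "b *v v = r *s v" "\<And>u. h (b *v u - r *s u) v = 0"
    "\<And>u. h u v = 0 \<Longrightarrow> \<exists>t. b *v u - r *s u = t *s v" using Uunip_E by blast
  have hbu: "h (b *v u) v = r * h u v" for u using r(3)[of u] by simp
  show "a ** b \<in> Uunip v"
  proof (rule Uunip_I[of _ _ "s * r"])
    show "a ** b \<in> U" using U_mult s r by blast
    show "(a ** b) *v v = (s * r) *s v" by (simp add: s r mult.commute)
    show "h ((a ** b) *v u - (s * r) *s u) v = 0" for u by (simp add: hau hbu)
    fix u assume u: "h u v = 0"
    then obtain t where t: "b *v u - r *s u = t *s v" using r(4) by blast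
    have "h (b *v u) v = 0" using hbu u by simp
    then obtain t' where t': "a *v (b *v u) - s *s (b *v u) = t' *s v" using s(4) by blast
    have "(a ** b) *v u - (s * r) *s u = (a *v (b *v u) - s *s (b *v u)) + s *s (b *v u - r *s u)"
      by (simp add: vec_eq_iff algebra_simps)
    also have "\<dots> = (t' + s * t) *s v" unfolding t t' by (simp add: vec_eq_iff algebra_simps)
    finally show "\<exists>t. (a ** b) *v u - (s * r) *s u = t *s v" by blast
  qed
qed

text \<open>Modulo scalars the commutator of two elements of \<open>Uunip v\<close> is a transvection with centre \<open>v\<close>, and
  these are central.\<close>

lemma Uunip_c_nilpotent:
  assumes v: "v \<in> Isotropic" and c: "2 \<le> c"
  shows "c_nilpotent c (PGU h\<lparr>carrier := proj ` Uunip v\<rparr>)"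
proof -
  interpret P: group "PGU h" by (rule group_PGU)
  have v0: "v \<noteq> 0" "h v v = 0" using v by (auto simp: Isotropic_def)
  have vsub: "p \<in> carrier (PGU h)" if "p \<in> proj ` Uunip v" for p using that by (auto simp: carrier_PGU Uunip_def)
  show ?thesis
  proof (rule P.c_nilpotent_class_two[OF Uunip_subgroup[OF v] _ c])
    fix x y w assume "x \<in> proj ` Uunip v" "y \<in> proj ` Uunip v" "w \<in> proj ` Uunip v"
    then obtain a b d where abd: "a \<in> Uunip v" "b \<in> Uunip v" "d \<in> Uunip v" "x = proj a" "y = proj b" "w = proj d" by blast
    obtain s where s: "a \<in> U" "a *v v = s *s v" "\<And>u. h (a *v u - s *s u) v = 0"
      "\<And>u. h u v = 0 \<Longrightarrow> \<exists>t. a *v u - s *s u = t *s v" using Uunip_E[OF abd(1)] by blast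
    obtain r where r: "b \<in> U" "b *v v = r *s v" "\<And>u. h (b *v u - r *s u) v = 0"
      "\<And>u. h u v = 0 \<Longrightarrow> \<exists>t. b *v u - r *s u = t *s v" using Uunip_E[OF abd(2)] by blast
    obtain e where e: "d \<in> U" "d *v v = e *s v" "\<And>u. h (d *v u - e *s u) v = 0"
      "\<And>u. h u v = 0 \<Longrightarrow> \<exists>t. d *v u - e *s u = t *s v" using Uunip_E[OF abd(3)] by blast
    define m where "m = a ** b ** ginv a ** ginv b"
    have mU: "m \<in> U" unfolding m_def using s r by (intro U_mult ginv(1))
    have mv: "m *v (b *v (a *v u)) = a *v (b *v u)" for u unfolding m_def using s(1) r(1) by simp
    have na: "\<exists>t. a *v p = s *s p + t *s v" if "h p v = 0" for p
      using s(4)[OF that] by (auto simp: diff_eq_eq add.commute)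
    have nb: "\<exists>t. b *v p = r *s p + t *s v" if "h p v = 0" for p
      using r(4)[OF that] by (auto simp: diff_eq_eq add.commute)
    have ha: "h (a *v u) v = s * h u v" for u using s(3)[of u] by simp
    have hb: "h (b *v u) v = r * h u v" for u using r(3)[of u] by simp
    have rs0: "r \<noteq> 0" "s \<noteq> 0" using U_inj[OF r(1), of v] r(2) U_inj[OF s(1), of v] s(2) v0 by auto
    \<comment> \<open>\<open>a b - b a\<close> is the commutator of the nilpotent parts; it maps everything into the line of
      \<open>v\<close> and kills the hyperplane.\<close>
    have ab: "\<exists>t. a *v (b *v u) = b *v (a *v u) + t *s v \<and> (h u v = 0 \<longrightarrow> t = 0)" for u
    proof -
      define nb' where "nb' = b *v u - r *s u"
      define na' where "na' = a *v u - s *s u"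
      have bu: "b *v u = r *s u + nb'" and au: "a *v u = s *s u + na'" by (simp_all add: nb'_def na'_def)
      have hn: "h nb' v = 0" "h na' v = 0" using s(3) r(3) by (simp_all add: nb'_def na'_def)
      obtain t1 t2 where t: "a *v nb' = s *s nb' + t1 *s v" "b *v na' = r *s na' + t2 *s v" using na[OF hn(1)] nb[OF hn(2)] by blast
      have "a *v (b *v u) = b *v (a *v u) + (t1 - t2) *s v"
        unfolding bu au by (simp add: mv_simps t bu au) (simp add: vec_eq_iff algebra_simps)
      moreover have "t1 - t2 = 0" if u: "h u v = 0"
      proof -
        obtain x y where xy: "nb' = x *s v" "na' = y *s v" using r(4)[OF u] s(4)[OF u] by (auto simp: nb'_def na'_def)
        have "a *v nb' = s *s nb'" "b *v na' = r *s na'" unfolding xy by (simp_all add: s(2) r(2) mult.commute)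
        then show ?thesis using t v0 by simp
      qed
      ultimately show ?thesis by blast
    qed
    have m1: "\<exists>t. m *v p = p + t *s v" for p
    proof -
      define u where "u = ginv a *v (ginv b *v p)"
      have p: "b *v (a *v u) = p" using s(1) r(1) by (simp add: u_def)
      show ?thesis using ab[of u] mv[of u] unfolding p by metis
    qed
    have m2: "m *v p = p" if hp: "h p v = 0" for p
    proof -
      define u where "u = ginv a *v (ginv b *v p)"
      have p: "b *v (a *v u) = p" using s(1) r(1) by (simp add: u_def)
      have "r * (s * h u v) = h p v" unfolding p[symmetric] hb ha ..
      then have "h u v = 0" using hp rs0 by simp
      then show ?thesis using ab[of u] mv[of u] unfolding p by auto
    qed
    have "m *v (d *v u) = d *v (m *v u)" for u
    proof -
      obtain t where t: "m *v u = u + t *s v" using m1 by blast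
      have "m *v (d *v u - e *s u) = d *v u - e *s u" by (rule m2[OF e(3)])
      then have "m *v (d *v u) = e *s (m *v u) + (d *v u - e *s u)" by (simp add: mv_simps diff_eq_eq add.commute)
      also have "\<dots> = d *v (m *v u)" unfolding t by (simp add: mv_simps e(2)) (simp add: vec_eq_iff algebra_simps)
      finally show ?thesis .
    qed
    then have "m ** d = d ** m" by (simp add: matrix_eq)
    moreover have "x \<otimes>\<^bsub>PGU h\<^esub> y \<otimes>\<^bsub>PGU h\<^esub> inv\<^bsub>PGU h\<^esub> x \<otimes>\<^bsub>PGU h\<^esub> inv\<^bsub>PGU h\<^esub> y = proj m"
      unfolding abd m_def by (rule proj_commutator[OF s(1) r(1)])
    ultimately show "x \<otimes>\<^bsub>PGU h\<^esub> y \<otimes>\<^bsub>PGU h\<^esub> inv\<^bsub>PGU h\<^esub> x \<otimes>\<^bsub>PGU h\<^esub> inv\<^bsub>PGU h\<^esub> y \<otimes>\<^bsub>PGU h\<^esub> w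
       = w \<otimes>\<^bsub>PGU h\<^esub> (x \<otimes>\<^bsub>PGU h\<^esub> y \<otimes>\<^bsub>PGU h\<^esub> inv\<^bsub>PGU h\<^esub> x \<otimes>\<^bsub>PGU h\<^esub> inv\<^bsub>PGU h\<^esub> y)"
      using mU e(1) by (simp add: abd(6) proj_mult)
  qed
qed

text \<open>An isometry commuting with a unipotent algebra is a polynomial \<open>x + y A + z A\<^sup>2\<close> in a cyclic
  \<open>A\<close> of \<open>Nil v\<close>, and \<open>x\<close> is the scalar by which it acts on the flag.\<close>

lemma Ucent_subset_Uunip:
  assumes v: "v \<in> Isotropic" and S: "S \<in> UnipAlg v"
  shows "Ucent S \<subseteq> Uunip v"
proof
  fix g assume g: "g \<in> Ucent S"
  have v0: "v \<noteq> 0" "h v v = 0" using v by (auto simp: Isotropic_def)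
  have Alg: "S \<in> Alg" "S \<subseteq> Unip v" using S by (auto simp: UnipAlg_def)
  obtain A0 where A0: "A0 \<in> S" "cyclic A0" using Alg_exists_cyclic[OF Alg(1)] UnipAlg_iso[OF v S] by blast
  then obtain s A where A: "s \<in> K" "A \<in> Nil v" "A0 = mat s + A" using Alg(2) by (auto simp: Unip_def)
  have cA: "cyclic A" using cyclic_shift[OF A0(2), of s] A(3) by simp
  have "g ** A0 = A0 ** g" using g A0 by (simp add: Ucent_def)
  then obtain x' y' z' where "g = pol x' y' z' A0" using cyclic_commutant[OF A0(2), of g] by metis
  then have "g ** A = A ** g" unfolding A(3) by (simp add: matrix_eq mv_simps)
  then obtain x y z where g': "g = pol x y z A" using cyclic_commutant[OF cA, of g] by metis
  have Av: "A *v v = 0" using A(2) by (simp add: Nil_def)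
  have hA: "h (A *v u) v = 0" for u by (rule Nil_range[OF A(2)])
  show "g \<in> Uunip v"
  proof (rule Uunip_I[of _ _ x])
    show "g \<in> U" using g by (simp add: Ucent_def)
    show "g *v v = x *s v" unfolding g' by (simp add: Av)
    show "h (g *v u - x *s u) v = 0" for u unfolding g' by (simp add: hA)
    fix u assume "h u v = 0"
    then obtain t where Au: "A *v u = t *s v" using A(2) by (auto simp: Nil_def)
    have "g *v u - x *s u = (y * t) *s v" unfolding g' by (simp add: Av Au)
    then show "\<exists>t. g *v u - x *s u = t *s v" by blast
  qed
qed

section \<open>The covers for \<open>q > 2\<close>\<close>

definition dist_elem :: "('a ^ 3 ^ 3) set \<Rightarrow> 'a ^ 3 ^ 3" where "dist_elem S = (SOME g. distinguished S g)"

lemma dist_elem: "S \<in> Alg \<Longrightarrow> q > 2 \<or> has_isotropic S \<Longrightarrow> distinguished S (dist_elem S)"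
  unfolding dist_elem_def using exists_distinguished by (metis someI)

lemma dist_elem_commuting_eq:
  assumes "S \<in> Alg" "S' \<in> Alg" "q > 2 \<or> has_isotropic S" "q > 2 \<or> has_isotropic S'" "c_nilpotent_pair 1 (PGU h) (proj (dist_elem S)) (proj (dist_elem S'))"
  shows "S = S'"
proof -
  interpret P: group "PGU h" by (rule group_PGU)
  obtain A where A: "A \<in> S" "cyclic A" using Alg_exists_cyclic[OF assms(1,3)] by blast
  obtain A' where A': "A' \<in> S'" "cyclic A'" using Alg_exists_cyclic[OF assms(2,4)] by blast
  have d: "distinguished S (dist_elem S)" "distinguished S' (dist_elem S')" using dist_elem assms by blast+
  have "proj (dist_elem S) \<in> carrier (PGU h)" "proj (dist_elem S') \<in> carrier (PGU h)" using distinguishedD(1)[OF d(1)] distinguishedD(1)[OF d(2)] by (auto simp: carrier_PGU)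
  then show ?thesis using distinguished_commuting[OF assms(1,2) A A' d] P.c_nilpotent_1_pair_commute assms(5) by blast
qed

text \<open>For class at least two, the unipotent algebras at an isotropic point are replaced by the single
  index \<open>Unip v\<close>. Since this set has \<open>q\<^sup>4\<close> elements, it cannot be mistaken for one of the
  algebras.\<close>

definition merged :: "('a ^ 3 ^ 3) set set \<Rightarrow> ('a ^ 3 ^ 3) set set" where
  "merged I = (I - (\<Union>v\<in>Isotropic. UnipAlg v)) \<union> Unip ` Isotropic"

text \<open>The algebra whose distinguished element represents an index; at an isotropic point any one of the
  unipotent algebras will do.\<close>

definition rep :: "('a ^ 3 ^ 3) set \<Rightarrow> ('a ^ 3 ^ 3) set" where
  "rep Q = (if Q \<in> Alg then Q else SOME S. \<exists>v\<in>Isotropic. Q = Unip v \<and> S \<in> UnipAlg v)"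

text \<open>The set \<open>Unip v\<close> determines \<open>v\<close> up to a scalar, hence also \<open>Uunip v\<close>.\<close>

definition member :: "('a ^ 3 ^ 3) set \<Rightarrow> ('a ^ 3 ^ 3) set" where
  "member Q = (if Q \<in> Alg then Ucent Q else Uunip (SOME v. v \<in> Isotropic \<and> Q = Unip v))"

lemma Unip_not_Alg: "v \<in> Isotropic \<Longrightarrow> Unip v \<notin> Alg"
proof
  assume v: "v \<in> Isotropic" and "Unip v \<in> Alg"
  then have S: "Unip v \<in> UnipAlg v" by (simp add: UnipAlg_def)
  have "Unip v \<inter> Nil v = Nil v" using Nil_subset_Unip by blast
  then have "q ^ 3 = q ^ 2" using UnipAlg_Nil(1)[OF v S] card_Nil[OF v] by simp
  then show False using q_gt_1 by simp
qed

lemma rep_Unip: assumes "v \<in> Isotropic" shows "rep (Unip v) \<in> UnipAlg v"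
proof -
  have "card (UnipAlg v) \<noteq> 0" using card_UnipAlg[OF assms] by simp
  then have "\<exists>S. S \<in> UnipAlg v" by (metis card.empty equals0I)
  then have "\<exists>S. \<exists>w\<in>Isotropic. Unip v = Unip w \<and> S \<in> UnipAlg w" using assms by blast
  then have "\<exists>w\<in>Isotropic. Unip v = Unip w \<and> rep (Unip v) \<in> UnipAlg w"
    unfolding rep_def using Unip_not_Alg[OF assms] by (simp, rule_tac someI_ex)
  then show ?thesis by (auto simp: UnipAlg_def)
qed

lemma member_Unip: assumes "v \<in> Isotropic" obtains w where "w \<in> Isotropic" "Unip v = Unip w" "member (Unip v) = Uunip w"
proof -
  have "\<exists>w. w \<in> Isotropic \<and> Unip v = Unip w" using assms by blast
  from someI_ex[OF this] have w: "(SOME w. w \<in> Isotropic \<and> Unip v = Unip w) \<in> Isotropic" "Unip v = Unip (SOME w. w \<in> Isotropic \<and> Unip v = Unip w)"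
    by blast+
  have "member (Unip v) = Uunip (SOME w. w \<in> Isotropic \<and> Unip v = Unip w)" using Unip_not_Alg[OF assms] by (simp add: member_def)
  then show thesis by (rule that[OF w])
qed

lemma merged_cover:
  assumes I: "I \<subseteq> Alg" "(\<Union>v\<in>Isotropic. UnipAlg v) \<subseteq> I" and q: "q > 2 \<or> (\<forall>S\<in>I. has_isotropic S)" and c: "2 \<le> c" and Q: "Q \<in> merged I"
  shows "subgroup (proj ` member Q) (PGU h)" "c_nilpotent c (PGU h\<lparr>carrier := proj ` member Q\<rparr>)"
    "rep Q \<in> I" "distinguished (rep Q) (dist_elem (rep Q))" "dist_elem (rep Q) \<in> member Q"
proof -
  have c1: "1 \<le> c" using c by (metis one_le_numeral order_trans)
  have all: "subgroup (proj ` member Q) (PGU h) \<and> c_nilpotent c (PGU h\<lparr>carrier := proj ` member Q\<rparr>) \<and> rep Q \<in> I \<and> Ucent (rep Q) \<subseteq> member Q"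
  proof (cases "Q \<in> Alg")
    case True
    then have QI: "Q \<in> I" using Q Unip_not_Alg by (auto simp: merged_def)
    then obtain A where "A \<in> Q" "cyclic A" using Alg_exists_cyclic[OF True] q by blast
    then show ?thesis using True QI Ucent_subgroup Ucent_c_nilpotent[OF _ _ c1] by (auto simp: member_def rep_def)
  next
    case False
    then obtain v where v: "v \<in> Isotropic" "Q = Unip v" using Q I(1) by (auto simp: merged_def)
    obtain w where w: "w \<in> Isotropic" "Unip v = Unip w" "member Q = Uunip w" using member_Unip[OF v(1)] v(2) by metis
    have r: "rep Q \<in> UnipAlg w" using rep_Unip[OF w(1)] v(2) w(2) by simp
    then show ?thesis using Uunip_subgroup[OF w(1)] Uunip_c_nilpotent[OF w(1) c] Ucent_subset_Uunip[OF w(1) r] I(2) w by auto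
  qed
  then show "subgroup (proj ` member Q) (PGU h)" "c_nilpotent c (PGU h\<lparr>carrier := proj ` member Q\<rparr>)" "rep Q \<in> I" by auto
  show d: "distinguished (rep Q) (dist_elem (rep Q))" using dist_elem all I(1) q by blast
  show "dist_elem (rep Q) \<in> member Q" using all distinguishedD(2)[OF d] by blast
qed

lemma merged_covers:
  assumes "I \<subseteq> Alg" "S \<in> I" "g \<in> Ucent S"
  shows "\<exists>Q\<in>merged I. g \<in> member Q"
proof (cases "\<exists>v\<in>Isotropic. S \<in> UnipAlg v")
  case True
  then obtain v where v: "v \<in> Isotropic" "S \<in> UnipAlg v" by blast
  obtain w where w: "w \<in> Isotropic" "Unip v = Unip w" "member (Unip v) = Uunip w" using member_Unip[OF v(1)] by metis
  then have "g \<in> member (Unip v)" using Ucent_subset_Uunip[OF w(1), of S] v(2) assms(3) by (auto simp: UnipAlg_def)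
  then show ?thesis using v(1) by (auto simp: merged_def)
next
  case False
  then have "S \<in> merged I" "member S = Ucent S" using assms by (auto simp: merged_def member_def)
  then show ?thesis using assms(3) by blast
qed

text \<open>Two representatives that generate a nilpotent group belong to the same algebra or to unipotent
  algebras at the same point, and in either case to the same index. Indeed an index is determined by
  its representative.\<close>

lemma merged_pair:
  assumes I: "I \<subseteq> Alg" "(\<Union>v\<in>Isotropic. UnipAlg v) \<subseteq> I" and q: "q > 2 \<or> (\<forall>S\<in>I. has_isotropic S)" and c: "2 \<le> c"
    and Q: "Q \<in> merged I" "Q' \<in> merged I"
    and nil: "c_nilpotent_pair c (PGU h) (proj (dist_elem (rep Q))) (proj (dist_elem (rep Q')))"
  shows "Q = Q'"
proof -
  have uniq: "Unip v = Unip w" if S: "S \<in> UnipAlg v" "S \<in> UnipAlg w" and vw: "v \<in> Isotropic" "w \<in> Isotropic" for S v w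
  proof -
    have "out v \<in> Unip w" using UnipAlg_Nil(2)[OF vw(1) S(1)] S(2) by (auto simp: UnipAlg_def)
    then have "out v ** out w = out w ** out v" using Unip_commute_out vw by (auto simp: Isotropic_def)
    then obtain c where c: "w = c *s v" using iso_commute[OF vw] by blast
    then have "c \<noteq> 0" using vw(2) by (auto simp: Isotropic_def)
    then show ?thesis using Unip_scale c by simp
  qed
  have key: "Q = (if \<exists>v\<in>Isotropic. rep Q \<in> UnipAlg v then Unip (SOME v. v \<in> Isotropic \<and> rep Q \<in> UnipAlg v) else rep Q)" if Q: "Q \<in> merged I" for Q
  proof (cases "Q \<in> Alg")
    case True
    then have "Q \<notin> (\<Union>v\<in>Isotropic. UnipAlg v)" using Q Unip_not_Alg by (auto simp: merged_def)
    then show ?thesis using True by (simp add: rep_def)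
  next
    case False
    then obtain v where v: "v \<in> Isotropic" "Q = Unip v" using Q I(1) by (auto simp: merged_def)
    have r: "v \<in> Isotropic \<and> rep Q \<in> UnipAlg v" using rep_Unip v by simp
    then have "(SOME v. v \<in> Isotropic \<and> rep Q \<in> UnipAlg v) \<in> Isotropic \<and> rep Q \<in> UnipAlg (SOME v. v \<in> Isotropic \<and> rep Q \<in> UnipAlg v)"
      by (rule someI)
    then have "Unip v = Unip (SOME v. v \<in> Isotropic \<and> rep Q \<in> UnipAlg v)" using uniq r by blast
    then show ?thesis using r v by auto
  qed
  note m = merged_cover[OF I q c Q(1)] and m' = merged_cover[OF I q c Q(2)]
  have S: "rep Q \<in> Alg" "rep Q' \<in> Alg" using m(3) m'(3) I by auto
  obtain A where A: "A \<in> rep Q" "cyclic A" using Alg_exists_cyclic[OF S(1)] q m(3) by blast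
  obtain A' where A': "A' \<in> rep Q'" "cyclic A'" using Alg_exists_cyclic[OF S(2)] q m'(3) by blast
  from distinguished_nilpotent_pair[OF S A A' m(4) m'(4) nil]
  consider "rep Q = rep Q'" | v where "v \<in> Isotropic" "rep Q \<in> UnipAlg v" "rep Q' \<in> UnipAlg v"
    using S by (auto simp: Isotropic_def UnipAlg_def)
  then show ?thesis
  proof cases
    case 1
    show ?thesis by (rule trans[OF key[OF Q(1), unfolded 1] key[OF Q(2), symmetric]])
  next
    case 2
    have e1: "Unip (SOME v. v \<in> Isotropic \<and> rep Q \<in> UnipAlg v) = Unip v"
      using someI[of "\<lambda>v. v \<in> Isotropic \<and> rep Q \<in> UnipAlg v" v] uniq 2 by blast
    have e2: "Unip (SOME v. v \<in> Isotropic \<and> rep Q' \<in> UnipAlg v) = Unip v"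
      using someI[of "\<lambda>v. v \<in> Isotropic \<and> rep Q' \<in> UnipAlg v" v] uniq 2 by blast
    have "\<exists>v\<in>Isotropic. rep Q \<in> UnipAlg v" "\<exists>v\<in>Isotropic. rep Q' \<in> UnipAlg v" using 2 by blast+
    then have k: "(if \<exists>v\<in>Isotropic. rep Q \<in> UnipAlg v then Unip (SOME v. v \<in> Isotropic \<and> rep Q \<in> UnipAlg v) else rep Q) = Unip v"
      "(if \<exists>v\<in>Isotropic. rep Q' \<in> UnipAlg v then Unip (SOME v. v \<in> Isotropic \<and> rep Q' \<in> UnipAlg v) else rep Q') = Unip v"
      using e1 e2 by simp_all
    show ?thesis by (rule trans[OF trans[OF key[OF Q(1)] k(1)] trans[OF key[OF Q(2)] k(2), symmetric]])
  qed
qed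

lemma card_merged:
  assumes "I \<subseteq> Alg" "(\<Union>v\<in>Isotropic. UnipAlg v) \<subseteq> I"
  shows "card (merged I) + q * (q ^ 3 + 1) = card I"
proof -
  have "card (merged I) = card (I - (\<Union>v\<in>Isotropic. UnipAlg v)) + card (Unip ` Isotropic)"
    unfolding merged_def using Unip_not_Alg assms by (intro card_Un_disjoint) auto
  moreover have "card (I - (\<Union>v\<in>Isotropic. UnipAlg v)) + card (\<Union>v\<in>Isotropic. UnipAlg v) = card I"
    using assms(2) by (subst card_Diff_subset) (auto simp: card_mono)
  ultimately show ?thesis using card_Unip card_UnipAlg_total by (simp add: algebra_simps)
qed

lemma large_q_class_1:
  assumes q: "q > 2"
  shows "(\<exists>\<N>. c_nilpotent_cover 1 (PGU h) \<N> \<and> two_minimal 1 (PGU h) \<N>) \<and> omega 1 (PGU h) = card Alg"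
proof -
  interpret P: group "PGU h" by (rule group_PGU)
  show ?thesis
  proof (rule P.two_minimal_cover[where H = "\<lambda>S. proj ` Ucent S" and g = "\<lambda>S. proj (dist_elem S)"])
    fix S assume S: "S \<in> Alg"
    obtain A where "A \<in> S" "cyclic A" using Alg_exists_cyclic[OF S] q by blast
    then show "c_nilpotent 1 (PGU h\<lparr>carrier := proj ` Ucent S\<rparr>)" using Ucent_c_nilpotent by blast
    show "proj (dist_elem S) \<in> proj ` Ucent S" using dist_elem[OF S] q distinguishedD(2) by blast
  next
    fix x assume "x \<in> carrier (PGU h)"
    then obtain g where g: "g \<in> U" "x = proj g" by (auto simp: carrier_PGU)
    obtain S where "S \<in> Alg" "g \<in> Ucent S" using unitary_in_Ucent[OF g(1)] by blast
    then show "\<exists>S\<in>Alg. x \<in> proj ` Ucent S" using g(2) by blast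
  qed (use Ucent_subgroup finite_PGU dist_elem_commuting_eq q in auto)
qed

lemma large_q_class_2:
  assumes q: "q > 2" and c: "2 \<le> c"
  shows "(\<exists>\<N>. c_nilpotent_cover c (PGU h) \<N> \<and> two_minimal c (PGU h) \<N>) \<and> omega c (PGU h) = card (merged Alg)"
proof -
  interpret P: group "PGU h" by (rule group_PGU)
  have I: "Alg \<subseteq> Alg" "(\<Union>v\<in>Isotropic. UnipAlg v) \<subseteq> Alg" by (auto simp: UnipAlg_def)
  have q': "q > 2 \<or> (\<forall>S\<in>Alg. has_isotropic S)" using q by blast
  show ?thesis
  proof (rule P.two_minimal_cover[where H = "\<lambda>Q. proj ` member Q" and g = "\<lambda>Q. proj (dist_elem (rep Q))"])
    fix x assume "x \<in> carrier (PGU h)"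
    then obtain g where g: "g \<in> U" "x = proj g" by (auto simp: carrier_PGU)
    obtain S where "S \<in> Alg" "g \<in> Ucent S" using unitary_in_Ucent[OF g(1)] by blast
    then show "\<exists>Q\<in>merged Alg. x \<in> proj ` member Q" using merged_covers[of Alg S g] g(2) by blast
  qed (use merged_cover[OF I q' c] merged_pair[OF I q' c] finite_PGU in auto)
qed

end

section \<open>The case \<open>q = 2\<close>: orthonormal frames\<close>

locale hermitian_plane_2 = hermitian_plane +
  assumes q2: "q = 2"
begin

lemma char2: "(2::'a) = 0" by (rule two_eq_0_iff[OF q2])

lemma add_self [simp]: "a + a = (0::'a)" using char2 by (metis mult_2 mult_zero_left)

lemma neg_self [simp]: "- a = (a::'a)" using add_self by (metis add_eq_0_iff)

lemma numeral_mod_2 [simp]: "(numeral (num.Bit0 n) :: 'a) = 0" "(numeral (num.Bit1 n) :: 'a) = 1"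
  by (simp_all only: numeral_Bit0 numeral_Bit1 add_self add_0)

lemma add_eq_iff: "a + b = c \<longleftrightarrow> a = b + (c::'a)" by (auto simp: add.assoc)

lemma cube_1: "a \<noteq> 0 \<Longrightarrow> a * a * a = (1::'a)"
  using nonzero_power_card[of a] by (simp add: q2 power3_eq_cube)

lemma cube_simps: "a \<noteq> 0 \<Longrightarrow> a * (a * a) = (1::'a)" "a \<noteq> 0 \<Longrightarrow> a * (a * (a * b)) = (b::'a)"
  using cube_1[of a] by (metis mult.assoc, metis mult.assoc mult_1)

lemma bar_sq: "bar a = a * a" unfolding bar_def by (simp add: q2 power2_eq_square)

lemma norm_1: "a \<noteq> 0 \<Longrightarrow> a * bar a = 1" using cube_1 by (simp add: bar_sq mult.assoc)

lemma norm_1': "a \<noteq> 0 \<Longrightarrow> bar a * a = 1" using norm_1 by (simp add: mult.commute)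

lemma norm_mult: "a \<noteq> 0 \<Longrightarrow> a * (bar a * x) = x" "a \<noteq> 0 \<Longrightarrow> bar a * (a * x) = x"
  using norm_1 norm_1' by (simp_all flip: mult.assoc)

lemma K_2: "K = {0, 1}"
proof -
  have "card K = 2" using card_K by (rule trans) (rule q2)
  then show ?thesis by (intro card_subset_eq[symmetric]) auto
qed

lemma norm_nonzero: "h v v \<noteq> 0 \<longleftrightarrow> h v v = 1"
  using h_self_K[of v] K_2 by auto

lemma not_01_sum: "d \<noteq> 0 \<Longrightarrow> d \<noteq> 1 \<Longrightarrow> d * d + d + 1 = (0::'a)"
proof -
  assume d: "d \<noteq> 0" "d \<noteq> 1"
  have "(d - 1) * (d * d + d + 1) = d * d * d - 1" by (simp add: algebra_simps)
  also have "\<dots> = 0" using cube_1[OF d(1)] by simp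
  finally show ?thesis using d by simp
qed

text \<open>A primitive cube root of unity; the field is \<open>{0, 1, w, bar w}\<close>.\<close>

definition w :: 'a where "w = (SOME a. a \<notin> K)"

lemma w: "w \<noteq> 0" "w \<noteq> 1" "bar w \<noteq> 1" "w \<noteq> bar w" "w * w = w + 1"
proof -
  have "w \<notin> K" unfolding w_def using not_K someI_ex by metis
  then have "bar w \<noteq> w" by (simp add: K_iff)
  moreover from this show *: "w \<noteq> 0" "w \<noteq> 1" by auto
  ultimately show "w \<noteq> bar w" by simp
  show "bar w \<noteq> 1" using * by (metis bar_1 bar_inject)
  show "w * w = w + 1" using not_01_sum[OF *(1,2)] by (metis add.assoc add_eq_0_iff neg_self)
qed

lemma cases_4: "a = 0 \<or> a = 1 \<or> a = w \<or> a = bar w" for a :: 'a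
proof -
  have "card {0, 1, w, bar w} = 4" using w by auto
  moreover have "CARD('a) = 4" by (simp add: card_field q2)
  ultimately have "{0, 1, w, bar w} = UNIV" by (intro card_subset_eq) auto
  then show ?thesis by blast
qed

subsection \<open>Orthonormal bases\<close>

definition ortho :: "'a ^ 3 \<Rightarrow> 'a ^ 3 \<Rightarrow> 'a ^ 3 \<Rightarrow> bool" where
  "ortho x y z \<longleftrightarrow> h x x = 1 \<and> h y y = 1 \<and> h z z = 1 \<and> h x y = 0 \<and> h y z = 0 \<and> h z x = 0"

lemma orthoD:
  assumes "ortho x y z"
  shows "h x x = 1" "h y y = 1" "h z z = 1" "h x y = 0" "h y x = 0" "h y z = 0" "h z y = 0" "h z x = 0" "h x z = 0"
  using assms h_eq_0_comm[of x y] h_eq_0_comm[of y z] h_eq_0_comm[of z x] by (auto simp: ortho_def)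

lemma ortho_rotate: "ortho x y z \<Longrightarrow> ortho y z x" by (auto simp: ortho_def)

lemma ortho_ind3: assumes "ortho x y z" shows "ind3 x y z"
  unfolding ind3_def
proof (intro allI impI)
  fix a b c assume e: "a *s x + b *s y + c *s z = 0"
  show "a = 0 \<and> b = 0 \<and> c = 0"
    using arg_cong[OF e, of "\<lambda>u. h u x"] arg_cong[OF e, of "\<lambda>u. h u y"] arg_cong[OF e, of "\<lambda>u. h u z"]
    by (simp add: orthoD[OF assms])
qed

lemma ortho_expand: assumes "ortho x y z" shows "u = h u x *s x + h u y *s y + h u z *s z"
proof -
  obtain a b c where u: "u = a *s x + b *s y + c *s z" using ind3_span[OF ortho_ind3[OF assms]] by blast
  have "h u x = a" "h u y = b" "h u z = c" unfolding u by (simp_all add: orthoD[OF assms])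
  then show ?thesis using u by simp
qed

lemma ortho_unitary:
  assumes o: "ortho x y z" and o': "ortho (X *v x) (X *v y) (X *v z)"
  shows "X \<in> U"
  unfolding U_def
proof (intro CollectI allI)
  fix u v
  obtain a b c where u: "u = a *s x + b *s y + c *s z" using ind3_span[OF ortho_ind3[OF o]] by blast
  obtain a' b' c' where v: "v = a' *s x + b' *s y + c' *s z" using ind3_span[OF ortho_ind3[OF o]] by blast
  show "h (X *v u) (X *v v) = h u v" unfolding u v by (simp add: mv_simps orthoD[OF o] orthoD[OF o'])
qed

lemma ortho_scale: "ortho x y z \<Longrightarrow> a \<noteq> 0 \<Longrightarrow> b \<noteq> 0 \<Longrightarrow> c \<noteq> 0 \<Longrightarrow> ortho (a *s x) (b *s y) (c *s z)"
  using norm_1' norm_1 by (simp add: ortho_def mult.assoc)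

lemma ortho_extend2:
  assumes "h x x = 1" "h y y = 1" "h x y = 0"
  obtains z where "ortho x y z"
proof -
  have yx: "h y x = 0" using assms h_eq_0_comm by blast
  have "a = 0 \<and> b = 0" if e: "a *s x + b *s y = 0" for a b
    using arg_cong[OF e, of "\<lambda>u. h u x"] arg_cong[OF e, of "\<lambda>u. h u y"] assms yx by simp
  then obtain p where p: "ind3 x y p" using ind3_extend by blast
  define z where "z = p - h p x *s x - h p y *s y"
  have z: "h z x = 0" "h z y = 0" unfolding z_def using assms yx by simp_all
  have z0: "z \<noteq> 0"
  proof
    assume "z = 0"
    then have "(- h p x) *s x + (- h p y) *s y + 1 *s p = 0" unfolding z_def by (simp add: vec_eq_iff algebra_simps)
    from ind3D[OF p this] show False by simp
  qed
  have "h z z \<noteq> 0"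
  proof
    assume zz: "h z z = 0"
    have "h z u = 0" for u
    proof -
      obtain a b c where u: "u = a *s x + b *s y + c *s p" using ind3_span[OF p] by blast
      have "p = z + h p x *s x + h p y *s y" by (simp add: z_def)
      then have "h z p = h z (z + h p x *s x + h p y *s y)" by simp
      also have "\<dots> = 0" using zz z by simp
      finally show ?thesis unfolding u using z by simp
    qed
    then show False using z0 h_nondeg by blast
  qed
  then have "ortho x y z" using z assms h_eq_0_comm[of z y] by (simp add: ortho_def norm_nonzero)
  then show thesis by (rule that)
qed

lemma ortho_exists:
  assumes "h x x = 1"
  obtains y z where "ortho x y z"
proof -
  obtain u where u: "u \<noteq> 0" "h u x = 0" using perp_pair[of x x] by blast
  have "\<exists>y. h y y = 1 \<and> h x y = 0"
  proof (cases "h u u = 0")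
    case False
    then show ?thesis using u norm_nonzero h_eq_0_comm by blast
  next
    case True
    obtain p0 where p0: "h p0 u = 1" using h_dual[OF u(1)] by blast
    define p where "p = p0 - h p0 x *s x"
    have xu: "h x u = 0" using u(2) h_eq_0_comm by blast
    have p: "h p x = 0" "h p u = 1" using assms p0 xu by (simp_all add: p_def)
    have p': "h x p = 0" "h u p = 1" using p by (metis h_eq_0_comm, metis bar_1 bar_h)
    show ?thesis
    proof (cases "h p p = 0")
      case F: False
      then show ?thesis using p' norm_nonzero by blast
    next
      case T: True
      \<comment> \<open>Two isotropic vectors with product one combine to a unit vector, as \<open>w\<close> has trace one.\<close>
      have "h (u + w *s p) (u + w *s p) = bar w + w" using True T p p' by (simp add: algebra_simps)
      also have "\<dots> = 1" using w(5) by (simp add: bar_sq add.commute[of w] add.assoc)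
      finally show ?thesis using xu p' by (intro exI[of _ "u + w *s p"]) simp
    qed
  qed
  then show thesis using ortho_extend2[OF assms] that by blast
qed

text \<open>For \<open>q = 2\<close> a unit vector lies in only one orthonormal basis up to scalars and order: the
  plane perpendicular to it has only two nonisotropic points. The frame of \<open>e\<close> is
  the set of all unit vectors on the three points of that basis.\<close>

definition frame :: "'a ^ 3 \<Rightarrow> ('a ^ 3) set" where
  "frame e = {x. h x x = 1 \<and> ((\<exists>c. x = c *s e) \<or> h x e = 0)}"

lemma frame_ortho:
  assumes o: "ortho x y z"
  shows "frame x = {u. \<exists>c. c \<noteq> 0 \<and> (u = c *s x \<or> u = c *s y \<or> u = c *s z)}"
proof (intro equalityI subsetI)
  fix u assume "u \<in> frame x"
  then have u: "h u u = 1" "(\<exists>c. u = c *s x) \<or> h u x = 0" by (auto simp: frame_def)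
  then have u0: "u \<noteq> 0" by auto
  consider c where "u = c *s x" | "h u x = 0" using u by blast
  then show "u \<in> {u. \<exists>c. c \<noteq> 0 \<and> (u = c *s x \<or> u = c *s y \<or> u = c *s z)}"
  proof cases
    case 1 then show ?thesis using u0 by auto
  next
    case 2
    then have e: "u = h u y *s y + h u z *s z" using ortho_expand[OF o, of u] by simp
    define a b where "a = h u y" and "b = h u z"
    have e: "u = a *s y + b *s z" using e by (simp add: a_def b_def)
    have "h u u = a * bar a + b * bar b" unfolding e by (simp add: orthoD[OF o] mult.commute)
    then have "\<not> (a \<noteq> 0 \<and> b \<noteq> 0)" using u(1) norm_1 by auto
    then consider "a = 0" | "b = 0" by blast
    then show ?thesis
    proof cases
      case 1
      then have "u = b *s z" using e by simp
      then show ?thesis using u0 by (metis (mono_tags, lifting) mem_Collect_eq vec.scale_zero_left)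
    next
      case 2
      then have "u = a *s y" using e by simp
      then show ?thesis using u0 by (metis (mono_tags, lifting) mem_Collect_eq vec.scale_zero_left)
    qed
  qed
next
  fix u assume "u \<in> {u. \<exists>c. c \<noteq> 0 \<and> (u = c *s x \<or> u = c *s y \<or> u = c *s z)}"
  then show "u \<in> frame x" using orthoD[OF o] norm_1 norm_1' by (auto simp: frame_def)
qed

lemma frame_ortho_eq: assumes "ortho x y z" shows "frame y = frame x" "frame z = frame x"
  unfolding frame_ortho[OF assms] frame_ortho[OF ortho_rotate[OF assms]] frame_ortho[OF ortho_rotate[OF ortho_rotate[OF assms]]]
  by blast+

lemma frame_scale: "c \<noteq> 0 \<Longrightarrow> frame (c *s x) = frame x"
proof -
  assume c: "c \<noteq> 0"
  have "(\<exists>d. u = d *s (c *s x)) \<longleftrightarrow> (\<exists>d. u = d *s x)" for u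
  proof
    assume "\<exists>d. u = d *s x"
    then obtain d where "u = d *s x" by blast
    then have "u = (d / c) *s (c *s x)" using c by simp
    then show "\<exists>d. u = d *s (c *s x)" by blast
  qed auto
  then show ?thesis using c by (simp add: frame_def)
qed

lemma frame_eq: "h e e = 1 \<Longrightarrow> x \<in> frame e \<Longrightarrow> frame x = frame e"
proof -
  assume e: "h e e = 1" and x: "x \<in> frame e"
  obtain y z where o: "ortho e y z" using ortho_exists[OF e] by blast
  obtain c where "c \<noteq> 0" "x = c *s e \<or> x = c *s y \<or> x = c *s z" using x unfolding frame_ortho[OF o] by blast
  then show ?thesis using frame_scale frame_ortho_eq[OF o] by metis
qed

lemma frame_self: "h e e = 1 \<Longrightarrow> e \<in> frame e" by (auto simp: frame_def intro: exI[of _ 1])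

definition Frames :: "('a ^ 3) set set" where "Frames = frame ` {e. h e e = 1}"

text \<open>Of the \<open>63\<close> nonzero vectors \<open>27\<close> are isotropic; the other \<open>36\<close> are unit vectors, and they are
  partitioned by the frames into sets of nine.\<close>

lemma card_Frames: "card Frames = 4"
proof -
  let ?E = "{e. h e e = 1}"
  have "UNIV = insert 0 (Isotropic \<union> ?E)" using norm_nonzero by (auto simp: Isotropic_def)
  then have "card (UNIV :: ('a ^ 3) set) = card (insert 0 (Isotropic \<union> ?E))" by simp
  also have "\<dots> = Suc (card Isotropic + card ?E)"
    by (subst card_insert_disjoint, auto simp: Isotropic_def, subst card_Un_disjoint, auto)
  finally have cE: "card ?E = 36" using card_V card_Isotropic by (simp add: q2 card_field_3)
  have c9: "card (frame e) = 9" if e1: "h e e = 1" for e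
  proof -
    obtain y z where o: "ortho e y z" using ortho_exists[OF e1] by blast
    let ?L = "\<lambda>x. (\<lambda>c. c *s x) ` (UNIV - {0})"
    have F: "frame e = ?L e \<union> (?L y \<union> ?L z)" unfolding frame_ortho[OF o] by auto
    have cL: "card (?L x) = 3" if "x \<noteq> 0" for x :: "'a ^ 3"
      using that by (subst card_image) (auto intro!: inj_onI simp: card_Diff_singleton card_field q2)
    have nz: "e \<noteq> 0" "y \<noteq> 0" "z \<noteq> 0" using orthoD[OF o] by auto
    have dis: "?L x \<inter> ?L x' = {}" if "h x x' = 0" "h x' x' = 1" for x x'
    proof (rule ccontr)
      assume "?L x \<inter> ?L x' \<noteq> {}"
      then obtain c d where cd: "c \<noteq> 0" "d \<noteq> 0" "c *s x = d *s x'" by auto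
      have "c * h x x' = d * h x' x'" using arg_cong[OF cd(3), of "\<lambda>u. h u x'"] by simp
      then show False using that cd(2) by simp
    qed
    have "?L e \<inter> (?L y \<union> ?L z) = {}" using dis[of e y] dis[of e z] orthoD[OF o] by blast
    then show ?thesis unfolding F using dis[of y z] orthoD[OF o] cL nz by (simp add: card_Un_disjoint)
  qed
  have "9 * card Frames = card (\<Union>Frames)"
  proof (rule card_partition)
    show "c1 \<inter> c2 = {}" if "c1 \<in> Frames" "c2 \<in> Frames" "c1 \<noteq> c2" for c1 c2
    proof (rule ccontr)
      assume "c1 \<inter> c2 \<noteq> {}"
      then obtain x where "x \<in> c1" "x \<in> c2" by blast
      then have "frame x = c1" "frame x = c2" using that frame_eq unfolding Frames_def by blast+
      then show False using that(3) by simp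
    qed
  qed (auto simp: Frames_def c9)
  also have "\<Union>Frames = ?E" using frame_self unfolding Frames_def by (auto simp: frame_def)
  finally show ?thesis using cE by simp
qed

subsection \<open>Isometries with scalar cube\<close>

text \<open>For \<open>q = 2\<close> all nonzero scalars have norm one, so this describes commuting in the projective group.\<close>

definition pcomm :: "'a ^ 3 ^ 3 \<Rightarrow> 'a ^ 3 ^ 3 \<Rightarrow> bool" where
  "pcomm a b \<longleftrightarrow> (\<exists>c. c \<noteq> 0 \<and> a ** b = mat c ** (b ** a))"

lemma pcommI: "c \<noteq> 0 \<Longrightarrow> (\<And>u. a *v (b *v u) = c *s (b *v (a *v u))) \<Longrightarrow> pcomm a b"
  unfolding pcomm_def by (intro exI[of _ c]) (simp add: matrix_eq)

lemma pcommE: assumes "pcomm a b" obtains c where "c \<noteq> 0" "\<And>u. a *v (b *v u) = c *s (b *v (a *v u))"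
proof -
  obtain c where c: "c \<noteq> 0" "a ** b = mat c ** (b ** a)" using assms by (auto simp: pcomm_def)
  have "a *v (b *v u) = c *s (b *v (a *v u))" for u using arg_cong[OF c(2), of "\<lambda>M. M *v u"] by simp
  then show thesis using that c by blast
qed

lemma pcomm_sym: "pcomm a b \<Longrightarrow> pcomm b a"
proof -
  assume "pcomm a b"
  then obtain c where c: "c \<noteq> 0" "\<And>u. a *v (b *v u) = c *s (b *v (a *v u))" using pcommE by blast
  show ?thesis by (rule pcommI[of "inverse c"]) (use c in simp_all)
qed

lemma pcomm_mult: "pcomm a c \<Longrightarrow> pcomm b c \<Longrightarrow> pcomm (a ** b) c"
proof -
  assume "pcomm a c" "pcomm b c"
  then obtain s t where s: "s \<noteq> 0" "\<And>u. a *v (c *v u) = s *s (c *v (a *v u))" 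
    and t: "t \<noteq> 0" "\<And>u. b *v (c *v u) = t *s (c *v (b *v u))" using pcommE by metis
  show ?thesis by (rule pcommI[of "t * s"]) (use s t in simp_all)
qed

lemma pcomm_scale: "pcomm a c \<Longrightarrow> pcomm (mat s ** a) c"
proof -
  assume "pcomm a c"
  then obtain t where t: "t \<noteq> 0" "\<And>u. a *v (c *v u) = t *s (c *v (a *v u))" using pcommE by blast
  show ?thesis by (rule pcommI[OF t(1)]) (simp add: t(2) mult.commute)
qed

lemma pcomm_ginv: "a \<in> U \<Longrightarrow> pcomm a c \<Longrightarrow> pcomm (ginv a) c"
proof -
  assume a: "a \<in> U" and "pcomm a c"
  then obtain t where t: "t \<noteq> 0" "\<And>u. a *v (c *v u) = t *s (c *v (a *v u))" using pcommE by blast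
  have "ginv a *v (c *v u) = inverse t *s (c *v (ginv a *v u))" for u
  proof -
    have "ginv a *v (a *v (c *v (ginv a *v u))) = t *s (ginv a *v (c *v u))" using a by (simp add: t(2))
    then have "c *v (ginv a *v u) = t *s (ginv a *v (c *v u))" using a by simp
    then show ?thesis using t(1) by simp
  qed
  then show ?thesis using t(1) by (intro pcommI[of "inverse t"]) auto
qed

lemma pcomm_proj: 
  assumes "a \<in> U" "b \<in> U" 
  shows "pcomm a b \<longleftrightarrow> proj a \<otimes>\<^bsub>PGU h\<^esub> proj b = proj b \<otimes>\<^bsub>PGU h\<^esub> proj a"
proof -
  have "(\<exists>c. c * bar c = 1 \<and> X c) \<longleftrightarrow> (\<exists>c. c \<noteq> 0 \<and> X c)" for X
    using norm_1 by (metis mult_zero_left zero_neq_one)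
  then show ?thesis unfolding proj_commute_iff[OF assms] pcomm_def by simp
qed

definition PCent :: "'a ^ 3 ^ 3 \<Rightarrow> ('a ^ 3 ^ 3) set" where "PCent g = {k \<in> U. pcomm k g}"

lemma PCent_subgroup: "subgroup (proj ` PCent g) (PGU h)"
proof (rule subgroup_proj)
  show "mat 1 \<in> PCent g" by (auto simp: PCent_def U_one pcomm_def intro: exI[of _ 1])
qed (auto simp: PCent_def U_mult pcomm_mult pcomm_ginv)

text \<open>For \<open>q = 2\<close> the nonzero scalar \<open>d \<noteq> 1\<close> has no cube root in the field, so \<open>x\<^sup>3 - d\<close> is irreducible.
  The isometries that satisfy this polynomial fix no isotropic point and are not rigid: up to a scalar each of
  them commutes with an operator that is diagonal in an orthonormal basis.\<close>

definition irred :: "'a ^ 3 ^ 3 \<Rightarrow> bool" where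
  "irred g \<longleftrightarrow> g \<in> U \<and> (\<exists>d. d \<noteq> 0 \<and> d \<noteq> 1 \<and> g ** (g ** g) = mat d)"

lemma irred_no_eigenvector: "irred g \<Longrightarrow> g *v v = c *s v \<Longrightarrow> v = 0"
proof (rule ccontr)
  assume g: "irred g" and v: "g *v v = c *s v" "v \<noteq> 0"
  obtain d where d: "d \<noteq> 0" "d \<noteq> 1" "g ** (g ** g) = mat d" "g \<in> U" using g by (auto simp: irred_def)
  have "c * (c * c) = d" using arg_cong[OF d(3), of "\<lambda>M. M *v v"] v by (simp add: mult.assoc)
  moreover have "c \<noteq> 0" using U_inj[OF d(4), of v] v by auto
  ultimately show False using cube_1[of c] d(2) by (simp add: mult.assoc)
qed

lemma commute_out_eigenvector:
  assumes "g ** out v = out v ** g" "v \<noteq> 0" obtains c where "g *v v = c *s v"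
proof -
  obtain x where x: "h x v = 1" using h_dual[OF assms(2)] by blast
  have "g *v v = h (g *v x) v *s v" using arg_cong[OF assms(1), of "\<lambda>M. M *v x"] x by simp
  then show thesis by (rule that)
qed

lemma irred_cyclic: "irred g \<Longrightarrow> cyclic g"
proof (rule ccontr)
  assume g: "irred g" and "\<not> cyclic g"
  then have gU: "g \<in> U" by (simp add: irred_def)
  have "g \<noteq> mat c" for c using irred_no_eigenvector[OF g, of "axis 1 1" c] by (auto simp: axis_eq_0_iff)
  then obtain x where "x \<noteq> 0" "g ** out x = out x ** g" using unitary_not_cyclic[OF gU \<open>\<not> cyclic g\<close>] by metis
  then show False using commute_out_eigenvector irred_no_eigenvector[OF g] by metis
qed

text \<open>Comparing the cubic relations of \<open>g\<close> and of its inverse, which is its adjoint, shows that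
  \<open>g\<^sup>3 = z g\<^sup>2 + x bar z g + x\<close>. If \<open>z \<noteq> 0\<close>, this is \<open>(g + z) (g + r)\<^sup>2 = 0\<close> with \<open>r = (x bar z)\<^sup>2\<close>, and the
  double root provides an eigenvector that is isotropic.\<close>

lemma cyclic_unitary_cases:
  assumes g: "g \<in> U" "cyclic g"
  shows "(\<exists>d. d \<noteq> 0 \<and> g ** (g ** g) = mat d) \<or> (\<exists>v\<in>Isotropic. g ** out v = out v ** g)"
proof -
  obtain x y z where p: "g ** (g ** g) = pol x y z g" using cyclic_minimal_polynomial[OF g(2)] by blast
  have x0: "x \<noteq> 0" using cube_pol[OF g p] .
  have "adj (g ** (g ** g)) (ginv g ** ginv g ** ginv g)" using adj_ginv[OF g(1)] by (intro adj_mult)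
  moreover have "adj (g ** (g ** g)) (pol (bar x) (bar y) (bar z) (ginv g))" unfolding p by (intro adj_pol adj_ginv g)
  ultimately have e: "ginv g ** ginv g ** ginv g = pol (bar x) (bar y) (bar z) (ginv g)" by (rule adj_unique)
  have pv: "g *v (g *v (g *v u)) = x *s u + y *s (g *v u) + z *s (g *v (g *v u))" for u
    using arg_cong[OF p, of "\<lambda>M. M *v u"] by simp
  have "u = bar x *s (g *v (g *v (g *v u))) + bar y *s (g *v (g *v u)) + bar z *s (g *v u)" for u
    using arg_cong[OF e, of "\<lambda>M. M *v (g *v (g *v (g *v u)))"] g(1) by simp
  then have "pol 1 0 0 g *v u = pol (bar x * x) (bar x * y + bar z) (bar x * z + bar y) g *v u" for u
    unfolding pv by (simp add: vec_eq_iff algebra_simps)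
  then have "pol 1 0 0 g = pol (bar x * x) (bar x * y + bar z) (bar x * z + bar y) g" unfolding matrix_eq by blast
  from cyclic_pol_inj[OF g(2) this] have "bar x * y = bar z" by (metis add_eq_0_iff neg_self)
  then have "x * (bar x * y) = x * bar z" by simp
  then have y: "y = x * bar z" using norm_mult(1)[OF x0] by simp
  show ?thesis
  proof (cases "z = 0")
    case True
    then have "g ** (g ** g) = mat x" using p y by (simp add: matrix_eq)
    then show ?thesis using x0 by blast
  next
    case z: False
    \<comment> \<open>The square root of \<open>y\<close>, since every element is its own fourth power.\<close>
    define r where "r = (x * bar z) * (x * bar z)"
    have xz: "x * bar z \<noteq> 0" using x0 z by simp
    have rr: "r * r = y" using cube_1[OF xz] unfolding r_def y by (simp add: ac_simps)
    have r0: "r \<noteq> 0" using xz by (simp add: r_def)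
    have yz: "y * z = x" unfolding y using norm_1'[OF z] by (simp add: mult.assoc)
    obtain u where u: "ind3 u (g *v u) (g *v (g *v u))" using g(2) cyclic_def by blast
    define v where "v = (z * r) *s u + (z + r) *s (g *v u) + 1 *s (g *v (g *v u))"
    have v0: "v \<noteq> 0" using ind3D[OF u, of "z * r" "z + r" 1] unfolding v_def by auto
    have gv: "g *v v = r *s v"
      unfolding v_def by (simp add: mv_simps pv) (simp add: vec_eq_iff rr[symmetric] yz[symmetric] algebra_simps)
    have "ginv g *v (g *v v) = r *s (ginv g *v v)" unfolding gv by simp
    then have giv: "ginv g *v v = bar r *s v" using g(1) norm_1'[OF r0]
      by (metis ginv(5) vec.scale_one vec.scale_scale)
    have hg: "h (g *v p) v = r * h p v" for p
      using adjD[OF adj_ginv[OF g(1)], of p v] by (simp add: giv)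
    have "h v v = (z * r) * h u v + (z + r) * (r * h u v) + r * (r * h u v)"
      by (subst (1) v_def) (simp add: hg)
    then have "h v v = 0" by (simp add: algebra_simps)
    moreover have "g ** out v = out v ** g" by (simp add: matrix_eq gv hg mult.commute)
    ultimately show ?thesis using v0 by (auto simp: Isotropic_def)
  qed
qed

text \<open>The rotation \<open>x \<mapsto> y \<mapsto> z \<mapsto> d x\<close> of an orthonormal basis. Up to scalars it commutes with the
  diagonal operators \<open>diag3 r\<close> with eigenvalues \<open>1, r, r\<^sup>2\<close>.\<close>

definition rot :: "'a \<Rightarrow> 'a ^ 3 \<Rightarrow> 'a ^ 3 \<Rightarrow> 'a ^ 3 \<Rightarrow> 'a ^ 3 ^ 3" where
  "rot d x y z = outer y x + outer z y + mat d ** outer x z"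

definition diag3 :: "'a \<Rightarrow> 'a ^ 3 \<Rightarrow> 'a ^ 3 \<Rightarrow> 'a ^ 3 \<Rightarrow> 'a ^ 3 ^ 3" where
  "diag3 r x y z = out x + mat r ** out y + mat (bar r) ** out z"

lemma rot_diag3_vec:
  assumes "ortho x y z"
  shows "rot d x y z *v x = y" "rot d x y z *v y = z" "rot d x y z *v z = d *s x"
    "diag3 r x y z *v x = x" "diag3 r x y z *v y = r *s y" "diag3 r x y z *v z = bar r *s z"
  using orthoD[OF assms] by (simp_all add: rot_def diag3_def mv_simps)

lemma rot_U: "ortho x y z \<Longrightarrow> d \<noteq> 0 \<Longrightarrow> rot d x y z \<in> U"
  using ortho_unitary[of x y z "rot d x y z"] ortho_scale[of y z x 1 1 d] ortho_rotate by (simp add: rot_diag3_vec)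

lemma diag3_U: "ortho x y z \<Longrightarrow> r \<noteq> 0 \<Longrightarrow> diag3 r x y z \<in> U"
  using ortho_unitary[of x y z "diag3 r x y z"] ortho_scale[of x y z 1 r "bar r"] by (simp add: rot_diag3_vec)

lemma rot_irred: assumes o: "ortho x y z" and d: "d \<noteq> 0" "d \<noteq> 1" shows "irred (rot d x y z)"
proof -
  have "rot d x y z ** (rot d x y z ** rot d x y z) = mat d"
    by (rule mat_eq_on_ind3[OF ortho_ind3[OF o]]) (simp_all add: rot_diag3_vec[OF o])
  then show ?thesis using rot_U[OF o d(1)] d by (auto simp: irred_def)
qed

lemma pcomm_on_ortho:
  assumes o: "ortho x y z" and "c \<noteq> 0" 
    "a *v (b *v x) = c *s (b *v (a *v x))" "a *v (b *v y) = c *s (b *v (a *v y))" "a *v (b *v z) = c *s (b *v (a *v z))"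
  shows "pcomm a b"
proof -
  have "a ** b = mat c ** (b ** a)" by (rule mat_eq_on_ind3[OF ortho_ind3[OF o]]) (use assms in simp_all)
  then show ?thesis using assms(2) unfolding pcomm_def by blast
qed

lemma diag3_rot:
  assumes o: "ortho x y z" and r: "r \<noteq> 0"
  shows "diag3 r x y z *v (rot d x y z *v u) = r *s (rot d x y z *v (diag3 r x y z *v u))"
proof -
  have "diag3 r x y z ** rot d x y z = mat r ** (rot d x y z ** diag3 r x y z)"
  proof (rule mat_eq_on_ind3[OF ortho_ind3[OF o]])
    show "(diag3 r x y z ** rot d x y z) *v y = (mat r ** (rot d x y z ** diag3 r x y z)) *v y"
      by (simp add: rot_diag3_vec[OF o] bar_sq)
  qed (simp_all add: rot_diag3_vec[OF o] norm_mult(1)[OF r] norm_1'[OF r] mult.left_commute)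
  from arg_cong[OF this, of "\<lambda>M. M *v u"] show ?thesis by simp
qed

lemma pcomm_diag3_rot: "ortho x y z \<Longrightarrow> r \<noteq> 0 \<Longrightarrow> pcomm (diag3 r x y z) (rot d x y z)"
  using pcommI diag3_rot by blast

text \<open>The sum of the basis is a cyclic vector, because \<open>1, r, r\<^sup>2\<close> are different.\<close>

lemma diag3_cyclic: assumes o: "ortho x y z" and r: "r \<noteq> 0" "r \<noteq> 1" shows "cyclic (diag3 r x y z)"
proof -
  let ?Z = "diag3 r x y z" and ?u = "x + y + z"
  have rr: "r * r = r + 1" using not_01_sum[OF r] by (metis add.assoc add_eq_0_iff neg_self)
  have Z: "?Z *v ?u = x + r *s y + (r * r) *s z" "?Z *v (x + r *s y + (r * r) *s z) = x + (r * r) *s y + r *s z"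
    using cube_1[OF r(1)] by (simp_all add: mv_simps rot_diag3_vec[OF o] bar_sq) (metis mult.assoc mult.left_neutral)
  have "ind3 ?u (?Z *v ?u) (?Z *v (?Z *v ?u))" unfolding Z ind3_def
  proof (intro allI impI)
    fix a b c assume e: "a *s ?u + b *s (x + r *s y + (r * r) *s z) + c *s (x + (r * r) *s y + r *s z) = 0"
    have 1: "a + b + c = 0" using arg_cong[OF e, of "\<lambda>u. h u x"] by (simp add: orthoD[OF o])
    have 2: "a + b * r + c * (r * r) = 0" using arg_cong[OF e, of "\<lambda>u. h u y"] by (simp add: orthoD[OF o])
    have 3: "a + b * (r * r) + c * r = 0" using arg_cong[OF e, of "\<lambda>u. h u z"] by (simp add: orthoD[OF o])
    have s: "t + (t * r + t * (r * r)) = 0" for t unfolding rr by (simp add: distrib_left flip: add.assoc)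
    have "a + (a + a) + (b + (b * r + b * (r * r))) + (c + (c * r + c * (r * r)))
      = (a + b + c) + ((a + b * r + c * (r * r)) + (a + b * (r * r) + c * r))" by (simp only: ac_simps)
    then have a: "a = 0" unfolding 1 2 3 s by simp
    then have bc: "b = c" using 1 by (simp add: add_eq_iff)
    then have "b * (r + r * r) = 0" using 2 a by (simp add: algebra_simps)
    then have "b = 0" unfolding rr by (simp flip: add.assoc)
    then show "a = 0 \<and> b = 0 \<and> c = 0" using a bc by simp
  qed
  then show ?thesis unfolding cyclic_def by blast
qed

text \<open>Let \<open>v\<close> be isotropic and scale \<open>g\<close> such that \<open>h (g v) v = 1\<close>; this is possible because the line of \<open>v\<close>
  is not fixed, and two different isotropic points are not perpendicular. Then \<open>e = v + g v + g\<^sup>2 v\<close> is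
  a unit vector perpendicular to \<open>g e\<close>, and \<open>e, g e, g\<^sup>2 e\<close> is an orthonormal basis rotated by \<open>g\<close>.\<close>

lemma irred_frame:
  assumes g: "irred g"
  obtains c d x y z where "c \<noteq> 0" "d \<noteq> 0" "d \<noteq> 1" "ortho x y z" "mat c ** g = rot d x y z"
proof -
  obtain d where d: "d \<noteq> 0" "d \<noteq> 1" "g ** (g ** g) = mat d" "g \<in> U" using g by (auto simp: irred_def)
  obtain v where v: "v \<noteq> 0" "h v v = 0" using Isotropic_exists by (auto simp: Isotropic_def)
  have b: "h (g *v v) v \<noteq> 0"
  proof
    assume "h (g *v v) v = 0"
    then have "h v (g *v v) = 0" using h_eq_0_comm by blast
    moreover have "h (g *v v) (g *v v) = 0" using U_D[OF d(4)] v by simp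
    ultimately obtain c where "g *v v = c *s v" using no_isotropic_plane[OF v(2) _ _ v(1)] by blast
    then show False using irred_no_eigenvector[OF g] v(1) by blast
  qed
  define c where "c = inverse (h (g *v v) v)"
  have c0: "c \<noteq> 0" using b by (simp add: c_def)
  define k where "k = mat c ** g"
  have kU: "k \<in> U" unfolding k_def using scalar_mult_U norm_1[OF c0] d(4) by blast
  have kv: "h (k *v v) v = 1" using b by (simp add: k_def c_def)
  have kv': "h v (k *v v) = 1" using kv by (metis bar_1 bar_h)
  have k3: "k *v (k *v (k *v u)) = d *s u" for u
  proof -
    have "k *v (k *v (k *v u)) = (c * c * c) *s (g *v (g *v (g *v u)))" by (simp add: k_def mult.assoc)
    then show ?thesis using arg_cong[OF d(3), of "\<lambda>M. M *v u"] cube_1[OF c0] by simp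
  qed
  have dd: "d * bar d = 1" "bar d = d + 1"
    using norm_1[OF d(1)] not_01_sum[OF d(1,2)] by (auto simp: bar_sq) (metis add.assoc add_eq_0_iff neg_self)
  let ?p = "k *v v" and ?q = "k *v (k *v v)"
  note kD = U_D[OF kU]
  have qv: "h ?q v = d"
  proof -
    have "h ?q (d *s v) = h ?q (k *v ?q)" using k3[of v] by simp
    also have "\<dots> = h ?p ?q" by (rule kD)
    also have "\<dots> = h v ?p" by (rule kD)
    finally have "bar d * h ?q v = 1" using kv' by simp
    then have "d * (bar d * h ?q v) = d" by simp
    then show ?thesis using norm_mult(1)[OF d(1)] by simp
  qed
  have ip: "h ?p ?p = 0" "h ?q ?q = 0" "h ?q ?p = 1" "h ?p ?q = 1" "h v ?q = bar d"
    using kD[of v v] kD[of ?p ?p] kD[of ?p v] kD[of v ?p] v kv kv' qv by (simp_all, metis bar_h)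
  define e where "e = v + ?p + ?q"
  have ke: "k *v e = ?p + ?q + d *s v" unfolding e_def by (simp add: mv_simps k3)
  have "h e e = 1" unfolding e_def using v ip kv kv' qv dd by (simp add: algebra_simps)
  moreover have ke0: "h (k *v e) e = 0" unfolding ke unfolding e_def using v ip kv kv' qv dd by (simp add: algebra_simps)
  moreover have "h (k *v (k *v e)) (k *v e) = 0" using kD ke0 by simp
  moreover have "h (k *v (k *v e)) e = 0"
  proof -
    have "h (k *v (k *v e)) (d *s e) = h (k *v (k *v e)) (k *v (k *v (k *v e)))" by (simp add: k3)
    also have "\<dots> = h e (k *v e)" by (simp only: kD)
    also have "\<dots> = 0" using ke0 h_eq_0_comm by blast
    finally show ?thesis using d(1) by simp
  qed
  ultimately have o: "ortho e (k *v e) (k *v (k *v e))"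
    using kD h_eq_0_comm[of "k *v e" e] h_eq_0_comm[of "k *v (k *v e)" "k *v e"] by (simp add: ortho_def)
  have "k = rot d e (k *v e) (k *v (k *v e))"
    by (rule mat_eq_on_ind3[OF ortho_ind3[OF o]]) (simp_all add: rot_diag3_vec[OF o] k3)
  then have "mat c ** g = rot d e (k *v e) (k *v (k *v e))" unfolding k_def[symmetric] .
  then show thesis by (rule that[OF c0 d(1,2) o])
qed

text \<open>An isometry \<open>m = x + y g + z g\<^sup>2\<close> fixes no isotropic point unless it is scalar, since \<open>g\<close> would fix it as
  well. So \<open>m\<^sup>3\<close> is scalar, and the coefficients of \<open>g\<close> and \<open>g\<^sup>2\<close> in \<open>m\<^sup>3\<close> do not both vanish if \<open>x\<close>,
  \<open>y\<close> and \<open>z\<close> are all different from zero; if one of them is zero, a second one has to be zero as well.\<close>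

lemma unitary_pol_irred:
  assumes g: "irred g" and m: "pol x y z g \<in> U"
  shows "(y = 0 \<and> z = 0) \<or> (x = 0 \<and> z = 0) \<or> (x = 0 \<and> y = 0)"
proof -
  define m where "m = pol x y z g"
  have mU: "m \<in> U" using assms by (simp add: m_def)
  have gm: "g ** m = m ** g" unfolding m_def by (rule pol_self_comm[symmetric])
  obtain d where d: "d \<noteq> 0" "d \<noteq> 1" "g ** (g ** g) = mat d" "g \<in> U" using g by (auto simp: irred_def)
  have g3: "g *v (g *v (g *v u)) = d *s u" for u using arg_cong[OF d(3), of "\<lambda>M. M *v u"] by simp
  have no: False if "v \<noteq> 0" "g ** out v = out v ** g" for v
    using commute_out_eigenvector[OF that(2,1)] irred_no_eigenvector[OF g] that(1) by metis
  show ?thesis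
  proof (cases "\<exists>c. m = mat c")
    case True
    then obtain c where "pol x y z g = pol c 0 0 g" by (auto simp: m_def matrix_eq)
    then show ?thesis using cyclic_pol_inj[OF irred_cyclic[OF g]] by blast
  next
    case ns: False
    have cm: "cyclic m"
    proof (rule ccontr)
      assume "\<not> cyclic m"
      then obtain v where "v \<noteq> 0" "\<And>B. B ** m = m ** B \<Longrightarrow> B ** out v = out v ** B"
        using unitary_not_cyclic[OF mU] ns by metis
      then show False using no gm by blast
    qed
    have "\<not> (\<exists>v\<in>Isotropic. m ** out v = out v ** m)"
    proof
      assume "\<exists>v\<in>Isotropic. m ** out v = out v ** m"
      then obtain v where v: "v \<in> Isotropic" "m ** out v = out v ** m" by blast
      then have "g ** out v = out v ** g" using cyclic_commuting_commute[OF cm gm[symmetric]] by blast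
      then show False using no v by (auto simp: Isotropic_def)
    qed
    then obtain d' where d': "m ** (m ** m) = mat d'" using cyclic_unitary_cases[OF mU cm] by blast
    have "pol (x * x * x + d * (y * y * y) + d * d * (z * z * z))
       (x * x * y + d * (x * z * z) + d * (y * y * z))
       (x * x * z + x * y * y + d * (y * z * z)) g *v u = (m ** (m ** m)) *v u" for u
    proof -
      have t: "a + a + a = a" "a + (a + a) = a" for a :: 'a by simp_all
      have "(m ** (m ** m)) *v u = (x * x * x + d * (y * y * y) + d * d * (z * z * z)) *s u
         + (3 * (x * x * y + d * (x * z * z) + d * (y * y * z))) *s (g *v u)
         + (3 * (x * x * z + x * y * y + d * (y * z * z))) *s (g *v (g *v u))
         + (6 * d * x * y * z) *s u"
        unfolding m_def by (simp add: mv_simps g3) (simp add: vec_eq_iff algebra_simps)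
then show ?thesis by simp
    qed
    then have "pol (x * x * x + d * (y * y * y) + d * d * (z * z * z))
       (x * x * y + d * (x * z * z) + d * (y * y * z))
       (x * x * z + x * y * y + d * (y * z * z)) g = pol d' 0 0 g" unfolding d' matrix_eq by simp
    from cyclic_pol_inj[OF irred_cyclic[OF g] this] have A: "x * x * y + d * (x * z * z) + d * (y * y * z) = 0"
      and B: "x * x * z + x * y * y + d * (y * z * z) = 0" by auto
    show ?thesis
    proof (cases "x = 0 \<or> y = 0 \<or> z = 0")
      case True then show ?thesis using A d(1) by auto
    next
      case False
      then have c: "x * x * x = 1" "y * y * y = 1" "z * z * z = 1" using cube_1 by auto
      have "(x * x * y + d * (x * z * z) + d * (y * y * z)) * (z * x) =
         (x * x * x) * y * z + d * (x * x) * (z * z * z) + d * (x * y * y * z * z)" by (simp add: algebra_simps)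
      then have 1: "y * z + d * (x * x) + d * (x * y * y * z * z) = 0" unfolding A c by simp
      have "(x * x * z + x * y * y + d * (y * z * z)) * (y * x) =
         (x * x * x) * y * z + (x * x) * (y * y * y) + d * (x * y * y * z * z)" by (simp add: algebra_simps)
      then have 2: "y * z + x * x + d * (x * y * y * z * z) = 0" unfolding B c by simp
      have "(d - 1) * (x * x) = (y * z + d * (x * x) + d * (x * y * y * z * z)) - (y * z + x * x + d * (x * y * y * z * z))"
        by (simp only: left_diff_distrib mult_1) (simp only: algebra_simps)
      then have "(d - 1) * (x * x) = 0" unfolding 1 2 by simp
      then show ?thesis using d(2) False by simp
    qed
  qed
qed

subsection \<open>Projective centralisers of rotations\<close>

text \<open>If \<open>k g = c g k\<close>, then multiplying \<open>k\<close> with the inverse of \<open>diag3 c\<close> produces an isometry that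
  commutes with \<open>g\<close>. It is a polynomial in \<open>g\<close>, hence a scalar multiple of a power of \<open>g\<close>.\<close>

lemma rot_centralizer_form:
  assumes o: "ortho x y z" and d: "d \<noteq> 0" "d \<noteq> 1" and k: "k \<in> PCent (rot d x y z)"
  obtains s r l where "s \<noteq> 0" "r \<noteq> 0" "l = mat 1 \<or> l = rot d x y z \<or> l = rot d x y z ** rot d x y z"
    "k = mat s ** l ** diag3 r x y z"
proof -
  let ?G = "rot d x y z"
  have kU: "k \<in> U" and "pcomm k ?G" using k by (auto simp: PCent_def)
  then obtain c where c: "c \<noteq> 0" "\<And>u. k *v (?G *v u) = c *s (?G *v (k *v u))" using pcommE by blast
  let ?Z = "diag3 c x y z" and ?Z' = "diag3 (bar c) x y z"
  have c': "bar c \<noteq> 0" using c(1) by simp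
  have ZZ: "?Z' ** ?Z = mat 1"
    by (rule mat_eq_on_ind3[OF ortho_ind3[OF o]]) (simp_all add: rot_diag3_vec[OF o] norm_1[OF c(1)] norm_1'[OF c(1)])
  note ZG = diag3_rot[OF o c', of d]
  define m where "m = k ** ?Z'"
  have mU: "m \<in> U" unfolding m_def using kU diag3_U[OF o c'] U_mult by blast
  have "?G ** m = m ** ?G"
    by (simp add: matrix_eq m_def ZG c(2) norm_1'[OF c(1)])
  then obtain a b e where m: "m = pol a b e ?G" using cyclic_commutant[OF irred_cyclic[OF rot_irred[OF o d]]] by blast
  have km: "k = m ** ?Z" unfolding m_def by (simp add: ZZ flip: matrix_mul_assoc)
  have nz: "\<not> (a = 0 \<and> b = 0 \<and> e = 0)"
  proof
    assume "a = 0 \<and> b = 0 \<and> e = 0"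
    then have "m *v x = 0" by (simp add: m)
    then show False using U_inj[OF mU] orthoD(1)[OF o] by fastforce
  qed
  from unitary_pol_irred[OF rot_irred[OF o d] mU[unfolded m]] show thesis
  proof (elim disjE)
    assume "b = 0 \<and> e = 0"
    then show thesis using nz by (intro that[of a c "mat 1"]) (auto simp: km m c(1) matrix_eq)
  next
    assume "a = 0 \<and> e = 0"
    then show thesis using nz by (intro that[of b c ?G]) (auto simp: km m c(1) matrix_eq)
  next
    assume "a = 0 \<and> b = 0"
    then show thesis using nz by (intro that[of e c "?G ** ?G"]) (auto simp: km m c(1) matrix_eq)
  qed
qed

lemma pcomm_refl: "pcomm a a" by (auto simp: pcomm_def intro: exI[of _ 1])

lemma pcomm_one: "pcomm (mat 1) a" by (auto simp: pcomm_def intro: exI[of _ 1])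

text \<open>By the normal form the projective centraliser is generated by scalars, the rotation and the
  operators \<open>diag3 r\<close>, which commute with each other up to scalars.\<close>

lemma PCent_irred_abelian:
  assumes g: "irred g" and a: "a \<in> PCent g" and b: "b \<in> PCent g"
  shows "pcomm a b"
proof -
  obtain c d x y z where f: "c \<noteq> 0" "d \<noteq> 0" "d \<noteq> 1" and o: "ortho x y z" and e: "mat c ** g = rot d x y z"
    using irred_frame[OF g] by metis
  let ?G = "rot d x y z"
  have sub: "k \<in> PCent ?G" if "k \<in> PCent g" for k
    using that pcomm_scale pcomm_sym unfolding PCent_def e[symmetric] by blast
  have form: "pcomm k p" if k: "k \<in> PCent ?G" and p: "pcomm ?G p" "\<And>r. r \<noteq> 0 \<Longrightarrow> pcomm (diag3 r x y z) p" for k p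
  proof -
    obtain s r l where f: "s \<noteq> 0" "r \<noteq> 0" "l = mat 1 \<or> l = ?G \<or> l = ?G ** ?G" "k = mat s ** l ** diag3 r x y z"
      using rot_centralizer_form[OF o f(2,3) k] by metis
    have "pcomm l p" using f(3) pcomm_one pcomm_mult p(1) by blast
    then show ?thesis unfolding f(4) using pcomm_mult pcomm_scale p(2)[OF f(2)] by blast
  qed
  have zz: "pcomm (diag3 r x y z) (diag3 r' x y z)" for r r'
    by (rule pcomm_on_ortho[OF o, of 1]) (simp_all add: rot_diag3_vec[OF o] mult.commute)
  have z: "pcomm k (diag3 r x y z)" if "k \<in> PCent ?G" "r \<noteq> 0" for k r
    using form[OF that(1)] zz pcomm_sym[OF pcomm_diag3_rot[OF o that(2)]] by blast
  have "pcomm ?G b" using sub[OF b] pcomm_sym by (auto simp: PCent_def)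
  then show ?thesis using form[OF sub[OF a]] z[OF sub[OF b]] pcomm_sym by blast
qed

lemma diag3_cube:
  assumes "ortho x y z" "r \<noteq> 0"
  shows "diag3 r x y z ** (diag3 r x y z ** diag3 r x y z) = mat 1"
  by (rule mat_eq_on_ind3[OF ortho_ind3[OF assms(1)]]) (use assms(2) cube_1[of r] cube_1[of "bar r"] in \<open>simp_all add: rot_diag3_vec[OF assms(1)] mult.assoc\<close>)

text \<open>If the rotation occurs in the normal form of \<open>k\<close>, then \<open>k\<^sup>3\<close> is \<open>d\<close> or \<open>d\<^sup>2\<close>.\<close>

lemma rot_centralizer_cases:
  assumes o: "ortho x y z" and d: "d \<noteq> 0" "d \<noteq> 1" and k: "k \<in> PCent (rot d x y z)" and ns: "\<And>c. k \<noteq> mat c"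
  shows "irred k \<or> (\<exists>s r. s \<noteq> 0 \<and> r \<noteq> 0 \<and> r \<noteq> 1 \<and> k = mat s ** diag3 r x y z)"
proof -
  obtain s r l where f: "s \<noteq> 0" "r \<noteq> 0" "l = mat 1 \<or> l = rot d x y z \<or> l = rot d x y z ** rot d x y z"
    "k = mat s ** l ** diag3 r x y z" using rot_centralizer_form[OF o d k] by metis
  have kU: "k \<in> U" using k by (simp add: PCent_def)
  have dd: "d * d \<noteq> 0" "d * d \<noteq> 1" using d not_01_sum[OF d] by auto
  note v = rot_diag3_vec[OF o]
  note c = cube_simps[OF f(1)] cube_simps[OF f(2)] cube_simps[OF d(1)]
  show ?thesis using f(3)
  proof (elim disjE)
    assume l: "l = mat 1"
    have "r \<noteq> 1"
    proof
      assume "r = 1"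
      then have "k = mat s" by (intro mat_eq_on_ind3[OF ortho_ind3[OF o]]) (simp_all add: f(4) l v)
      then show False using ns by blast
    qed
    then show ?thesis using f l by auto
  next
    assume l: "l = rot d x y z"
    have "k ** (k ** k) = mat d"
      by (rule mat_eq_on_ind3[OF ortho_ind3[OF o]])
        (simp_all add: f(4) l v mv_simps bar_sq, simp_all add: ac_simps c)
    then show ?thesis using kU d by (auto simp: irred_def)
  next
    assume l: "l = rot d x y z ** rot d x y z"
    have "k ** (k ** k) = mat (d * d)"
      by (rule mat_eq_on_ind3[OF ortho_ind3[OF o]])
        (simp_all add: f(4) l v mv_simps bar_sq, simp_all add: ac_simps c)
    then show ?thesis using kU dd unfolding irred_def by blast
  qed
qed

text \<open>The eigenvalues \<open>1, r, bar r\<close> are different, so an eigenvector is a multiple of \<open>x\<close>, \<open>y\<close> or \<open>z\<close>.\<close>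

lemma diag3_eigenvector_frame:
  assumes o: "ortho x y z" and r: "r \<noteq> 0" "r \<noteq> 1" and u: "h u u = 1" "diag3 r x y z *v u = s *s u"
  shows "frame u = frame x"
proof -
  have e: "diag3 r x y z *v u = h u x *s x + (r * h u y) *s y + (bar r * h u z) *s z"
    by (simp add: diag3_def mv_simps mult.commute)
  note e' = e[unfolded u(2)]
  have 1: "s * h u x = h u x" using arg_cong[OF e', of "\<lambda>p. h p x"] by (simp add: orthoD[OF o])
  have 2: "s * h u y = r * h u y" using arg_cong[OF e', of "\<lambda>p. h p y"] by (simp add: orthoD[OF o])
  have 3: "s * h u z = bar r * h u z" using arg_cong[OF e', of "\<lambda>p. h p z"] by (simp add: orthoD[OF o])
  have n: "bar r \<noteq> 1" "bar r \<noteq> r" 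
    using r by (metis bar_1 bar_bar, metis bar_sq mult_cancel_left1)
  have at: "(h u y = 0 \<and> h u z = 0) \<or> (h u x = 0 \<and> h u z = 0) \<or> (h u x = 0 \<and> h u y = 0)"
    using 1 2 3 r n by auto
  have u0: "u \<noteq> 0" using u(1) by auto
  note ex = ortho_expand[OF o, of u]
  from at obtain c where c: "u = c *s x \<or> u = c *s y \<or> u = c *s z"
    using ex by (metis add_0 add_0_right vec.scale_zero_left)
  then have "c \<noteq> 0" using u0 by auto
  then show ?thesis using c frame_scale frame_ortho_eq[OF o] by metis
qed

text \<open>Up to a scalar \<open>diag3 r x y z\<close> is itself diagonal in the basis \<open>x', y', z'\<close>, for it has an eigenvector
  and is not irreducible. So \<open>x'\<close> is one of its eigenvectors.\<close>

lemma diag3_rot_frame: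
  assumes o: "ortho x y z" and r: "r \<noteq> 0" "r \<noteq> 1" and o': "ortho x' y' z'" and d: "d \<noteq> 0" "d \<noteq> 1"
    and p: "pcomm (diag3 r x y z) (rot d x' y' z')"
  shows "frame x = frame x'"
proof -
  let ?k = "diag3 r x y z"
  have "?k \<in> PCent (rot d x' y' z')" using p diag3_U[OF o r(1)] by (simp add: PCent_def)
  moreover have "?k \<noteq> mat c" for c
  proof
    assume e: "?k = mat c"
    have "x = c *s x" "r *s y = c *s y" using arg_cong[OF e, of "\<lambda>M. M *v x"] arg_cong[OF e, of "\<lambda>M. M *v y"] rot_diag3_vec[OF o] by simp_all
    then have "h x x = c * h x x" "r * h y y = c * h y y" by (metis h_scale_left)+
    then show False using r orthoD[OF o] by simp
  qed
  ultimately consider "irred ?k" | s r' where "?k = mat s ** diag3 r' x' y' z'"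
    using rot_centralizer_cases[OF o' d] by metis
  then show ?thesis
  proof cases
    case 1
    have "x = 0" using irred_no_eigenvector[OF 1, of x 1] rot_diag3_vec[OF o] by simp
    then show ?thesis using orthoD(1)[OF o] by simp
  next
    case 2
    have "?k *v x' = s *s x'" unfolding 2 by (simp add: rot_diag3_vec[OF o'])
    then show ?thesis by (rule diag3_eigenvector_frame[OF o r orthoD(1)[OF o'], symmetric])
  qed
qed

text \<open>The projective centraliser of the first rotation is abelian and contains both \<open>diag3 w x y z\<close> and the
  second rotation.\<close>

lemma rot_pcomm_frame:
  assumes o: "ortho x y z" and d: "d \<noteq> 0" "d \<noteq> 1" and o': "ortho x' y' z'" and d': "d' \<noteq> 0" "d' \<noteq> 1"
    and p: "pcomm (rot d x y z) (rot d' x' y' z')"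
  shows "frame x = frame x'"
proof -
  have "diag3 w x y z \<in> PCent (rot d x y z)" using diag3_U[OF o w(1)] pcomm_diag3_rot[OF o w(1)] by (simp add: PCent_def)
  moreover have "rot d' x' y' z' \<in> PCent (rot d x y z)" using rot_U[OF o' d'(1)] pcomm_sym[OF p] by (simp add: PCent_def)
  ultimately have "pcomm (diag3 w x y z) (rot d' x' y' z')" using PCent_irred_abelian[OF rot_irred[OF o d]] by blast
  then show ?thesis using diag3_rot_frame[OF o w(1,2) o' d'] by blast
qed

lemma rot_pcomm_same_basis:
  assumes o: "ortho x y z" and p: "pcomm (rot d x y z) (rot d' x y z)"
  shows "d = d'"
proof -
  obtain c where c: "\<And>u. rot d x y z *v (rot d' x y z *v u) = c *s (rot d' x y z *v (rot d x y z *v u))" using pcommE[OF p] by blast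
  have "z = c *s z" using c[of x] by (simp add: rot_diag3_vec[OF o])
  then have "h z z = c * h z z" by (metis h_scale_left)
  then have c1: "c = 1" using orthoD[OF o] by simp
  have "d *s x = d' *s x" using c[of y] by (simp add: rot_diag3_vec[OF o] c1)
  then have "d * h x x = d' * h x x" by (metis h_scale_left)
  then show ?thesis using orthoD[OF o] by simp
qed

subsection \<open>Coverage\<close>

text \<open>The operator \<open>k\<close> permutes the points of the basis as a power of the rotation does. It then commutes
  with \<open>diag3 w\<close> up to a scalar, and with the rotation if the product of the three scalars by which it
  multiplies the basis vectors has the right value. All these scalars are cube roots of unity.\<close>

lemma monomial_pcomm:
  assumes o: "ortho x y z" and pqr: "p \<noteq> 0" "q' \<noteq> 0" "r \<noteq> 0"
  shows "k *v x = p *s x \<Longrightarrow> k *v y = q' *s y \<Longrightarrow> k *v z = r *s z \<Longrightarrow> p * q' * r = 1 \<Longrightarrow> pcomm k (rot d x y z)"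
    and "k *v x = p *s x \<Longrightarrow> k *v y = q' *s y \<Longrightarrow> k *v z = r *s z \<Longrightarrow> pcomm k (diag3 w x y z)"
    and "k *v x = p *s y \<Longrightarrow> k *v y = q' *s z \<Longrightarrow> k *v z = r *s x \<Longrightarrow> p * q' * r = d \<Longrightarrow> pcomm k (rot d x y z)"
    and "k *v x = p *s y \<Longrightarrow> k *v y = q' *s z \<Longrightarrow> k *v z = r *s x \<Longrightarrow> pcomm k (diag3 w x y z)"
    and "k *v x = p *s z \<Longrightarrow> k *v y = r *s x \<Longrightarrow> k *v z = q' *s y \<Longrightarrow> p * q' * r * d = 1 \<Longrightarrow> pcomm k (rot d x y z)"
    and "k *v x = p *s z \<Longrightarrow> k *v y = r *s x \<Longrightarrow> k *v z = q' *s y \<Longrightarrow> pcomm k (diag3 w x y z)"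
proof -
  note v = rot_diag3_vec[OF o]
  note c = cube_simps[OF pqr(1)] cube_simps[OF pqr(2)] cube_simps[OF pqr(3)]
  note ww = bar_sq cube_simps[OF w(1)]
  { assume k: "k *v x = p *s x" "k *v y = q' *s y" "k *v z = r *s z"
    show "pcomm k (diag3 w x y z)"
      by (rule pcomm_on_ortho[OF o, of 1]) (simp_all add: k v mv_simps mult.commute)
    assume "p * q' * r = 1"
    then have r: "r = p * p * (q' * q')" using c by (metis mult.assoc mult.commute mult.left_neutral)
    show "pcomm k (rot d x y z)"
      by (rule pcomm_on_ortho[OF o, of "q' * (p * p)"]) (simp_all add: k v mv_simps pqr r ac_simps c) }
  { assume k: "k *v x = p *s y" "k *v y = q' *s z" "k *v z = r *s x"
    show "pcomm k (diag3 w x y z)"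
      by (rule pcomm_sym, rule pcomm_on_ortho[OF o, of w]) (simp_all add: k v mv_simps w(1) ww ac_simps)
    assume d: "p * q' * r = d"
    show "pcomm k (rot d x y z)" unfolding d[symmetric]
      by (rule pcomm_on_ortho[OF o, of "q' * (p * p)"]) (simp_all add: k v mv_simps pqr ac_simps c) }
  { assume k: "k *v x = p *s z" "k *v y = r *s x" "k *v z = q' *s y"
    show "pcomm k (diag3 w x y z)"
      by (rule pcomm_sym, rule pcomm_on_ortho[OF o, of "bar w"]) (simp_all add: k v mv_simps w(1) ww ac_simps)
    assume e: "p * q' * r * d = 1"
    have "d = (p * q' * r) * (p * q' * r) * (p * q' * r * d)" by (simp add: ac_simps c)
    then have d: "d = (p * q' * r) * (p * q' * r)" unfolding e by simp
    show "pcomm k (rot d x y z)" unfolding d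
      by (rule pcomm_on_ortho[OF o, of "q' * (r * r)"]) (simp_all add: k v mv_simps pqr ac_simps c) }
qed

lemma frame_permutation:
  assumes e: "ortho e1 e2 e3" and o: "ortho x y z" and F: "frame x = frame e1"
  obtains f1 f2 f3 a b c where "a \<noteq> 0" "b \<noteq> 0" "c \<noteq> 0"
    "(f1, f2, f3) \<in> {(e1, e2, e3), (e2, e3, e1), (e3, e1, e2)}"
    "x = a *s f1" "(y = b *s f2 \<and> z = c *s f3) \<or> (y = b *s f3 \<and> z = c *s f2)"
proof -
  have "x \<in> frame e1" "y \<in> frame e1" "z \<in> frame e1"
    using frame_self[OF orthoD(1)[OF o]] frame_self[OF orthoD(2)[OF o]] frame_self[OF orthoD(3)[OF o]]
    unfolding frame_ortho_eq[OF o] F by blast+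
  then obtain a b c f g k where abc: "a \<noteq> 0" "b \<noteq> 0" "c \<noteq> 0" "f \<in> {e1, e2, e3}" "g \<in> {e1, e2, e3}" "k \<in> {e1, e2, e3}"
    and xyz: "x = a *s f" "y = b *s g" "z = c *s k"
    unfolding frame_ortho[OF e] by blast
  have ne: "f \<noteq> g" "g \<noteq> k" "k \<noteq> f"
  proof -
    have "h x y \<noteq> 0" if "f = g" using that abc orthoD[OF e] unfolding xyz by auto
    moreover have "h y z \<noteq> 0" if "g = k" using that abc orthoD[OF e] unfolding xyz by auto
    moreover have "h z x \<noteq> 0" if "k = f" using that abc orthoD[OF e] unfolding xyz by auto
    ultimately show "f \<noteq> g" "g \<noteq> k" "k \<noteq> f" using orthoD[OF o] by auto
  qed
  show thesis
  proof (cases "g = (if f = e1 then e2 else if f = e2 then e3 else e1)")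
    case True
    then show thesis using abc ne by (intro that[of a b c f g k, OF abc(1-3) _ xyz(1)]) (auto simp: xyz)
  next
    case False
    then show thesis using abc ne by (intro that[of a b c f k g, OF abc(1-3) _ xyz(1)]) (auto simp: xyz)
  qed
qed

definition frame_basis :: "('a ^ 3) set \<Rightarrow> ('a ^ 3) \<times> ('a ^ 3) \<times> ('a ^ 3)" where
  "frame_basis T = (SOME (x, y, z). ortho x y z \<and> frame x = T)"

definition frame_rot :: "'a \<Rightarrow> ('a ^ 3) set \<Rightarrow> 'a ^ 3 ^ 3" where "frame_rot d T = (case frame_basis T of (x, y, z) \<Rightarrow> rot d x y z)"

definition frame_diag :: "('a ^ 3) set \<Rightarrow> 'a ^ 3 ^ 3" where "frame_diag T = (case frame_basis T of (x, y, z) \<Rightarrow> diag3 w x y z)"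

lemma frame_basis:
  assumes "T \<in> Frames"
  obtains x y z where "ortho x y z" "frame x = T" "\<And>d. frame_rot d T = rot d x y z" "frame_diag T = diag3 w x y z"
proof -
  obtain e where e: "h e e = 1" "T = frame e" using assms by (auto simp: Frames_def)
  obtain y z where "ortho e y z" using ortho_exists[OF e(1)] by blast
  then have "\<exists>b. case b of (x, y, z) \<Rightarrow> ortho x y z \<and> frame x = T" using e by auto
  from someI_ex[OF this] have b: "case frame_basis T of (x, y, z) \<Rightarrow> ortho x y z \<and> frame x = T" by (simp add: frame_basis_def)
  obtain x y z where xyz: "frame_basis T = (x, y, z)" by (cases "frame_basis T") auto
  show thesis using b by (intro that[of x y z]) (auto simp: xyz frame_rot_def frame_diag_def)
qed

text \<open>By \<open>irred_frame\<close> the isometry \<open>g\<close> rotates some basis, up to a scalar. The chosen basis of the same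
  frame arises from that one by a permutation and by scaling, and an odd permutation replaces \<open>d\<close> by
  its inverse \<open>bar d\<close>.\<close>

lemma irred_covered:
  assumes g: "irred g"
  obtains T d where "T \<in> Frames" "d \<in> {w, bar w}" "pcomm g (frame_rot d T)" "pcomm g (frame_diag T)"
proof -
  obtain c d e1 e2 e3 where f: "c \<noteq> 0" "d \<noteq> 0" "d \<noteq> 1" and e: "ortho e1 e2 e3" and ge: "mat c ** g = rot d e1 e2 e3"
    using irred_frame[OF g] by metis
  let ?G = "rot d e1 e2 e3" and ?T = "frame e1"
  have T: "?T \<in> Frames" using orthoD[OF e] by (auto simp: Frames_def)
  obtain x y z where o: "ortho x y z" and F: "frame x = ?T" and gz: "\<And>d. frame_rot d ?T = rot d x y z" "frame_diag ?T = diag3 w x y z" 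
    using frame_basis[OF T] by metis
  obtain f1 f2 f3 a b r where abr: "a \<noteq> 0" "b \<noteq> 0" "r \<noteq> 0" and
    fs: "(f1, f2, f3) \<in> {(e1, e2, e3), (e2, e3, e1), (e3, e1, e2)}" and
    xyz: "x = a *s f1" "(y = b *s f2 \<and> z = r *s f3) \<or> (y = b *s f3 \<and> z = r *s f2)"
    by (rule frame_permutation[OF e o F])
  have "\<exists>p1 p2 p3. p1 \<noteq> 0 \<and> p2 \<noteq> 0 \<and> p3 \<noteq> 0 \<and> p1 * p2 * p3 = d \<and> ?G *v f1 = p1 *s f2 \<and> ?G *v f2 = p2 *s f3 \<and> ?G *v f3 = p3 *s f1"
  proof -
    consider "(f1, f2, f3) = (e1, e2, e3)" | "(f1, f2, f3) = (e2, e3, e1)" | "(f1, f2, f3) = (e3, e1, e2)" using fs by blast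
    then show ?thesis
    proof cases
      case 1 then show ?thesis using f by (intro exI[of _ 1] exI[of _ d]) (simp add: rot_diag3_vec[OF e])
    next
      case 2 then show ?thesis using f by (intro exI[of _ 1] exI[of _ d]) (simp add: rot_diag3_vec[OF e])
    next
      case 3 then show ?thesis using f by (intro exI[of _ 1] exI[of _ d]) (simp add: rot_diag3_vec[OF e])
    qed
  qed
  then obtain p1 p2 p3 where p: "p1 \<noteq> 0" "p2 \<noteq> 0" "p3 \<noteq> 0" "p1 * p2 * p3 = d" 
    and Gf: "?G *v f1 = p1 *s f2" "?G *v f2 = p2 *s f3" "?G *v f3 = p3 *s f1" by blast
  have "\<exists>d'. d' \<noteq> 0 \<and> d' \<noteq> 1 \<and> pcomm ?G (rot d' x y z) \<and> pcomm ?G (diag3 w x y z)"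
    using xyz(2)
  proof
    assume "y = b *s f2 \<and> z = r *s f3"
    then have m: "?G *v x = (a * p1 / b) *s y" "?G *v y = (b * p2 / r) *s z" "?G *v z = (r * p3 / a) *s x"
      using abr by (simp_all add: xyz(1) Gf)
    have "(a * p1 / b) * (b * p2 / r) * (r * p3 / a) = d" using abr by (simp add: p(4)[symmetric])
    then have "pcomm ?G (rot d x y z)" "pcomm ?G (diag3 w x y z)"
      using monomial_pcomm(3,4)[OF o _ _ _ m] abr p by auto
    then show ?thesis using f by blast
  next
    assume "y = b *s f3 \<and> z = r *s f2"
    then have m: "?G *v x = (a * p1 / r) *s z" "?G *v y = (b * p3 / a) *s x" "?G *v z = (r * p2 / b) *s y"
      using abr by (simp_all add: xyz(1) Gf)
    have "(a * p1 / r) * (r * p2 / b) * (b * p3 / a) * bar d = d * bar d" using abr by (simp add: p(4)[symmetric])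
    then have "pcomm ?G (rot (bar d) x y z)" "pcomm ?G (diag3 w x y z)"
      using monomial_pcomm(5,6)[OF o _ _ _ m] abr p norm_1[OF f(2)] by auto
    moreover have "bar d \<noteq> 1" using f(3) by (metis bar_1 bar_bar)
    ultimately show ?thesis using f(2) by (intro exI[of _ "bar d"]) simp
  qed
  then obtain d' where d': "d' \<noteq> 0" "d' \<noteq> 1" "pcomm ?G (frame_rot d' ?T)" "pcomm ?G (frame_diag ?T)" unfolding gz by blast
  have "pcomm g k" if "pcomm ?G k" for k
  proof -
    have "g = mat (inverse c) ** ?G" unfolding ge[symmetric] using f(1) by (simp add: matrix_eq)
    then show ?thesis using pcomm_scale[OF that] by metis
  qed
  then show thesis using that[OF T] d' cases_4[of d'] by blast
qed

lemma iso_commuting_covered: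
  assumes g: "g \<in> U" "cyclic g" and v: "v \<in> Isotropic" "g ** out v = out v ** g"
  obtains S where "S \<in> Alg" "has_isotropic S" "g \<in> Ucent S"
proof -
  define S where "S = {B \<in> Herm. g ** B = B ** g}"
  have "out v \<in> S" using v by (simp add: S_def Herm_closed)
  then have "has_isotropic S" using v(1) unfolding has_isotropic_def Isotropic_def by blast
  moreover have "g \<in> Ucent S" using g(1) by (auto simp: Ucent_def S_def)
  ultimately show thesis using that unitary_cyclic_Alg[OF g] unfolding S_def by blast
qed

text \<open>The vectors \<open>g\<^sup>2 u + r g u + r\<^sup>2 u\<close>, for a cyclic vector \<open>u\<close> and \<open>r\<close> running over the cube roots of
  unity, are eigenvectors for \<open>r\<close>. They are perpendicular to each other, and none of them is isotropic
  because \<open>g\<^sup>3\<close> is scalar. So \<open>g\<close> is diagonal in an orthonormal basis with eigenvalues \<open>1, w, bar w\<close>.\<close>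

lemma cube_one_covered:
  assumes g: "g \<in> U" "cyclic g" and g3: "g ** (g ** g) = mat 1"
  obtains T where "T \<in> Frames" "pcomm g (frame_rot w T)" "pcomm g (frame_diag T)"
proof -
  have g3v: "g *v (g *v (g *v u)) = u" for u using arg_cong[OF g3, of "\<lambda>M. M *v u"] by simp
  obtain u where u: "ind3 u (g *v u) (g *v (g *v u))" using g(2) cyclic_def by blast
  define e where "e r = (r * r) *s u + r *s (g *v u) + 1 *s (g *v (g *v u))" for r
  have ge: "g *v e r = r *s e r" if "r \<noteq> 0" for r
    unfolding e_def using cube_simps[OF that] by (simp add: mv_simps g3v) (simp add: vec_eq_iff algebra_simps)
  have e0: "e r \<noteq> 0" for r using ind3D[OF u, of "r * r" r 1] unfolding e_def by auto
  have perp: "h (e r) (e s) = 0" if rs: "r \<noteq> 0" "s \<noteq> 0" "r \<noteq> s" for r s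
  proof -
    have "h (e r) (e s) = h (r *s e r) (s *s e s)"
      using U_D[OF g(1), of "e r" "e s"] by (simp only: ge[OF rs(1)] ge[OF rs(2)])
    also have "\<dots> = r * (bar s * h (e r) (e s))" by (simp add: ac_simps)
    finally have "h (e r) (e s) = r * (bar s * h (e r) (e s))" .
    then have "s * h (e r) (e s) = r * h (e r) (e s)" using norm_mult(1)[OF rs(2)] by (metis mult.left_commute)
    then show ?thesis using rs(3) by simp
  qed
  have unit: "h (e r) (e r) = 1" if r: "r \<noteq> 0" for r
  proof (rule ccontr)
    assume "h (e r) (e r) \<noteq> 1"
    then have z: "h (e r) (e r) = 0" using norm_nonzero by blast
    have "h (g *v p) (e r) = r * h p (e r)" for p
    proof -
      have "bar r * h (g *v p) (e r) = h p (e r)" using U_D[OF g(1), of p "e r"] by (simp add: ge[OF r])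
      then show ?thesis using norm_mult(1)[OF r] by metis
    qed
    then have "g ** out (e r) = out (e r) ** g" by (simp add: matrix_eq ge[OF r] mult.commute)
    then show False using isotropic_cube_not_scalar[OF g e0 z] g3 by blast
  qed
  have w': "bar w \<noteq> 0" "bar w \<noteq> 1" "bar w \<noteq> w" using w by auto
  have o: "ortho (e 1) (e w) (e (bar w))" using perp unit w w' by (simp add: ortho_def)
  let ?T = "frame (e 1)"
  have T: "?T \<in> Frames" using orthoD[OF o] by (auto simp: Frames_def)
  obtain x y z where b: "ortho x y z" and F: "frame x = ?T" and gz: "\<And>d. frame_rot d ?T = rot d x y z" "frame_diag ?T = diag3 w x y z" 
    using frame_basis[OF T] by metis
  obtain f1 f2 f3 a b' r where abr: "a \<noteq> 0" "b' \<noteq> 0" "r \<noteq> 0" and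
    fs: "(f1, f2, f3) \<in> {(e 1, e w, e (bar w)), (e w, e (bar w), e 1), (e (bar w), e 1, e w)}" and
    xyz: "x = a *s f1" "(y = b' *s f2 \<and> z = r *s f3) \<or> (y = b' *s f3 \<and> z = r *s f2)"
    by (rule frame_permutation[OF o b F])
  obtain p1 p2 p3 where p: "(p1, p2, p3) \<in> {(1, w, bar w), (w, bar w, 1), (bar w, 1, w)}" and f: "f1 = e p1" "f2 = e p2" "f3 = e p3"
    using fs by auto
  have p0: "p1 \<noteq> 0" "p2 \<noteq> 0" "p3 \<noteq> 0" "p1 * p2 * p3 = 1" "p1 * p3 * p2 = 1" using p w norm_1[OF w(1)] norm_1'[OF w(1)] by auto
  have "pcomm g (rot d x y z) \<and> pcomm g (diag3 w x y z)" for d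
    using xyz(2)
  proof
    assume "y = b' *s f2 \<and> z = r *s f3"
    then have m: "g *v x = p1 *s x" "g *v y = p2 *s y" "g *v z = p3 *s z"
      using p0 by (simp_all add: xyz(1) f ge mult.commute)
    show ?thesis using monomial_pcomm(1,2)[OF b p0(1-3) m] p0 by blast
  next
    assume "y = b' *s f3 \<and> z = r *s f2"
    then have m: "g *v x = p1 *s x" "g *v y = p3 *s y" "g *v z = p2 *s z"
      using p0 by (simp_all add: xyz(1) f ge mult.commute)
    show ?thesis using monomial_pcomm(1,2)[OF b p0(1,3,2) m] p0 by blast
  qed
  then show thesis using that[OF T] unfolding gz by blast
qed

text \<open>For \<open>q = 2\<close> the sum of two perpendicular unit vectors is isotropic, so every nonisotropic vector is
  perpendicular to an isotropic one.\<close>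

lemma iso_Alg_through:
  assumes "x \<noteq> 0" obtains S where "S \<in> Alg" "out x \<in> S" "has_isotropic S"
proof (cases "h x x = 0")
  case True
  have "card {S \<in> Alg. out x \<in> S} \<noteq> 0" using card_Alg_through[OF assms] by simp
  then have "{S \<in> Alg. out x \<in> S} \<noteq> {}" by force
  then show thesis using that assms True unfolding has_isotropic_def by blast
next
  case False
  then have "h x x = 1" using norm_nonzero by blast
  then obtain y z where o: "ortho x y z" using ortho_exists by blast
  define v where "v = y + z"
  have v: "h v v = 0" "h x v = 0" "h v x = 0" using orthoD[OF o] by (simp_all add: v_def)
  have vy: "h v y = 1" using orthoD[OF o] by (simp add: v_def)
  then have v0: "v \<noteq> 0" by (metis h_zero(1) zero_neq_one)
  have n: "out x \<notin> span_out v"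
  proof
    assume "out x \<in> span_out v"
    then obtain s t where e: "out x = mat s + mat t ** out v" by (auto simp: span_out_def)
    have 1: "h (out x *v x) x = s" by (subst e) (simp add: mv_simps v orthoD[OF o])
    have 2: "h (out x *v v) y = s" by (subst e) (simp add: mv_simps v vy)
    show False using 1 2 v orthoD[OF o] by simp
  qed
  have "out x ** out v = out v ** out x" using v by (simp add: matrix_eq)
  then show thesis using span_out2_Alg[OF Herm_closed(5) v0 _ n] that v(1) v0 unfolding has_isotropic_def by blast
qed

text \<open>Elements that are not cyclic, and cyclic ones fixing an isotropic point, commute with an algebra
  containing that point. The remaining ones have a scalar cube.\<close>

lemma small_q_cases:
  assumes g: "g \<in> U"
  shows "(\<exists>S\<in>Alg. has_isotropic S \<and> g \<in> Ucent S) \<or> (\<exists>T\<in>Frames. \<exists>d\<in>{w, bar w}. pcomm g (frame_rot d T) \<and> pcomm g (frame_diag T))"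
proof (cases "cyclic g")
  case False
  obtain x where x: "x \<noteq> 0" "\<And>S. S \<in> Alg \<Longrightarrow> out x \<in> S \<Longrightarrow> g \<in> Ucent S" using unitary_not_cyclic[OF g False] by metis
  moreover obtain S where "S \<in> Alg" "out x \<in> S" "has_isotropic S" using iso_Alg_through[OF x(1)] by blast
  ultimately show ?thesis by blast
next
  case True
  from cyclic_unitary_cases[OF g True] show ?thesis
  proof (elim disjE exE bexE conjE)
    fix d assume d: "d \<noteq> 0" "g ** (g ** g) = mat d"
    show ?thesis
    proof (cases "d = 1")
      case True
      then have g3: "g ** (g ** g) = mat 1" using d by simp
      obtain T where "T \<in> Frames" "pcomm g (frame_rot w T)" "pcomm g (frame_diag T)" by (rule cube_one_covered[OF g \<open>cyclic g\<close> g3])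
      then show ?thesis by blast
    next
      case False
      then have "irred g" using d g by (auto simp: irred_def)
      then show ?thesis using irred_covered by metis
    qed
  next
    fix v assume "v \<in> Isotropic" "g ** out v = out v ** g"
    then show ?thesis using iso_commuting_covered[OF g True] by metis
  qed
qed

subsection \<open>The covers\<close>

lemma det_eigenvectors:
  fixes m :: "'a ^ 3 ^ 3"
  assumes i: "ind3 x y z" and m: "m *v x = a *s x" "m *v y = b *s y" "m *v z = c *s z"
  shows "det m = a * b * c"
proof -
  define P :: "'a ^ 3 ^ 3" where "P = (\<chi> i j. if j = 1 then x $ i else if j = 2 then y $ i else z $ i)"
  define D :: "'a ^ 3 ^ 3" where "D = (\<chi> i j. if i \<noteq> j then 0 else if j = 1 then a else if j = 2 then b else c)"
  have Pv: "P *v u = (u $ 1) *s x + (u $ 2) *s y + (u $ 3) *s z" for u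
    by (simp add: P_def matrix_vector_mult_def vec_eq_iff sum_3 mult.commute)
  have Dv: "(D *v u) $ 1 = a * u $ 1" "(D *v u) $ 2 = b * u $ 2" "(D *v u) $ 3 = c * u $ 3" for u
    by (simp_all add: D_def matrix_vector_mult_def sum_3)
  have "m ** P = P ** D"
    by (simp add: matrix_eq Pv Dv mv_simps m mult.commute)
  then have "det m * det P = det P * det D" by (metis det_mul)
  moreover have "det D = a * b * c" by (simp add: det_3 D_def)
  moreover have "invertible P"
  proof (rule invertible_of_injective)
    fix u assume "P *v u = 0"
    then have "(u $ 1) *s x + (u $ 2) *s y + (u $ 3) *s z = 0" by (simp only: Pv)
    from ind3D[OF i this] show "u = 0" by (simp add: vec_eq_iff forall_3)
  qed
  then have "det P \<noteq> 0" by (simp add: invertible_det_nz)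
  ultimately show ?thesis by simp
qed

text \<open>A commutator \<open>m\<close> of elements of the projective centraliser commutes with \<open>diag3 w x y z\<close>, so it is
  diagonal in this basis, and its determinant is one. The three eigenvalues are cube roots of unity
  with product one, hence proportional to \<open>1, r, r\<^sup>2\<close>; so up to a scalar \<open>m\<close> is a power of
  \<open>diag3 w x y z\<close> itself.\<close>

lemma diag3_centralizer_class_two:
  assumes o: "ortho x y z" and abe: "a \<in> PCent (diag3 w x y z)" "b \<in> PCent (diag3 w x y z)" "e \<in> PCent (diag3 w x y z)"
  shows "pcomm (a ** b ** ginv a ** ginv b) e"
proof -
  let ?Z = "diag3 w x y z"
  define m where "m = a ** b ** ginv a ** ginv b"
  have U: "a \<in> U" "b \<in> U" "e \<in> U" using abe by (auto simp: PCent_def)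
  have mU: "m \<in> U" unfolding m_def using U by (intro U_mult ginv(1))
  have mab: "m *v (b *v (a *v u)) = a *v (b *v u)" for u unfolding m_def using U by simp
  obtain s where s: "s \<noteq> 0" "\<And>u. a *v (?Z *v u) = s *s (?Z *v (a *v u))" using abe(1) pcommE unfolding PCent_def by blast
  obtain t where t: "t \<noteq> 0" "\<And>u. b *v (?Z *v u) = t *s (?Z *v (b *v u))" using abe(2) pcommE unfolding PCent_def by blast
  have "m *v (?Z *v p) = ?Z *v (m *v p)" for p
  proof -
    define u where "u = ginv a *v (ginv b *v p)"
    have p: "p = b *v (a *v u)" using U by (simp add: u_def)
    have "(s * t) *s (m *v (?Z *v p)) = m *v (b *v (a *v (?Z *v u)))" unfolding p by (simp add: s(2) t(2))
    also have "\<dots> = a *v (b *v (?Z *v u))" by (rule mab)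
    also have "\<dots> = (s * t) *s (?Z *v (m *v p))" unfolding p mab by (simp add: s(2) t(2) mult.commute)
    finally show ?thesis using s(1) t(1) by simp
  qed
  then have mZ: "?Z ** m = m ** ?Z" by (simp add: matrix_eq)
  have cZ: "cyclic ?Z" by (rule diag3_cyclic[OF o w(1,2)])
  obtain p0 p1 p2 where "m = pol p0 p1 p2 ?Z" using cyclic_commutant[OF cZ mZ] by blast
  then obtain l1 l2 l3 where l: "m *v x = l1 *s x" "m *v y = l2 *s y" "m *v z = l3 *s z"
    by (simp add: rot_diag3_vec[OF o] flip: vec.scale_left_distrib) metis
  have "x \<noteq> 0" "y \<noteq> 0" "z \<noteq> 0" using orthoD[OF o] by auto
  then have l0: "l1 \<noteq> 0" "l2 \<noteq> 0" "l3 \<noteq> 0" using l U_inj[OF mU] by auto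
  have "det a * det (ginv a) = 1" "det b * det (ginv b) = 1" using U by (simp_all flip: det_mul)
  then have "det m = 1" unfolding m_def det_mul by (metis mult.assoc mult.commute mult.left_neutral)
  then have d: "l1 * l2 * l3 = 1" using det_eigenvectors[OF ortho_ind3[OF o] l] by simp
  \<comment> \<open>This is \<open>l2 / l1\<close>, since \<open>l1\<close> is a cube root of unity.\<close>
  define r where "r = l1 * l1 * l2"
  have r0: "r \<noteq> 0" using l0 by (simp add: r_def)
  note c = cube_simps[OF l0(1)] cube_simps[OF l0(2)]
  have "l3 = (l1 * l1 * (l2 * l2)) * (l1 * l2 * l3)" by (simp add: ac_simps c)
  then have l3: "l3 = l1 * l1 * (l2 * l2)" unfolding d by simp
  have m: "m = mat l1 ** diag3 r x y z"
    by (rule mat_eq_on_ind3[OF ortho_ind3[OF o]]) (simp_all add: l rot_diag3_vec[OF o] bar_sq r_def l3 ac_simps c)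
  have pZ: "pcomm ?Z e" using abe(3) pcomm_sym by (auto simp: PCent_def)
  have "r = 1 \<or> r = w \<or> r = bar w" using cases_4[of r] r0 by blast
  then have "pcomm (diag3 r x y z) e"
  proof (elim disjE)
    assume "r = 1"
    then have "diag3 r x y z = mat 1" by (intro mat_eq_on_ind3[OF ortho_ind3[OF o]]) (simp_all add: rot_diag3_vec[OF o])
    then show ?thesis using pcomm_one by simp
  next
    assume "r = bar w"
    then have "diag3 r x y z = ?Z ** ?Z" 
      by (intro mat_eq_on_ind3[OF ortho_ind3[OF o]]) (simp_all add: rot_diag3_vec[OF o] bar_sq)
    then show ?thesis using pcomm_mult pZ by simp
  qed (use pZ in simp)
  then show ?thesis using pcomm_scale m unfolding m_def by metis
qed

lemma frame_diag_subgroup_nilpotent: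
  assumes T: "T \<in> Frames" and c: "2 \<le> c"
  shows "c_nilpotent c (PGU h\<lparr>carrier := proj ` PCent (frame_diag T)\<rparr>)"
proof -
  interpret P: group "PGU h" by (rule group_PGU)
  obtain x y z where o: "ortho x y z" and zT: "frame_diag T = diag3 w x y z" using frame_basis[OF T] by metis
  show ?thesis
  proof (rule P.c_nilpotent_class_two[OF PCent_subgroup _ c])
    fix x1 x2 x3 assume "x1 \<in> proj ` PCent (frame_diag T)" "x2 \<in> proj ` PCent (frame_diag T)" "x3 \<in> proj ` PCent (frame_diag T)"
    then obtain a b e where abe: "a \<in> PCent (frame_diag T)" "b \<in> PCent (frame_diag T)" "e \<in> PCent (frame_diag T)" "x1 = proj a" "x2 = proj b" "x3 = proj e" by blast
    have U: "a \<in> U" "b \<in> U" "e \<in> U" using abe by (auto simp: PCent_def)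
    have m: "a ** b ** ginv a ** ginv b \<in> U" using U by (intro U_mult ginv(1))
    show "x1 \<otimes>\<^bsub>PGU h\<^esub> x2 \<otimes>\<^bsub>PGU h\<^esub> inv\<^bsub>PGU h\<^esub> x1 \<otimes>\<^bsub>PGU h\<^esub> inv\<^bsub>PGU h\<^esub> x2 \<otimes>\<^bsub>PGU h\<^esub> x3
       = x3 \<otimes>\<^bsub>PGU h\<^esub> (x1 \<otimes>\<^bsub>PGU h\<^esub> x2 \<otimes>\<^bsub>PGU h\<^esub> inv\<^bsub>PGU h\<^esub> x1 \<otimes>\<^bsub>PGU h\<^esub> inv\<^bsub>PGU h\<^esub> x2)"
      using diag3_centralizer_class_two[OF o abe(1-3)[unfolded zT]]
      unfolding abe(4-6) proj_commutator[OF U(1,2)] pcomm_proj[OF m U(3)] .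
  qed
qed

lemma frame_rot_subgroup_nilpotent:
  assumes T: "T \<in> Frames" and d: "d \<in> {w, bar w}" and c: "1 \<le> c"
  shows "c_nilpotent c (PGU h\<lparr>carrier := proj ` PCent (frame_rot d T)\<rparr>)"
proof -
  interpret P: group "PGU h" by (rule group_PGU)
  have i: "irred (frame_rot d T)" using frame_basis[OF T] rot_irred d w by (metis bar_eq_0_iff insertE singletonD)
  show ?thesis
  proof (rule P.c_nilpotent_abelian[OF PCent_subgroup _ c])
    fix x y assume "x \<in> proj ` PCent (frame_rot d T)" "y \<in> proj ` PCent (frame_rot d T)"
    then obtain a b where ab: "a \<in> PCent (frame_rot d T)" "b \<in> PCent (frame_rot d T)" "x = proj a" "y = proj b" by blast
    then show "x \<otimes>\<^bsub>PGU h\<^esub> y = y \<otimes>\<^bsub>PGU h\<^esub> x" using PCent_irred_abelian[OF i ab(1,2)] pcomm_proj[of a b] by (auto simp: PCent_def)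
  qed
qed

lemma frame_rot_irred: "T \<in> Frames \<Longrightarrow> d \<in> {w, bar w} \<Longrightarrow> irred (frame_rot d T)"
  using frame_basis rot_irred w by (metis bar_eq_0_iff insertE singletonD)

text \<open>A nontrivial central element \<open>k\<close> of the group generated by both rotations lies in both projective
  centralisers. If \<open>k\<close> is irreducible, its own projective centraliser is abelian and the rotations
  commute up to a scalar; otherwise \<open>k\<close> is diagonal and determines the frame.\<close>

lemma frame_rot_pair:
  assumes T: "T \<in> Frames" "T' \<in> Frames" and d: "d \<in> {w, bar w}" "d' \<in> {w, bar w}"
    and nil: "c_nilpotent_pair c (PGU h) (proj (frame_rot d T)) (proj (frame_rot d' T'))"
  shows "T = T'"
proof -
  obtain x y z where o: "ortho x y z" "frame x = T" "frame_rot d T = rot d x y z" using frame_basis[OF T(1)] by metis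
  obtain x' y' z' where o': "ortho x' y' z'" "frame x' = T'" "frame_rot d' T' = rot d' x' y' z'" using frame_basis[OF T(2)] by metis
  have d0: "d \<noteq> 0" "d \<noteq> 1" "d' \<noteq> 0" "d' \<noteq> 1" using d w by auto
  have irred: "irred (frame_rot d T)" "irred (frame_rot d' T')" using frame_rot_irred T d by blast+
  then have U: "frame_rot d T \<in> U" "frame_rot d' T' \<in> U" by (auto simp: irred_def)
  have ns: "frame_rot d T \<noteq> mat c" for c using irred_no_eigenvector[OF irred(1), of x c] orthoD(1)[OF o(1)] by fastforce
  obtain k where k0: "k \<in> U" "\<forall>c. k \<noteq> mat c"
    "proj k \<otimes>\<^bsub>PGU h\<^esub> proj (frame_rot d T) = proj (frame_rot d T) \<otimes>\<^bsub>PGU h\<^esub> proj k"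
    "proj k \<otimes>\<^bsub>PGU h\<^esub> proj (frame_rot d' T') = proj (frame_rot d' T') \<otimes>\<^bsub>PGU h\<^esub> proj k"
    by (rule proj_nilpotent_pair_central[OF U ns nil])
  then have k: "k \<in> U" "\<And>c. k \<noteq> mat c" "pcomm k (frame_rot d T)" "pcomm k (frame_rot d' T')"
    using pcomm_proj[OF k0(1) U(1)] pcomm_proj[OF k0(1) U(2)] by blast+
  have "k \<in> PCent (rot d x y z)" using k o by (simp add: PCent_def)
  from rot_centralizer_cases[OF o(1) d0(1,2) this k(2)] show ?thesis
  proof (elim disjE exE conjE)
    assume i: "irred k"
    have "frame_rot d T \<in> PCent k" "frame_rot d' T' \<in> PCent k" using k U pcomm_sym unfolding PCent_def by blast+
    then have "pcomm (frame_rot d T) (frame_rot d' T')" by (rule PCent_irred_abelian[OF i])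
    then show ?thesis using rot_pcomm_frame[OF o(1) d0(1,2) o'(1) d0(3,4)] o o' by simp
  next
    fix s r assume s: "s \<noteq> 0" "r \<noteq> 0" "r \<noteq> 1" "k = mat s ** diag3 r x y z"
    have "diag3 r x y z = mat (inverse s) ** k" unfolding s(4) using s(1) by (simp add: matrix_eq)
    then have "pcomm (diag3 r x y z) (rot d' x' y' z')" using pcomm_scale[OF k(4)] o' by metis
    then show ?thesis using diag3_rot_frame[OF o(1) s(2,3) o'(1) d0(3,4)] o o' by simp
  qed
qed

text \<open>A central element would commute with the rigid \<open>g\<close>, hence fix the isotropic point of \<open>S\<close>. But in the
  projective centraliser of a rotation the nonscalar elements are up to scalars cyclic with scalar
  cube, and such elements fix no isotropic point.\<close>

lemma distinguished_frame_rot_pair: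
  assumes S: "S \<in> Alg" "has_isotropic S" "distinguished S g" and T: "T \<in> Frames" and d: "d \<in> {w, bar w}"
    and nil: "c_nilpotent_pair c (PGU h) (proj g) (proj (frame_rot d T)) \<or> c_nilpotent_pair c (PGU h) (proj (frame_rot d T)) (proj g)"
  shows False
proof -
  obtain x y z where o: "ortho x y z" "frame x = T" "frame_rot d T = rot d x y z" using frame_basis[OF T] by metis
  have d0: "d \<noteq> 0" "d \<noteq> 1" using d w by auto
  have "irred (frame_rot d T)" using frame_rot_irred T d by blast
  then have U: "frame_rot d T \<in> U" by (simp add: irred_def)
  note g = distinguishedD[OF S(3)]
  have nil': "c_nilpotent_pair c (PGU h) (proj g) (proj (frame_rot d T))" 
    using nil by (simp add: c_nilpotent_pair_def insert_commute)
  have ns: "g \<noteq> mat c" for c using cyclic_not_scalar_mod[OF g(3), of 0] by (auto simp: scalar_mod_def)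
  obtain k where k0: "k \<in> U" "\<forall>c. k \<noteq> mat c" "proj k \<otimes>\<^bsub>PGU h\<^esub> proj g = proj g \<otimes>\<^bsub>PGU h\<^esub> proj k"
    "proj k \<otimes>\<^bsub>PGU h\<^esub> proj (frame_rot d T) = proj (frame_rot d T) \<otimes>\<^bsub>PGU h\<^esub> proj k"
    by (rule proj_nilpotent_pair_central[OF g(1) U ns nil'])
  then have k: "k \<in> U" "\<And>c. k \<noteq> mat c" "k ** g = g ** k" "pcomm k (frame_rot d T)"
    using proj_commute_rigid[OF g(4,1) k0(1)] pcomm_proj[OF k0(1) U] by blast+
  obtain v where v: "v \<noteq> 0" "h v v = 0" "out v \<in> S" using S(2) by (auto simp: has_isotropic_def)
  have kv: "k ** out v = out v ** k" using cyclic_commuting_commute[OF g(3) k(3)[symmetric] g(6)[OF v(3)]] .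
  have "k \<in> PCent (rot d x y z)" using k o by (simp add: PCent_def)
  from rot_centralizer_cases[OF o(1) d0 this k(2)] show False
  proof (elim disjE exE conjE)
    assume i: "irred k"
    then show False using isotropic_cube_not_scalar[OF k(1) irred_cyclic[OF i] v(1,2) kv] by (auto simp: irred_def)
  next
    fix s r assume s: "s \<noteq> 0" "r \<noteq> 0" "r \<noteq> 1" "k = mat s ** diag3 r x y z"
    have zv: "diag3 r x y z ** out v = out v ** diag3 r x y z" 
    proof -
      have "mat s ** (diag3 r x y z ** out v) = k ** out v" "mat s ** (out v ** diag3 r x y z) = out v ** k"
        unfolding s(4) by (simp_all add: matrix_eq)
      then show ?thesis using kv mat_cancel[OF s(1)] by metis
    qed
    show False 
      using isotropic_cube_not_scalar[OF diag3_U[OF o(1) s(2)] diag3_cyclic[OF o(1) s(2,3)] v(1,2) zv] diag3_cube[OF o(1) s(2)] by blast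
  qed
qed

abbreviation iso_Alg :: "('a ^ 3 ^ 3) set set" where "iso_Alg \<equiv> {S \<in> Alg. has_isotropic S}"

text \<open>There are \<open>63\<close> algebras with an isotropic point; merging replaces the \<open>27\<close> unipotent ones by \<open>9\<close>
  isotropic points, and the \<open>4\<close> frames are added: \<open>63 - 27 + 9 + 4 = 49\<close>.\<close>

lemma small_q_class_2:
  assumes c: "2 \<le> c"
  shows "(\<exists>\<N>. c_nilpotent_cover c (PGU h) \<N> \<and> two_minimal c (PGU h) \<N>) \<and> omega c (PGU h) = 49"
proof -
  interpret P: group "PGU h" by (rule group_PGU)
  have I: "iso_Alg \<subseteq> Alg" "(\<Union>v\<in>Isotropic. UnipAlg v) \<subseteq> iso_Alg" using UnipAlg_iso by (auto simp: UnipAlg_def)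
  have q': "q > 2 \<or> (\<forall>S\<in>iso_Alg. has_isotropic S)" by blast
  note M = merged_cover[OF I q' c] and MP = merged_pair[OF I q' c]
  have gz: "frame_rot w T \<in> PCent (frame_diag T)" if T: "T \<in> Frames" for T
  proof -
    obtain x y z where o: "ortho x y z" "frame_rot w T = rot w x y z" "frame_diag T = diag3 w x y z" using frame_basis[OF T] by metis
    show ?thesis unfolding PCent_def o using rot_U[OF o(1) w(1)] pcomm_sym[OF pcomm_diag3_rot[OF o(1) w(1)]] by simp
  qed
  have no: False if "Q \<in> merged iso_Alg" "T \<in> Frames" 
      "c_nilpotent_pair c (PGU h) (proj (dist_elem (rep Q))) (proj (frame_rot w T)) \<or> c_nilpotent_pair c (PGU h) (proj (frame_rot w T)) (proj (dist_elem (rep Q)))" for Q T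
    using distinguished_frame_rot_pair[OF _ _ M(4)[OF that(1)] that(2) _ that(3)] M(3)[OF that(1)] by blast
  let ?I = "Inl ` merged iso_Alg \<union> Inr ` Frames"
  have "(\<exists>\<N>. c_nilpotent_cover c (PGU h) \<N> \<and> two_minimal c (PGU h) \<N>) \<and> omega c (PGU h) = card ?I"
  proof (rule P.two_minimal_cover[where H = "case_sum (\<lambda>Q. proj ` member Q) (\<lambda>T. proj ` PCent (frame_diag T))"
        and g = "case_sum (\<lambda>Q. proj (dist_elem (rep Q))) (\<lambda>T. proj (frame_rot w T))"])
    fix x assume "x \<in> carrier (PGU h)"
    then obtain g where g: "g \<in> U" "x = proj g" by (auto simp: carrier_PGU)
    from small_q_cases[OF g(1)] show "\<exists>i\<in>?I. x \<in> case_sum (\<lambda>Q. proj ` member Q) (\<lambda>T. proj ` PCent (frame_diag T)) i"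
    proof (elim disjE bexE conjE)
      fix S assume "S \<in> Alg" "has_isotropic S" "g \<in> Ucent S"
      then obtain Q where "Q \<in> merged iso_Alg" "g \<in> member Q" using merged_covers[OF I(1), of S g] by blast
      then show ?thesis unfolding g(2) by (intro bexI[of _ "Inl Q"]) auto
    next
      fix T d assume "T \<in> Frames" "pcomm g (frame_diag T)"
      then show ?thesis using g by (intro bexI[of _ "Inr T"]) (auto simp: PCent_def)
    qed
  next
    fix i j assume ij: "i \<in> ?I" "j \<in> ?I" and nil: "c_nilpotent_pair c (PGU h)
      (case_sum (\<lambda>Q. proj (dist_elem (rep Q))) (\<lambda>T. proj (frame_rot w T)) i) (case_sum (\<lambda>Q. proj (dist_elem (rep Q))) (\<lambda>T. proj (frame_rot w T)) j)"
    from ij(1) show "i = j"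
    proof (elim UnE imageE)
      fix Q assume i: "i = Inl Q" "Q \<in> merged iso_Alg"
      from ij(2) show ?thesis
      proof (elim UnE imageE)
        fix Q' assume "j = Inl Q'" "Q' \<in> merged iso_Alg"
        then show ?thesis using i nil MP[of Q Q'] by simp
      next
        fix T assume "j = Inr T" "T \<in> Frames"
        then show ?thesis using i nil no[of Q T] by simp
      qed
    next
      fix T assume i: "i = Inr T" "T \<in> Frames"
      from ij(2) show ?thesis
      proof (elim UnE imageE)
        fix Q assume "j = Inl Q" "Q \<in> merged iso_Alg"
        then show ?thesis using i nil no[of Q T] by simp
      next
        fix T' assume "j = Inr T'" "T' \<in> Frames"
        then show ?thesis using i nil frame_rot_pair[of T T' w w c] by simp
      qed
    qed
  qed (use M frame_diag_subgroup_nilpotent[OF _ c] PCent_subgroup gz finite_PGU in auto)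
  moreover have "card ?I = 49"
  proof -
    have "card ?I = card (merged iso_Alg) + card Frames"
      by (subst card_Un_disjoint) (auto simp: card_image)
    moreover have "card (merged iso_Alg) + q * (q ^ 3 + 1) = (q ^ 3 + 1) * (q ^ 2 + q + 1)"
      using card_merged[OF I] card_iso_Alg by simp
    moreover have "q * (q ^ 3 + 1) = 18" "(q ^ 3 + 1) * (q ^ 2 + q + 1) = 63" by (simp_all add: q2)
    ultimately show ?thesis using card_Frames by linarith
  qed
  ultimately show ?thesis by simp
qed

text \<open>For class one each frame contributes two abelian subgroups, belonging to the rotations with \<open>d = w\<close>
  and \<open>d = bar w\<close>: \<open>63 + 2 * 4 = 71\<close>.\<close>

lemma small_q_class_1:
  shows "(\<exists>\<N>. c_nilpotent_cover 1 (PGU h) \<N> \<and> two_minimal 1 (PGU h) \<N>) \<and> omega 1 (PGU h) = 71"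
proof -
  interpret P: group "PGU h" by (rule group_PGU)
  let ?I = "Inl ` iso_Alg \<union> Inr ` (Frames \<times> {w, bar w})"
  let ?H = "case_sum (\<lambda>S. proj ` Ucent S) (\<lambda>(T, d). proj ` PCent (frame_rot d T))"
  let ?g = "case_sum (\<lambda>S. proj (dist_elem S)) (\<lambda>(T, d). proj (frame_rot d T))"
  have D: "distinguished S (dist_elem S)" if "S \<in> iso_Alg" for S using that dist_elem by blast
  have gg: "frame_rot d T \<in> PCent (frame_rot d T)" if "T \<in> Frames" "d \<in> {w, bar w}" for T d
    using frame_rot_irred[OF that] pcomm_refl by (simp add: PCent_def irred_def)
  have Ucent: "c_nilpotent 1 (PGU h\<lparr>carrier := proj ` Ucent S\<rparr>)" if S: "S \<in> iso_Alg" for S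
  proof -
    obtain A where "A \<in> S" "cyclic A" using Alg_exists_cyclic[of S] S by blast
    then show ?thesis using Ucent_c_nilpotent by blast
  qed
  have no: False if "S \<in> iso_Alg" "T \<in> Frames" "d \<in> {w, bar w}"
      "c_nilpotent_pair 1 (PGU h) (proj (dist_elem S)) (proj (frame_rot d T)) \<or> c_nilpotent_pair 1 (PGU h) (proj (frame_rot d T)) (proj (dist_elem S))" for S T d
    using distinguished_frame_rot_pair[OF _ _ D[OF that(1)] that(2-4)] that(1) by blast
  have gp: "T = T' \<and> d = d'" if T: "T \<in> Frames" "T' \<in> Frames" and d: "d \<in> {w, bar w}" "d' \<in> {w, bar w}"
    and nil: "c_nilpotent_pair 1 (PGU h) (proj (frame_rot d T)) (proj (frame_rot d' T'))" for T T' d d'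
  proof -
    have TT: "T = T'" using frame_rot_pair[OF T d nil] .
    obtain x y z where o: "ortho x y z" "\<And>d. frame_rot d T = rot d x y z" using frame_basis[OF T(1)] by metis
    have U: "frame_rot d T \<in> U" "frame_rot d' T \<in> U" using frame_rot_irred T d unfolding irred_def by blast+
    then have "pcomm (frame_rot d T) (frame_rot d' T)"
      using P.c_nilpotent_1_pair_commute[OF _ _ nil] TT pcomm_proj[OF U] by (auto simp: carrier_PGU)
    then show ?thesis using rot_pcomm_same_basis[OF o(1)] TT unfolding o(2) by blast
  qed
  have "(\<exists>\<N>. c_nilpotent_cover 1 (PGU h) \<N> \<and> two_minimal 1 (PGU h) \<N>) \<and> omega 1 (PGU h) = card ?I"
  proof (rule P.two_minimal_cover[where H = ?H and g = ?g])
    fix x assume "x \<in> carrier (PGU h)"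
    then obtain g where g: "g \<in> U" "x = proj g" by (auto simp: carrier_PGU)
    from small_q_cases[OF g(1)] show "\<exists>i\<in>?I. x \<in> ?H i"
    proof (elim disjE bexE conjE)
      fix S assume "S \<in> Alg" "has_isotropic S" "g \<in> Ucent S"
      then show ?thesis unfolding g(2) by (intro bexI[of _ "Inl S"]) auto
    next
      fix T d assume "T \<in> Frames" "d \<in> {w, bar w}" "pcomm g (frame_rot d T)"
      then show ?thesis using g by (intro bexI[of _ "Inr (T, d)"]) (auto simp: PCent_def)
    qed
  next
    fix i j assume ij: "i \<in> ?I" "j \<in> ?I" and nil: "c_nilpotent_pair 1 (PGU h) (?g i) (?g j)"
    from ij(1) show "i = j"
    proof (elim UnE imageE)
      fix S assume i: "i = Inl S" "S \<in> iso_Alg"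
      from ij(2) show ?thesis
      proof (elim UnE imageE)
        fix S' assume "j = Inl S'" "S' \<in> iso_Alg"
        then show ?thesis using i nil dist_elem_commuting_eq[of S S'] by auto
      next
        fix p assume "j = Inr p" "p \<in> Frames \<times> {w, bar w}"
        then show ?thesis using i nil no[of S "fst p" "snd p"] by (cases p) auto
      qed
    next
      fix p assume i: "i = Inr p" "p \<in> Frames \<times> {w, bar w}"
      from ij(2) show ?thesis
      proof (elim UnE imageE)
        fix S assume "j = Inl S" "S \<in> iso_Alg"
        then show ?thesis using i nil no[of S "fst p" "snd p"] by (cases p) auto
      next
        fix p' assume "j = Inr p'" "p' \<in> Frames \<times> {w, bar w}"
        then show ?thesis using i nil gp[of "fst p" "fst p'" "snd p" "snd p'"] by (cases p, cases p') auto
      qed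
    qed
  qed (use Ucent Ucent_subgroup D distinguishedD(2) frame_rot_subgroup_nilpotent PCent_subgroup gg finite_PGU in auto)
  moreover have "card ?I = 71"
  proof -
    have "card ?I = card iso_Alg + card (Frames \<times> {w, bar w})"
      by (subst card_Un_disjoint) (auto simp: card_image)
    moreover have "card (Frames \<times> {w, bar w}) = 8" using w(4) card_Frames by (simp add: card_cartesian_product)
    moreover have "(q ^ 3 + 1) * (q ^ 2 + q + 1) = 63" by (simp add: q2)
    ultimately show ?thesis using card_iso_Alg by linarith
  qed
  ultimately show ?thesis by simp
qed

end

section \<open>Non-nilpotent sets in the projective unitary group\<close>

theorem theorem5p6:
  fixes q :: nat
    and h :: "'a::{field,finite} ^ 3 \<Rightarrow> 'a ^ 3 \<Rightarrow> 'a"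
    and c :: enat
  assumes "primepow q"
    and "[int q = -1] (mod 3)"
    and "CARD('a) = q ^ 2"
    and "hermitian_form q h"
    and "nondegenerate_form h"
    and "1 \<le> c"
  shows "(\<exists>\<N>. c_nilpotent_cover c (PGU h) \<N> \<and> two_minimal c (PGU h) \<N>) \<and>
    (2 \<le> c \<and> q = 2 \<longrightarrow> omega c (PGU h) = 49) \<and>
    (c = 1 \<and> q = 2 \<longrightarrow> omega c (PGU h) = 71) \<and>
    (2 \<le> c \<and> q > 2 \<longrightarrow> omega c (PGU h) = q^6 + q^5 + q^3 + q^2 + 1) \<and>
    (c = 1 \<and> q > 2 \<longrightarrow> omega c (PGU h) = q^6 + q^5 + q^4 + q^3 + q^2 + q + 1)"
proof -
  interpret hermitian_plane q h using assms by unfold_locales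
  have "c = 1 \<or> 2 \<le> c"
  proof (cases c)
    case (enat n)
    then show ?thesis using assms(6) by (cases "n = 1") (auto simp: one_enat_def numeral_eq_enat)
  qed simp
  then consider "c = 1" | "2 \<le> c" "c \<noteq> 1" by (auto simp: one_enat_def numeral_eq_enat)
  note c = this
  show ?thesis
  proof (cases "q = 2")
    case True
    interpret hermitian_plane_2 q h by unfold_locales (rule True)
    show ?thesis using c small_q_class_1 small_q_class_2[of c] True by cases auto
  next
    case False
    then have q: "q > 2" using q_gt_1 by simp
    have "card (merged Alg) + (q ^ 4 + q) = card Alg"
      using card_merged[of Alg] by (auto simp: UnipAlg_def power4_eq_xxxx power3_eq_cube algebra_simps)
    then have "card (merged Alg) = q^6 + q^5 + q^3 + q^2 + 1" using card_Alg by simp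
    then show ?thesis using c large_q_class_1[OF q] large_q_class_2[OF q, of c] card_Alg q by cases auto
  qed
qed

end
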